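(* Let $\mu\neq0$ be a transformable measure on $\mathbb{R}$ and $\lambda$ a fourth root of unity. Then the following are equivalent. (1) $\mathrm{supp}(\mu)$ is uniformly discrete and $\mu$ is an eigenmeasure of $\mathcal{F}$ with eigenvalue $\lambda$ (equivalently, under uniform discreteness of the support, a strict eigenmeasure of $\mathcal{F}$ with eigenvalue $\lambda$). (2) There are integers $n,k\in\mathbb{N}$ and numbers $c_1,\dots,c_k\in\mathbb{C}$, $r_1,\dots,r_k,s_1,\dots,s_k\in\mathbb{R}$ such that $$\mu=\nu+\lambda^{-1}\widehat\nu+\lambda^{-2}\widehat{\widehat\nu}+\lambda^{-3}\widehat{\widehat{\widehat\nu}}\quad\text{for}\quad \nu=\sum_{i=1}^k c_i\,\mathcal{Z}_{r_i,s_i,\beta},\ \beta=\sqrt n.$$ (3) There is some $n\in\mathbb{N}$ such that $\mu\in\mathcal{E}_\lambda(n):=\mathrm{span}_{\mathbb{C}}\{\mathcal{Y}_{r,s,\sqrt n,\lambda}: r,s\in\mathbb{R}\}$, where $\mathcal{Y}_{r,s,\sqrt n,\lambda}:=\bigl(\mathrm{id}+\lambda^{-1}\mathcal{F}+\lambda^{-2}\mathcal{F}^2+\lambda^{-3}\mathcal{F}^3\bigr)\mathcal{Z}_{r,s,\sqrt n}$.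
   Context: For $r,s\in\mathbb{R}$ and $\alpha>0$, $\mathcal{Z}_{r,s,\alpha}:=\sum_{m\in\mathbb{Z}}e^{2\pi i r(s+m\alpha)}\delta_{s+m\alpha}$, where $\delta_x$ is the unit point mass at $x$. The Fourier transform $\mathcal{F}$ is $\widehat{g}(y)=\int e^{-2\pi ixy}g(x)\,dx$, extended to tempered distributions by duality; a tempered (Radon) measure is transformable if its distributional transform is a measure (then all iterates $\mathcal{F}^j$ of it are measures). It is strictly transformable if there is a measure $\widehat\mu$ with $\check f\in L^1(|\widehat\mu|)$ and $\mu(f)=\widehat\mu(\check f)$ for all $f$ in the span of $\{g*h:g,h\in C_c(\mathbb{R})\}$, $\check f(y)=\widehat f(-y)$. A non-trivial tempered measure $\mu$ is an eigenmeasure with eigenvalue $\lambda$ if it is transformable with $\mathcal{F}(\mu)=\lambda\mu$; a strict eigenmeasure if strictly transformable with $\widehat\mu=\lambda\mu$ as measures. A set is uniformly discrete if distinct points have distance bounded below by some $r>0$. *)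

theory Defs
  imports "HOL-Analysis.Analysis"
begin

text \<open>A (complex Radon) measure on the real line is represented, via the Riesz
  representation, as a linear functional on compactly supported continuous
  functions. Values on other functions are irrelevant; two measures are equal
  iff they agree on all such functions.\<close>

type_synonym rmeas = "(real \<Rightarrow> complex) \<Rightarrow> complex"

definition fsupp :: "(real \<Rightarrow> complex) \<Rightarrow> real set" where
  "fsupp f = closure {x. f x \<noteq> 0}"

definition Cc :: "(real \<Rightarrow> complex) \<Rightarrow> bool" where
  "Cc f \<longleftrightarrow> continuous_on UNIV f \<and> compact (fsupp f)"

definition supnorm :: "(real \<Rightarrow> complex) \<Rightarrow> real" where
  "supnorm f = (SUP x. norm (f x))"

definition radon :: "rmeas \<Rightarrow> bool" where
  "radon \<mu> \<longleftrightarrow>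
     (\<forall>f g. Cc f \<longrightarrow> Cc g \<longrightarrow> \<mu> (\<lambda>x. f x + g x) = \<mu> f + \<mu> g) \<and>
     (\<forall>c f. Cc f \<longrightarrow> \<mu> (\<lambda>x. c * f x) = c * \<mu> f) \<and>
     (\<forall>K. compact K \<longrightarrow> (\<exists>C. \<forall>f. Cc f \<and> fsupp f \<subseteq> K \<longrightarrow> norm (\<mu> f) \<le> C * supnorm f))"

definition nontrivial :: "rmeas \<Rightarrow> bool" where
  "nontrivial \<mu> \<longleftrightarrow> (\<exists>f. Cc f \<and> \<mu> f \<noteq> 0)"

definition msupp :: "rmeas \<Rightarrow> real set" where
  "msupp \<mu> = {x. \<forall>e>0. \<exists>f. Cc f \<and> fsupp f \<subseteq> ball x e \<and> \<mu> f \<noteq> 0}"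

definition uniformly_discrete :: "real set \<Rightarrow> bool" where
  "uniformly_discrete S \<longleftrightarrow> (\<exists>r>0. \<forall>x\<in>S. \<forall>y\<in>S. x \<noteq> y \<longrightarrow> r \<le> dist x y)"

definition vd :: "(real \<Rightarrow> complex) \<Rightarrow> real \<Rightarrow> complex" where
  "vd g = (\<lambda>x. vector_derivative g (at x))"

definition smooth :: "(real \<Rightarrow> complex) \<Rightarrow> bool" where
  "smooth \<phi> \<longleftrightarrow> (\<forall>k x. ((vd ^^ k) \<phi>) differentiable (at x))"

definition schwartz :: "(real \<Rightarrow> complex) \<Rightarrow> bool" where
  "schwartz \<phi> \<longleftrightarrow> smooth \<phi> \<and>
     (\<forall>a b::nat. \<exists>C. \<forall>x. \<bar>x\<bar> ^ a * norm ((vd ^^ b) \<phi> x) \<le> C)"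

definition testfun :: "(real \<Rightarrow> complex) \<Rightarrow> bool" where
  "testfun \<phi> \<longleftrightarrow> smooth \<phi> \<and> compact (fsupp \<phi>)"

definition seminorm_sum :: "nat \<Rightarrow> (real \<Rightarrow> complex) \<Rightarrow> real" where
  "seminorm_sum N \<phi> = (\<Sum>a\<le>N. \<Sum>b\<le>N. (SUP x. \<bar>x\<bar> ^ a * norm ((vd ^^ b) \<phi> x)))"

definition ft :: "(real \<Rightarrow> complex) \<Rightarrow> real \<Rightarrow> complex" where
  "ft g = (\<lambda>y. integral UNIV (\<lambda>x. exp (- 2 * pi * \<i> * complex_of_real (x * y)) * g x))"

definition ftc :: "(real \<Rightarrow> complex) \<Rightarrow> real \<Rightarrow> complex" where
  "ftc g = (\<lambda>y. ft g (- y))"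

definition tempered_ext :: "rmeas \<Rightarrow> rmeas \<Rightarrow> bool" where
  "tempered_ext \<mu> T \<longleftrightarrow>
     (\<forall>\<phi> \<psi>. schwartz \<phi> \<longrightarrow> schwartz \<psi> \<longrightarrow> T (\<lambda>x. \<phi> x + \<psi> x) = T \<phi> + T \<psi>) \<and>
     (\<forall>c \<phi>. schwartz \<phi> \<longrightarrow> T (\<lambda>x. c * \<phi> x) = c * T \<phi>) \<and>
     (\<exists>C N. \<forall>\<phi>. schwartz \<phi> \<longrightarrow> norm (T \<phi>) \<le> C * seminorm_sum N \<phi>) \<and>
     (\<forall>\<phi>. testfun \<phi> \<longrightarrow> T \<phi> = \<mu> \<phi>)"

definition is_ft :: "rmeas \<Rightarrow> rmeas \<Rightarrow> bool" where
  "is_ft \<mu> \<nu> \<longleftrightarrow> radon \<mu> \<and> radon \<nu> \<and>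
     (\<exists>T. tempered_ext \<mu> T \<and> (\<forall>\<phi>. testfun \<phi> \<longrightarrow> T (ft \<phi>) = \<nu> \<phi>))"

definition transformable :: "rmeas \<Rightarrow> bool" where
  "transformable \<mu> \<longleftrightarrow> (\<exists>\<nu>. is_ft \<mu> \<nu>)"

definition eigenmeasure :: "rmeas \<Rightarrow> complex \<Rightarrow> bool" where
  "eigenmeasure \<mu> lam \<longleftrightarrow> nontrivial \<mu> \<and> is_ft \<mu> (\<lambda>f. lam * \<mu> f)"

definition conv :: "(real \<Rightarrow> complex) \<Rightarrow> (real \<Rightarrow> complex) \<Rightarrow> real \<Rightarrow> complex" where
  "conv g h = (\<lambda>x. integral UNIV (\<lambda>y. g (x - y) * h y))"

definition conv_span :: "(real \<Rightarrow> complex) \<Rightarrow> bool" where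
  "conv_span f \<longleftrightarrow> (\<exists>(n::nat) g h. (\<forall>i<n. Cc (g i) \<and> Cc (h i)) \<and>
                      f = (\<lambda>x. \<Sum>i<n. conv (g i) (h i) x))"

text \<open>\<open>meas_integral_is \<nu> F v\<close>: the continuous function \<open>F\<close> lies in \<open>L^1(|\<nu>|)\<close> and
  \<open>\<integral> F d\<nu> = v\<close>. Here \<open>\<integral>|F| d|\<nu>| = sup {|\<nu>(h)| : h \<in> C_c, |h| \<le> |F|}\<close>, and
  the integral is the limit of \<open>\<nu>(gF)\<close> along cut-offs \<open>0 \<le> g \<le> 1\<close>, \<open>g = 1\<close> on
  larger and larger compacts.\<close>
definition meas_integral_is :: "rmeas \<Rightarrow> (real \<Rightarrow> complex) \<Rightarrow> complex \<Rightarrow> bool" where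
  "meas_integral_is \<nu> F v \<longleftrightarrow> continuous_on UNIV F \<and>
     (\<exists>B. \<forall>h. Cc h \<and> (\<forall>x. norm (h x) \<le> norm (F x)) \<longrightarrow> norm (\<nu> h) \<le> B) \<and>
     (\<forall>e>0. \<exists>K. compact K \<and>
        (\<forall>g::real \<Rightarrow> real. Cc (\<lambda>x. complex_of_real (g x)) \<and> (\<forall>x. 0 \<le> g x \<and> g x \<le> 1)
            \<and> (\<forall>x\<in>K. g x = 1) \<longrightarrow> norm (\<nu> (\<lambda>x. complex_of_real (g x) * F x) - v) \<le> e))"

definition strict_ft :: "rmeas \<Rightarrow> rmeas \<Rightarrow> bool" where
  "strict_ft \<mu> \<nu> \<longleftrightarrow> radon \<mu> \<and> radon \<nu> \<and>
     (\<forall>f. conv_span f \<longrightarrow> meas_integral_is \<nu> (ftc f) (\<mu> f))"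

definition strict_eigenmeasure :: "rmeas \<Rightarrow> complex \<Rightarrow> bool" where
  "strict_eigenmeasure \<mu> lam \<longleftrightarrow> nontrivial \<mu> \<and> strict_ft \<mu> (\<lambda>f. lam * \<mu> f)"

definition Zcomb :: "real \<Rightarrow> real \<Rightarrow> real \<Rightarrow> rmeas" where
  "Zcomb r s \<alpha> = (\<lambda>f. infsum (\<lambda>m::int.
      exp (2 * pi * \<i> * complex_of_real (r * (s + of_int m * \<alpha>))) * f (s + of_int m * \<alpha>)) UNIV)"

definition is_Y :: "real \<Rightarrow> real \<Rightarrow> real \<Rightarrow> complex \<Rightarrow> rmeas \<Rightarrow> bool" where
  "is_Y r s \<alpha> lam Y \<longleftrightarrow> (\<exists>\<zeta>::nat \<Rightarrow> rmeas. \<zeta> 0 = Zcomb r s \<alpha> \<and>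
      (\<forall>j<3. is_ft (\<zeta> j) (\<zeta> (Suc j))) \<and>
      (\<forall>f. Cc f \<longrightarrow> Y f = (\<Sum>j<4. inverse lam ^ j * \<zeta> j f)))"

end

theory Submission
  imports Defs "HOL-Computational_Algebra.Polynomial" "HOL-Complex_Analysis.Cauchy_Integral_Formula"
begin

text \<open>The substance is that an eigenmeasure \<open>\<mu> = \<Sum> m x \<delta>\<^sub>x\<close> with uniformly discrete support \<open>L\<close> is a
  finite combination of combs with period \<open>\<surd>n\<close>; the argument follows the ideas of Lev and Olevskii.
  A separated measure with a spectral gap has support of density bounded below. The correlation
  \<open>\<Sum> m x * m (x - h) \<delta>\<^sub>x\<close> has a spectral gap for every difference \<open>h\<close> of points of \<open>L\<close>, so a
  translate of \<open>L\<close> by \<open>h\<close> meets \<open>L\<close> with positive density, and only boundedly many differences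
  lie in an interval of given length. Hence every additive function \<open>f\<close> is almost linear on \<open>L\<close>, that is,
  \<open>f x - c x\<close> is bounded there. Twisting \<open>\<mu>\<close> by the characters \<open>ee (u (f x - c x))\<close> gives a family of
  measures that depends analytically on \<open>u\<close>; a spectral gap common to all of them passes to the level
  sets of \<open>f x - c x\<close>, so there are finitely many, and \<open>L\<close> lies in finitely many translates of
  a lattice \<open>b \<int>\<close>. Then \<open>\<mu>\<close> splits into combs, and the eigenvalue equation with Poisson summation
  forces \<open>b\<^sup>2\<close> to be rational. For the strict version, Bessel's inequality on lattices gives the
  integrability of transforms of convolutions, and conversely a test function whose transform decays
  exactly polynomially shows that the weights grow at most polynomially.\<close>

text \<open>The gap of a correlation is where the eigenvalue equation enters: the transform of
  \<open>x \<mapsto> m x * m (x - h)\<close> is a superposition of translates of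
  \<open>\<mu>\<close> that move a point of its own support to the origin, and such a translate has
  no atom in \<open>(0, d)\<close>. The gap is the same for every \<open>h\<close>, and the density
  it forces depends only on \<open>d\<close> and the length of the gap; this uniformity makes
  counting possible. Finite local complexity alone does not give lattices, since model sets have it
  too; for them \<open>f x - c x\<close> would fill a window. Kronecker's theorem approximates
  \<open>ee (u * f x)\<close> on finitely many differences by honest characters
  \<open>ee (t * x)\<close>, which only translate the spectrum. What survives the limit is a
  quadratic condition: of two test functions with disjoint supports in \<open>(0, d)\<close>, one is
  not charged. Which one may depend on \<open>u\<close>, and analyticity removes this dependence. A
  single residue class is cut out by a polynomial in a character, so its transform is still a
  locally finite measure.\<close>

definition ee :: "real \<Rightarrow> complex" where
  "ee x = cis (2 * pi * x)"

lemma norm_ee [simp]: "norm (ee x) = 1"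
  by (simp add: ee_def)

lemma ee_0 [simp]: "ee 0 = 1"
  by (simp add: ee_def)

lemma ee_nonzero [simp]: "ee x \<noteq> 0"
  by (metis norm_ee norm_zero zero_neq_one)

lemma ee_add: "ee (x + y) = ee x * ee y"
  by (simp add: ee_def cis_mult distrib_left)

lemma ee_minus: "ee (- x) = inverse (ee x)"
  by (simp add: ee_def)

lemma ee_diff: "ee (x - y) = ee x / ee y"
  by (simp add: ee_def cis_divide right_diff_distrib)

lemma ee_mult_minus [simp]: "ee x * ee (- x) = 1" "ee (- x) * ee x = 1"
  by (simp_all add: ee_minus)

lemma ee_of_int [simp]: "ee (of_int k) = 1"
  by (simp add: ee_def)

lemma ee_add_int [simp]: "ee (x + of_int k) = ee x" "ee (of_int k + x) = ee x"
  by (simp_all add: ee_add)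

lemma ee_power: "ee x ^ n = ee (real n * x)"
  by (induction n) (auto simp: ee_add[symmetric] algebra_simps)

lemma ee_eq_exp: "ee x = exp (2 * pi * \<i> * complex_of_real x)"
  by (simp add: ee_def cis_conv_exp mult_ac)

lemma cnj_ee: "cnj (ee x) = ee (- x)"
  by (simp add: ee_def cis_cnj)

lemma ee_eq_1_iff: "ee x = 1 \<longleftrightarrow> (\<exists>k::int. x = of_int k)"
proof
  assume "ee x = 1"
  then have "cos (2 * pi * x) = 1" unfolding ee_def by (metis Re_complex_of_real cis.simps(1) of_real_1)
  then obtain k :: int where "2 * pi * x = of_int k * 2 * pi" using cos_one_2pi_int by blast
  then have "x = of_int k" by simp
  then show "\<exists>k::int. x = of_int k" by blast
qed (auto)

lemma continuous_on_ee [continuous_intros]: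
  "continuous_on S f \<Longrightarrow> continuous_on S (\<lambda>x. ee (f x))"
  unfolding ee_def by (intro continuous_intros)

lemma has_vector_derivative_ee:
  "((\<lambda>x. ee (c * x)) has_vector_derivative 2 * pi * \<i> * c * ee (c * x)) (at x)"
  unfolding ee_def has_vector_derivative_complex_iff
  by (auto intro!: derivative_eq_intros simp: has_real_derivative_iff_has_vector_derivative[symmetric])

lemma ft_eq: "ft g y = integral UNIV (\<lambda>x. ee (- (x * y)) * g x)"
  by (simp add: ft_def ee_eq_exp mult_ac)

section \<open>Smooth functions\<close>

text \<open>\<open>smooth\<close> speaks of all iterates of \<open>vd\<close>. A class that contains
  a derivative of each of its members yields all iterates at once, so smoothness proofs only have to
  exhibit such a class \<open>P\<close>.\<close>

lemma smooth_coinduct: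
  assumes "P f" and step: "\<And>g. P g \<Longrightarrow> \<exists>h. P h \<and> (\<forall>x. (g has_vector_derivative h x) (at x))"
  shows "smooth f"
proof -
  have vdP: "P (vd g) \<and> (\<forall>x. g differentiable at x)" if Pg: "P g" for g
  proof -
    obtain h where h: "P h" "\<And>x. (g has_vector_derivative h x) (at x)" using step[OF Pg] by blast
    have "vd g = h" unfolding vd_def using h(2) vector_derivative_at by blast
    then show ?thesis using h differentiableI_vector by blast
  qed
  have "P ((vd ^^ k) f)" for k by (induction k) (simp_all add: vdP assms(1))
  then show ?thesis unfolding smooth_def using vdP by blast
qed

lemma smooth_vd: "smooth f \<Longrightarrow> smooth (vd f)"
  unfolding smooth_def by (metis comp_apply funpow_Suc_right)

lemma smooth_has_vector_derivative:
  "smooth f \<Longrightarrow> (f has_vector_derivative vd f x) (at x)"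
  unfolding smooth_def vd_def using vector_derivative_works[of f "at x"] by (metis funpow_0)

lemma smooth_continuous: "smooth f \<Longrightarrow> continuous_on S f"
  by (meson continuous_at_imp_continuous_on has_vector_derivative_continuous smooth_has_vector_derivative)

lemma smooth_vd_pow: "smooth f \<Longrightarrow> smooth ((vd ^^ k) f)"
  by (induction k) (auto intro: smooth_vd)

lemma smoothI_vd:
  assumes "\<And>x. (f has_vector_derivative g x) (at x)" "smooth g"
  shows "smooth f"
proof (rule smooth_coinduct[where P="\<lambda>h. h = f \<or> smooth h"])
  fix h assume "h = f \<or> smooth h"
  then show "\<exists>k. (k = f \<or> smooth k) \<and> (\<forall>x. (h has_vector_derivative k x) (at x))"
  proof
    assume "h = f" then show ?thesis using assms by (intro exI[of _ g]) auto
  next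
    assume "smooth h" then show ?thesis
      by (intro exI[of _ "vd h"]) (auto intro: smooth_vd smooth_has_vector_derivative)
  qed
qed simp

lemma vd_eqI: "(\<And>x. (f has_vector_derivative g x) (at x)) \<Longrightarrow> vd f = g"
  unfolding vd_def using vector_derivative_at by blast

lemma smooth_const [simp]: "smooth (\<lambda>x. c)"
proof (rule smooth_coinduct[where P="\<lambda>g. \<exists>c. g = (\<lambda>x. c)"])
  fix g :: "real \<Rightarrow> complex" assume "\<exists>c. g = (\<lambda>x. c)"
  then show "\<exists>h. (\<exists>c. h = (\<lambda>x. c)) \<and> (\<forall>x. (g has_vector_derivative h x) (at x))"
    by (intro exI[of _ "\<lambda>_. 0"]) auto
qed blast

text \<open>Products of smooth functions are not closed under differentiation, but finite sums of
  such products are; this is the class needed for \<open>smooth_coinduct\<close>.\<close>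

inductive product_span :: "(real \<Rightarrow> complex) \<Rightarrow> bool" where
  product: "smooth f \<Longrightarrow> smooth g \<Longrightarrow> product_span (\<lambda>x. f x * g x)"
| plus: "product_span f \<Longrightarrow> product_span g \<Longrightarrow> product_span (\<lambda>x. f x + g x)"

lemma product_span_smooth: "product_span f \<Longrightarrow> smooth f"
proof (erule smooth_coinduct)
  fix g assume "product_span g"
  then show "\<exists>h. product_span h \<and> (\<forall>x. (g has_vector_derivative h x) (at x))"
  proof induction
    case (product f g)
    have "product_span (\<lambda>x. f x * vd g x + vd f x * g x)"
      using product by (intro product_span.intros smooth_vd)
    moreover have "((\<lambda>x. f x * g x) has_vector_derivative f x * vd g x + vd f x * g x) (at x)" for x
      using product by (intro has_vector_derivative_mult smooth_has_vector_derivative)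
    ultimately show ?case by blast
  next
    case (plus f g)
    then obtain h k where "product_span h" "\<And>x. (f has_vector_derivative h x) (at x)"
      "product_span k" "\<And>x. (g has_vector_derivative k x) (at x)" by blast
    then show ?case
      by (intro exI[of _ "\<lambda>x. h x + k x"]) (auto intro: product_span.plus has_vector_derivative_add)
  qed
qed

lemma smooth_mult: "smooth f \<Longrightarrow> smooth g \<Longrightarrow> smooth (\<lambda>x. f x * g x)"
  by (simp add: product_span.product product_span_smooth)

lemma smooth_add: "smooth f \<Longrightarrow> smooth g \<Longrightarrow> smooth (\<lambda>x. f x + g x)"
  using product_span_smooth[OF product_span.plus[OF product_span.product product_span.product],
      of f "\<lambda>_. 1" g "\<lambda>_. 1"] by simp

lemma smooth_cmult: "smooth f \<Longrightarrow> smooth (\<lambda>x. c * f x)"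
  by (simp add: smooth_mult)

lemma smooth_diff: "smooth f \<Longrightarrow> smooth g \<Longrightarrow> smooth (\<lambda>x. f x - g x)"
  using smooth_add[of f "\<lambda>x. -1 * g x"] smooth_cmult[of g "-1"] by simp

lemma has_vector_derivative_affine:
  fixes f :: "real \<Rightarrow> complex"
  assumes "(f has_vector_derivative d) (at (a * x + c))"
  shows "((\<lambda>x. f (a * x + c)) has_vector_derivative a *\<^sub>R d) (at x)"
proof -
  have "((\<lambda>x. a * x + c) has_vector_derivative a) (at x)"
    unfolding has_real_derivative_iff_has_vector_derivative[symmetric] by (auto intro!: derivative_eq_intros)
  then show ?thesis using vector_diff_chain_at[of "\<lambda>x. a * x + c" a x f d] assms by (simp add: o_def)
qed

lemma smooth_affine: "smooth f \<Longrightarrow> smooth (\<lambda>x. f (a * x + c))"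
proof (rule smooth_coinduct[where P="\<lambda>g. \<exists>h k. smooth h \<and> g = (\<lambda>x. k * h (a * x + c))"])
  assume "smooth f"
  then show "\<exists>h k. smooth h \<and> (\<lambda>x. f (a * x + c)) = (\<lambda>x. k * h (a * x + c))"
    by (intro exI[of _ f] exI[of _ 1]) auto
next
  fix g assume "\<exists>h k. smooth h \<and> g = (\<lambda>x. k * h (a * x + c))"
  then obtain h k where h: "smooth h" "g = (\<lambda>x. k * h (a * x + c))" by blast
  have "(g has_vector_derivative k * (a *\<^sub>R vd h (a * x + c))) (at x)" for x
    unfolding h(2) by (intro has_vector_derivative_mult_right has_vector_derivative_affine
        smooth_has_vector_derivative h)
  then show "\<exists>h. (\<exists>ha k. smooth ha \<and> h = (\<lambda>x. k * ha (a * x + c))) \<and> (\<forall>x. (g has_vector_derivative h x) (at x))"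
    by (intro exI[of _ "\<lambda>x. (k * a) * vd h (a * x + c)"])
       (auto simp: scaleR_conv_of_real mult_ac intro!: exI[of _ "vd h"] exI[of _ "k * a"] smooth_vd h)
qed

lemma smooth_ee: "smooth (\<lambda>x. ee (c * x))"
proof (rule smooth_coinduct[where P="\<lambda>g. \<exists>k. g = (\<lambda>x. k * ee (c * x))"])
  show "\<exists>k. (\<lambda>x. ee (c * x)) = (\<lambda>x. k * ee (c * x))" by (intro exI[of _ 1]) simp
  fix g assume "\<exists>k. g = (\<lambda>x. k * ee (c * x))"
  then obtain k where g: "g = (\<lambda>x. k * ee (c * x))" by blast
  have "(g has_vector_derivative k * (2 * pi * \<i> * c * ee (c * x))) (at x)" for x
    unfolding g by (intro has_vector_derivative_mult_right has_vector_derivative_ee)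
  then show "\<exists>h. (\<exists>k. h = (\<lambda>x. k * ee (c * x))) \<and> (\<forall>x. (g has_vector_derivative h x) (at x))"
    by (intro exI[of _ "\<lambda>x. (k * (2 * pi * \<i> * c)) * ee (c * x)"] conjI exI[of _ "k * (2 * pi * \<i> * c)"] refl)
      (simp only: mult.assoc, simp)
qed

lemma smooth_of_real: "smooth complex_of_real"
  by (rule smoothI_vd[where g="\<lambda>_. 1"])
     (auto simp: has_vector_derivative_complex_iff)

lemma smooth_cnj: "smooth f \<Longrightarrow> smooth (\<lambda>x. cnj (f x))"
proof (rule smooth_coinduct[where P="\<lambda>g. \<exists>h. smooth h \<and> g = (\<lambda>x. cnj (h x))"])
  fix g assume "\<exists>h. smooth h \<and> g = (\<lambda>x. cnj (h x))"
  then obtain h where h: "smooth h" "g = (\<lambda>x. cnj (h x))" by blast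
  then have "(g has_vector_derivative cnj (vd h x)) (at x)" for x
    using has_vector_derivative_cnj[OF smooth_has_vector_derivative[of h x]] by simp
  then show "\<exists>k. (\<exists>h. smooth h \<and> k = (\<lambda>x. cnj (h x))) \<and> (\<forall>x. (g has_vector_derivative k x) (at x))"
    using h smooth_vd by blast
qed auto

section \<open>Supports\<close>

lemma fsupp_subset: "closed S \<Longrightarrow> (\<And>x. f x \<noteq> 0 \<Longrightarrow> x \<in> S) \<Longrightarrow> fsupp f \<subseteq> S"
  unfolding fsupp_def by (rule closure_minimal) auto

lemma not_in_fsupp: "x \<notin> fsupp f \<Longrightarrow> f x = 0"
  unfolding fsupp_def using closure_subset[of "{x. f x \<noteq> 0}"] by (auto simp: subset_iff)

lemma closed_fsupp [simp]: "closed (fsupp f)"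
  unfolding fsupp_def by simp

lemma compact_fsuppI:
  assumes "\<And>x. f x \<noteq> 0 \<Longrightarrow> a \<le> x \<and> x \<le> b"
  shows "compact (fsupp f)"
proof -
  have "fsupp f \<subseteq> {a..b}" using assms by (intro fsupp_subset) auto
  then have "bounded (fsupp f)" using bounded_closed_interval bounded_subset by blast
  then show ?thesis by (simp add: compact_eq_bounded_closed)
qed

lemma compact_fsuppE:
  assumes "compact (fsupp f)"
  obtains R where "R > 0" "\<And>x. f x \<noteq> 0 \<Longrightarrow> \<bar>x\<bar> < R" "fsupp f \<subseteq> {-R..R}"
proof -
  obtain a where a: "\<forall>x\<in>fsupp f. norm x \<le> a"
    using assms compact_imp_bounded bounded_iff by blast
  show ?thesis
  proof (rule that[of "\<bar>a\<bar> + 1"])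
    show "\<bar>x\<bar> < \<bar>a\<bar> + 1" if "f x \<noteq> 0" for x
      using a not_in_fsupp[of x f] that by fastforce
    show "fsupp f \<subseteq> {- (\<bar>a\<bar> + 1)..\<bar>a\<bar> + 1}" using a by fastforce
  qed auto
qed

lemma CcI: "continuous_on UNIV f \<Longrightarrow> (\<And>x. f x \<noteq> 0 \<Longrightarrow> a \<le> x \<and> x \<le> b) \<Longrightarrow> Cc f"
  unfolding Cc_def using compact_fsuppI by blast

lemma CcE:
  assumes "Cc f"
  obtains R where "R > 0" "\<And>x. f x \<noteq> 0 \<Longrightarrow> \<bar>x\<bar> < R" "fsupp f \<subseteq> {-R..R}"
  using assms compact_fsuppE[of f] unfolding Cc_def by metis

lemma Cc_continuous: "Cc f \<Longrightarrow> continuous_on S f"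
  unfolding Cc_def using continuous_on_subset by blast

lemma testfunI: "smooth f \<Longrightarrow> (\<And>x. f x \<noteq> 0 \<Longrightarrow> a \<le> x \<and> x \<le> b) \<Longrightarrow> testfun f"
  unfolding testfun_def using compact_fsuppI by blast

lemma testfunE:
  assumes "testfun f"
  obtains R where "R > 0" "\<And>x. f x \<noteq> 0 \<Longrightarrow> \<bar>x\<bar> < R" "fsupp f \<subseteq> {-R..R}"
  using assms compact_fsuppE[of f] unfolding testfun_def by metis

lemma testfun_smooth: "testfun f \<Longrightarrow> smooth f"
  by (simp add: testfun_def)

lemma testfun_Cc: "testfun f \<Longrightarrow> Cc f"
  by (simp add: testfun_def Cc_def smooth_continuous)

lemma Cc_add: assumes "Cc f" "Cc g" shows "Cc (\<lambda>x. f x + g x)"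
proof -
  obtain R R' where "\<And>x. f x \<noteq> 0 \<Longrightarrow> \<bar>x\<bar> < R" "\<And>x. g x \<noteq> 0 \<Longrightarrow> \<bar>x\<bar> < R'"
    using CcE[OF assms(1)] CcE[OF assms(2)] by metis
  then have *: "f x + g x \<noteq> 0 \<Longrightarrow> - max R R' \<le> x \<and> x \<le> max R R'" for x
    by (smt (verit) add.right_neutral)
  show ?thesis by (rule CcI[OF _ *]) (intro continuous_intros Cc_continuous assms)
qed

lemma Cc_mult: assumes "Cc f" "continuous_on UNIV g" shows "Cc (\<lambda>x. g x * f x)"
proof -
  obtain R where "\<And>x. f x \<noteq> 0 \<Longrightarrow> \<bar>x\<bar> < R" using CcE[OF assms(1)] by metis
  then have *: "g x * f x \<noteq> 0 \<Longrightarrow> - R \<le> x \<and> x \<le> R" for x by fastforce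
  show ?thesis by (rule CcI[OF _ *]) (intro continuous_intros Cc_continuous assms)
qed

lemma Cc_zero [simp]: "Cc (\<lambda>x. 0)"
  by (rule CcI) auto

lemma Cc_cmult: "Cc f \<Longrightarrow> Cc (\<lambda>x. c * f x)"
  by (rule Cc_mult) auto

lemma Cc_sum: "(\<And>i. i \<in> I \<Longrightarrow> Cc (f i)) \<Longrightarrow> Cc (\<lambda>x. \<Sum>i\<in>I. f i x)"
  by (induction I rule: infinite_finite_induct) (auto intro: Cc_add)

lemma Cc_diff: "Cc f \<Longrightarrow> Cc g \<Longrightarrow> Cc (\<lambda>x. f x - g x)"
  using Cc_add[of f "\<lambda>x. -1 * g x"] Cc_cmult[of g "-1"] by simp

lemma Cc_affine: assumes "Cc f" "a \<noteq> 0" shows "Cc (\<lambda>x. f (a * x + c))"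
proof -
  obtain R where R: "\<And>x. f x \<noteq> 0 \<Longrightarrow> \<bar>x\<bar> < R" using CcE[OF assms(1)] by metis
  have *: "- ((R + \<bar>c\<bar>) / \<bar>a\<bar>) \<le> x \<and> x \<le> (R + \<bar>c\<bar>) / \<bar>a\<bar>" if "f (a * x + c) \<noteq> 0" for x
  proof -
    have "\<bar>a\<bar> * \<bar>x\<bar> \<le> R + \<bar>c\<bar>" using R[OF that] by (simp add: abs_mult[symmetric])
    then have "\<bar>x\<bar> \<le> (R + \<bar>c\<bar>) / \<bar>a\<bar>" using assms by (simp add: field_simps)
    then show ?thesis by (simp add: abs_le_iff)
  qed
  show ?thesis
    by (rule CcI[OF _ *]) (intro continuous_on_compose2[OF Cc_continuous[OF assms(1)], of UNIV] continuous_intros, auto)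
qed

lemma testfun_iff: "testfun f \<longleftrightarrow> smooth f \<and> Cc f"
  unfolding testfun_def Cc_def by (auto intro: smooth_continuous)

lemma testfun_add: "testfun f \<Longrightarrow> testfun g \<Longrightarrow> testfun (\<lambda>x. f x + g x)"
  by (simp add: testfun_iff Cc_add smooth_add)

lemma testfun_mult: "testfun f \<Longrightarrow> smooth g \<Longrightarrow> testfun (\<lambda>x. g x * f x)"
  by (simp add: testfun_iff Cc_mult smooth_mult smooth_continuous)

lemma testfun_cmult: "testfun f \<Longrightarrow> testfun (\<lambda>x. c * f x)"
  by (simp add: testfun_mult)

lemma testfun_affine: "testfun f \<Longrightarrow> a \<noteq> 0 \<Longrightarrow> testfun (\<lambda>x. f (a * x + c))"
  by (simp add: testfun_iff Cc_affine smooth_affine)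

lemma testfun_shift: "testfun f \<Longrightarrow> testfun (\<lambda>x. f (x - c))"
  using testfun_affine[of f 1 "-c"] by simp

lemma Cc_cnj: assumes "Cc f" shows "Cc (\<lambda>x. cnj (f x))"
proof -
  obtain R where R: "\<And>x. f x \<noteq> 0 \<Longrightarrow> \<bar>x\<bar> < R" using CcE[OF assms(1)] by metis
  have *: "cnj (f x) \<noteq> 0 \<Longrightarrow> -R \<le> x \<and> x \<le> R" for x using R[of x] by auto
  show ?thesis by (rule CcI[OF _ *]) (intro continuous_intros Cc_continuous assms)
qed

lemma testfun_cnj: "testfun f \<Longrightarrow> testfun (\<lambda>x. cnj (f x))"
  by (simp add: testfun_iff Cc_cnj smooth_cnj)

lemma testfun_vd: assumes "testfun f" shows "testfun (vd f)"
proof -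
  obtain R where R: "\<And>x. f x \<noteq> 0 \<Longrightarrow> \<bar>x\<bar> < R" using testfunE[OF assms(1)] by metis
  have "vd f x = 0" if x: "\<bar>x\<bar> > R" for x
  proof -
    have "(f has_vector_derivative 0) (at x)"
    proof (rule has_vector_derivative_transform_within_open[where f="\<lambda>_. 0"])
      show "open {y::real. \<bar>y\<bar> > R}" by (intro open_Collect_less continuous_intros)
      show "((\<lambda>_. 0) has_vector_derivative 0) (at x)" by simp
      show "x \<in> {y. R < \<bar>y\<bar>}" using x by simp
      show "0 = f y" if "y \<in> {y. R < \<bar>y\<bar>}" for y using that R[of y] by fastforce
    qed
    then show ?thesis unfolding vd_def by (rule vector_derivative_at)
  qed
  then have "vd f x \<noteq> 0 \<Longrightarrow> -R \<le> x \<and> x \<le> R" for x by (smt (verit))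
  then show ?thesis using testfunI[OF smooth_vd[OF testfun_smooth[OF assms]]] by blast
qed

section \<open>Bump functions\<close>

text \<open>The polynomial in \<open>1 / x\<close> makes the family stable under differentiation:
  the derivative replaces \<open>p\<close> by \<open>X^2 * (p - p')\<close>.\<close>

definition flat :: "real poly \<Rightarrow> real \<Rightarrow> real" where
  "flat p x = (if x > 0 then poly p (1 / x) * exp (- (1 / x)) else 0)"

lemma poly_exp_decay: "((\<lambda>t::real. poly p t * exp (- t)) \<longlongrightarrow> 0) at_top"
proof (induction p)
  case (pCons a p)
  have mono: "((\<lambda>t::real. t ^ k * exp (- t)) \<longlongrightarrow> 0) at_top" for k
    using tendsto_power_div_exp_0[of k] by (simp add: exp_minus divide_inverse)
  have "((\<lambda>t::real. (\<Sum>i\<le>degree (pCons a p). coeff (pCons a p) i * (t ^ i * exp (- t)))) \<longlongrightarrow>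
      (\<Sum>i\<le>degree (pCons a p). coeff (pCons a p) i * 0)) at_top"
    by (intro tendsto_sum tendsto_mult tendsto_const mono)
  then show ?case by (simp only: poly_altdef sum_distrib_right mult.assoc) simp
qed auto

lemma flat_has_real_derivative:
  "(flat p has_real_derivative flat ([:0, 0, 1:] * (p - pderiv p)) x) (at x)"
proof (cases x "0::real" rule: linorder_cases)
  case less
  have "((\<lambda>_. 0) has_real_derivative 0) (at x)" by simp
  then have "(flat p has_real_derivative 0) (at x)"
    by (rule DERIV_cong_ev[THEN iffD1, rotated -1])
       (use less in \<open>auto simp: flat_def intro!: eventually_mono[OF eventually_nhds_in_open[of "{..<0}"]]\<close>)
  then show ?thesis using less by (simp add: flat_def)
next
  case greater
  have "((\<lambda>x. poly p (1 / x) * exp (- (1 / x))) has_real_derivative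
       flat ([:0, 0, 1:] * (p - pderiv p)) x) (at x)"
    using greater by (auto intro!: derivative_eq_intros DERIV_chain2[OF poly_DERIV]
        simp: flat_def field_simps power2_eq_square)
  then show ?thesis
    by (rule DERIV_cong_ev[THEN iffD1, rotated -1])
       (use greater in \<open>auto simp: flat_def intro!: eventually_mono[OF eventually_nhds_in_open[of "{0<..}"]]\<close>)
next
  case equal
  have "((\<lambda>h. (flat p (0 + h) - flat p 0) / h) \<longlongrightarrow> 0) (at 0)"
  proof (rule filterlim_split_at)
    show "((\<lambda>h. (flat p (0 + h) - flat p 0) / h) \<longlongrightarrow> 0) (at_left 0)"
      by (rule Lim_transform_eventually[where f="\<lambda>_. 0"])
         (auto simp: flat_def eventually_at_left_field intro!: exI[of _ "-1"])
    have "((\<lambda>h::real. poly ([:0, 1:] * p) (inverse h) * exp (- inverse h)) \<longlongrightarrow> 0) (at_right 0)"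
      by (rule filterlim_compose[OF poly_exp_decay filterlim_inverse_at_top_right])
    then show "((\<lambda>h. (flat p (0 + h) - flat p 0) / h) \<longlongrightarrow> 0) (at_right 0)"
      by (rule Lim_transform_eventually)
         (auto simp: flat_def eventually_at_right_field field_simps intro!: exI[of _ 1])
  qed
  then show ?thesis using equal by (simp add: DERIV_def flat_def)
qed

lemma has_vector_derivative_of_real_complex:
  "(f has_real_derivative d) (at x) \<Longrightarrow> ((\<lambda>x. complex_of_real (f x)) has_vector_derivative of_real d) (at x)"
  by (simp add: has_vector_derivative_complex_iff)

lemma smooth_flat: "smooth (\<lambda>x. complex_of_real (flat p x))"
proof (rule smooth_coinduct[where P="\<lambda>g. \<exists>p. g = (\<lambda>x. complex_of_real (flat p x))"])
  fix g assume "\<exists>p. g = (\<lambda>x. complex_of_real (flat p x))"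
  then obtain p where g: "g = (\<lambda>x. complex_of_real (flat p x))" by blast
  have "(g has_vector_derivative complex_of_real (flat ([:0, 0, 1:] * (p - pderiv p)) x)) (at x)" for x
    unfolding g by (intro has_vector_derivative_of_real_complex flat_has_real_derivative)
  then show "\<exists>h. (\<exists>p. h = (\<lambda>x. complex_of_real (flat p x))) \<and> (\<forall>x. (g has_vector_derivative h x) (at x))"
    by (intro exI[of _ "\<lambda>x. complex_of_real (flat ([:0, 0, 1:] * (p - pderiv p)) x)"] conjI allI
        exI[of _ "[:0, 0, 1:] * (p - pderiv p)"] refl)
qed blast

text \<open>The factor \<open>exp 2\<close> normalizes the value at \<open>0\<close>, which is also
  the maximum, to \<open>1\<close>.\<close>

definition bump :: "real \<Rightarrow> real" where
  "bump x = exp 2 * (flat 1 (1 + x) * flat 1 (1 - x))"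

lemma bump_nonneg: "0 \<le> bump x"
  by (simp add: bump_def flat_def)

lemma bump_nonzero_iff: "bump x \<noteq> 0 \<longleftrightarrow> \<bar>x\<bar> < 1"
  by (auto simp: bump_def flat_def)

lemma bump_0 [simp]: "bump 0 = 1"
  by (simp add: bump_def flat_def exp_add[symmetric])

lemma bump_le_1: "bump x \<le> 1"
proof (cases "\<bar>x\<bar> < 1")
  case True
  then have "x\<^sup>2 < 1" by (simp add: abs_square_less_1)
  then have p: "0 < (1 + x) * (1 - x)" and "(1 + x) * (1 - x) \<le> 1" by (auto simp: algebra_simps power2_eq_square)
  then have "2 \<le> 2 / ((1 + x) * (1 - x))" by (simp add: field_simps)
  also have "\<dots> = 1 / (1 + x) + 1 / (1 - x)" using True by (simp add: field_simps)
  finally have "2 - 1 / (1 + x) - 1 / (1 - x) \<le> 0" by simp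
  then have "exp (2 - 1 / (1 + x) - 1 / (1 - x)) \<le> 1" by simp
  then show ?thesis using True
    by (simp add: bump_def flat_def exp_add[symmetric] algebra_simps)
qed (use bump_nonzero_iff[of x] in auto)

definition cbump :: "real \<Rightarrow> real \<Rightarrow> real \<Rightarrow> complex" where
  "cbump c r x = of_real (bump ((x - c) / r))"

lemma smooth_bump: "smooth (\<lambda>x. complex_of_real (bump x))"
  using smooth_cmult[OF smooth_mult[OF smooth_affine[OF smooth_flat[of 1], of 1 1]
      smooth_affine[OF smooth_flat[of 1], of "-1" 1]], of "of_real (exp 2)"]
  by (simp add: bump_def add.commute[of 1])

lemma cbump_nonzero_iff: "r > 0 \<Longrightarrow> cbump c r x \<noteq> 0 \<longleftrightarrow> \<bar>x - c\<bar> < r"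
  by (simp add: cbump_def bump_nonzero_iff)

lemma cbump_center [simp]: "cbump c r c = 1"
  by (simp add: cbump_def)

lemma norm_cbump_le_1: "norm (cbump c r x) \<le> 1"
  using bump_nonneg bump_le_1 by (simp add: cbump_def)

lemma testfun_cbump:
  assumes "r > 0" shows "testfun (cbump c r)"
proof (rule testfunI)
  show "smooth (cbump c r)"
    using smooth_affine[OF smooth_bump, of "1 / r" "- c / r"] assms
    by (simp add: cbump_def[abs_def] diff_divide_distrib)
  show "c - r \<le> x \<and> x \<le> c + r" if "cbump c r x \<noteq> 0" for x
    using that cbump_nonzero_iff[OF assms, of c x] by auto
qed

lemma bump_continuous: "continuous_on S bump"
proof -
  have "continuous_on S (\<lambda>x. Re (complex_of_real (bump x)))"
    by (intro continuous_intros smooth_continuous smooth_bump)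
  then show ?thesis by simp
qed

lemma bump_integral_pos: "0 < integral {-1..1} bump"
proof -
  have "0 \<le> integral {-1..1} bump"
    by (rule integral_nonneg) (auto intro: integrable_continuous_real bump_continuous bump_nonneg)
  moreover have "integral {-1..1} bump \<noteq> 0"
  proof
    assume "integral {-1..1} bump = 0"
    then have "\<forall>x\<in>{-1..1}. bump x = 0"
      using integral_eq_0_iff[of "-1" 1 bump] bump_continuous bump_nonneg by auto
    moreover have "(0::real) \<in> {-1..1}" by simp
    ultimately have "bump 0 = 0" by blast
    then show False by simp
  qed
  ultimately show ?thesis by linarith
qed

definition step :: "real \<Rightarrow> real" where
  "step x = integral {-1..max (-1) x} bump / integral {-1..1} bump"

lemma step_has_real_derivative: "(step has_real_derivative bump x / integral {-1..1} bump) (at x)"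
proof -
  have int: "bump integrable_on {a..b}" for a b by (intro integrable_continuous_real bump_continuous)
  \<comment> \<open>The base point of the integral is moved to the left of both \<open>-1\<close>
    and \<open>x\<close>, so that \<open>x\<close> is interior to the interval and the fundamental
    theorem of calculus gives a two-sided derivative.\<close>
  define a where "a = min (-2) (x - 1)"
  have eq: "step y = integral {a..y} bump / integral {-1..1} bump" if "y > a" for y
  proof -
    have "integral {-1..max (-1) y} bump = integral {a..y} bump"
    proof (cases "y \<le> -1")
      case True
      then have "integral {a..y} bump = integral {a..y} (\<lambda>_. 0)"
        by (intro integral_cong) (use bump_nonzero_iff in force)
      then show ?thesis using True by simp
    next
      case False
      have "integral {a..-1} bump = integral {a..-1} (\<lambda>_. 0)"
        by (intro integral_cong) (use bump_nonzero_iff in force)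
      moreover have "integral {a..-1} bump + integral {-1..y} bump = integral {a..y} bump"
        using False by (intro Henstock_Kurzweil_Integration.integral_combine int) (auto simp: a_def)
      ultimately show ?thesis using False by simp
    qed
    then show ?thesis by (simp add: step_def)
  qed
  have "((\<lambda>y. integral {a..y} bump) has_vector_derivative bump x) (at x within {a..x+1})"
    by (intro integral_has_vector_derivative bump_continuous) (auto simp: a_def)
  then have "((\<lambda>y. integral {a..y} bump) has_real_derivative bump x) (at x)"
    by (simp add: has_real_derivative_iff_has_vector_derivative at_within_Icc_at a_def)
  then have "((\<lambda>y. integral {a..y} bump / integral {-1..1} bump) has_real_derivative bump x / integral {-1..1} bump) (at x)"
    by (rule DERIV_cdivide)
  then show ?thesis
    by (rule DERIV_cong_ev[THEN iffD1, rotated -1])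
       (auto simp: eq a_def intro!: eventually_mono[OF eventually_nhds_in_open[of "{a<..}"]])
qed

lemma step_eq_1: "x \<ge> 1 \<Longrightarrow> step x = 1"
proof -
  assume x: "x \<ge> 1"
  have int: "bump integrable_on {a..b}" for a b by (intro integrable_continuous_real bump_continuous)
  have "integral {1..x} bump = integral {1..x} (\<lambda>_. 0)"
    by (intro integral_cong) (use bump_nonzero_iff in force)
  moreover have "integral {-1..1} bump + integral {1..x} bump = integral {-1..x} bump"
    using x by (intro Henstock_Kurzweil_Integration.integral_combine int) auto
  ultimately show ?thesis using x bump_integral_pos by (simp add: step_def)
qed

lemma step_eq_0: "x \<le> -1 \<Longrightarrow> step x = 0"
  by (simp add: step_def)

lemma smooth_step: "smooth (\<lambda>x. complex_of_real (step x))"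
  by (rule smoothI_vd[OF has_vector_derivative_of_real_complex[OF step_has_real_derivative]])
     (use smooth_cmult[OF smooth_bump, of "1 / of_real (integral {-1..1} bump)"] in \<open>simp\<close>)

text \<open>A smooth cut-off, equal to \<open>1\<close> on \<open>[-2, 2]\<close> and zero outside
  \<open>[-4, 4]\<close>. Rescaled, it truncates Schwartz functions and localizes near
  atoms.\<close>

definition plateau :: "real \<Rightarrow> complex" where
  "plateau x = of_real (step (x + 3)) * of_real (step (3 - x))"

lemma testfun_plateau: "testfun plateau"
proof (rule testfunI)
  show "smooth plateau"
    using smooth_mult[OF smooth_affine[OF smooth_step, of 1 3] smooth_affine[OF smooth_step, of "-1" 3]]
    by (simp add: plateau_def[abs_def] algebra_simps)
  show "-4 \<le> x \<and> x \<le> 4" if "plateau x \<noteq> 0" for x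
    using that step_eq_0[of "x + 3"] step_eq_0[of "3 - x"] unfolding plateau_def
    by (smt (verit) mult_eq_0_iff of_real_eq_0_iff)
qed

lemma plateau_eq_1: "\<bar>x\<bar> \<le> 2 \<Longrightarrow> plateau x = 1"
  by (simp add: plateau_def step_eq_1)

section \<open>Integrals and Fourier transforms of compactly supported functions\<close>

lemma Cc_integrable: assumes "Cc f" shows "integrable lborel f"
proof -
  obtain R where R: "\<And>x. f x \<noteq> 0 \<Longrightarrow> \<bar>x\<bar> < R" using CcE[OF assms] by metis
  have "integrable lborel (\<lambda>x. indicator {-R..R} x *\<^sub>R f x)"
    by (intro borel_integrable_compact Cc_continuous assms) auto
  moreover have "(\<lambda>x. indicator {-R..R} x *\<^sub>R f x) = f"
    using R by (force simp: fun_eq_iff indicator_def)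
  ultimately show ?thesis by simp
qed

lemma Cc_integral: "Cc f \<Longrightarrow> integral UNIV f = (LINT x|lborel. f x)"
  by (rule integral_lborel[OF Cc_integrable])

lemma Cc_ee_mult: "Cc f \<Longrightarrow> Cc (\<lambda>x. ee (c * x) * f x)"
  by (intro Cc_mult continuous_intros)

lemma ft_lborel: "Cc f \<Longrightarrow> ft f y = (LINT x|lborel. ee (- y * x) * f x)"
  unfolding ft_eq using Cc_integral[OF Cc_ee_mult[of f "-y"]] by (simp add: mult_ac)

lemma ft_interval:
  assumes "continuous_on UNIV f" "\<And>x. f x \<noteq> 0 \<Longrightarrow> a \<le> x \<and> x \<le> b"
  shows "ft f y = integral {a..b} (\<lambda>x. ee (- (x * y)) * f x)"
proof -
  have "(\<lambda>x. ee (- (x * y)) * f x) = (\<lambda>x. if x \<in> {a..b} then ee (- (x * y)) * f x else 0)"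
    using assms(2) by (force simp: fun_eq_iff)
  then show ?thesis unfolding ft_eq using integral_restrict_UNIV[of "{a..b}" "\<lambda>x. ee (- (x * y)) * f x"] by simp
qed

lemma norm_ft_le: "Cc f \<Longrightarrow> norm (ft f y) \<le> (LINT x|lborel. norm (f x))"
  unfolding ft_lborel by (rule order_trans[OF integral_norm_bound]) (simp add: norm_mult)

lemma ft_add: "Cc f \<Longrightarrow> Cc g \<Longrightarrow> ft (\<lambda>x. f x + g x) y = ft f y + ft g y"
  by (simp only: ft_lborel Cc_add distrib_left Bochner_Integration.integral_add Cc_integrable Cc_ee_mult)

lemma ft_cmult: "Cc f \<Longrightarrow> ft (\<lambda>x. c * f x) y = c * ft f y"
  by (simp add: ft_lborel Cc_cmult mult.left_commute[of _ c])

lemma ft_zero [simp]: "ft (\<lambda>x. 0) y = 0"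
  by (simp add: ft_eq)

lemma ft_sum: "(\<And>i. i \<in> I \<Longrightarrow> Cc (f i)) \<Longrightarrow> ft (\<lambda>x. \<Sum>i\<in>I. f i x) y = (\<Sum>i\<in>I. ft (f i) y)"
  by (induction I rule: infinite_finite_induct) (auto simp: ft_add Cc_sum)

lemma ft_affine:
  assumes "Cc f" "a \<noteq> 0"
  shows "ft (\<lambda>x. f (a * x + c)) y = ee (c * y / a) * ft f (y / a) / \<bar>a\<bar>"
proof -
  have "ft f (y / a) = (LINT x|lborel. ee (- (y / a) * x) * f x)"
    by (rule ft_lborel[OF assms(1)])
  also have "\<dots> = \<bar>a\<bar> *\<^sub>R (LINT x|lborel. ee (- (y / a) * (c + a * x)) * f (c + a * x))"
    by (rule lborel_integral_real_affine[OF assms(2)])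
  also have "(\<lambda>x. ee (- (y / a) * (c + a * x)) * f (c + a * x)) = (\<lambda>x. ee (- (c * y / a)) * (ee (- y * x) * f (a * x + c)))"
  proof
    fix x
    have "- (y / a) * (c + a * x) = - (c * y / a) + - y * x" using assms(2) by (simp add: field_simps)
    then show "ee (- (y / a) * (c + a * x)) * f (c + a * x) = ee (- (c * y / a)) * (ee (- y * x) * f (a * x + c))"
      by (simp only: ee_add mult.assoc add.commute[of c])
  qed
  also have "(LINT x|lborel. ee (- (c * y / a)) * (ee (- y * x) * f (a * x + c))) = ee (- (c * y / a)) * ft (\<lambda>x. f (a * x + c)) y"
    by (simp add: ft_lborel[OF Cc_affine[OF assms]])
  finally show ?thesis using assms(2)
    by (simp add: scaleR_conv_of_real ee_minus field_simps)
qed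

lemma ft_shift: "Cc f \<Longrightarrow> ft (\<lambda>x. f (x - c)) y = ee (- (c * y)) * ft f y"
  using ft_affine[of f 1 "-c" y] by simp

lemma ft_modulate: "Cc f \<Longrightarrow> ft (\<lambda>x. ee (c * x) * f x) y = ft f (y - c)"
proof -
  have "ee (- (x * y)) * (ee (c * x) * f x) = ee (- (x * (y - c))) * f x" for x
    unfolding mult.assoc[symmetric] ee_add[symmetric] by (simp add: algebra_simps)
  then show ?thesis unfolding ft_eq by presburger
qed

lemma ft_cnj: "Cc f \<Longrightarrow> ft (\<lambda>x. cnj (f x)) y = cnj (ft f (- y))"
  using Henstock_Kurzweil_Integration.integral_cnj[of UNIV "\<lambda>x. ee (x * y) * f x"] by (simp add: ft_eq cnj_ee)

lemma ft_vd: assumes "testfun f" shows "ft (vd f) y = 2 * pi * \<i> * y * ft f y"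
proof -
  obtain R where R: "R > 0" "\<And>x. f x \<noteq> 0 \<Longrightarrow> \<bar>x\<bar> < R" using testfunE[OF assms] by metis
  obtain R' where R': "R' > 0" "\<And>x. vd f x \<noteq> 0 \<Longrightarrow> \<bar>x\<bar> < R'" using testfunE[OF testfun_vd[OF assms]] by metis
  define M where "M = max R R'"
  have M: "f x \<noteq> 0 \<Longrightarrow> -M \<le> x \<and> x \<le> M" "vd f x \<noteq> 0 \<Longrightarrow> -M \<le> x \<and> x \<le> M" for x
    using R(2)[of x] R'(2)[of x] unfolding M_def by linarith+
  have fM: "f M = 0" "f (-M) = 0" using R(2)[of M] R(2)[of "-M"] unfolding M_def by fastforce+
  have "((\<lambda>x. ee (- y * x) * f x) has_vector_derivative ee (- y * x) * vd f x + (2 * pi * \<i> * (- y) * ee (- y * x)) * f x) (at x within {-M..M})" for x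
    using has_vector_derivative_mult[OF has_vector_derivative_at_within[OF has_vector_derivative_ee]
        has_vector_derivative_at_within[OF smooth_has_vector_derivative[OF testfun_smooth[OF assms]]], of "-y" x "{-M..M}"]
    by simp
  then have "((\<lambda>x. ee (- y * x) * vd f x + (2 * pi * \<i> * (- y) * ee (- y * x)) * f x) has_integral
      ee (- y * M) * f M - ee (- y * (-M)) * f (-M)) {-M..M}"
    using R(1) R'(1) by (intro fundamental_theorem_of_calculus) (auto simp: M_def)
  then have "integral {-M..M} (\<lambda>x. ee (- (x * y)) * vd f x + (- (2 * pi * \<i> * y)) * (ee (- (x * y)) * f x)) = 0"
    unfolding fM by (subst integral_unique) (auto simp: mult_ac)
  moreover have "integral {-M..M} (\<lambda>x. ee (- (x * y)) * vd f x + (- (2 * pi * \<i> * y)) * (ee (- (x * y)) * f x))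
     = integral {-M..M} (\<lambda>x. ee (- (x * y)) * vd f x) + (- (2 * pi * \<i> * y)) * integral {-M..M} (\<lambda>x. ee (- (x * y)) * f x)"
    by (subst Henstock_Kurzweil_Integration.integral_add)
       (auto intro!: integrable_continuous_real continuous_intros smooth_continuous[OF smooth_vd[OF testfun_smooth[OF assms]]]
         smooth_continuous[OF testfun_smooth[OF assms]])
  moreover have "ft f y = integral {-M..M} (\<lambda>x. ee (- (x * y)) * f x)"
    by (rule ft_interval[OF smooth_continuous[OF testfun_smooth[OF assms]] M(1)])
  moreover have "ft (vd f) y = integral {-M..M} (\<lambda>x. ee (- (x * y)) * vd f x)"
    by (rule ft_interval[OF smooth_continuous[OF smooth_vd[OF testfun_smooth[OF assms]]] M(2)])
  ultimately show ?thesis by simp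
qed

lemma ft_has_vector_derivative:
  assumes "Cc f"
  shows "(ft f has_vector_derivative ft (\<lambda>x. (- (2 * pi * \<i>) * of_real x) * f x) y) (at y)"
proof -
  obtain R where R: "R > 0" "\<And>x. f x \<noteq> 0 \<Longrightarrow> -R \<le> x \<and> x \<le> R"
    using CcE[OF assms] by (metis abs_le_D1 abs_le_D2 less_imp_le minus_le_iff)
  define g where "g = (\<lambda>x. (- (2 * pi * \<i>) * of_real x) * f x)"
  have g: "g x \<noteq> 0 \<Longrightarrow> -R \<le> x \<and> x \<le> R" for x using R(2) unfolding g_def by fastforce
  have cg: "continuous_on UNIV g" unfolding g_def by (intro continuous_intros Cc_continuous assms)
  have "((\<lambda>y. integral (cbox (-R) R) (\<lambda>x. ee (- (x * y)) * f x)) has_vector_derivative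
      integral (cbox (-R) R) (\<lambda>x. ee (- (x * y)) * g x)) (at y within UNIV)"
  proof (rule leibniz_rule_vector_derivative[where f="\<lambda>y x. ee (- (x * y)) * f x" and fx="\<lambda>y x. ee (- (x * y)) * g x"])
    fix y x :: real
    have "((\<lambda>y. ee ((- x) * y) * f x) has_vector_derivative (2 * pi * \<i> * (- x) * ee ((- x) * y)) * f x) (at y)"
      by (intro has_vector_derivative_mult_left has_vector_derivative_ee)
    then show "((\<lambda>y. ee (- (x * y)) * f x) has_vector_derivative ee (- (x * y)) * g x) (at y within UNIV)"
      by (simp add: g_def mult_ac)
  next
    fix y :: real
    show "(\<lambda>x. ee (- (x * y)) * f x) integrable_on cbox (-R) R"
      by (intro integrable_continuous continuous_intros Cc_continuous assms)
  next
    show "continuous_on (UNIV \<times> cbox (-R) R) (\<lambda>(y, x). ee (- (x * y)) * g x)"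
      unfolding case_prod_unfold
      by (intro continuous_intros continuous_on_compose2[OF cg]) auto
  qed auto
  then show ?thesis
    unfolding g_def[symmetric] using ft_interval[OF Cc_continuous[OF assms] R(2)] ft_interval[OF cg g]
    by (simp add: cbox_interval) (metis (no_types, lifting) ext)
qed

lemma ft_continuous: "Cc f \<Longrightarrow> continuous_on S (ft f)"
  by (meson continuous_at_imp_continuous_on has_vector_derivative_continuous ft_has_vector_derivative)

lemma testfun_times_id: "testfun f \<Longrightarrow> testfun (\<lambda>x. (c * of_real x) * f x)"
  by (intro testfun_mult smooth_mult smooth_const smooth_of_real)

lemma vd_pow_ft:
  assumes "testfun f" shows "\<exists>g. testfun g \<and> (vd ^^ k) (ft f) = ft g"
proof (induction k)
  case (Suc k)
  then obtain g where g: "testfun g" "(vd ^^ k) (ft f) = ft g" by blast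
  have "vd (ft g) = ft (\<lambda>x. (- (2 * pi * \<i>) * of_real x) * g x)"
    using ft_has_vector_derivative[OF testfun_Cc[OF g(1)]] by (intro vd_eqI)
  then show ?case using g testfun_times_id[OF g(1), of "- (2 * pi * \<i>)"] by auto
qed (use assms in auto)

text \<open>Differentiating \<open>k\<close> times multiplies the transform by
  \<open>(2 * pi * \<i> * y) ^ k\<close>, and a transform is bounded by the integral of the
  modulus.\<close>

lemma ft_decay:
  assumes "testfun f" shows "\<exists>C. \<forall>y. \<bar>y\<bar> ^ k * norm (ft f y) \<le> C"
proof -
  have eq: "(2 * pi * \<bar>y\<bar>) ^ k * norm (ft f y) = norm (ft ((vd ^^ k) f) y) \<and> testfun ((vd ^^ k) f)" for y
    by (induction k) (use assms in \<open>auto simp: testfun_vd ft_vd norm_mult abs_mult\<close>)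
  then have tf: "testfun ((vd ^^ k) f)" by simp
  have "\<bar>y\<bar> ^ k * norm (ft f y) \<le> (LINT x|lborel. norm ((vd ^^ k) f x))" for y
  proof -
    have "\<bar>y\<bar> ^ k \<le> (2 * pi * \<bar>y\<bar>) ^ k"
      using pi_gt3 by (intro power_mono) (auto simp: mult_le_cancel_right1)
    then have "\<bar>y\<bar> ^ k * norm (ft f y) \<le> (2 * pi * \<bar>y\<bar>) ^ k * norm (ft f y)" by (intro mult_right_mono) auto
    then show ?thesis using eq[of y] norm_ft_le[OF testfun_Cc[OF tf], of y] by linarith
  qed
  then show ?thesis by blast
qed

lemma schwartz_ft: assumes "testfun f" shows "schwartz (ft f)"
  unfolding schwartz_def
proof (intro conjI allI)
  show "smooth (ft f)"
  proof (rule smooth_coinduct[where P="\<lambda>g. \<exists>f. testfun f \<and> g = ft f"])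
    fix g assume "\<exists>f. testfun f \<and> g = ft f"
    then obtain f where f: "testfun f" "g = ft f" by blast
    show "\<exists>h. (\<exists>f. testfun f \<and> h = ft f) \<and> (\<forall>x. (g has_vector_derivative h x) (at x))"
      unfolding f(2)
      by (intro exI[of _ "ft (\<lambda>x. (- (2 * pi * \<i>) * of_real x) * f x)"] conjI allI
          ft_has_vector_derivative[OF testfun_Cc[OF f(1)]] exI[of _ "\<lambda>x. (- (2 * pi * \<i>) * of_real x) * f x"]
          testfun_times_id f refl)
  qed (use assms in blast)
  fix a b :: nat
  obtain g where "testfun g" "(vd ^^ b) (ft f) = ft g" using vd_pow_ft[OF assms] by blast
  then show "\<exists>C. \<forall>x. \<bar>x\<bar> ^ a * cmod ((vd ^^ b) (ft f) x) \<le> C" using ft_decay by simp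
qed

section \<open>Sums over separated sets\<close>

text \<open>Uniform discreteness with the gap \<open>d\<close> as a parameter, because the density
  constants depend on it.\<close>

definition separated :: "real \<Rightarrow> real set \<Rightarrow> bool" where
  "separated d Q \<longleftrightarrow> d > 0 \<and> (\<forall>x\<in>Q. \<forall>y\<in>Q. x \<noteq> y \<longrightarrow> d \<le> \<bar>x - y\<bar>)"

definition supp :: "(real \<Rightarrow> complex) \<Rightarrow> real set" where
  "supp m = {x. m x \<noteq> 0}"

text \<open>The sum ranges over all reals, and \<open>infsum\<close> is \<open>0\<close> for a sum
  that does not converge; additivity and limits therefore rest on summability, which separation,
  growth and decay provide.\<close>

definition atomic :: "(real \<Rightarrow> complex) \<Rightarrow> rmeas" where
  "atomic m f = (\<Sum>\<^sub>\<infinity>x. m x * f x)"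

lemma separated_pos: "separated d Q \<Longrightarrow> d > 0"
  by (simp add: separated_def)

lemma separated_subset: "separated d Q \<Longrightarrow> Q' \<subseteq> Q \<Longrightarrow> separated d Q'"
  by (auto simp: separated_def)

lemma separatedD: "separated d Q \<Longrightarrow> x \<in> Q \<Longrightarrow> y \<in> Q \<Longrightarrow> \<bar>x - y\<bar> < d \<Longrightarrow> x = y"
  by (force simp: separated_def)

lemma in_supp: "x \<in> supp m \<longleftrightarrow> m x \<noteq> 0"
  by (simp add: supp_def)

text \<open>A half-open cell of length \<open>d\<close> contains at most one point. This injection
  into the integers drives both the counting bound and the comparison of sums over \<open>Q\<close>
  with sums over the integers.\<close>

lemma separated_floor_inj:
  assumes "separated d Q" shows "inj_on (\<lambda>q. \<lfloor>(q - x) / d\<rfloor>) Q"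
proof (rule inj_onI)
  fix p q assume pq: "p \<in> Q" "q \<in> Q" "\<lfloor>(p - x) / d\<rfloor> = \<lfloor>(q - x) / d\<rfloor>"
  have d: "d > 0" using assms by (simp add: separated_def)
  have "\<bar>(p - x) / d - (q - x) / d\<bar> < 1" using pq(3) by linarith
  moreover have "(p - x) / d - (q - x) / d = (p - q) / d" by (simp add: diff_divide_distrib)
  ultimately have "\<bar>p - q\<bar> < d" using d by (simp add: field_simps)
  then show "p = q" using separatedD assms pq by blast
qed

lemma separated_finite:
  assumes "separated d Q" shows "finite (Q \<inter> {a..b})"
    and "a \<le> b \<Longrightarrow> card (Q \<inter> {a..b}) \<le> (b - a) / d + 1"
proof -
  have d: "d > 0" using assms by (simp add: separated_def)
  have inj: "inj_on (\<lambda>q. \<lfloor>(q - a) / d\<rfloor>) (Q \<inter> {a..b})"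
    using separated_floor_inj[OF assms, of a] by (auto simp: inj_on_def)
  have sub: "(\<lambda>q. \<lfloor>(q - a) / d\<rfloor>) ` (Q \<inter> {a..b}) \<subseteq> {0..\<lfloor>(b - a) / d\<rfloor>}"
    using d by (auto simp: divide_right_mono floor_mono)
  show "finite (Q \<inter> {a..b})"
    using finite_imageD[OF finite_subset[OF sub] inj] by simp
  assume ab: "a \<le> b"
  have "card (Q \<inter> {a..b}) \<le> card {0..\<lfloor>(b - a) / d\<rfloor>}"
    using card_mono[OF _ sub] card_image[OF inj] by simp
  moreover have "\<lfloor>(b - a) / d\<rfloor> \<ge> 0" using ab d by simp
  ultimately have "real (card (Q \<inter> {a..b})) \<le> of_int \<lfloor>(b - a) / d\<rfloor> + 1" by simp linarith
  also have "\<dots> \<le> (b - a) / d + 1" by linarith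
  finally show "card (Q \<inter> {a..b}) \<le> (b - a) / d + 1" .
qed

lemma summable_inverse_square_int: "(\<lambda>k::int. 1 / (1 + (real_of_int k)\<^sup>2)) summable_on UNIV"
proof -
  have "summable (\<lambda>n::nat. 1 / (1 + (real n)\<^sup>2))"
    by (rule summable_comparison_test[OF _ inverse_power_summable[of 2]])
       (auto intro!: exI[of _ 1] le_imp_inverse_le simp: inverse_eq_divide[symmetric])
  then have n: "(\<lambda>n::nat. 1 / (1 + (real n)\<^sup>2)) summable_on UNIV"
    by (simp add: summable_on_UNIV_nonneg_real_iff)
  have "(\<lambda>k::int. 1 / (1 + (real_of_int k)\<^sup>2)) summable_on (range int)"
    using n by (subst summable_on_reindex) (auto simp: o_def)
  moreover have "(\<lambda>k::int. 1 / (1 + (real_of_int k)\<^sup>2)) summable_on (range (\<lambda>n. - int n))"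
    using n by (subst summable_on_reindex) (auto simp: o_def inj_on_def)
  ultimately have "(\<lambda>k::int. 1 / (1 + (real_of_int k)\<^sup>2)) summable_on (range int \<union> range (\<lambda>n. - int n))"
    by (rule summable_on_union)
  moreover have "k \<in> range int \<union> range (\<lambda>n. - int n)" for k
    by (cases k rule: int_cases2) auto
  then have "range int \<union> range (\<lambda>n. - int n) = UNIV" by blast
  ultimately show ?thesis by simp
qed

text \<open>The prefactor compares \<open>1 + k^2\<close>, for the index \<open>k\<close> of the
  cell of length \<open>d\<close> that contains \<open>q\<close>, with \<open>1 + (q - x)^2\<close>.
  The constant does not depend on the centre \<open>x\<close>.\<close>

definition sep_const :: "real \<Rightarrow> real" where
  "sep_const d = (3 + 2 / d\<^sup>2) * (\<Sum>\<^sub>\<infinity>k::int. 1 / (1 + (real_of_int k)\<^sup>2))"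

lemma sep_const_nonneg: "sep_const d \<ge> 0"
  unfolding sep_const_def by (intro mult_nonneg_nonneg infsum_nonneg) auto

lemma separated_sum_le:
  assumes "separated d Q" "finite F" "F \<subseteq> Q"
  shows "(\<Sum>q\<in>F. 1 / (1 + (q - x)\<^sup>2)) \<le> sep_const d"
proof -
  have d: "d > 0" using assms by (simp add: separated_def)
  define k where "k q = \<lfloor>(q - x) / d\<rfloor>" for q
  have inj: "inj_on k F" unfolding k_def using separated_floor_inj[OF assms(1), of x] assms(3) inj_on_subset by blast
  have le: "1 / (1 + (q - x)\<^sup>2) \<le> (3 + 2 / d\<^sup>2) * (1 / (1 + (real_of_int (k q))\<^sup>2))" for q
  proof -
    define t where "t = (q - x) / d"
    have "\<bar>real_of_int (k q)\<bar> \<le> \<bar>t\<bar> + 1" unfolding k_def t_def by linarith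
    then have "(real_of_int (k q))\<^sup>2 \<le> (\<bar>t\<bar> + 1)\<^sup>2" by (simp add: abs_le_square_iff[symmetric])
    also have "\<dots> \<le> 2 * t\<^sup>2 + 2" using sum_squares_bound[of "\<bar>t\<bar>" 1] by (simp add: power2_sum)
    finally have "1 + (real_of_int (k q))\<^sup>2 \<le> 3 + 2 * t\<^sup>2" by simp
    also have "2 * t\<^sup>2 = 2 / d\<^sup>2 * (q - x)\<^sup>2" unfolding t_def by (simp add: power_divide)
    also have "3 + 2 / d\<^sup>2 * (q - x)\<^sup>2 \<le> (3 + 2 / d\<^sup>2) * (1 + (q - x)\<^sup>2)"
      unfolding distrib_left distrib_right by simp
    finally have *: "1 + (real_of_int (k q))\<^sup>2 \<le> (3 + 2 / d\<^sup>2) * (1 + (q - x)\<^sup>2)" .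
    have pos: "0 < 1 + (q - x)\<^sup>2" "0 < 1 + (real_of_int (k q))\<^sup>2" by (auto simp: add_pos_nonneg)
    show ?thesis using * pos by (simp add: divide_le_eq pos_le_divide_eq)
  qed
  have "(\<Sum>q\<in>F. 1 / (1 + (q - x)\<^sup>2)) \<le> (\<Sum>q\<in>F. (3 + 2 / d\<^sup>2) * (1 / (1 + (real_of_int (k q))\<^sup>2)))"
    by (intro sum_mono le)
  also have "\<dots> = (3 + 2 / d\<^sup>2) * (\<Sum>j\<in>k ` F. 1 / (1 + (real_of_int j)\<^sup>2))"
    by (simp add: sum.reindex[OF inj] sum_distrib_left o_def)
  also have "\<dots> \<le> sep_const d"
    unfolding sep_const_def using assms(2)
    by (intro mult_left_mono finite_sum_le_infsum summable_inverse_square_int) auto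
  finally show ?thesis .
qed

lemma separated_summable:
  fixes h :: "real \<Rightarrow> real"
  assumes "separated d Q" "\<And>q. h q \<ge> 0" "\<And>q. h q \<noteq> 0 \<Longrightarrow> q \<in> Q" "\<And>q. h q \<le> C / (1 + (q - x)\<^sup>2)"
  shows "h summable_on UNIV" "infsum h UNIV \<le> \<bar>C\<bar> * sep_const d"
proof -
  have b: "sum h F \<le> \<bar>C\<bar> * sep_const d" if "finite F" for F
  proof -
    have "sum h F = sum h (F \<inter> Q)" using that assms(3) by (intro sum.mono_neutral_right) auto
    also have "\<dots> \<le> (\<Sum>q\<in>F \<inter> Q. \<bar>C\<bar> * (1 / (1 + (q - x)\<^sup>2)))"
    proof (rule sum_mono)
      fix q
      have "C / (1 + (q - x)\<^sup>2) \<le> \<bar>C\<bar> / (1 + (q - x)\<^sup>2)" by (intro divide_right_mono) auto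
      then show "h q \<le> \<bar>C\<bar> * (1 / (1 + (q - x)\<^sup>2))" using assms(4)[of q] by simp
    qed
    also have "\<dots> = \<bar>C\<bar> * (\<Sum>q\<in>F \<inter> Q. 1 / (1 + (q - x)\<^sup>2))" by (simp add: sum_distrib_left)
    also have "\<dots> \<le> \<bar>C\<bar> * sep_const d"
      using that assms(1) by (intro mult_left_mono separated_sum_le) auto
    finally show ?thesis .
  qed
  show s: "h summable_on UNIV"
    by (rule nonneg_bdd_above_summable_on) (use assms b in \<open>auto intro!: bdd_aboveI2[where M="\<bar>C\<bar> * sep_const d"]\<close>)
  show "infsum h UNIV \<le> \<bar>C\<bar> * sep_const d"
    using b by (intro infsum_le_finite_sums s) auto
qed

text \<open>Dominated convergence for unconditional sums: a finite set carries all but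
  \<open>r / 4\<close> of the majorant, convergence on it is termwise, and off it both sums are at
  most \<open>r / 4\<close>.\<close>

lemma infsum_dominated:
  fixes f :: "nat \<Rightarrow> 'a \<Rightarrow> complex"
  assumes lim: "\<And>x. (\<lambda>n. f n x) \<longlonglongrightarrow> g x" and bd: "\<And>n x. norm (f n x) \<le> h x" and sm: "h summable_on UNIV"
  shows "(\<lambda>n. infsum (f n) UNIV) \<longlonglongrightarrow> infsum g UNIV"
proof -
  have gb: "norm (g x) \<le> h x" for x
    by (rule LIMSEQ_le_const2[OF tendsto_norm[OF lim]]) (use bd in blast)
  have h0: "h x \<ge> 0" for x using gb norm_ge_zero order_trans by blast
  have sf: "f n summable_on UNIV" for n
    using abs_summable_summable Infinite_Sum.abs_summable_on_comparison_test'[OF sm] bd by blast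
  have sg: "g summable_on UNIV"
    using abs_summable_summable Infinite_Sum.abs_summable_on_comparison_test'[OF sm] gb by blast
  show ?thesis
  proof (rule LIMSEQ_I)
    fix r :: real assume r: "r > 0"
    obtain F where F: "finite F" "dist (sum h F) (infsum h UNIV) \<le> r / 4"
      using infsum_finite_approximation[OF sm, of "r / 4"] r by auto
    have split: "infsum k UNIV = sum k F + infsum k (- F)" if "k summable_on UNIV" for k :: "'a \<Rightarrow> 'b::banach"
      using infsum_Un_disjoint[of k F "- F"] that F(1) summable_on_subset_banach[OF that]
      by (metis Compl_disjoint Compl_partition finite_imp_compact infsum_finite subset_UNIV summable_on_finite)
    have tail: "infsum h (- F) \<le> r / 4" using split[OF sm] F(2) by (simp add: dist_real_def abs_le_iff)
    have smF: "h summable_on (- F)" using summable_on_subset_banach[OF sm] by auto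
    have tl: "norm (infsum k (- F)) \<le> r / 4" if "\<And>x. norm (k x) \<le> h x" for k :: "'a \<Rightarrow> complex"
    proof -
      have "(\<lambda>x. norm (k x)) summable_on (- F)" by (rule Infinite_Sum.abs_summable_on_comparison_test'[OF smF]) (rule that)
      then have "norm (infsum k (- F)) \<le> infsum (\<lambda>x. norm (k x)) (- F)" by (rule norm_infsum_bound)
      also have "\<dots> \<le> infsum h (- F)"
        by (rule infsum_mono) (use that smF \<open>(\<lambda>x. norm (k x)) summable_on (- F)\<close> in auto)
      finally show ?thesis using tail by linarith
    qed
    have "(\<lambda>n. sum (f n) F) \<longlonglongrightarrow> sum g F" by (intro tendsto_sum lim)
    then obtain N where N: "\<And>n. n \<ge> N \<Longrightarrow> norm (sum (f n) F - sum g F) < r / 4"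
      using LIMSEQ_D[of _ _ "r / 4"] r by (metis zero_less_divide_iff zero_less_numeral)
    have "norm (infsum (f n) UNIV - infsum g UNIV) < r" if "n \<ge> N" for n
    proof -
      have "infsum (f n) UNIV - infsum g UNIV = (sum (f n) F - sum g F) + infsum (f n) (- F) - infsum g (- F)"
        using split[OF sf] split[OF sg] by simp
      then have "norm (infsum (f n) UNIV - infsum g UNIV)
         \<le> norm (sum (f n) F - sum g F) + norm (infsum (f n) (- F)) + norm (infsum g (- F))"
        using norm_triangle_ineq4[of "sum (f n) F - sum g F + infsum (f n) (- F)" "infsum g (- F)"]
          norm_triangle_ineq[of "sum (f n) F - sum g F" "infsum (f n) (- F)"] by simp
      then show ?thesis using N[OF that] tl[of "f n", OF bd] tl[of g, OF gb] r by linarith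
    qed
    then show "\<exists>N. \<forall>n\<ge>N. norm (infsum (f n) UNIV - infsum g UNIV) < r" by blast
  qed
qed

text \<open>Decay without derivatives, which covers Schwartz functions, transforms of test functions
  and continuous functions of compact support alike. The weight \<open>1 + x^2\<close> has no zero
  and can be divided by.\<close>

definition rapid :: "(real \<Rightarrow> complex) \<Rightarrow> bool" where
  "rapid g \<longleftrightarrow> (\<forall>N. \<exists>C. \<forall>x. (1 + x\<^sup>2) ^ N * norm (g x) \<le> C)"

definition growth :: "(real \<Rightarrow> complex) \<Rightarrow> bool" where
  "growth m \<longleftrightarrow> (\<exists>C N. \<forall>x. norm (m x) \<le> C * (1 + x\<^sup>2) ^ N)"

lemma one_plus_square_power_le: "(1 + x\<^sup>2) ^ N \<le> 2 ^ N * (1 + \<bar>x\<bar> ^ (2 * N))" for x :: real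
proof (cases "\<bar>x\<bar> \<le> 1")
  case True
  then have "x\<^sup>2 \<le> 1" by (simp add: abs_square_le_1)
  then have "(1 + x\<^sup>2) ^ N \<le> 2 ^ N" by (intro power_mono) auto
  also have "\<dots> \<le> 2 ^ N * (1 + \<bar>x\<bar> ^ (2 * N))" by simp
  finally show ?thesis .
next
  case False
  then have "1 \<le> x\<^sup>2" using abs_square_less_1[of x] by linarith
  then have "(1 + x\<^sup>2) ^ N \<le> (2 * x\<^sup>2) ^ N" by (intro power_mono) auto
  also have "\<dots> = 2 ^ N * \<bar>x\<bar> ^ (2 * N)" by (simp add: power_mult_distrib power_mult)
  finally show ?thesis by (simp add: distrib_left add_increasing)
qed

lemma rapidI:
  assumes "\<And>a. \<exists>C. \<forall>x. \<bar>x\<bar> ^ a * norm (g x) \<le> C" shows "rapid g"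
  unfolding rapid_def
proof
  fix N
  obtain C0 where C0: "\<And>x. \<bar>x\<bar> ^ 0 * norm (g x) \<le> C0" using assms by blast
  obtain C1 where C1: "\<And>x. \<bar>x\<bar> ^ (2 * N) * norm (g x) \<le> C1" using assms by blast
  have "(1 + x\<^sup>2) ^ N * norm (g x) \<le> 2 ^ N * (C0 + C1)" for x
  proof -
    have "(1 + x\<^sup>2) ^ N * norm (g x) \<le> 2 ^ N * (1 + \<bar>x\<bar> ^ (2 * N)) * norm (g x)"
      by (intro mult_right_mono one_plus_square_power_le) auto
    also have "\<dots> = 2 ^ N * (norm (g x) + \<bar>x\<bar> ^ (2 * N) * norm (g x))" by (simp add: algebra_simps)
    also have "\<dots> \<le> 2 ^ N * (C0 + C1)" using C0[of x] C1[of x] by (intro mult_left_mono add_mono) auto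
    finally show ?thesis .
  qed
  then show "\<exists>C. \<forall>x. (1 + x\<^sup>2) ^ N * norm (g x) \<le> C" by blast
qed

lemma rapid_schwartz: "schwartz g \<Longrightarrow> rapid g"
  by (rule rapidI) (use schwartz_def funpow_0 in metis)

lemma rapid_ft: "testfun f \<Longrightarrow> rapid (ft f)"
  by (rule rapidI[OF ft_decay])

lemma rapid_Cc: assumes "Cc f" shows "rapid f"
proof (rule rapidI)
  fix a
  obtain R where R: "R > 0" "\<And>x. f x \<noteq> 0 \<Longrightarrow> \<bar>x\<bar> < R" using CcE[OF assms] by metis
  have "compact ((\<lambda>x. \<bar>x\<bar> ^ a * norm (f x)) ` {-R..R})"
    by (intro compact_continuous_image continuous_intros Cc_continuous assms) auto
  then have "bounded ((\<lambda>x. \<bar>x\<bar> ^ a * norm (f x)) ` {-R..R})" by (rule compact_imp_bounded)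
  then obtain C where "\<forall>y\<in>(\<lambda>x. \<bar>x\<bar> ^ a * norm (f x)) ` {-R..R}. \<bar>y\<bar> \<le> C" unfolding bounded_real by blast
  then have C: "\<bar>x\<bar> ^ a * norm (f x) \<le> C" if "x \<in> {-R..R}" for x using that by (simp add: abs_mult)
  have "\<bar>x\<bar> ^ a * norm (f x) \<le> max C 0" for x
    using C[of x] R(2)[of x] by (cases "f x = 0") (auto simp: abs_less_iff le_max_iff_disj)
  then show "\<exists>C. \<forall>x. \<bar>x\<bar> ^ a * norm (f x) \<le> C" by blast
qed

lemma growth_bounded: "(\<And>x. norm (m x) \<le> C) \<Longrightarrow> growth m"
  unfolding growth_def by (rule exI[of _ C], rule exI[of _ 0]) simp

text \<open>One power of \<open>1 + x^2\<close> beyond the growth of \<open>m\<close> pays for the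
  summation over a separated set; the other powers cancel the growth.\<close>

lemma atomic_bound:
  assumes "separated d (supp m)" "\<And>x. norm (m x) \<le> C * (1 + x\<^sup>2) ^ N" "\<And>x. (1 + x\<^sup>2) ^ Suc N * norm (g x) \<le> D"
  shows "(\<lambda>x. norm (m x * g x)) summable_on UNIV"
    "(\<Sum>\<^sub>\<infinity>x. norm (m x * g x)) \<le> \<bar>C\<bar> * D * sep_const d"
    "norm (atomic m g) \<le> \<bar>C\<bar> * D * sep_const d"
proof -
  have D0: "D \<ge> 0" using order_trans[OF _ assms(3)[of 0]] by simp
  have b: "norm (m x * g x) \<le> (\<bar>C\<bar> * D) / (1 + (x - 0)\<^sup>2)" for x
  proof -
    have p: "1 + x\<^sup>2 > 0" by (simp add: add_pos_nonneg)
    have "norm (m x) \<le> \<bar>C\<bar> * (1 + x\<^sup>2) ^ N"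
      by (rule order_trans[OF assms(2)]) (intro mult_right_mono, auto)
    then have "norm (m x) * norm (g x) * (1 + x\<^sup>2) \<le> \<bar>C\<bar> * (1 + x\<^sup>2) ^ N * norm (g x) * (1 + x\<^sup>2)"
      by (intro mult_right_mono) auto
    also have "\<dots> = \<bar>C\<bar> * ((1 + x\<^sup>2) ^ Suc N * norm (g x))" by simp
    also have "\<dots> \<le> \<bar>C\<bar> * D" using assms(3) by (intro mult_left_mono) auto
    finally show ?thesis using p by (simp add: norm_mult pos_le_divide_eq)
  qed
  show s: "(\<lambda>x. norm (m x * g x)) summable_on UNIV"
    using separated_summable(1)[OF assms(1) _ _ b] by (auto simp: in_supp)
  show i: "(\<Sum>\<^sub>\<infinity>x. norm (m x * g x)) \<le> \<bar>C\<bar> * D * sep_const d"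
    using separated_summable(2)[OF assms(1) _ _ b] D0 by (auto simp: in_supp abs_mult)
  show "norm (atomic m g) \<le> \<bar>C\<bar> * D * sep_const d"
    unfolding atomic_def using norm_infsum_bound[OF s] i by linarith
qed

lemma atomic_abs_summable:
  assumes "separated d (supp m)" "growth m" "rapid g"
  shows "(\<lambda>x. norm (m x * g x)) summable_on UNIV"
proof -
  obtain C N where "\<And>x. norm (m x) \<le> C * (1 + x\<^sup>2) ^ N" using assms(2) unfolding growth_def by blast
  moreover obtain D where "\<And>x. (1 + x\<^sup>2) ^ Suc N * norm (g x) \<le> D" using assms(3) unfolding rapid_def by blast
  ultimately show ?thesis using atomic_bound(1)[OF assms(1)] by blast
qed

lemma atomic_summable:
  assumes "separated d (supp m)" "growth m" "rapid g"
  shows "(\<lambda>x. m x * g x) summable_on UNIV"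
  by (rule abs_summable_summable[OF atomic_abs_summable[OF assms]])

lemma atomic_add:
  assumes "separated d (supp m)" "growth m" "rapid f" "rapid g"
  shows "atomic m (\<lambda>x. f x + g x) = atomic m f + atomic m g"
  unfolding atomic_def distrib_left by (intro infsum_add atomic_summable[OF assms(1)] assms)

lemma atomic_cmult: "atomic m (\<lambda>x. c * f x) = c * atomic m f"
  unfolding atomic_def by (simp add: infsum_cmult_right' mult.left_commute[of _ c])

lemma atomic_finite_support:
  assumes "separated d (supp m)" "\<And>x. f x \<noteq> 0 \<Longrightarrow> a \<le> x \<and> x \<le> b"
  shows "atomic m f = (\<Sum>x\<in>supp m \<inter> {a..b}. m x * f x)"
proof -
  have "atomic m f = infsum (\<lambda>x. m x * f x) (supp m \<inter> {a..b})"
    unfolding atomic_def by (rule infsum_cong_neutral) (use assms(2) in_supp in force)+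
  then show ?thesis using separated_finite(1)[OF assms(1)] by simp
qed

lemma norm_le_supnorm: assumes "Cc f" shows "norm (f x) \<le> supnorm f"
proof -
  obtain C where "\<And>x. (1 + x\<^sup>2) ^ 0 * norm (f x) \<le> C" using rapid_Cc[OF assms] unfolding rapid_def by blast
  then have "bdd_above (range (\<lambda>x. norm (f x)))" by (intro bdd_aboveI2[where M=C]) simp
  then show ?thesis unfolding supnorm_def by (rule cSUP_upper[rotated]) auto
qed

lemma supnorm_leI: "(\<And>x. norm (f x) \<le> C) \<Longrightarrow> supnorm f \<le> C"
  unfolding supnorm_def by (rule cSUP_least) auto

lemma radon_atomic:
  assumes "separated d (supp m)" shows "radon (atomic m)"
  unfolding radon_def
proof (intro conjI allI impI)
  fix f g assume fg: "Cc f" "Cc g"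
  obtain R where R: "\<And>x. f x \<noteq> 0 \<Longrightarrow> \<bar>x\<bar> < R" using CcE[OF fg(1)] by metis
  obtain R' where R': "\<And>x. g x \<noteq> 0 \<Longrightarrow> \<bar>x\<bar> < R'" using CcE[OF fg(2)] by metis
  define M where "M = max R R'"
  have f: "f x \<noteq> 0 \<Longrightarrow> -M \<le> x \<and> x \<le> M" for x using R[of x] unfolding M_def by linarith
  have g: "g x \<noteq> 0 \<Longrightarrow> -M \<le> x \<and> x \<le> M" for x using R'[of x] unfolding M_def by linarith
  have h: "f x + g x \<noteq> 0 \<Longrightarrow> -M \<le> x \<and> x \<le> M" for x using f[of x] g[of x] by fastforce
  have "atomic m f = (\<Sum>x\<in>supp m \<inter> {-M..M}. m x * f x)"
    "atomic m g = (\<Sum>x\<in>supp m \<inter> {-M..M}. m x * g x)"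
    "atomic m (\<lambda>x. f x + g x) = (\<Sum>x\<in>supp m \<inter> {-M..M}. m x * (f x + g x))"
    by (intro atomic_finite_support[OF assms] f g h; assumption)+
  then show "atomic m (\<lambda>x. f x + g x) = atomic m f + atomic m g"
    by (simp add: distrib_left sum.distrib)
next
  fix c f show "atomic m (\<lambda>x. c * f x) = c * atomic m f" by (rule atomic_cmult)
next
  fix K :: "real set" assume "compact K"
  then obtain a where "\<And>x. x \<in> K \<Longrightarrow> norm x \<le> a" using compact_imp_bounded bounded_iff by metis
  then have a: "\<And>x. x \<in> K \<Longrightarrow> - a \<le> x \<and> x \<le> a" by fastforce
  show "\<exists>C. \<forall>f. Cc f \<and> fsupp f \<subseteq> K \<longrightarrow> cmod (atomic m f) \<le> C * supnorm f"
  proof (intro exI[of _ "\<Sum>x\<in>supp m \<inter> {-a..a}. norm (m x)"] allI impI)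
    fix f assume f: "Cc f \<and> fsupp f \<subseteq> K"
    have "f x \<noteq> 0 \<Longrightarrow> - a \<le> x \<and> x \<le> a" for x using a f not_in_fsupp by blast
    then have "norm (atomic m f) \<le> (\<Sum>x\<in>supp m \<inter> {-a..a}. norm (m x * f x))"
      using atomic_finite_support[OF assms, of f "-a" a] norm_sum by metis
    also have "\<dots> \<le> (\<Sum>x\<in>supp m \<inter> {-a..a}. norm (m x) * supnorm f)"
      by (intro sum_mono) (auto simp: norm_mult intro!: mult_left_mono norm_le_supnorm conjunct1[OF f])
    finally show "norm (atomic m f) \<le> (\<Sum>x\<in>supp m \<inter> {-a..a}. norm (m x)) * supnorm f"
      by (simp add: sum_distrib_right)
  qed
qed

section \<open>Tempered extensions\<close>

lemma schwartz_seminorm_bdd: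
  assumes "schwartz f" shows "bdd_above (range (\<lambda>x. \<bar>x\<bar> ^ a * norm ((vd ^^ b) f x)))"
  using assms unfolding schwartz_def by (meson bdd_aboveI2)

lemma schwartz_seminorm_nonneg:
  assumes "schwartz f" shows "0 \<le> (SUP x. \<bar>x\<bar> ^ a * norm ((vd ^^ b) f x))"
proof -
  have "0 \<le> \<bar>0\<bar> ^ a * norm ((vd ^^ b) f 0)" by simp
  also have "\<dots> \<le> (SUP x. \<bar>x\<bar> ^ a * norm ((vd ^^ b) f x))"
    by (rule cSUP_upper[OF _ schwartz_seminorm_bdd[OF assms]]) simp
  finally show ?thesis .
qed

lemma seminorm_sum_ge:
  assumes "schwartz f" "a \<le> N" "b \<le> N"
  shows "\<bar>x\<bar> ^ a * norm ((vd ^^ b) f x) \<le> seminorm_sum N f"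
proof -
  have "\<bar>x\<bar> ^ a * norm ((vd ^^ b) f x) \<le> (SUP x. \<bar>x\<bar> ^ a * norm ((vd ^^ b) f x))"
    by (rule cSUP_upper[OF _ schwartz_seminorm_bdd[OF assms(1)]]) simp
  also have "\<dots> \<le> (\<Sum>b\<le>N. (SUP x. \<bar>x\<bar> ^ a * norm ((vd ^^ b) f x)))"
    using assms schwartz_seminorm_nonneg[OF assms(1)] by (intro member_le_sum) auto
  also have "\<dots> \<le> seminorm_sum N f"
    unfolding seminorm_sum_def using assms schwartz_seminorm_nonneg[OF assms(1)]
    by (intro member_le_sum[of a "{..N}" "\<lambda>a. (\<Sum>b\<le>N. (SUP x. \<bar>x\<bar> ^ a * norm ((vd ^^ b) f x)))"] sum_nonneg) auto
  finally show ?thesis .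
qed

lemma tempered_ext_atomic:
  assumes "separated d (supp m)" "growth m"
  shows "tempered_ext (atomic m) (atomic m)"
  unfolding tempered_ext_def
proof (intro conjI allI impI)
  obtain C N where C: "\<And>x. norm (m x) \<le> C * (1 + x\<^sup>2) ^ N" using assms(2) unfolding growth_def by blast
  define M where "M = 2 * Suc N"
  have "norm (atomic m f) \<le> (\<bar>C\<bar> * 2 ^ Suc N * 2 * sep_const d) * seminorm_sum M f" if f: "schwartz f" for f
  proof -
    have "(1 + x\<^sup>2) ^ Suc N * norm (f x) \<le> 2 ^ Suc N * 2 * seminorm_sum M f" for x
    proof -
      have "(1 + x\<^sup>2) ^ Suc N * norm (f x) \<le> 2 ^ Suc N * (1 + \<bar>x\<bar> ^ M) * norm (f x)"
        unfolding M_def by (intro mult_right_mono one_plus_square_power_le) auto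
      also have "\<dots> = 2 ^ Suc N * (\<bar>x\<bar> ^ 0 * norm ((vd ^^ 0) f x) + \<bar>x\<bar> ^ M * norm ((vd ^^ 0) f x))" by (simp add: algebra_simps)
      also have "\<dots> \<le> 2 ^ Suc N * (seminorm_sum M f + seminorm_sum M f)"
        by (intro mult_left_mono add_mono seminorm_sum_ge f) auto
      finally show ?thesis by simp
    qed
    from atomic_bound(3)[OF assms(1) C this] show ?thesis by (simp add: mult_ac)
  qed
  then show "\<exists>C N. \<forall>f. schwartz f \<longrightarrow> norm (atomic m f) \<le> C * seminorm_sum N f" by blast
qed (use assms in \<open>auto intro!: atomic_add rapid_schwartz atomic_cmult\<close>)

section \<open>Truncation of Schwartz functions\<close>

lemma vd_pow_add: "smooth f \<Longrightarrow> smooth g \<Longrightarrow> (vd ^^ k) (\<lambda>x. f x + g x) = (\<lambda>x. (vd ^^ k) f x + (vd ^^ k) g x)"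
proof (induction k)
  case (Suc k)
  have "vd (\<lambda>x. (vd ^^ k) f x + (vd ^^ k) g x) = (\<lambda>x. vd ((vd ^^ k) f) x + vd ((vd ^^ k) g) x)"
    by (intro vd_eqI has_vector_derivative_add smooth_has_vector_derivative smooth_vd_pow Suc)
  then show ?case using Suc by simp
qed simp

lemma vd_pow_cmult: "smooth f \<Longrightarrow> (vd ^^ k) (\<lambda>x. c * f x) = (\<lambda>x. c * (vd ^^ k) f x)"
proof (induction k)
  case (Suc k)
  have "vd (\<lambda>x. c * (vd ^^ k) f x) = (\<lambda>x. c * vd ((vd ^^ k) f) x)"
    by (intro vd_eqI has_vector_derivative_mult_right smooth_has_vector_derivative smooth_vd_pow Suc)
  then show ?case using Suc by simp
qed simp

lemma schwartz_smooth: "schwartz f \<Longrightarrow> smooth f"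
  by (simp add: schwartz_def)

lemma schwartz_vd: assumes "schwartz f" shows "schwartz (vd f)"
proof -
  have "(vd ^^ b) (vd f) = (vd ^^ Suc b) f" for b by (simp add: funpow_swap1)
  then show ?thesis using assms unfolding schwartz_def by (metis smooth_vd)
qed

text \<open>What truncation removes from a function is its product with a rescaled \<open>t\<close>
  of this kind. The class is closed under \<open>vd\<close>, as the induction on the order of
  differentiation needs.\<close>

definition cutoff :: "(real \<Rightarrow> complex) \<Rightarrow> bool" where
  "cutoff t \<longleftrightarrow> smooth t \<and> (\<forall>k. \<exists>B. \<forall>x. norm ((vd ^^ k) t x) \<le> B) \<and> (\<forall>x. \<bar>x\<bar> < 1 \<longrightarrow> t x = 0)"

lemma cutoff_vd: assumes "cutoff t" shows "cutoff (vd t)"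
  unfolding cutoff_def
proof (intro conjI allI impI)
  show "smooth (vd t)" using assms cutoff_def smooth_vd by blast
  have "(vd ^^ b) (vd t) = (vd ^^ Suc b) t" for b by (simp add: funpow_swap1)
  then show "\<exists>B. \<forall>x. norm ((vd ^^ k) (vd t) x) \<le> B" for k using assms unfolding cutoff_def by metis
  fix x :: real assume x: "\<bar>x\<bar> < 1"
  have "(t has_vector_derivative 0) (at x)"
  proof (rule has_vector_derivative_transform_within_open[where f="\<lambda>_. 0"])
    show "open {y::real. \<bar>y\<bar> < 1}" by (intro open_Collect_less continuous_intros)
  qed (use x assms in \<open>auto simp: cutoff_def\<close>)
  then show "vd t x = 0" unfolding vd_def by (rule vector_derivative_at)
qed

text \<open>Where the rescaled cut-off is non-zero, \<open>R \<le> \<bar>x\<bar>\<close>, so one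
  extra power of \<open>\<bar>x\<bar>\<close> in the decay of \<open>f\<close> yields the factor
  \<open>1 / R\<close>. The derivative of the product is a sum of two products of the same kind,
  hence the generalization over \<open>f\<close> and \<open>t\<close>.\<close>

lemma cutoff_bound:
  assumes "schwartz f" "cutoff t"
  shows "\<exists>C. \<forall>R\<ge>1. \<forall>x. \<bar>x\<bar> ^ a * norm ((vd ^^ b) (\<lambda>x. f x * t ((1 / R) * x + 0)) x) \<le> C / R"
  using assms
proof (induction b arbitrary: f t)
  case 0
  obtain B where B: "\<And>x. norm ((vd ^^ 0) t x) \<le> B" using 0(2) unfolding cutoff_def by blast
  obtain C where C: "\<And>x. \<bar>x\<bar> ^ Suc a * norm ((vd ^^ 0) f x) \<le> C" using 0(1) unfolding schwartz_def by blast
  have B0: "B \<ge> 0" using B[of 0] norm_ge_zero order_trans by blast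
  have C0: "C \<ge> 0" using C[of 0] by (simp add: order_trans[OF _ C[of 0]])
  have "\<bar>x\<bar> ^ a * norm (f x * t (x / R)) \<le> (C * B) / R" if R: "R \<ge> 1" for R x
  proof (cases "\<bar>x\<bar> < R")
    case True
    then have "t (x / R) = 0" using 0(2) R unfolding cutoff_def by (simp add: field_simps)
    then show ?thesis using B0 C0 R by simp
  next
    case False
    have "R * (\<bar>x\<bar> ^ a * norm (f x * t (x / R))) \<le> \<bar>x\<bar> * (\<bar>x\<bar> ^ a * norm (f x * t (x / R)))"
      using False by (intro mult_right_mono) auto
    also have "\<dots> = (\<bar>x\<bar> ^ Suc a * norm (f x)) * norm (t (x / R))" by (simp add: norm_mult)
    also have "\<dots> \<le> C * B" using C[of x] B[of "x / R"] C0 by (intro mult_mono) auto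
    finally show ?thesis using R by (simp add: field_simps)
  qed
  then show ?case by (intro exI[of _ "C * B"]) simp
next
  case (Suc b)
  obtain C1 where C1: "\<And>R x. R \<ge> 1 \<Longrightarrow> \<bar>x\<bar> ^ a * norm ((vd ^^ b) (\<lambda>x. vd f x * t ((1 / R) * x + 0)) x) \<le> C1 / R"
    using Suc.IH[OF schwartz_vd[OF Suc.prems(1)] Suc.prems(2)] by blast
  obtain C2 where C2: "\<And>R x. R \<ge> 1 \<Longrightarrow> \<bar>x\<bar> ^ a * norm ((vd ^^ b) (\<lambda>x. f x * vd t ((1 / R) * x + 0)) x) \<le> C2 / R"
    using Suc.IH[OF Suc.prems(1) cutoff_vd[OF Suc.prems(2)]] by blast
  have st: "smooth t" using Suc.prems(2) cutoff_def by blast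
  have sf: "smooth f" using Suc.prems(1) schwartz_smooth by blast
  have "\<bar>x\<bar> ^ a * norm ((vd ^^ Suc b) (\<lambda>x. f x * t ((1 / R) * x + 0)) x) \<le> (C1 + C2) / R" if R: "R \<ge> 1" for R x
  proof -
    define g1 where "g1 = (\<lambda>x. vd f x * t ((1 / R) * x + 0))"
    define g2 where "g2 = (\<lambda>x. f x * vd t ((1 / R) * x + 0))"
    have s: "smooth g1" "smooth g2"
      unfolding g1_def g2_def by (intro smooth_mult smooth_affine[of _ "1 / R" 0] smooth_vd sf st)+
    have "vd (\<lambda>x. f x * t ((1 / R) * x + 0)) = (\<lambda>x. f x * ((1 / R) *\<^sub>R vd t ((1 / R) * x + 0)) + vd f x * t ((1 / R) * x + 0))"
      by (intro vd_eqI has_vector_derivative_mult has_vector_derivative_affine smooth_has_vector_derivative sf st)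
    also have "\<dots> = (\<lambda>x. g1 x + of_real (1 / R) * g2 x)"
      by (simp add: g1_def g2_def scaleR_conv_of_real fun_eq_iff)
    finally have "(vd ^^ Suc b) (\<lambda>x. f x * t ((1 / R) * x + 0)) = (vd ^^ b) (\<lambda>x. g1 x + of_real (1 / R) * g2 x)"
      by (simp add: funpow_swap1)
    also have "\<dots> = (\<lambda>x. (vd ^^ b) g1 x + of_real (1 / R) * (vd ^^ b) g2 x)"
      by (simp only: vd_pow_add[OF s(1) smooth_cmult[OF s(2)]] vd_pow_cmult[OF s(2)])
    finally have "\<bar>x\<bar> ^ a * norm ((vd ^^ Suc b) (\<lambda>x. f x * t ((1 / R) * x + 0)) x)
        \<le> \<bar>x\<bar> ^ a * (norm ((vd ^^ b) g1 x) + norm (of_real (1 / R) * (vd ^^ b) g2 x))"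
      by (simp only:) (intro mult_left_mono norm_triangle_ineq, auto)
    also have "norm (of_real (1 / R) * (vd ^^ b) g2 x) \<le> norm ((vd ^^ b) g2 x)"
      using R mult_right_mono[of "1 / R" 1 "norm ((vd ^^ b) g2 x)"] by (simp add: norm_mult norm_divide)
    finally have "\<bar>x\<bar> ^ a * norm ((vd ^^ Suc b) (\<lambda>x. f x * t ((1 / R) * x + 0)) x)
        \<le> \<bar>x\<bar> ^ a * norm ((vd ^^ b) g1 x) + \<bar>x\<bar> ^ a * norm ((vd ^^ b) g2 x)"
      by (simp add: distrib_left mult_left_mono)
    then show ?thesis using C1[OF R, of x] C2[OF R, of x] unfolding g1_def g2_def by (simp add: add_divide_distrib)
  qed
  then show ?case by blast
qed

lemma cutoff_plateau: "cutoff (\<lambda>x. 1 - plateau x)"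
  unfolding cutoff_def
proof (intro conjI allI impI)
  show "smooth (\<lambda>x. 1 - plateau x)" by (intro smooth_diff smooth_const testfun_smooth testfun_plateau)
  fix k
  have tf: "testfun ((vd ^^ k) plateau)" by (induction k) (auto intro: testfun_vd testfun_plateau)
  obtain B where B: "\<And>x. (1 + x\<^sup>2) ^ 0 * norm ((vd ^^ k) plateau x) \<le> B"
    using rapid_Cc[OF testfun_Cc[OF tf]] unfolding rapid_def by blast
  have c: "norm ((vd ^^ k) (\<lambda>x. 1) x) \<le> 1" for x
  proof -
    have v: "vd (\<lambda>x. c) = (\<lambda>x. 0)" for c by (intro vd_eqI) simp
    have "(vd ^^ Suc n) (\<lambda>x. 1) = (\<lambda>x. 0)" for n by (induction n) (auto simp: v)
    then show ?thesis by (cases k) (auto simp del: funpow.simps(2))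
  qed
  have "(vd ^^ k) (\<lambda>x. 1 - plateau x) = (\<lambda>x. (vd ^^ k) (\<lambda>x. 1) x + (-1) * (vd ^^ k) plateau x)"
    using vd_pow_add[of "\<lambda>x. 1" "\<lambda>x. (-1) * plateau x" k] vd_pow_cmult[of plateau k "-1"]
      testfun_smooth[OF testfun_plateau] smooth_cmult[of plateau "-1"] by simp
  then have "norm ((vd ^^ k) (\<lambda>x. 1 - plateau x) x) \<le> 1 + B" for x
    using norm_triangle_ineq[of "(vd ^^ k) (\<lambda>x. 1) x" "(-1) * (vd ^^ k) plateau x"] c[of x] B[of x] by simp
  then show "\<exists>B. \<forall>x. norm ((vd ^^ k) (\<lambda>x. 1 - plateau x) x) \<le> B" by blast
qed (simp add: plateau_eq_1)

lemma testfun_schwartz: assumes "testfun f" shows "schwartz f"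
  unfolding schwartz_def
proof (intro conjI allI)
  show "smooth f" using assms testfun_smooth by blast
  fix a b
  have tf: "testfun ((vd ^^ b) f)" by (induction b) (auto intro: testfun_vd assms)
  obtain C where C: "\<And>x. (1 + x\<^sup>2) ^ a * norm ((vd ^^ b) f x) \<le> C"
    using rapid_Cc[OF testfun_Cc[OF tf]] unfolding rapid_def by blast
  have "\<bar>x\<bar> ^ a * norm ((vd ^^ b) f x) \<le> C" for x
  proof -
    have "\<bar>x\<bar> \<le> 1 + x\<^sup>2" using sum_squares_bound[of "\<bar>x\<bar>" 1] by (simp add: power2_eq_square[symmetric])
    then have "\<bar>x\<bar> ^ a * norm ((vd ^^ b) f x) \<le> (1 + x\<^sup>2) ^ a * norm ((vd ^^ b) f x)"
      by (intro mult_right_mono power_mono) auto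
    then show ?thesis using C[of x] by linarith
  qed
  then show "\<exists>C. \<forall>x. \<bar>x\<bar> ^ a * norm ((vd ^^ b) f x) \<le> C" by blast
qed

text \<open>\<open>is_ft\<close> only asserts that some extension \<open>T\<close> exists; this
  makes it canonical. The truncation \<open>h R\<close> is a test function, on which both
  functionals are given by the measures, and the remainder \<open>g R\<close> is
  \<open>O(1 / R)\<close> in every seminorm.\<close>

lemma tempered_ext_unique:
  assumes T: "tempered_ext \<mu> T" and T': "tempered_ext \<mu>' T'" and eq: "\<And>f. testfun f \<Longrightarrow> \<mu> f = \<mu>' f"
    and f: "schwartz f"
  shows "T f = T' f"
proof -
  define t where "t = (\<lambda>x. 1 - plateau x)"
  have t: "cutoff t" unfolding t_def by (rule cutoff_plateau)
  define g where "g = (\<lambda>R x. f x * t ((1 / R) * x + 0))"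
  define h where "h = (\<lambda>R x. f x * plateau ((1 / R) * x + 0))"
  have sf: "smooth f" using f schwartz_smooth by blast
  have st: "smooth t" using t cutoff_def by blast
  have gs: "schwartz (g R)" if "R \<ge> 1" for R
    unfolding schwartz_def g_def
    using cutoff_bound[OF f t] that by (intro conjI allI smooth_mult sf smooth_affine[OF st, of "1 / R" 0]) blast
  have hs: "testfun (h R)" if "R \<ge> 1" for R
    unfolding h_def using that
    by (intro testfun_mult[OF testfun_affine[OF testfun_plateau, of "1 / R" 0] sf]) auto
  have fgh: "f = (\<lambda>x. h R x + g R x)" for R by (simp add: fun_eq_iff g_def h_def t_def algebra_simps)
  have sem: "\<exists>C. \<forall>R\<ge>1. seminorm_sum N (g R) \<le> C / R" for N
  proof -
    obtain C where C: "\<And>a b R x. R \<ge> 1 \<Longrightarrow> \<bar>x\<bar> ^ a * norm ((vd ^^ b) (g R) x) \<le> C a b / R"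
      using cutoff_bound[OF f t] unfolding g_def by metis
    have "seminorm_sum N (g R) \<le> (\<Sum>a\<le>N. \<Sum>b\<le>N. C a b) / R" if "R \<ge> 1" for R
      unfolding seminorm_sum_def sum_divide_distrib by (intro sum_mono cSUP_least C that) auto
    then show ?thesis by blast
  qed
  have diff: "\<exists>C. \<forall>R\<ge>1. norm (T f - T' f) \<le> C / R"
  proof -
    obtain C N where C: "\<And>f. schwartz f \<Longrightarrow> norm (T f) \<le> C * seminorm_sum N f"
      using T unfolding tempered_ext_def by blast
    obtain C' N' where C': "\<And>f. schwartz f \<Longrightarrow> norm (T' f) \<le> C' * seminorm_sum N' f"
      using T' unfolding tempered_ext_def by blast
    obtain D where D: "\<And>R. R \<ge> 1 \<Longrightarrow> seminorm_sum N (g R) \<le> D / R" using sem by blast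
    obtain D' where D': "\<And>R. R \<ge> 1 \<Longrightarrow> seminorm_sum N' (g R) \<le> D' / R" using sem by blast
    have "norm (T f - T' f) \<le> (\<bar>C\<bar> * D + \<bar>C'\<bar> * D') / R" if R: "R \<ge> 1" for R
    proof -
      have p: "0 \<le> seminorm_sum n (g R)" for n
        unfolding seminorm_sum_def by (intro sum_nonneg schwartz_seminorm_nonneg gs R)
      have "T (\<lambda>x. h R x + g R x) = T (h R) + T (g R)" "T' (\<lambda>x. h R x + g R x) = T' (h R) + T' (g R)"
        using T T' gs[OF R] testfun_schwartz[OF hs[OF R]] unfolding tempered_ext_def by simp_all
      then have "T f = T (h R) + T (g R)" "T' f = T' (h R) + T' (g R)"
        using arg_cong[OF fgh[of R], of T] arg_cong[OF fgh[of R], of T'] by simp_all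
      moreover have "T (h R) = T' (h R)" using T T' hs[OF R] eq unfolding tempered_ext_def by metis
      ultimately have "norm (T f - T' f) \<le> norm (T (g R)) + norm (T' (g R))"
        by (simp add: norm_triangle_ineq4)
      also have "\<dots> \<le> C * seminorm_sum N (g R) + C' * seminorm_sum N' (g R)"
        by (intro add_mono C C' gs R)
      also have "\<dots> \<le> \<bar>C\<bar> * seminorm_sum N (g R) + \<bar>C'\<bar> * seminorm_sum N' (g R)"
        using p by (intro add_mono mult_right_mono) auto
      also have "\<dots> \<le> \<bar>C\<bar> * (D / R) + \<bar>C'\<bar> * (D' / R)"
        using D[OF R] D'[OF R] by (intro add_mono mult_left_mono) auto
      finally show ?thesis by (simp add: add_divide_distrib)
    qed
    then show ?thesis by blast
  qed
  then obtain C where C: "\<And>R. R \<ge> 1 \<Longrightarrow> norm (T f - T' f) \<le> C / R" by blast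
  have "((\<lambda>R. C / R) \<longlongrightarrow> 0) at_top" by (rule real_tendsto_divide_at_top[OF tendsto_const filterlim_ident])
  then have "norm (T f - T' f) \<le> 0"
    by (rule tendsto_lowerbound) (auto intro!: eventually_mono[OF eventually_ge_at_top[of 1]] C)
  then show ?thesis by simp
qed

section \<open>Convolution and mollification\<close>

lemma conv_lborel: assumes "Cc g" "Cc h" shows "conv g h x = (LINT y|lborel. g (x - y) * h y)"
proof -
  have "continuous_on UNIV (\<lambda>y. g (x - y))"
    by (intro continuous_on_compose2[OF Cc_continuous[OF assms(1), of UNIV]] continuous_intros) auto
  then show ?thesis unfolding conv_def by (intro Cc_integral Cc_mult assms)
qed

lemma conv_commute: assumes "Cc g" "Cc h" shows "conv g h x = (LINT y|lborel. g y * h (x - y))"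
  unfolding conv_lborel[OF assms] using lborel_integral_real_affine[of "-1" "\<lambda>y. g (x - y) * h y" x] by simp

lemma conv_support:
  assumes "\<And>x. g x \<noteq> 0 \<Longrightarrow> \<bar>x\<bar> < R" "\<And>x. h x \<noteq> 0 \<Longrightarrow> \<bar>x\<bar> < R'" "conv g h x \<noteq> 0"
  shows "\<bar>x\<bar> < R + R'"
proof (rule ccontr)
  assume x: "\<not> \<bar>x\<bar> < R + R'"
  have "g (x - y) * h y = 0" for y using x assms(1)[of "x - y"] assms(2)[of y] by fastforce
  then have "conv g h x = 0" unfolding conv_def by (simp only: Henstock_Kurzweil_Integration.integral_0)
  then show False using assms(3) by simp
qed

lemma conv_interval:
  assumes "\<And>y. h y \<noteq> 0 \<Longrightarrow> -R \<le> y \<and> y \<le> R"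
  shows "conv g h x = integral {-R..R} (\<lambda>y. g (x - y) * h y)"
proof -
  have "(\<lambda>y. g (x - y) * h y) = (\<lambda>y. if y \<in> {-R..R} then g (x - y) * h y else 0)"
    using assms by (force simp: fun_eq_iff)
  then show ?thesis unfolding conv_def using integral_restrict_UNIV[of "{-R..R}" "\<lambda>y. g (x - y) * h y"] by simp
qed

lemma CcE':
  assumes "Cc f"
  obtains R where "R > 0" "\<And>x. f x \<noteq> 0 \<Longrightarrow> \<bar>x\<bar> < R" "\<And>x. f x \<noteq> 0 \<Longrightarrow> -R \<le> x \<and> x \<le> R"
proof -
  obtain R where R: "R > 0" "\<And>x. f x \<noteq> 0 \<Longrightarrow> \<bar>x\<bar> < R" using CcE[OF assms] by metis
  have "-R \<le> x \<and> x \<le> R" if "f x \<noteq> 0" for x using R(2)[OF that] by linarith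
  then show ?thesis using R by (intro that[of R])
qed

lemma conv_continuous: assumes "Cc g" "Cc h" shows "continuous_on UNIV (conv g h)"
proof -
  obtain R where R: "\<And>x. h x \<noteq> 0 \<Longrightarrow> -R \<le> x \<and> x \<le> R" using CcE'[OF assms(2)] by metis
  have "continuous_on UNIV (\<lambda>x. integral (cbox (-R) R) (\<lambda>y. g (x - y) * h y))"
    by (rule integral_continuous_on_param[where U=UNIV and f="\<lambda>x y. g (x - y) * h y"])
      (auto simp: case_prod_unfold intro!: continuous_intros continuous_on_compose2[OF Cc_continuous[OF assms(1), of UNIV]]
        continuous_on_compose2[OF Cc_continuous[OF assms(2), of UNIV]])
  then show ?thesis using conv_interval[of h R g, OF R] by (simp add: cbox_interval cong: continuous_on_cong)
qed

lemma conv_Cc: assumes "Cc g" "Cc h" shows "Cc (conv g h)"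
proof -
  obtain R where R: "\<And>x. g x \<noteq> 0 \<Longrightarrow> \<bar>x\<bar> < R" using CcE'[OF assms(1)] by metis
  obtain R' where R': "\<And>x. h x \<noteq> 0 \<Longrightarrow> \<bar>x\<bar> < R'" using CcE'[OF assms(2)] by metis
  have "- (R + R') \<le> x \<and> x \<le> R + R'" if "conv g h x \<noteq> 0" for x
    using conv_support[of g R h R' x, OF R R' that] by linarith
  then show ?thesis using CcI[OF conv_continuous[OF assms]] by blast
qed

lemma conv_has_vector_derivative:
  assumes "testfun g" "Cc h"
  shows "(conv g h has_vector_derivative conv (vd g) h x) (at x)"
proof -
  obtain R where R: "\<And>x. h x \<noteq> 0 \<Longrightarrow> -R \<le> x \<and> x \<le> R" using CcE'[OF assms(2)] by metis
  have cg: "continuous_on UNIV g" "continuous_on UNIV (vd g)"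
    using assms by (auto intro: smooth_continuous smooth_vd testfun_smooth)
  have "((\<lambda>x. integral (cbox (-R) R) (\<lambda>y. g (x - y) * h y)) has_vector_derivative
      integral (cbox (-R) R) (\<lambda>y. vd g (x - y) * h y)) (at x within UNIV)"
  proof (rule leibniz_rule_vector_derivative[where f="\<lambda>x y. g (x - y) * h y" and fx="\<lambda>x y. vd g (x - y) * h y"])
    fix x y :: real
    have "((\<lambda>x. g (1 * x + (- y))) has_vector_derivative 1 *\<^sub>R vd g (1 * x + (- y))) (at x)"
      by (intro has_vector_derivative_affine smooth_has_vector_derivative testfun_smooth assms)
    then have "((\<lambda>x. g (x - y)) has_vector_derivative vd g (x - y)) (at x)" by simp
    then show "((\<lambda>x. g (x - y) * h y) has_vector_derivative vd g (x - y) * h y) (at x within UNIV)"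
      by (rule has_vector_derivative_mult_left)
  next
    fix x
    show "(\<lambda>y. g (x - y) * h y) integrable_on cbox (-R) R"
      by (intro integrable_continuous continuous_intros Cc_continuous assms continuous_on_compose2[OF cg(1)]) auto
  next
    show "continuous_on (UNIV \<times> cbox (-R) R) (\<lambda>(x, y). vd g (x - y) * h y)"
      unfolding case_prod_unfold
      by (intro continuous_intros continuous_on_compose2[OF cg(2)] continuous_on_compose2[OF Cc_continuous[OF assms(2), of UNIV]]) auto
  qed auto
  moreover have "conv g h = (\<lambda>x. integral (cbox (-R) R) (\<lambda>y. g (x - y) * h y))"
    "conv (vd g) h x = integral (cbox (-R) R) (\<lambda>y. vd g (x - y) * h y)"
    using conv_interval[of h R, OF R] by (auto simp: cbox_interval fun_eq_iff)
  ultimately show ?thesis by simp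
qed

lemma conv_testfun: assumes "testfun g" "Cc h" shows "testfun (conv g h)"
proof -
  have "smooth (conv g h)"
  proof (rule smooth_coinduct[where P="\<lambda>k. \<exists>g. testfun g \<and> k = conv g h"])
    fix k assume "\<exists>g. testfun g \<and> k = conv g h"
    then obtain g where g: "testfun g" "k = conv g h" by blast
    show "\<exists>l. (\<exists>g. testfun g \<and> l = conv g h) \<and> (\<forall>x. (k has_vector_derivative l x) (at x))"
      unfolding g(2) by (intro exI[of _ "conv (vd g) h"] conjI allI conv_has_vector_derivative g(1) assms(2) exI[of _ "vd g"] testfun_vd refl)
  qed (use assms in blast)
  then show ?thesis using conv_Cc[OF testfun_Cc[OF assms(1)] assms(2)] testfun_iff by blast
qed

lemma ft_conv: assumes "Cc g" "Cc h" shows "ft (conv g h) t = ft g t * ft h t"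
proof -
  define F where "F = (\<lambda>y x. ee (- t * x) * (g (x - y) * h y))"
  have cF: "continuous_on UNIV (\<lambda>(y, x). F y x)"
    unfolding F_def case_prod_unfold
    by (intro continuous_intros continuous_on_compose2[OF Cc_continuous[OF assms(1), of UNIV]]
        continuous_on_compose2[OF Cc_continuous[OF assms(2), of UNIV]]) auto
  have inner: "(LINT x|lborel. k (x - y)) = (LINT x|lborel. k x)" for k :: "real \<Rightarrow> 'a::euclidean_space" and y
    using lborel_integral_real_affine[of 1 "\<lambda>x. k (x - y)" y] by simp
  have Fy: "Cc (F y)" for y
    unfolding F_def using Cc_ee_mult[OF Cc_cmult[OF Cc_affine[OF assms(1), of 1 "-y"], of "h y"], of "-t"]
    by (simp add: mult.commute[of "h y"])
  have int: "integrable (lborel \<Otimes>\<^sub>M lborel) (\<lambda>(y, x). F y x)"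
  proof (rule lborel_pair.Fubini_integrable)
    show "(\<lambda>(y, x). F y x) \<in> borel_measurable (lborel \<Otimes>\<^sub>M lborel)"
      unfolding lborel_prod using borel_measurable_continuous_onI[OF cF] by simp
    have "(LINT x|lborel. norm (F y x)) = (LINT x|lborel. norm (g x)) * norm (h y)" for y
    proof -
      have "(LINT x|lborel. norm (F y x)) = (LINT x|lborel. norm (g (x - y))) * norm (h y)"
        unfolding F_def by (simp add: norm_mult)
      then show ?thesis using inner[of "\<lambda>x. norm (g x)" y] by simp
    qed
    then show "integrable lborel (\<lambda>y. LINT x|lborel. norm (case (y, x) of (y, x) \<Rightarrow> F y x))"
      using integrable_norm[OF Cc_integrable[OF assms(2)]] by simp
    show "AE y in lborel. integrable lborel (\<lambda>x. case (y, x) of (y, x) \<Rightarrow> F y x)"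
      using Cc_integrable[OF Fy] by simp
  qed
  have "ft (conv g h) t = (LINT x|lborel. ee (- t * x) * (LINT y|lborel. g (x - y) * h y))"
    by (simp only: ft_lborel[OF conv_Cc[OF assms]] conv_lborel[OF assms])
  also have "\<dots> = (LINT x|lborel. LINT y|lborel. F y x)" unfolding F_def by simp
  also have "\<dots> = (LINT y|lborel. LINT x|lborel. F y x)"
    by (rule lborel_pair.Fubini_integral[OF int])
  also have "(\<lambda>y. LINT x|lborel. F y x) = (\<lambda>y. ft g t * (ee (- t * y) * h y))"
  proof
    fix y
    have e: "ee (- t * x) = ee (- t * (x - y)) * ee (- t * y)" for x
      unfolding ee_add[symmetric] by (simp add: algebra_simps)
    have "F y x = (ee (- t * (x - y)) * g (x - y)) * (ee (- t * y) * h y)" for x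
      unfolding F_def by (subst e) (simp only: mult_ac)
    then have "(LINT x|lborel. F y x) = (LINT x|lborel. (ee (- t * (x - y)) * g (x - y)) * (ee (- t * y) * h y))"
      by presburger
    also have "\<dots> = (LINT x|lborel. ee (- t * (x - y)) * g (x - y)) * (ee (- t * y) * h y)" by simp
    also have "(LINT x|lborel. ee (- t * (x - y)) * g (x - y)) = ft g t"
      using inner[of "\<lambda>x. ee (- t * x) * g x" y] ft_lborel[OF assms(1), of t] by simp
    finally show "(LINT x|lborel. F y x) = ft g t * (ee (- t * y) * h y)" .
  qed
  also have "(LINT y|lborel. ft g t * (ee (- t * y) * h y)) = ft g t * ft h t"
    by (simp add: ft_lborel[OF assms(2), of t])
  finally show ?thesis .
qed

lemma bump_Cc: "Cc (\<lambda>x. complex_of_real (bump x))"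
  by (rule CcI[where a="-1" and b=1]) (use smooth_continuous[OF smooth_bump] bump_nonzero_iff in \<open>auto simp: abs_less_iff\<close>)

definition bump_mass :: real where "bump_mass = (LINT x|lborel. bump x)"

lemma bump_integrable: "integrable lborel bump"
  using integrable_Re[OF Cc_integrable[OF bump_Cc]] by simp

lemma bump_mass_pos: "bump_mass > 0"
proof -
  have "bump_mass = integral UNIV bump"
    unfolding bump_mass_def by (rule integral_lborel[OF bump_integrable, symmetric])
  also have "\<dots> = integral {-1..1} bump"
  proof -
    have "bump = (\<lambda>y. if y \<in> {-1..1} then bump y else 0)"
      using bump_nonzero_iff by (force simp: fun_eq_iff)
    then show ?thesis using integral_restrict_UNIV[of "{-1..1}" bump] by metis
  qed
  finally show ?thesis using bump_integral_pos by simp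
qed

definition moll :: "real \<Rightarrow> real \<Rightarrow> complex" where
  "moll e x = of_real (bump (x / e) / (e * bump_mass))"

lemma moll_eq_cbump: "moll e = (\<lambda>x. of_real (1 / (e * bump_mass)) * cbump 0 e x)"
  by (simp add: moll_def cbump_def fun_eq_iff)

lemma testfun_moll: "e > 0 \<Longrightarrow> testfun (moll e)"
  unfolding moll_eq_cbump by (intro testfun_cmult testfun_cbump)

lemma moll_nonzero: "e > 0 \<Longrightarrow> moll e x \<noteq> 0 \<Longrightarrow> \<bar>x\<bar> < e"
  by (simp add: moll_def bump_nonzero_iff[of "x / e", unfolded abs_divide, symmetric]) (use bump_nonzero_iff[of "x / e"] in auto)

lemma norm_moll: "e > 0 \<Longrightarrow> moll e x = of_real (norm (moll e x))"
  using bump_nonneg[of "x / e"] bump_mass_pos by (simp add: moll_def norm_divide norm_mult)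

lemma moll_integral: assumes "e > 0" shows "(LINT x|lborel. norm (moll e x)) = 1" "(LINT x|lborel. moll e x) = 1"
proof -
  have "(LINT x|lborel. bump x) = \<bar>1 / e\<bar> *\<^sub>R (LINT x|lborel. bump (0 + (1 / e) * x))"
    by (rule lborel_integral_real_affine) (use assms in auto)
  then have "(LINT x|lborel. bump (x / e)) = e * bump_mass" using assms by (simp add: bump_mass_def field_simps)
  moreover have "e * bump_mass \<noteq> 0" using assms bump_mass_pos by simp
  ultimately have "(LINT x|lborel. bump (x / e) / (e * bump_mass)) = 1" by (metis Bochner_Integration.integral_divide_zero divide_self)
  moreover have n: "norm (moll e x) = bump (x / e) / (e * bump_mass)" for x
    using bump_nonneg[of "x / e"] bump_mass_pos assms by (simp add: moll_def norm_divide norm_mult)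
  ultimately show 1: "(LINT x|lborel. norm (moll e x)) = 1" by presburger
  have "(LINT x|lborel. moll e x) = (LINT x|lborel. complex_of_real (norm (moll e x)))"
    using norm_moll[OF assms] by metis
  then show "(LINT x|lborel. moll e x) = 1" using 1 by simp
qed

lemma conv_moll_close:
  assumes f: "Cc f" and e: "e > 0" and close: "\<And>t. \<bar>t\<bar> < e \<Longrightarrow> norm (f (x - t) - f x) \<le> r"
  shows "norm (conv (moll e) f x - f x) \<le> r"
proof -
  have cm: "Cc (moll e)" using testfun_Cc[OF testfun_moll[OF e]] .
  have cf: "continuous_on UNIV (\<lambda>t. f (x - t))"
    by (intro continuous_on_compose2[OF Cc_continuous[OF f, of UNIV]] continuous_intros) auto
  have i1: "integrable lborel (\<lambda>t. moll e t * f (x - t))"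
    using Cc_integrable[OF Cc_mult[OF cm cf]] by (simp add: mult.commute)
  have i2: "integrable lborel (\<lambda>t. moll e t * f x)"
    using Cc_integrable[OF Cc_cmult[OF cm, of "f x"]] by (simp add: mult.commute)
  have i3: "integrable lborel (\<lambda>t. norm (moll e t))" using integrable_norm[OF Cc_integrable[OF cm]] .
  have r: "r \<ge> 0" using close[of 0] e by (auto intro: order_trans[OF norm_ge_zero])
  have "conv (moll e) f x - f x = (LINT t|lborel. moll e t * f (x - t)) - (LINT t|lborel. moll e t * f x)"
    using conv_commute[OF cm f, of x] moll_integral(2)[OF e] by simp
  also have "\<dots> = (LINT t|lborel. moll e t * f (x - t) - moll e t * f x)"
    by (rule Bochner_Integration.integral_diff[OF i1 i2, symmetric])
  finally have "norm (conv (moll e) f x - f x) \<le> (LINT t|lborel. norm (moll e t * f (x - t) - moll e t * f x))"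
    by simp
  also have "\<dots> \<le> (LINT t|lborel. norm (moll e t) * r)"
  proof (rule integral_mono)
    show "integrable lborel (\<lambda>t. norm (moll e t * f (x - t) - moll e t * f x))"
      by (intro integrable_norm Bochner_Integration.integrable_diff i1 i2)
    show "integrable lborel (\<lambda>t. norm (moll e t) * r)" using i3 by simp
    fix t
    have "norm (moll e t * f (x - t) - moll e t * f x) = norm (moll e t) * norm (f (x - t) - f x)"
      by (simp add: norm_mult[symmetric] right_diff_distrib)
    also have "\<dots> \<le> norm (moll e t) * r"
      using moll_nonzero[OF e, of t] close[of t] by (cases "moll e t = 0") (auto intro: mult_left_mono)
    finally show "norm (moll e t * f (x - t) - moll e t * f x) \<le> norm (moll e t) * r" .
  qed
  also have "\<dots> = r" using moll_integral(1)[OF e] by simp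
  finally show ?thesis .
qed

lemma Cc_uniformly_continuous:
  assumes "Cc f" "r > 0"
  obtains e where "e > 0" "\<And>x y. \<bar>x - y\<bar> < e \<Longrightarrow> norm (f x - f y) \<le> r"
proof -
  obtain R where R: "R > 0" "\<And>x. f x \<noteq> 0 \<Longrightarrow> \<bar>x\<bar> < R" using CcE'[OF assms(1)] by metis
  have "uniformly_continuous_on {-R-1..R+1} f"
    by (intro compact_uniformly_continuous Cc_continuous assms) auto
  then obtain d where d: "d > 0" "\<And>x y. x \<in> {-R-1..R+1} \<Longrightarrow> y \<in> {-R-1..R+1} \<Longrightarrow> dist y x < d \<Longrightarrow> dist (f y) (f x) < r"
    unfolding uniformly_continuous_on_def using assms(2) by metis
  have "norm (f x - f y) \<le> r" if xy: "\<bar>x - y\<bar> < min d 1" for x y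
  proof (cases "x \<in> {-R-1..R+1} \<and> y \<in> {-R-1..R+1}")
    case True
    then show ?thesis using d(2)[of y x] xy by (simp add: dist_norm)
  next
    case False
    then have "\<bar>x\<bar> \<ge> R" "\<bar>y\<bar> \<ge> R" using xy by auto
    then have "f x = 0" "f y = 0" using R(2)[of x] R(2)[of y] by auto
    then show ?thesis using assms(2) by simp
  qed
  then show ?thesis using that[of "min d 1"] d(1) by simp
qed

lemma radonD:
  assumes "radon \<mu>"
  shows "Cc f \<Longrightarrow> Cc g \<Longrightarrow> \<mu> (\<lambda>x. f x + g x) = \<mu> f + \<mu> g" "Cc f \<Longrightarrow> \<mu> (\<lambda>x. c * f x) = c * \<mu> f"
    "Cc f \<Longrightarrow> Cc g \<Longrightarrow> \<mu> (\<lambda>x. f x - g x) = \<mu> f - \<mu> g" "\<mu> (\<lambda>x. 0) = 0"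
proof -
  show 1: "Cc f \<Longrightarrow> Cc g \<Longrightarrow> \<mu> (\<lambda>x. f x + g x) = \<mu> f + \<mu> g" for f g
    using assms unfolding radon_def by simp
  show 2: "Cc f \<Longrightarrow> \<mu> (\<lambda>x. c * f x) = c * \<mu> f" for f c
    using assms unfolding radon_def by simp
  show "Cc f \<Longrightarrow> Cc g \<Longrightarrow> \<mu> (\<lambda>x. f x - g x) = \<mu> f - \<mu> g"
    using 1[of f "\<lambda>x. -1 * g x"] 2[of g "-1"] Cc_cmult[of g "-1"] by simp
  show "\<mu> (\<lambda>x. 0) = 0" using 2[of "\<lambda>x. 0" 0] by simp
qed

lemma radon_sum:
  assumes "radon \<mu>" "\<And>i. i \<in> I \<Longrightarrow> Cc (f i)"
  shows "\<mu> (\<lambda>x. \<Sum>i\<in>I. f i x) = (\<Sum>i\<in>I. \<mu> (f i))"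
  using assms(2) by (induction I rule: infinite_finite_induct) (auto simp: radonD[OF assms(1)] Cc_sum)

lemma radon_bound:
  assumes "radon \<mu>"
  obtains C where "C \<ge> 0" "\<And>f B. Cc f \<Longrightarrow> (\<And>x. f x \<noteq> 0 \<Longrightarrow> -R \<le> x \<and> x \<le> R) \<Longrightarrow> (\<And>x. norm (f x) \<le> B) \<Longrightarrow> norm (\<mu> f) \<le> C * B"
proof -
  obtain C where C: "\<And>f. Cc f \<Longrightarrow> fsupp f \<subseteq> {-R..R} \<Longrightarrow> norm (\<mu> f) \<le> C * supnorm f"
    using assms unfolding radon_def by (meson compact_Icc)
  have "norm (\<mu> f) \<le> \<bar>C\<bar> * B" if f: "Cc f" "\<And>x. f x \<noteq> 0 \<Longrightarrow> -R \<le> x \<and> x \<le> R" "\<And>x. norm (f x) \<le> B" for f B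
  proof -
    have "fsupp f \<subseteq> {-R..R}" by (rule fsupp_subset) (use f(2) in auto)
    then have "norm (\<mu> f) \<le> C * supnorm f" using C f(1) by blast
    also have "\<dots> \<le> \<bar>C\<bar> * supnorm f"
      by (intro mult_right_mono order_trans[OF norm_ge_zero norm_le_supnorm[OF f(1), of 0]]) auto
    also have "\<dots> \<le> \<bar>C\<bar> * B" by (intro mult_left_mono supnorm_leI f(3)) auto
    finally show ?thesis .
  qed
  then show ?thesis using that[of "\<bar>C\<bar>"] by simp
qed

text \<open>Mollification converges uniformly while all supports stay in
  \<open>[-(R + 1), R + 1]\<close>, so a single constant \<open>C\<close> of the measure
  applies.\<close>

lemma radon_moll_tendsto:
  assumes "radon \<mu>" "Cc f"
  shows "(\<lambda>n. \<mu> (conv (moll (1 / real (Suc n))) f)) \<longlonglongrightarrow> \<mu> f"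
proof -
  obtain R where R: "R > 0" "\<And>x. f x \<noteq> 0 \<Longrightarrow> \<bar>x\<bar> < R" using CcE'[OF assms(2)] by metis
  obtain C where C: "C \<ge> 0" "\<And>f B. Cc f \<Longrightarrow> (\<And>x. f x \<noteq> 0 \<Longrightarrow> -(R+1) \<le> x \<and> x \<le> R+1) \<Longrightarrow> (\<And>x. norm (f x) \<le> B) \<Longrightarrow> norm (\<mu> f) \<le> C * B"
    using radon_bound[OF assms(1), of "R + 1"] by metis
  show ?thesis
  proof (rule LIMSEQ_I)
    fix r :: real assume r: "r > 0"
    define r' where "r' = r / (2 * (C + 1))"
    have r': "r' > 0" using r C(1) by (simp add: r'_def)
    obtain e where e: "e > 0" "\<And>x y. \<bar>x - y\<bar> < e \<Longrightarrow> norm (f x - f y) \<le> r'"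
      using Cc_uniformly_continuous[OF assms(2) r'] by metis
    obtain N where N: "1 / real (Suc N) < e" using e(1) nat_approx_posE by blast
    have "norm (\<mu> (conv (moll (1 / real (Suc n))) f) - \<mu> f) < r" if n: "n \<ge> N" for n
    proof -
      define h where "h = 1 / real (Suc n)"
      have h: "h > 0" "h \<le> 1" unfolding h_def by auto
      have "h \<le> 1 / real (Suc N)" unfolding h_def using n by (simp add: field_simps)
      then have he: "h < e" using N by linarith
      have cc: "Cc (conv (moll h) f)" by (intro conv_Cc testfun_Cc testfun_moll h assms)
      have cd: "Cc (\<lambda>x. conv (moll h) f x - f x)" by (intro Cc_diff cc assms)
      have b: "norm (conv (moll h) f x - f x) \<le> r'" for x
      proof (rule conv_moll_close[OF assms(2) h(1)])
        fix t assume "\<bar>t\<bar> < h"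
        then show "norm (f (x - t) - f x) \<le> r'" using e(2)[of "x - t" x] he by simp
      qed
      have s: "-(R+1) \<le> x \<and> x \<le> R+1" if x: "conv (moll h) f x - f x \<noteq> 0" for x
      proof (cases "f x = 0")
        case True
        then have "conv (moll h) f x \<noteq> 0" using x by simp
        then have "\<bar>x\<bar> < h + R" using conv_support[of "moll h" h f R x] moll_nonzero[OF h(1)] R(2) by blast
        then show ?thesis using h(2) by linarith
      next
        case False then show ?thesis using R(2)[of x] by linarith
      qed
      have "norm (\<mu> (\<lambda>x. conv (moll h) f x - f x)) \<le> C * r'" by (rule C(2)[OF cd s b])
      also have "\<dots> \<le> r / 2" unfolding r'_def using C(1) r by (simp add: field_simps)
      finally show ?thesis using r radonD(3)[OF assms(1) cc assms(2)] unfolding h_def by simp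
    qed
    then show "\<exists>N. \<forall>n\<ge>N. norm (\<mu> (conv (moll (1 / real (Suc n))) f) - \<mu> f) < r" by blast
  qed
qed

text \<open>Distributional identities compare measures on test functions only; mollification carries
  them over to all continuous functions of compact support, which is what equality of measures means
  here.\<close>

lemma radon_eq_testfun:
  assumes "radon \<mu>" "radon \<nu>" "\<And>f. testfun f \<Longrightarrow> \<mu> f = \<nu> f" "Cc f"
  shows "\<mu> f = \<nu> f"
proof -
  have "(\<lambda>n. \<mu> (conv (moll (1 / real (Suc n))) f)) = (\<lambda>n. \<nu> (conv (moll (1 / real (Suc n))) f))"
    by (intro ext assms(3) conv_testfun testfun_moll assms(4)) simp
  then show ?thesis
    using LIMSEQ_unique[OF radon_moll_tendsto[OF assms(1,4)]] radon_moll_tendsto[OF assms(2,4)] by simp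
qed

section \<open>Transformability\<close>

lemma radon_cong: assumes "radon \<mu>" "\<And>f. Cc f \<Longrightarrow> \<mu>' f = \<mu> f" shows "radon \<mu>'"
proof -
  have "radon \<mu>" by fact
  then show ?thesis using assms(2) unfolding radon_def by (auto simp: Cc_add Cc_cmult)
qed

lemma is_ft_cong:
  assumes "is_ft \<mu> \<nu>" "\<And>f. Cc f \<Longrightarrow> \<mu>' f = \<mu> f" "\<And>f. Cc f \<Longrightarrow> \<nu>' f = \<nu> f"
  shows "is_ft \<mu>' \<nu>'"
proof -
  obtain T where T: "tempered_ext \<mu> T" "\<And>f. testfun f \<Longrightarrow> T (ft f) = \<nu> f" using assms(1) unfolding is_ft_def by blast
  have "tempered_ext \<mu>' T" using T(1) assms(2) testfun_Cc unfolding tempered_ext_def by auto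
  moreover have "\<And>f. testfun f \<Longrightarrow> T (ft f) = \<nu>' f" using T(2) assms(3) testfun_Cc by auto
  ultimately show ?thesis using assms radon_cong unfolding is_ft_def by meson
qed

lemma is_ft_unique:
  assumes "is_ft \<mu> \<nu>" "is_ft \<mu>' \<nu>'" "\<And>f. Cc f \<Longrightarrow> \<mu>' f = \<mu> f" "Cc f"
  shows "\<nu>' f = \<nu> f"
proof -
  obtain T where T: "tempered_ext \<mu> T" "\<And>f. testfun f \<Longrightarrow> T (ft f) = \<nu> f" using assms(1) unfolding is_ft_def by blast
  obtain T' where T': "tempered_ext \<mu>' T'" "\<And>f. testfun f \<Longrightarrow> T' (ft f) = \<nu>' f" using assms(2) unfolding is_ft_def by blast
  have "\<nu>' f = \<nu> f" if f: "testfun f" for f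
    using tempered_ext_unique[OF T(1) T'(1) _ schwartz_ft[OF f]] T(2)[OF f] T'(2)[OF f] assms(3) testfun_Cc by metis
  then show ?thesis using radon_eq_testfun[of \<nu>' \<nu>] assms unfolding is_ft_def by blast
qed

lemma radon_compact:
  assumes "radon \<mu>" "compact K"
  obtains C where "\<And>f. Cc f \<Longrightarrow> fsupp f \<subseteq> K \<Longrightarrow> norm (\<mu> f) \<le> C * supnorm f"
proof -
  have "\<exists>C. \<forall>f. Cc f \<and> fsupp f \<subseteq> K \<longrightarrow> norm (\<mu> f) \<le> C * supnorm f"
    using assms unfolding radon_def by simp
  then show ?thesis using that by blast
qed

lemma radon_add: assumes "radon \<mu>" "radon \<nu>" shows "radon (\<lambda>f. \<mu> f + \<nu> f)"
  unfolding radon_def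
proof (intro conjI allI impI)
  fix K :: "real set" assume K: "compact K"
  obtain C where C: "\<And>f. Cc f \<Longrightarrow> fsupp f \<subseteq> K \<Longrightarrow> norm (\<mu> f) \<le> C * supnorm f" using radon_compact[OF assms(1) K] by metis
  obtain D where D: "\<And>f. Cc f \<Longrightarrow> fsupp f \<subseteq> K \<Longrightarrow> norm (\<nu> f) \<le> D * supnorm f" using radon_compact[OF assms(2) K] by metis
  have "norm (\<mu> f + \<nu> f) \<le> (C + D) * supnorm f" if "Cc f" "fsupp f \<subseteq> K" for f
    using norm_triangle_ineq[of "\<mu> f" "\<nu> f"] C[OF that] D[OF that] by (simp add: distrib_right)
  then show "\<exists>C. \<forall>f. Cc f \<and> fsupp f \<subseteq> K \<longrightarrow> norm (\<mu> f + \<nu> f) \<le> C * supnorm f" by blast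
next
  fix f g assume "Cc f" "Cc g"
  then show "\<mu> (\<lambda>x. f x + g x) + \<nu> (\<lambda>x. f x + g x) = \<mu> f + \<nu> f + (\<mu> g + \<nu> g)"
    using radonD(1)[OF assms(1), of f g] radonD(1)[OF assms(2), of f g] by simp
next
  fix c f assume "Cc f"
  then show "\<mu> (\<lambda>x. c * f x) + \<nu> (\<lambda>x. c * f x) = c * (\<mu> f + \<nu> f)"
    using radonD(2)[OF assms(1), of f c] radonD(2)[OF assms(2), of f c] by (simp add: distrib_left)
qed

lemma radon_cmult: assumes "radon \<mu>" shows "radon (\<lambda>f. c * \<mu> f)"
  unfolding radon_def
proof (intro conjI allI impI)
  fix K :: "real set" assume K: "compact K"
  obtain C where C: "\<And>f. Cc f \<Longrightarrow> fsupp f \<subseteq> K \<Longrightarrow> norm (\<mu> f) \<le> C * supnorm f" using radon_compact[OF assms(1) K] by metis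
  have "norm (c * \<mu> f) \<le> (norm c * C) * supnorm f" if "Cc f" "fsupp f \<subseteq> K" for f
    using mult_left_mono[OF C[OF that], of "norm c"] by (simp add: norm_mult mult.assoc)
  then show "\<exists>C. \<forall>f. Cc f \<and> fsupp f \<subseteq> K \<longrightarrow> norm (c * \<mu> f) \<le> C * supnorm f" by blast
next
  fix f g assume "Cc f" "Cc g"
  then show "c * \<mu> (\<lambda>x. f x + g x) = c * \<mu> f + c * \<mu> g"
    using radonD(1)[OF assms(1), of f g] by (simp add: distrib_left)
next
  fix b f assume "Cc f"
  then show "c * \<mu> (\<lambda>x. b * f x) = b * (c * \<mu> f)"
    using radonD(2)[OF assms(1), of f b] by simp
qed

lemma seminorm_sum_mono:
  assumes "schwartz f" "N \<le> M" shows "seminorm_sum N f \<le> seminorm_sum M f"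
proof -
  have "seminorm_sum N f \<le> (\<Sum>a\<le>N. \<Sum>b\<le>M. (SUP x. \<bar>x\<bar> ^ a * norm ((vd ^^ b) f x)))"
    unfolding seminorm_sum_def using assms by (intro sum_mono sum_mono2 schwartz_seminorm_nonneg) auto
  also have "\<dots> \<le> seminorm_sum M f"
    unfolding seminorm_sum_def using assms by (intro sum_mono2 sum_nonneg schwartz_seminorm_nonneg) auto
  finally show ?thesis .
qed

lemma seminorm_sum_nonneg: "schwartz f \<Longrightarrow> 0 \<le> seminorm_sum N f"
  unfolding seminorm_sum_def by (intro sum_nonneg schwartz_seminorm_nonneg)

lemma tempered_ext_add:
  assumes "tempered_ext \<mu> T" "tempered_ext \<nu> S"
  shows "tempered_ext (\<lambda>f. \<mu> f + \<nu> f) (\<lambda>f. T f + S f)"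
  unfolding tempered_ext_def
proof (intro conjI allI impI)
  obtain C N where C: "\<And>f. schwartz f \<Longrightarrow> norm (T f) \<le> C * seminorm_sum N f" using assms(1) unfolding tempered_ext_def by blast
  obtain D M where D: "\<And>f. schwartz f \<Longrightarrow> norm (S f) \<le> D * seminorm_sum M f" using assms(2) unfolding tempered_ext_def by blast
  define K where "K = max N M"
  have "norm (T f + S f) \<le> (\<bar>C\<bar> + \<bar>D\<bar>) * seminorm_sum K f" if f: "schwartz f" for f
  proof -
    have "C * seminorm_sum N f \<le> \<bar>C\<bar> * seminorm_sum K f"
      by (intro mult_mono seminorm_sum_mono f seminorm_sum_nonneg) (auto simp: K_def)
    moreover have "D * seminorm_sum M f \<le> \<bar>D\<bar> * seminorm_sum K f"
      by (intro mult_mono seminorm_sum_mono f seminorm_sum_nonneg) (auto simp: K_def)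
    ultimately show ?thesis using C[OF f] D[OF f] norm_triangle_ineq[of "T f" "S f"] by (simp add: distrib_right)
  qed
  then show "\<exists>C N. \<forall>f. schwartz f \<longrightarrow> norm (T f + S f) \<le> C * seminorm_sum N f" by blast
qed (use assms in \<open>simp_all add: tempered_ext_def distrib_left\<close>)

lemma tempered_ext_cmult:
  assumes "tempered_ext \<mu> T" shows "tempered_ext (\<lambda>f. c * \<mu> f) (\<lambda>f. c * T f)"
  unfolding tempered_ext_def
proof (intro conjI allI impI)
  obtain C N where C: "\<And>f. schwartz f \<Longrightarrow> norm (T f) \<le> C * seminorm_sum N f" using assms(1) unfolding tempered_ext_def by blast
  have "norm (c * T f) \<le> (norm c * C) * seminorm_sum N f" if f: "schwartz f" for f
    using mult_left_mono[OF C[OF f], of "norm c"] by (simp add: norm_mult mult.assoc)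
  then show "\<exists>C N. \<forall>f. schwartz f \<longrightarrow> norm (c * T f) \<le> C * seminorm_sum N f" by blast
qed (use assms in \<open>simp_all add: tempered_ext_def distrib_left mult.left_commute\<close>)

lemma is_ft_add: assumes "is_ft \<mu> \<nu>" "is_ft \<mu>' \<nu>'" shows "is_ft (\<lambda>f. \<mu> f + \<mu>' f) (\<lambda>f. \<nu> f + \<nu>' f)"
proof -
  obtain T where T: "tempered_ext \<mu> T" "\<And>f. testfun f \<Longrightarrow> T (ft f) = \<nu> f" using assms(1) unfolding is_ft_def by blast
  obtain T' where T': "tempered_ext \<mu>' T'" "\<And>f. testfun f \<Longrightarrow> T' (ft f) = \<nu>' f" using assms(2) unfolding is_ft_def by blast
  show ?thesis using tempered_ext_add[OF T(1) T'(1)] T(2) T'(2) radon_add assms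
    unfolding is_ft_def by (intro conjI exI[of _ "\<lambda>f. T f + T' f"]) auto
qed

lemma is_ft_cmult: assumes "is_ft \<mu> \<nu>" shows "is_ft (\<lambda>f. c * \<mu> f) (\<lambda>f. c * \<nu> f)"
proof -
  obtain T where T: "tempered_ext \<mu> T" "\<And>f. testfun f \<Longrightarrow> T (ft f) = \<nu> f" using assms(1) unfolding is_ft_def by blast
  show ?thesis using tempered_ext_cmult[OF T(1)] T(2) radon_cmult assms
    unfolding is_ft_def by (intro conjI exI[of _ "\<lambda>f. c * T f"]) auto
qed

lemma is_ft_zero: "is_ft (\<lambda>f. 0) (\<lambda>f. 0)"
proof -
  have s: "separated 1 (supp (\<lambda>x. 0))" by (simp add: separated_def supp_def)
  have a: "atomic (\<lambda>x. 0) = (\<lambda>f. 0)" by (simp add: atomic_def fun_eq_iff)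
  have g: "growth (\<lambda>x. 0)" by (rule growth_bounded[of _ 0]) simp
  show ?thesis unfolding is_ft_def
    using radon_atomic[OF s] tempered_ext_atomic[OF s g] unfolding a by (intro conjI exI[of _ "\<lambda>f. 0"]) auto
qed

lemma is_ft_sum:
  assumes "\<And>i. i \<in> I \<Longrightarrow> is_ft (\<mu> i) (\<nu> i)"
  shows "is_ft (\<lambda>f. \<Sum>i\<in>I. \<mu> i f) (\<lambda>f. \<Sum>i\<in>I. \<nu> i f)"
  using assms by (induction I rule: infinite_finite_induct) (auto intro: is_ft_zero is_ft_add)

section \<open>Measures with uniformly discrete support\<close>

text \<open>Off the support there are only small balls on which the measure vanishes. A Lebesgue
  number for this cover of \<open>fsupp f\<close> and a partition of \<open>f\<close> into short
  pieces reduce the claim to single balls.\<close>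

lemma radon_vanish_off_support:
  assumes \<mu>: "radon \<mu>" and f: "Cc f" and disj: "fsupp f \<inter> msupp \<mu> = {}"
  shows "\<mu> f = 0"
proof -
  define G where "G = {ball x e | x e. e > 0 \<and> (\<forall>f. Cc f \<and> fsupp f \<subseteq> ball x e \<longrightarrow> \<mu> f = 0)}"
  have cover: "fsupp f \<subseteq> \<Union>G"
  proof
    fix x assume "x \<in> fsupp f"
    then have "x \<notin> msupp \<mu>" using disj by blast
    then obtain e where "e > 0" "\<forall>f. Cc f \<and> fsupp f \<subseteq> ball x e \<longrightarrow> \<mu> f = 0" unfolding msupp_def by blast
    then have "ball x e \<in> G" "x \<in> ball x e" unfolding G_def by auto
    then show "x \<in> \<Union>G" by blast
  qed
  have cpt: "compact (fsupp f)" using f Cc_def by blast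
  have op: "open U" if "U \<in> G" for U using that unfolding G_def by auto
  obtain e where e: "e > 0" "\<And>x. x \<in> fsupp f \<Longrightarrow> \<exists>U\<in>G. ball x e \<subseteq> U"
    using Heine_Borel_lemma[OF cpt cover op] by metis
  obtain R where R: "R > 0" "\<And>x. f x \<noteq> 0 \<Longrightarrow> \<bar>x\<bar> < R" using CcE'[OF f] by metis
  define h where "h = e / 4"
  have h: "h > 0" using e(1) by (simp add: h_def)
  \<comment> \<open>Consecutive ramps differ by a tent of width \<open>2 * h\<close>, and the
    differences telescope to \<open>c 0 - c N\<close>, which is \<open>1\<close> wherever
    \<open>f\<close> is non-zero. As \<open>h = e / 4\<close>, a tent fits into the ball of radius
    \<open>e\<close> about any of its points.\<close>
  define c where "c j x = min 1 (max 0 ((x + R) / h + 1 - real j))" for j x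
  define p where "p j x = complex_of_real (c j x - c (Suc j) x) * f x" for j x
  obtain N :: nat where N: "real N > 2 * R / h + 2" using reals_Archimedean2 by blast
  have cp: "Cc (p j)" for j unfolding p_def c_def using h by (intro Cc_mult f continuous_intros) auto
  have p0: "\<mu> (p j) = 0" for j
  proof (cases "\<exists>x. p j x \<noteq> 0")
    case False
    then have "p j = (\<lambda>x. 0)" by auto
    then show ?thesis using radonD(4)[OF \<mu>] by simp
  next
    case True
    have loc: "h * (real j - 1) - R \<le> x \<and> x \<le> h * (real j + 1) - R" if "p j x \<noteq> 0" for x
    proof (rule ccontr)
      assume x: "\<not> ?thesis"
      have "(x + R) / h + 1 - real j < 0 \<or> (x + R) / h + 1 - real j > 2"
        using x h by (auto simp: field_simps)
      then have "c j x = c (Suc j) x" unfolding c_def by auto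
      then show False using that unfolding p_def by simp
    qed
    obtain x where x: "p j x \<noteq> 0" using True by blast
    then have "f x \<noteq> 0" unfolding p_def by auto
    then have "x \<in> fsupp f" using not_in_fsupp by blast
    then obtain U where U: "U \<in> G" "ball x e \<subseteq> U" using e(2) by blast
    have "fsupp (p j) \<subseteq> {h * (real j - 1) - R..h * (real j + 1) - R}" by (rule fsupp_subset) (use loc in auto)
    also have "\<dots> \<subseteq> ball x e"
    proof
      fix y assume "y \<in> {h * (real j - 1) - R..h * (real j + 1) - R}"
      then have "\<bar>x - y\<bar> \<le> 2 * h" using loc[OF x] by (auto simp: algebra_simps)
      then show "y \<in> ball x e" using h unfolding h_def by (simp add: dist_real_def)
    qed
    finally show ?thesis using U cp[of j] unfolding G_def by blast
  qed
  have "f = (\<lambda>x. \<Sum>j<N. p j x)"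
  proof
    fix x
    have "(\<Sum>j<N. p j x) = complex_of_real (\<Sum>j<N. c j x - c (Suc j) x) * f x"
      unfolding p_def by (simp add: sum_distrib_right[symmetric])
    also have "(\<Sum>j<N. c j x - c (Suc j) x) = c 0 x - c N x" by (rule sum_lessThan_telescope')
    finally have s: "(\<Sum>j<N. p j x) = complex_of_real (c 0 x - c N x) * f x" .
    show "f x = (\<Sum>j<N. p j x)"
    proof (cases "f x = 0")
      case False
      then have x: "-R < x" "x < R" using R(2)[of x] by auto
      have "(x + R) / h \<ge> 0" using x h by simp
      moreover have "(x + R) / h \<le> 2 * R / h" using x h by (intro divide_right_mono) auto
      ultimately have "c 0 x = 1" "c N x = 0" using N unfolding c_def by auto
      then show ?thesis using s by simp
    qed (use s in simp)
  qed
  then have "\<mu> f = (\<Sum>j<N. \<mu> (p j))" using radon_sum[OF \<mu>, of "{..<N}" p] cp by simp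
  then show ?thesis using p0 by simp
qed

lemma plateau_nonzero: "plateau x \<noteq> 0 \<Longrightarrow> \<bar>x\<bar> < 4"
  using step_eq_0[of "x + 3"] step_eq_0[of "3 - x"] unfolding plateau_def
  by (smt (verit) mult_eq_0_iff of_real_eq_0_iff)

lemma plateau_bounded: obtains M where "M > 0" "\<And>x. norm (plateau x) \<le> M"
proof -
  obtain B where B: "\<And>x. (1 + x\<^sup>2) ^ 0 * norm (plateau x) \<le> B"
    using rapid_Cc[OF testfun_Cc[OF testfun_plateau]] unfolding rapid_def by blast
  have "norm (plateau x) \<le> \<bar>B\<bar> + 1" for x using B[of x] by simp
  then show ?thesis using that[of "\<bar>B\<bar> + 1"] by simp
qed

text \<open>\<open>f\<close> is zero on the support but not near it. Subtracting localized pieces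
  around the support points leaves a function that vanishes in a neighbourhood of the support. The
  pieces are \<open>O(r)\<close> by uniform continuity, and their number does not depend on
  \<open>r\<close>.\<close>

lemma radon_vanish_on_support:
  assumes \<mu>: "radon \<mu>" and f: "Cc f" and sep: "separated d (msupp \<mu>)" and z: "\<And>x. x \<in> msupp \<mu> \<Longrightarrow> f x = 0"
  shows "\<mu> f = 0"
proof -
  obtain R where R: "R > 0" "\<And>x. f x \<noteq> 0 \<Longrightarrow> \<bar>x\<bar> < R" using CcE'[OF f] by metis
  define X where "X = msupp \<mu> \<inter> {-R-1..R+1}"
  have X: "finite X" unfolding X_def by (rule separated_finite(1)[OF sep])
  obtain C where C: "C \<ge> 0" "\<And>f B. Cc f \<Longrightarrow> (\<And>x. f x \<noteq> 0 \<Longrightarrow> -R \<le> x \<and> x \<le> R) \<Longrightarrow> (\<And>x. norm (f x) \<le> B) \<Longrightarrow> norm (\<mu> f) \<le> C * B"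
    using radon_bound[OF \<mu>, of R] by metis
  obtain M where M: "M > 0" "\<And>x. norm (plateau x) \<le> M" using plateau_bounded by metis
  have "norm (\<mu> f) \<le> real (card X) * (C * (M * r))" if r: "r > 0" for r
  proof -
    obtain e where e: "e > 0" "\<And>x y. \<bar>x - y\<bar> < e \<Longrightarrow> norm (f x - f y) \<le> r"
      using Cc_uniformly_continuous[OF f r] by metis
    \<comment> \<open>A piece reaches up to \<open>4 * h\<close> from its centre. This is far enough
      below \<open>d\<close> to keep pieces of distinct atoms apart near the atoms, and below
      \<open>e\<close>, so that \<open>f\<close> is small on the piece.\<close>
    define h where "h = min (min 1 d) e / 8"
    have h: "h > 0" "8 * h \<le> 1" "8 * h \<le> d" "8 * h \<le> e" using e(1) separated_pos[OF sep] by (auto simp: h_def)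
    define q where "q x y = plateau ((1 / h) * y + (- x / h)) * f y" for x y
    have qn: "\<bar>y - x\<bar> < 4 * h" if "q x y \<noteq> 0" for x y
    proof -
      have "(1 / h) * y + (- x / h) = (y - x) / h" by (simp add: diff_divide_distrib)
      then have "\<bar>(y - x) / h\<bar> < 4" using plateau_nonzero that unfolding q_def by force
      then show ?thesis using h(1) by (simp add: field_simps)
    qed
    have cq: "Cc (q x)" for x
      unfolding q_def using h(1)
      by (intro Cc_mult f smooth_continuous smooth_affine testfun_smooth testfun_plateau)
    have qb: "norm (q x y) \<le> M * r" if "x \<in> X" for x y
    proof (cases "q x y = 0")
      case False
      then have "\<bar>y - x\<bar> < e" using qn[of x y] h by linarith
      then have "norm (f y) \<le> r" using e(2)[of y x] z that unfolding X_def by auto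
      then show ?thesis unfolding q_def norm_mult using M by (intro mult_mono) auto
    qed (use M r in simp)
    have q\<mu>: "norm (\<mu> (q x)) \<le> C * (M * r)" if "x \<in> X" for x
    proof (rule C(2)[OF cq _ qb[OF that]])
      fix y assume "q x y \<noteq> 0"
      then have "f y \<noteq> 0" unfolding q_def by auto
      then show "- R \<le> y \<and> y \<le> R" using R(2)[of y] by linarith
    qed
    define g where "g y = f y - (\<Sum>x\<in>X. q x y)" for y
    have cs: "Cc (\<lambda>y. \<Sum>x\<in>X. q x y)" by (intro Cc_sum cq)
    have cg: "Cc g" unfolding g_def by (intro Cc_diff f cs)
    have near: "g y = 0" if x: "x \<in> msupp \<mu>" and y: "\<bar>y - x\<bar> < h" for x y
    proof (cases "f y = 0")
      case True then show ?thesis unfolding g_def q_def by simp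
    next
      case False
      then have "x \<in> X" using R(2)[of y] x y h unfolding X_def by auto
      moreover have "q x' y = 0" if "x' \<in> X - {x}" for x'
      proof (rule ccontr)
        assume "q x' y \<noteq> 0"
        then have "\<bar>x' - x\<bar> < d" using qn[of x' y] y h by linarith
        then show False using separatedD[OF sep, of x' x] that x unfolding X_def by auto
      qed
      moreover have "q x y = f y"
      proof -
        have "(1 / h) * y + (- x / h) = (y - x) / h" by (simp add: diff_divide_distrib)
        moreover have "\<bar>(y - x) / h\<bar> \<le> 2" using y h(1) by (simp add: field_simps)
        ultimately show ?thesis unfolding q_def using plateau_eq_1 by simp
      qed
      ultimately show ?thesis unfolding g_def using X by (simp add: sum.remove[of X x])
    qed
    have "fsupp g \<inter> msupp \<mu> = {}"
    proof (rule ccontr)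
      assume "fsupp g \<inter> msupp \<mu> \<noteq> {}"
      then obtain x where x: "x \<in> fsupp g" "x \<in> msupp \<mu>" by blast
      have "fsupp g \<subseteq> - ball x h"
        by (rule fsupp_subset) (use near[OF x(2)] in \<open>auto simp: dist_real_def abs_minus_commute\<close>)
      then show False using x(1) h(1) by auto
    qed
    then have "\<mu> g = 0" using radon_vanish_off_support[OF \<mu> cg] by blast
    then have "\<mu> f = (\<Sum>x\<in>X. \<mu> (q x))"
      unfolding g_def using radonD(3)[OF \<mu> f cs] radon_sum[OF \<mu>, of X q] cq by simp
    then have "norm (\<mu> f) \<le> (\<Sum>x\<in>X. C * (M * r))" using sum_norm_le[of X "\<lambda>x. \<mu> (q x)" "\<lambda>_. C * (M * r)"] q\<mu> by simp
    then show ?thesis by simp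
  qed
  then have *: "norm (\<mu> f) \<le> (real (card X) * C * M) * r" if "r > 0" for r
    unfolding mult.assoc using that by blast
  have "((\<lambda>r. (real (card X) * C * M) * r) \<longlongrightarrow> (real (card X) * C * M) * 0) (at_right 0)"
    by (intro tendsto_intros)
  then have "norm (\<mu> f) \<le> (real (card X) * C * M) * 0"
    by (rule tendsto_lowerbound) (auto simp: eventually_at_right_field intro!: exI[of _ 1] *)
  then show ?thesis by simp
qed

text \<open>A bump of radius \<open>d\<close> isolates a support point, so its measure is the weight
  there; \<open>f\<close> and the combination of bumps with the values of \<open>f\<close> agree on
  the support.\<close>

lemma radon_separated_atomic:
  assumes \<mu>: "radon \<mu>" and sep: "separated d (msupp \<mu>)"
  obtains m where "supp m \<subseteq> msupp \<mu>" "separated d (supp m)" "\<And>f. Cc f \<Longrightarrow> \<mu> f = atomic m f"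
proof -
  have d: "d > 0" using separated_pos[OF sep] .
  define m where "m x = (if x \<in> msupp \<mu> then \<mu> (cbump x d) else 0)" for x
  have sub: "supp m \<subseteq> msupp \<mu>" by (auto simp: supp_def m_def)
  have sm: "separated d (supp m)" by (rule separated_subset[OF sep sub])
  have "\<mu> f = atomic m f" if f: "Cc f" for f
  proof -
    obtain R where R: "R > 0" "\<And>x. f x \<noteq> 0 \<Longrightarrow> -R \<le> x \<and> x \<le> R" using CcE'[OF f] by metis
    define X where "X = msupp \<mu> \<inter> {-R..R}"
    have X: "finite X" unfolding X_def by (rule separated_finite(1)[OF sep])
    have cb: "Cc (\<lambda>y. f x * cbump x d y)" for x by (intro Cc_cmult testfun_Cc testfun_cbump d)
    have cs: "Cc (\<lambda>y. \<Sum>x\<in>X. f x * cbump x d y)" by (intro Cc_sum cb)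
    have "\<mu> (\<lambda>y. f y - (\<Sum>x\<in>X. f x * cbump x d y)) = 0"
    proof (rule radon_vanish_on_support[OF \<mu> Cc_diff[OF f cs] sep])
      fix y assume y: "y \<in> msupp \<mu>"
      have z: "cbump x d y = 0" if "x \<in> X" "x \<noteq> y" for x
        using separatedD[OF sep, of y x] y that cbump_nonzero_iff[OF d, of x y] unfolding X_def by auto
      show "f y - (\<Sum>x\<in>X. f x * cbump x d y) = 0"
      proof (cases "y \<in> X")
        case True
        then have "(\<Sum>x\<in>X. f x * cbump x d y) = f y + (\<Sum>x\<in>X-{y}. f x * cbump x d y)"
          using X by (simp add: sum.remove)
        also have "(\<Sum>x\<in>X-{y}. f x * cbump x d y) = 0" using z by (intro sum.neutral) auto
        finally show ?thesis by simp
      next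
        case False
        then have "f y = 0" using R(2)[of y] y unfolding X_def by auto
        moreover have "(\<Sum>x\<in>X. f x * cbump x d y) = 0" using z False by (intro sum.neutral) auto
        ultimately show ?thesis by simp
      qed
    qed
    then have "\<mu> f = \<mu> (\<lambda>y. \<Sum>x\<in>X. f x * cbump x d y)" using radonD(3)[OF \<mu> f cs] by simp
    also have "\<dots> = (\<Sum>x\<in>X. f x * \<mu> (cbump x d))"
      using radon_sum[OF \<mu>, of X "\<lambda>x y. f x * cbump x d y", OF cb] radonD(2)[OF \<mu> testfun_Cc[OF testfun_cbump[OF d]]] by simp
    also have "\<dots> = (\<Sum>x\<in>X. m x * f x)" unfolding m_def X_def by (intro sum.cong) auto
    also have "\<dots> = (\<Sum>x\<in>supp m \<inter> {-R..R}. m x * f x)"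
      using X sub unfolding X_def by (intro sum.mono_neutral_right) (auto simp: supp_def)
    also have "\<dots> = atomic m f" by (rule atomic_finite_support[OF sm R(2), symmetric])
    finally show ?thesis .
  qed
  then show ?thesis using that[of m] sub sm by blast
qed

lemma atomic_point:
  assumes "separated d (supp m)" "m x \<noteq> 0" "\<And>y. f y \<noteq> 0 \<Longrightarrow> \<bar>y - x\<bar> < d"
  shows "atomic m f = m x * f x"
proof -
  have "atomic m f = infsum (\<lambda>y. m y * f y) {x}"
    unfolding atomic_def
  proof (rule infsum_cong_neutral)
    fix y assume "y \<in> UNIV - {x}"
    then show "m y * f y = 0" using assms separatedD[OF assms(1), of y x] by (auto simp: in_supp)
  qed auto
  then show ?thesis by simp
qed

section \<open>A density lemma for spectral gaps\<close>

lemma sin_ge_chord: assumes "0 \<le> y" "y \<le> pi / 2" shows "2 * y / pi \<le> sin y"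
proof -
  have "convex_on {0..pi/2} (\<lambda>x. - sin x)"
  proof (rule f''_ge0_imp_convex[where f'="\<lambda>x. - cos x" and f''="\<lambda>x. sin x"])
    show "0 \<le> sin x" if "x \<in> {0..pi/2}" for x using that by (intro sin_ge_zero) auto
  qed (auto intro!: derivative_eq_intros)
  then have "- sin ((1 - 2 * y / pi) *\<^sub>R 0 + (2 * y / pi) *\<^sub>R (pi / 2)) \<le> (1 - 2 * y / pi) * (- sin 0) + (2 * y / pi) * (- sin (pi / 2))"
    using assms by (intro convex_onD) (auto simp: field_simps)
  then show ?thesis by simp
qed

lemma norm_ee_minus_1: "norm (ee t - 1) = 2 * \<bar>sin (pi * t)\<bar>"
  using dist_exp_i_1[of "2 * pi * t"] by (simp add: ee_def cis_conv_exp)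

lemma norm_ee_minus_1_ge: assumes "\<bar>t\<bar> \<le> 1 / 2" shows "4 * \<bar>t\<bar> \<le> norm (ee t - 1)"
proof -
  have "2 * (pi * \<bar>t\<bar>) / pi \<le> sin (pi * \<bar>t\<bar>)" using assms by (intro sin_ge_chord) (auto simp: field_simps)
  also have "\<dots> \<le> \<bar>sin (pi * t)\<bar>" by (cases "t \<ge> 0") auto
  finally show ?thesis unfolding norm_ee_minus_1 by simp
qed

lemma norm_ee_diff: "norm (ee s - ee t) = norm (ee (s - t) - 1)"
proof -
  have "ee s - ee t = ee t * (ee (s - t) - 1)" by (simp add: ee_diff field_simps)
  then show ?thesis by (simp add: norm_mult)
qed

text \<open>\<open>g\<close> stands for the transform of a measure on \<open>[0, K]\<close>, for
  instance a trigonometric polynomial. Only the effect on test functions is recorded: convolution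
  with that measure enlarges supports by at most \<open>K\<close> to the right.\<close>

definition multiplier :: "real \<Rightarrow> (real \<Rightarrow> complex) \<Rightarrow> bool" where
  "multiplier K g \<longleftrightarrow> (\<forall>u v \<phi>. testfun \<phi> \<longrightarrow> (\<forall>x. \<phi> x \<noteq> 0 \<longrightarrow> u \<le> x \<and> x \<le> v) \<longrightarrow>
     (\<exists>\<psi>. testfun \<psi> \<and> (\<forall>x. \<psi> x \<noteq> 0 \<longrightarrow> u \<le> x \<and> x \<le> v + K) \<and> (\<forall>x. ft \<psi> x = g x * ft \<phi> x)))"

lemma multiplierI:
  assumes "\<And>u v \<phi>. testfun \<phi> \<Longrightarrow> (\<And>x. \<phi> x \<noteq> 0 \<Longrightarrow> u \<le> x \<and> x \<le> v) \<Longrightarrow>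
     \<exists>\<psi>. testfun \<psi> \<and> (\<forall>x. \<psi> x \<noteq> 0 \<longrightarrow> u \<le> x \<and> x \<le> v + K) \<and> (\<forall>x. ft \<psi> x = g x * ft \<phi> x)"
  shows "multiplier K g"
  unfolding multiplier_def using assms by simp

lemma multiplierE:
  assumes "multiplier K g" "testfun \<phi>" "\<And>x. \<phi> x \<noteq> 0 \<Longrightarrow> u \<le> x \<and> x \<le> v"
  obtains \<psi> where "testfun \<psi>" "\<And>x. \<psi> x \<noteq> 0 \<Longrightarrow> u \<le> x \<and> x \<le> v + K" "\<And>x. ft \<psi> x = g x * ft \<phi> x"
proof -
  have "\<exists>\<psi>. testfun \<psi> \<and> (\<forall>x. \<psi> x \<noteq> 0 \<longrightarrow> u \<le> x \<and> x \<le> v + K) \<and> (\<forall>x. ft \<psi> x = g x * ft \<phi> x)"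
    using assms unfolding multiplier_def by simp
  then show ?thesis using that by metis
qed

lemma multiplier_ee: assumes "0 \<le> \<nu>" "\<nu> \<le> K" shows "multiplier K (\<lambda>x. ee (- (\<nu> * x)))"
proof (rule multiplierI)
  fix u v \<phi> assume \<phi>: "testfun \<phi>" "\<And>x. \<phi> x \<noteq> 0 \<Longrightarrow> u \<le> x \<and> x \<le> v"
  have "u \<le> x \<and> x \<le> v + K" if "\<phi> (x - \<nu>) \<noteq> 0" for x using \<phi>(2)[OF that] assms by linarith
  then show "\<exists>\<psi>. testfun \<psi> \<and> (\<forall>x. \<psi> x \<noteq> 0 \<longrightarrow> u \<le> x \<and> x \<le> v + K) \<and> (\<forall>x. ft \<psi> x = ee (- (\<nu> * x)) * ft \<phi> x)"
    by (intro exI[of _ "\<lambda>x. \<phi> (x - \<nu>)"] conjI testfun_shift \<phi>(1) allI ft_shift testfun_Cc) blast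
qed

lemma multiplier_cmult: assumes "multiplier K g" shows "multiplier K (\<lambda>x. c * g x)"
proof (rule multiplierI)
  fix u v \<phi> assume \<phi>: "testfun \<phi>" "\<And>x. \<phi> x \<noteq> 0 \<Longrightarrow> u \<le> x \<and> x \<le> v"
  obtain \<psi> where \<psi>: "testfun \<psi>" "\<And>x. \<psi> x \<noteq> 0 \<Longrightarrow> u \<le> x \<and> x \<le> v + K" "\<And>x. ft \<psi> x = g x * ft \<phi> x"
    using multiplierE[OF assms \<phi>] by metis
  show "\<exists>\<psi>. testfun \<psi> \<and> (\<forall>x. \<psi> x \<noteq> 0 \<longrightarrow> u \<le> x \<and> x \<le> v + K) \<and> (\<forall>x. ft \<psi> x = c * g x * ft \<phi> x)"
    by (intro exI[of _ "\<lambda>x. c * \<psi> x"] conjI testfun_cmult \<psi>(1) allI impI)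
       (use \<psi> in \<open>auto simp: ft_cmult testfun_Cc\<close>)
qed

lemma multiplier_add: assumes "multiplier K g" "multiplier K h" shows "multiplier K (\<lambda>x. g x + h x)"
proof (rule multiplierI)
  fix u v \<phi> assume \<phi>: "testfun \<phi>" "\<And>x. \<phi> x \<noteq> 0 \<Longrightarrow> u \<le> x \<and> x \<le> v"
  obtain \<psi> where \<psi>: "testfun \<psi>" "\<And>x. \<psi> x \<noteq> 0 \<Longrightarrow> u \<le> x \<and> x \<le> v + K" "\<And>x. ft \<psi> x = g x * ft \<phi> x"
    using multiplierE[OF assms(1) \<phi>] by metis
  obtain \<xi> where \<xi>: "testfun \<xi>" "\<And>x. \<xi> x \<noteq> 0 \<Longrightarrow> u \<le> x \<and> x \<le> v + K" "\<And>x. ft \<xi> x = h x * ft \<phi> x"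
    using multiplierE[OF assms(2) \<phi>] by metis
  have "u \<le> x \<and> x \<le> v + K" if "\<psi> x + \<xi> x \<noteq> 0" for x using that \<psi>(2)[of x] \<xi>(2)[of x] by fastforce
  then show "\<exists>\<psi>. testfun \<psi> \<and> (\<forall>x. \<psi> x \<noteq> 0 \<longrightarrow> u \<le> x \<and> x \<le> v + K) \<and> (\<forall>x. ft \<psi> x = (g x + h x) * ft \<phi> x)"
    by (intro exI[of _ "\<lambda>x. \<psi> x + \<xi> x"] conjI testfun_add \<psi>(1) \<xi>(1) allI impI)
       (use \<psi> \<xi> in \<open>auto simp: ft_add testfun_Cc distrib_right\<close>)
qed

lemma multiplier_mult: assumes "multiplier K g" "multiplier L h" shows "multiplier (K + L) (\<lambda>x. g x * h x)"
proof (rule multiplierI)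
  fix u v \<phi> assume \<phi>: "testfun \<phi>" "\<And>x. \<phi> x \<noteq> 0 \<Longrightarrow> u \<le> x \<and> x \<le> v"
  obtain \<psi> where \<psi>: "testfun \<psi>" "\<And>x. \<psi> x \<noteq> 0 \<Longrightarrow> u \<le> x \<and> x \<le> v + L" "\<And>x. ft \<psi> x = h x * ft \<phi> x"
    using multiplierE[OF assms(2) \<phi>] by metis
  obtain \<xi> where \<xi>: "testfun \<xi>" "\<And>x. \<xi> x \<noteq> 0 \<Longrightarrow> u \<le> x \<and> x \<le> v + L + K" "\<And>x. ft \<xi> x = g x * ft \<psi> x"
    using multiplierE[OF assms(1) \<psi>(1,2)] by metis
  show "\<exists>\<psi>. testfun \<psi> \<and> (\<forall>x. \<psi> x \<noteq> 0 \<longrightarrow> u \<le> x \<and> x \<le> v + (K + L)) \<and> (\<forall>x. ft \<psi> x = g x * h x * ft \<phi> x)"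
    by (intro exI[of _ \<xi>] conjI \<xi>(1) allI impI) (use \<xi> \<psi> in \<open>auto simp: algebra_simps\<close>)
qed

lemma multiplier_const: "0 \<le> K \<Longrightarrow> multiplier K (\<lambda>x. c)"
  using multiplier_cmult[OF multiplier_ee[of 0 K], of c] by simp

lemma multiplier_sum:
  "0 \<le> K \<Longrightarrow> (\<And>i. i \<in> I \<Longrightarrow> multiplier K (g i)) \<Longrightarrow> multiplier K (\<lambda>x. \<Sum>i\<in>I. g i x)"
  by (induction I rule: infinite_finite_induct) (auto intro: multiplier_const multiplier_add)

lemma multiplier_prod:
  "finite I \<Longrightarrow> (\<And>i. i \<in> I \<Longrightarrow> multiplier K (g i)) \<Longrightarrow> multiplier (real (card I) * K) (\<lambda>x. \<Prod>i\<in>I. g i x)"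
proof (induction I rule: finite_induct)
  case empty then show ?case using multiplier_const[of 0 1] by simp
next
  case (insert i I)
  then have "multiplier (K + real (card I) * K) (\<lambda>x. g i x * (\<Prod>i\<in>I. g i x))" by (intro multiplier_mult) auto
  then show ?case using insert by (simp add: algebra_simps)
qed

lemma multiplier_power: "multiplier K g \<Longrightarrow> multiplier (real n * K) (\<lambda>x. g x ^ n)"
  using multiplier_prod[of "{..<n}" K "\<lambda>_. g"] by simp

text \<open>An average of \<open>N\<close> characters with frequencies in \<open>[0, w)\<close>, a
  discrete substitute for the transform of the uniform density on that interval. It has period
  \<open>N / w\<close>, so its decay is limited to
  \<open>\<bar>y\<bar> \<le> N / (2 * w)\<close>.\<close>

definition dirichlet :: "nat \<Rightarrow> real \<Rightarrow> real \<Rightarrow> complex" where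
  "dirichlet N w y = (1 / of_nat N) * (\<Sum>j<N. ee (- (real j * w / real N) * y))"

lemma multiplier_dirichlet:
  assumes "w \<ge> 0" shows "multiplier w (\<lambda>x. dirichlet N w (x - q))"
proof -
  have "multiplier w (\<lambda>x. ee (- (real j * w / real N) * (x - q)))" if "j < N" for j
  proof -
    have e: "ee (- (real j * w / real N) * (x - q)) = ee (real j * w / real N * q) * ee (- (real j * w / real N * x))" for x
    proof -
      have "- A * (x - q) = A * q + - (A * x)" for A by (simp add: algebra_simps)
      then show ?thesis by (simp only: ee_add[symmetric])
    qed
    have "real j * w \<le> real N * w" using that assms by (intro mult_right_mono) auto
    then have "real j * w / real N \<le> w" using that by (simp add: field_simps)
    then show ?thesis unfolding e using assms by (intro multiplier_cmult multiplier_ee) auto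
  qed
  then show ?thesis unfolding dirichlet_def using assms by (intro multiplier_cmult multiplier_sum) auto
qed

lemma norm_dirichlet_le_1: "norm (dirichlet N w y) \<le> 1"
proof -
  have "norm (\<Sum>j<N. ee (- (real j * w / real N) * y)) \<le> (\<Sum>j<N. 1)" by (intro sum_norm_le) simp
  then have "norm (dirichlet N w y) \<le> 1 / real N * real N"
    unfolding dirichlet_def norm_mult by (intro mult_mono) (auto simp: norm_divide)
  then show ?thesis by (cases "N = 0") auto
qed

lemma dirichlet_0: "N > 0 \<Longrightarrow> dirichlet N w 0 = 1"
  by (simp add: dirichlet_def)

lemma norm_dirichlet_le:
  assumes "N > 0" "w > 0" "y \<noteq> 0" "w * \<bar>y\<bar> / real N \<le> 1 / 2"
  shows "norm (dirichlet N w y) \<le> 1 / (2 * w * \<bar>y\<bar>)"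
proof -
  define t where "t = - (w * y / real N)"
  have t: "\<bar>t\<bar> = w * \<bar>y\<bar> / real N" using assms by (simp add: t_def abs_mult)
  have tpos: "\<bar>t\<bar> > 0" using assms t by simp
  have lb: "4 * \<bar>t\<bar> \<le> norm (ee t - 1)" using norm_ee_minus_1_ge[of t] assms t by simp
  have eq: "ee (- (real j * w / real N) * y) = ee t ^ j" for j by (simp add: ee_power t_def mult.assoc)
  have ne: "ee t \<noteq> 1" using lb tpos by auto
  have "(\<Sum>j<N. ee (- (real j * w / real N) * y)) = (ee t ^ N - 1) / (ee t - 1)"
    unfolding eq by (rule geometric_sum[OF ne])
  then have "norm (\<Sum>j<N. ee (- (real j * w / real N) * y)) = norm (ee t ^ N - 1) / norm (ee t - 1)"
    by (simp add: norm_divide)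
  also have "\<dots> \<le> 2 / (4 * \<bar>t\<bar>)"
    using norm_triangle_ineq4[of "ee t ^ N" 1] lb tpos by (intro frac_le) (auto simp: norm_power)
  finally have "norm (dirichlet N w y) \<le> 1 / real N * (2 / (4 * \<bar>t\<bar>))"
    unfolding dirichlet_def norm_mult using assms by (intro mult_mono) (auto simp: norm_divide)
  also have "\<dots> = 1 / (2 * w * \<bar>y\<bar>)" using assms unfolding t by (simp add: field_simps)
  finally show ?thesis .
qed

lemma fact_card_le_prod:
  assumes "finite A" "\<And>k. k \<in> A \<Longrightarrow> k \<ge> 1" shows "fact (card A) \<le> \<Prod>(A :: nat set)"
  using assms
proof (induction "card A" arbitrary: A)
  case 0 then show ?case by simp
next
  case (Suc n)
  define M where "M = Max A"
  have ne: "A \<noteq> {}" using Suc.hyps(2) by auto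
  have M: "M \<in> A" unfolding M_def using Suc.prems(1) ne by simp
  have "A \<subseteq> {1..M}" using Suc.prems M_def by auto
  then have "card A \<le> M" using card_mono[of "{1..M}" A] by simp
  moreover have c: "card (A - {M}) = n" using M Suc.hyps(2) Suc.prems(1) by simp
  then have "fact n \<le> \<Prod>(A - {M})" using Suc.hyps(1)[of "A - {M}"] Suc.prems by simp
  ultimately have "Suc n * fact n \<le> M * \<Prod>(A - {M})" using Suc.hyps(2) by (intro mult_le_mono) auto
  also have "\<dots> = \<Prod>A" using prod.remove[OF Suc.prems(1) M, of "\<lambda>x. x"] by simp
  finally show ?case unfolding Suc.hyps(2)[symmetric] by simp
qed

lemma power_over_fact_le_exp: "x \<ge> 0 \<Longrightarrow> x ^ n / fact n \<le> exp (x::real)"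
proof -
  assume x: "x \<ge> 0"
  have "(\<Sum>k\<in>{n}. x ^ k / fact k) \<le> (\<Sum>k. x ^ k / fact k)"
    using summable_exp[of x] x by (intro sum_le_suminf) (auto simp: field_simps)
  also have "\<dots> = exp x" by (simp add: exp_def field_simps)
  finally show ?thesis by simp
qed

text \<open>The distances \<open>s q\<close> of points on one side of a base point, divided by
  \<open>d\<close> and rounded down, are distinct positive integers, so their product is at least
  \<open>fact (card S)\<close>. The inequality \<open>A ^ n / fact n \<le> exp A\<close> with
  \<open>A = \<theta> * T / d\<close> trades the factorial for a power of \<open>\<theta>\<close>; a
  small \<open>\<theta>\<close> keeps the exponential loss small.\<close>

lemma prod_distance_ge:
  assumes sep: "separated d S" and S: "finite S" and pos: "\<And>q. q \<in> S \<Longrightarrow> d \<le> s q" and dist: "\<And>p q. p \<in> S \<Longrightarrow> q \<in> S \<Longrightarrow> \<bar>s p - s q\<bar> = \<bar>p - q\<bar>"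
    and \<theta>: "0 < \<theta>" and T: "T > 0"
  shows "\<theta> ^ card S * exp (- (\<theta> * T / d)) \<le> (\<Prod>q\<in>S. s q / T)"
proof -
  have d: "d > 0" using separated_pos[OF sep] .
  define k where "k q = nat \<lfloor>s q / d\<rfloor>" for q
  have k1: "k q \<ge> 1" if "q \<in> S" for q
  proof -
    have "s q / d \<ge> 1" using pos[OF that] d by simp
    then show ?thesis unfolding k_def by linarith
  qed
  have kle: "real (k q) * d \<le> s q" if "q \<in> S" for q
  proof -
    have "s q / d \<ge> 1" using pos[OF that] d by simp
    then have "real (k q) \<le> s q / d" unfolding k_def by linarith
    then show ?thesis using d by (simp add: field_simps)
  qed
  have inj: "inj_on k S"
  proof (rule inj_onI)
    fix p q assume pq: "p \<in> S" "q \<in> S" "k p = k q"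
    have "s p / d \<ge> 1" "s q / d \<ge> 1" using pos pq d by auto
    then have "\<bar>s p / d - s q / d\<bar> < 1" using pq(3) unfolding k_def by linarith
    then have "\<bar>s p - s q\<bar> < d" using d by (simp add: diff_divide_distrib[symmetric] field_simps)
    then show "p = q" using separatedD[OF sep pq(1,2)] dist[OF pq(1,2)] by simp
  qed
  have "(\<theta> * T / d) ^ card S / fact (card S) \<le> exp (\<theta> * T / d)"
    using \<theta> T d by (intro power_over_fact_le_exp) simp
  then have "(\<theta> * T / d) ^ card S \<le> exp (\<theta> * T / d) * fact (card S)"
    using divide_le_eq[of "(\<theta> * T / d) ^ card S" "fact (card S)"] by simp
  then have "(\<theta> * T / d) ^ card S * exp (- (\<theta> * T / d)) \<le> (exp (\<theta> * T / d) * fact (card S)) * exp (- (\<theta> * T / d))"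
    by (intro mult_right_mono) auto
  also have "\<dots> = fact (card S)" by (simp add: exp_minus)
  finally have "(\<theta> * T / d) ^ card S * exp (- (\<theta> * T / d)) \<le> fact (card S)" .
  then have "(d / T) ^ card S * ((\<theta> * T / d) ^ card S * exp (- (\<theta> * T / d))) \<le> (d / T) ^ card S * fact (card S)"
    using d T by (intro mult_left_mono) auto
  moreover have "(d / T) ^ card S * (\<theta> * T / d) ^ card S = \<theta> ^ card S"
    using d T by (simp add: power_mult_distrib[symmetric])
  ultimately have 1: "\<theta> ^ card S * exp (- (\<theta> * T / d)) \<le> (d / T) ^ card S * fact (card S)"
    by (simp add: mult.assoc[symmetric])
  have "fact (card (k ` S)) \<le> \<Prod>(k ` S)" by (rule fact_card_le_prod) (use S k1 in auto)
  then have "fact (card S) \<le> (\<Prod>q\<in>S. k q)" by (simp add: card_image[OF inj] prod.reindex[OF inj] o_def)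
  then have "fact (card S) \<le> (\<Prod>q\<in>S. real (k q))" by (metis of_nat_fact of_nat_le_iff of_nat_prod)
  then have "(d / T) ^ card S * fact (card S) \<le> (d / T) ^ card S * (\<Prod>q\<in>S. real (k q))"
    using d T by (intro mult_left_mono) auto
  also have "\<dots> = (\<Prod>q\<in>S. d / T * real (k q))" by (simp only: prod.distrib prod_constant)
  also have "\<dots> \<le> (\<Prod>q\<in>S. s q / T)"
    using kle d T by (intro prod_mono) (auto simp: divide_right_mono mult.commute)
  finally show ?thesis using 1 by linarith
qed

definition annihilates :: "(real \<Rightarrow> complex) \<Rightarrow> real \<Rightarrow> real \<Rightarrow> bool" where
  "annihilates b u v \<longleftrightarrow> (\<forall>\<phi>. testfun \<phi> \<longrightarrow> (\<forall>x. \<phi> x \<noteq> 0 \<longrightarrow> u < x \<and> x < v) \<longrightarrow> atomic b (ft \<phi>) = 0)"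

lemma annihilatesD:
  "annihilates b u v \<Longrightarrow> testfun \<phi> \<Longrightarrow> (\<And>x. \<phi> x \<noteq> 0 \<Longrightarrow> u < x \<and> x < v) \<Longrightarrow> atomic b (ft \<phi>) = 0"
  unfolding annihilates_def by simp

text \<open>Let \<open>\<theta> = min 1 (a * d / 128)\<close> and let \<open>c\<close> be the
  density. Then \<open>c * ln (2 / \<theta>) \<le> a / 64\<close> limits the growth of the
  interpolating polynomial in \<open>spectral_gap_estimate\<close>, and \<open>c \<le> a\<close>
  limits its bandwidth to \<open>a / 4\<close>.\<close>

definition gap_density :: "real \<Rightarrow> real \<Rightarrow> real" where
  "gap_density d a = min a (a / (64 * ln (2 / min 1 (a * d / 128))))"

lemma gap_density_pos: assumes "d > 0" "a > 0" shows "gap_density d a > 0"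
proof -
  have "1 < 2 / min 1 (a * d / 128)" using assms by (simp add: field_simps)
  then show ?thesis unfolding gap_density_def using assms by simp
qed

text \<open>If few support points lie in \<open>[-T, T]\<close>, a trigonometric polynomial
  \<open>P\<close> of bandwidth at most \<open>a / 4\<close> vanishes at all of them except
  \<open>q0\<close> and grows, relative to its value at \<open>q0\<close>, by at most
  \<open>exp (a * T / 32)\<close>. A power of the Dirichlet kernel, again of bandwidth
  \<open>a / 4\<close>, gains about \<open>exp (- a * T / 16)\<close> outside. All this fits into
  the gap, so the term at \<open>q0\<close> is minus the sum over the points outside
  \<open>[-T, T]\<close>, which is exponentially small.\<close>

lemma spectral_gap_estimate:
  assumes d: "d > 0" and a: "a > 0" and sep: "separated d (supp b)" and bd: "\<And>x. norm (b x) \<le> B"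
    and ann: "annihilates b u (u + a)" and q0: "b q0 \<noteq> 0"
    and th: "\<theta>0 = ft (\<lambda>x. ee (q0 * x) * cbump (u + a / 8) (a / 16) x)"
    and C2: "\<And>x. (1 + x\<^sup>2) ^ 2 * norm (\<theta>0 x) \<le> C2"
    and T: "T \<ge> 1" "T \<ge> 2 * \<bar>q0\<bar>" "T \<ge> 16 / a"
    and few: "card (supp b \<inter> {-T..T}) \<le> gap_density d a * T"
  shows "norm (b q0) * norm (\<theta>0 q0) \<le> B * C2 * sep_const d * exp (1 - a * T / 32)"
proof -
  define \<theta> where "\<theta> = min 1 (a * d / 128)"
  define c where "c = gap_density d a"
  have \<theta>: "0 < \<theta>" "\<theta> \<le> 1" "\<theta> \<le> a * d / 128" using a d by (auto simp: \<theta>_def)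
  have ln2: "ln (2 / \<theta>) > 0" using \<theta> by (simp add: field_simps)
  have c: "0 < c" "c \<le> a" "c * ln (2 / \<theta>) \<le> a / 64"
  proof -
    show "0 < c" "c \<le> a" using gap_density_pos[OF d a] by (auto simp: c_def gap_density_def)
    have "c \<le> a / (64 * ln (2 / \<theta>))" unfolding c_def gap_density_def \<theta>_def by simp
    then show "c * ln (2 / \<theta>) \<le> a / 64" using ln2 by (simp add: field_simps)
  qed
  have B0: "B \<ge> 0" using bd[of 0] norm_ge_zero order_trans by blast
  define Q where "Q = supp b \<inter> {-T..T} - {q0}"
  define n where "n = card Q"
  have fin: "finite (supp b \<inter> {-T..T})" by (rule separated_finite(1)[OF sep])
  have finQ: "finite Q" unfolding Q_def using fin by simp
  have n: "real n \<le> c * T"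
  proof -
    have "n \<le> card (supp b \<inter> {-T..T})" unfolding n_def Q_def using fin by (intro card_mono) auto
    then have "real n \<le> real (card (supp b \<inter> {-T..T}))" by simp
    then show ?thesis using few unfolding c_def by linarith
  qed
  have q0T: "\<bar>q0\<bar> \<le> T / 2" using T(2) by simp
  \<comment> \<open>The frequency \<open>1 / (4 * T)\<close> keeps the phase
    \<open>(q - q0) / (4 * T)\<close> within \<open>1 / 2\<close>, where the chord bound from below
    applies, and lets each zero cost only \<open>1 / (4 * T)\<close> of bandwidth.\<close>
  define fac where "fac q x = ee (- (1 / (4 * T) * x)) + (-1) * ee (- (1 / (4 * T) * q))" for q x
  define P where "P x = (\<Prod>q\<in>Q. fac q x)" for x
  have mP: "multiplier (real n * (1 / (4 * T))) P"
    unfolding P_def n_def fac_def using T(1) finQ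
    by (intro multiplier_prod multiplier_add multiplier_const multiplier_ee) auto
  have P0: "P q = 0" if "q \<in> Q" for q
  proof -
    have "fac q q = 0" by (simp add: fac_def)
    then show ?thesis unfolding P_def using that finQ by (metis prod_zero)
  qed
  have P2: "norm (P x) \<le> 2 ^ n" for x
  proof -
    have "norm (fac q x) \<le> 2" for q
      unfolding fac_def using norm_triangle_ineq[of "ee (- (1 / (4 * T) * x))" "(-1) * ee (- (1 / (4 * T) * q))"] by (simp add: norm_mult)
    then have "norm (P x) \<le> (\<Prod>q\<in>Q. 2)" unfolding P_def prod_norm[symmetric] by (intro prod_mono) auto
    then show ?thesis by (simp add: n_def)
  qed
  have Plow: "\<theta> ^ n * exp (- (2 * (\<theta> * T / d))) \<le> norm (P q0)"
  proof -
    define Q1 where "Q1 = {q \<in> Q. q > q0}"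
    define Q2 where "Q2 = {q \<in> Q. q < q0}"
    have Q12: "Q = Q1 \<union> Q2" "Q1 \<inter> Q2 = {}" "finite Q1" "finite Q2"
      using finQ by (auto simp: Q1_def Q2_def Q_def[symmetric]) (auto simp: Q_def)
    have sepQ: "d \<le> \<bar>q - q0\<bar>" if "q \<in> Q" for q
      using sep that q0 unfolding separated_def Q_def by (auto simp: in_supp)
    have facl: "\<bar>q - q0\<bar> / T \<le> norm (fac q q0)" if "q \<in> Q" for q
    proof -
      have "\<bar>q - q0\<bar> \<le> 2 * T" using that q0T T(1) unfolding Q_def by auto
      then have "\<bar>(q - q0) / (4 * T)\<bar> \<le> 1 / 2" using T(1) by (simp add: field_simps)
      then have "4 * \<bar>(q - q0) / (4 * T)\<bar> \<le> norm (ee ((q - q0) / (4 * T)) - 1)" by (rule norm_ee_minus_1_ge)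
      also have "\<dots> = norm (fac q q0)" unfolding fac_def
        using norm_ee_diff[of "- (1 / (4 * T) * q0)" "- (1 / (4 * T) * q)"] by (simp add: diff_divide_distrib)
      finally show ?thesis using T(1) by simp
    qed
    have 1: "\<theta> ^ card Q1 * exp (- (\<theta> * T / d)) \<le> (\<Prod>q\<in>Q1. (q - q0) / T)"
    proof (rule prod_distance_ge[OF separated_subset[OF sep] Q12(3) _ _ \<theta>(1)])
      show "Q1 \<subseteq> supp b" by (auto simp: Q1_def Q_def)
      show "d \<le> q - q0" if "q \<in> Q1" for q using sepQ[of q] that unfolding Q1_def by auto
    qed (use T in auto)
    have 2: "\<theta> ^ card Q2 * exp (- (\<theta> * T / d)) \<le> (\<Prod>q\<in>Q2. (q0 - q) / T)"
    proof (rule prod_distance_ge[OF separated_subset[OF sep] Q12(4) _ _ \<theta>(1)])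
      show "Q2 \<subseteq> supp b" by (auto simp: Q2_def Q_def)
      show "d \<le> q0 - q" if "q \<in> Q2" for q using sepQ[of q] that unfolding Q2_def by auto
    qed (use T in auto)
    have "\<theta> ^ n * exp (- (2 * (\<theta> * T / d))) = (\<theta> ^ card Q1 * exp (- (\<theta> * T / d))) * (\<theta> ^ card Q2 * exp (- (\<theta> * T / d)))"
    proof -
      have "n = card Q1 + card Q2" unfolding n_def Q12(1) by (rule card_Un_disjoint[OF Q12(3,4,2)])
      then have "\<theta> ^ n = \<theta> ^ card Q1 * \<theta> ^ card Q2" by (simp add: power_add)
      moreover have "exp (- (2 * (\<theta> * T / d))) = exp (- (\<theta> * T / d)) * exp (- (\<theta> * T / d))"
        unfolding exp_add[symmetric] by simp
      ultimately show ?thesis by simp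
    qed
    also have "\<dots> \<le> (\<Prod>q\<in>Q1. (q - q0) / T) * (\<Prod>q\<in>Q2. (q0 - q) / T)"
      using 1 2 \<theta>(1) T(1) by (intro mult_mono) (auto intro!: prod_nonneg simp: Q1_def Q2_def)
    also have "\<dots> = (\<Prod>q\<in>Q1. \<bar>q - q0\<bar> / T) * (\<Prod>q\<in>Q2. \<bar>q - q0\<bar> / T)"
      by (intro arg_cong2[where f="times"] prod.cong) (auto simp: Q1_def Q2_def)
    also have "\<dots> = (\<Prod>q\<in>Q. \<bar>q - q0\<bar> / T)" unfolding Q12(1) by (rule prod.union_disjoint[OF Q12(3,4,2), symmetric])
    also have "\<dots> \<le> (\<Prod>q\<in>Q. norm (fac q q0))" using facl T(1) by (intro prod_mono) auto
    also have "\<dots> = norm (P q0)" by (simp add: P_def prod_norm)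
    finally show ?thesis .
  qed
  have Ppos: "norm (P q0) > 0" using Plow \<theta>(1) by (meson exp_gt_zero less_le_trans mult_pos_pos zero_less_power)
  define E where "E = exp (a * T / 32)"
  have PE: "norm (P x) / norm (P q0) \<le> E" for x
  proof -
    have "2 ^ n \<le> E * (\<theta> ^ n * exp (- (2 * (\<theta> * T / d))))"
    proof -
      have "(2 / \<theta>) ^ n = exp (real n * ln (2 / \<theta>))" using \<theta>(1) by (simp add: exp_of_nat_mult)
      also have "\<dots> \<le> exp (a * T / 64)"
      proof -
        have "real n * ln (2 / \<theta>) \<le> c * T * ln (2 / \<theta>)" using n ln2 by (intro mult_right_mono) auto
        also have "\<dots> = (c * ln (2 / \<theta>)) * T" by simp
        also have "\<dots> \<le> a / 64 * T" using c(3) T(1) by (intro mult_right_mono) auto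
        finally show ?thesis by simp
      qed
      finally have 1: "(2 / \<theta>) ^ n \<le> exp (a * T / 64)" .
      have "2 * (\<theta> * T / d) \<le> a * T / 64"
      proof -
        have "\<theta> / d \<le> a / 128" using \<theta>(3) d by (simp add: field_simps)
        then have "2 * T * (\<theta> / d) \<le> 2 * T * (a / 128)" using T(1) by (intro mult_left_mono) auto
        then show ?thesis by (simp add: mult_ac)
      qed
      then have 2: "exp (2 * (\<theta> * T / d)) \<le> exp (a * T / 64)" by simp
      have "(2 / \<theta>) ^ n * exp (2 * (\<theta> * T / d)) \<le> exp (a * T / 64) * exp (a * T / 64)"
        using 1 2 \<theta>(1) by (intro mult_mono) auto
      also have "\<dots> = E" unfolding E_def exp_add[symmetric] by simp
      finally have 3: "(2 / \<theta>) ^ n * exp (2 * (\<theta> * T / d)) \<le> E" .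
      have "2 ^ n = ((2 / \<theta>) ^ n * exp (2 * (\<theta> * T / d))) * (\<theta> ^ n * exp (- (2 * (\<theta> * T / d))))"
        using \<theta>(1) by (simp add: power_divide exp_minus)
      also have "\<dots> \<le> E * (\<theta> ^ n * exp (- (2 * (\<theta> * T / d))))" using 3 \<theta>(1) by (intro mult_right_mono) auto
      finally show ?thesis .
    qed
    also have "\<dots> \<le> E * norm (P q0)" using Plow by (intro mult_left_mono) (auto simp: E_def)
    finally have "norm (P x) \<le> E * norm (P q0)" using P2[of x] by linarith
    then show ?thesis using Ppos by (simp add: field_simps)
  qed
  \<comment> \<open>\<open>M\<close> is about twice the exponent of \<open>E\<close>, so that
    \<open>E * exp (- M)\<close> still decays exponentially in \<open>T\<close>.\<close>
  define M where "M = nat \<lfloor>a * T / 16\<rfloor>"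
  have aT: "a * T / 16 \<ge> 1" using T(3) a by (simp add: field_simps)
  have M: "M \<ge> 1" "real M \<le> a * T / 16" "real M \<ge> a * T / 16 - 1"
    using aT unfolding M_def by linarith+
  \<comment> \<open>Bandwidth \<open>w\<close> per factor gives \<open>a / 4\<close> in total. Since
    \<open>M \<le> a * T / 16\<close>, also \<open>w * T \<ge> 4\<close>, so as far as the kernel
    bound reaches, the kernel is at most \<open>1 / 4 \<le> exp (- 1)\<close> at distances from
    \<open>T / 2\<close> on.\<close>
  define w where "w = a / (4 * real M)"
  have w: "w > 0" "real M * w = a / 4" using M(1) a by (auto simp: w_def)
  \<comment> \<open>Where periodicity spoils the kernel bound, this \<open>N\<close> forces
    \<open>\<bar>x\<bar> > exp M\<close>; there one of the two factors \<open>1 + x^2\<close> in the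
    decay of \<open>\<theta>0\<close> supplies \<open>exp (- M)\<close>.\<close>
  obtain N :: nat where N: "real N > (exp (real M) + \<bar>q0\<bar>) * (2 * w)" using reals_Archimedean2 by blast
  have N0: "N > 0"
  proof (rule ccontr)
    assume "\<not> N > 0"
    then have "(exp (real M) + \<bar>q0\<bar>) * (2 * w) < 0" using N by simp
    moreover have "(exp (real M) + \<bar>q0\<bar>) * (2 * w) \<ge> 0" using w(1) by simp
    ultimately show False by linarith
  qed
  define G where "G x = (1 / P q0) * P x * dirichlet N w (x - q0) ^ M" for x
  have mG: "multiplier (real n * (1 / (4 * T)) + real M * w) G"
    unfolding G_def using w(1) by (intro multiplier_mult multiplier_cmult mP multiplier_power multiplier_dirichlet) auto
  define \<phi>0 where "\<phi>0 = (\<lambda>x. ee (q0 * x) * cbump (u + a / 8) (a / 16) x)"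
  have \<phi>0: "testfun \<phi>0" unfolding \<phi>0_def using a by (intro testfun_mult testfun_cbump smooth_ee) auto
  have \<phi>0s: "u + a / 16 \<le> x \<and> x \<le> u + 3 * a / 16" if "\<phi>0 x \<noteq> 0" for x
  proof -
    have "cbump (u + a / 8) (a / 16) x \<noteq> 0" using that unfolding \<phi>0_def by auto
    then have "\<bar>x - (u + a / 8)\<bar> < a / 16" using cbump_nonzero_iff[of "a / 16"] a by simp
    then show ?thesis by linarith
  qed
  obtain \<psi> where \<psi>: "testfun \<psi>" "\<And>x. \<psi> x \<noteq> 0 \<Longrightarrow> u + a / 16 \<le> x \<and> x \<le> u + 3 * a / 16 + (real n * (1 / (4 * T)) + real M * w)"
    "\<And>x. ft \<psi> x = G x * ft \<phi>0 x"
    using multiplierE[OF mG \<phi>0 \<phi>0s] by metis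
  have nT: "real n * (1 / (4 * T)) \<le> a / 4"
  proof -
    have "real n \<le> a * T" using n c(2) T(1) by (meson mult_right_mono order_trans zero_le_one)
    then show ?thesis using T(1) by (simp add: field_simps)
  qed
  have "atomic b (ft \<psi>) = 0"
  proof (rule annihilatesD[OF ann \<psi>(1)])
    fix x assume "\<psi> x \<noteq> 0"
    then show "u < x \<and> x < u + a" using \<psi>(2)[of x] nT w(2) a by linarith
  qed
  have \<theta>0: "ft \<phi>0 = \<theta>0" using th unfolding \<phi>0_def by simp
  have sum: "(\<lambda>x. b x * ft \<psi> x) summable_on UNIV"
    by (rule atomic_summable[OF sep growth_bounded[OF bd] rapid_ft[OF \<psi>(1)]])
  have Gq0: "G q0 = 1" unfolding G_def using Ppos dirichlet_0[OF N0] by auto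
  define h where "h x = (if x = q0 then 0 else b x * ft \<psi> x)" for x
  have bq: "b q0 * \<theta>0 q0 = - infsum h UNIV"
  proof -
    have "infsum (\<lambda>x. b x * ft \<psi> x) UNIV = b q0 * ft \<psi> q0 + infsum (\<lambda>x. b x * ft \<psi> x) (UNIV - {q0})"
      using infsum_Un_disjoint[of "\<lambda>x. b x * ft \<psi> x" "{q0}" "UNIV - {q0}"] summable_on_subset_banach[OF sum] by (simp add: insert_absorb)
    moreover have "infsum (\<lambda>x. b x * ft \<psi> x) (UNIV - {q0}) = infsum h UNIV"
      by (rule infsum_cong_neutral) (auto simp: h_def)
    ultimately show ?thesis using \<open>atomic b (ft \<psi>) = 0\<close> \<psi>(3)[of q0] Gq0 \<theta>0 unfolding atomic_def
      by (simp add: eq_neg_iff_add_eq_0)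
  qed
  define D where "D = B * (E * exp (- real M) * C2)"
  have hb: "norm (h x) \<le> D / (1 + (x - 0)\<^sup>2)" for x
  proof (cases "h x = 0")
    case True
    have "C2 \<ge> 0" using C2[of 0] by (simp add: order_trans[OF _ C2[of 0]])
    then have "D \<ge> 0" unfolding D_def E_def using B0 by simp
    then show ?thesis using True by simp
  next
    case False
    then have x: "x \<noteq> q0" "b x \<noteq> 0" "G x \<noteq> 0" using \<psi>(3)[of x] by (auto simp: h_def split: if_splits)
    have "x \<notin> Q" using x(3) P0 unfolding G_def by auto
    then have xT: "\<bar>x\<bar> > T" using x unfolding Q_def by (auto simp: in_supp)
    define y where "y = x - q0"
    have y: "\<bar>y\<bar> \<ge> T / 2" using xT q0T unfolding y_def by linarith
    have p1: "1 + x\<^sup>2 \<ge> 1" by simp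
    then have pp: "1 + x\<^sup>2 > 0" by linarith
    have GE: "norm (G x) \<le> E * norm (dirichlet N w y) ^ M"
    proof -
      have "norm (G x) = (norm (P x) / norm (P q0)) * norm (dirichlet N w y) ^ M"
        unfolding G_def y_def by (simp add: norm_mult norm_divide norm_power)
      also have "\<dots> \<le> E * norm (dirichlet N w y) ^ M" by (intro mult_right_mono PE) auto
      finally show ?thesis .
    qed
    have C2': "norm (\<theta>0 x) \<le> C2 / (1 + x\<^sup>2) ^ 2"
    proof -
      have "(1 + x\<^sup>2) ^ 2 > 0" using p1 by (intro zero_less_power) linarith
      then show ?thesis using C2[of x] by (simp only: pos_le_divide_eq mult.commute)
    qed
    have C20: "C2 \<ge> 0" using C2[of 0] by (simp add: order_trans[OF _ C2[of 0]])
    have key: "norm (dirichlet N w y) ^ M * norm (\<theta>0 x) \<le> exp (- real M) * C2 / (1 + x\<^sup>2)"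
    proof (cases "w * \<bar>y\<bar> / real N \<le> 1 / 2")
      case True
      have ypos: "\<bar>y\<bar> > 0" using y T(1) by linarith
      have "norm (dirichlet N w y) \<le> 1 / (2 * w * \<bar>y\<bar>)" using True ypos by (intro norm_dirichlet_le N0 w) auto
      also have "\<dots> \<le> 1 / (w * T)"
      proof -
        have "w * T \<le> 2 * w * \<bar>y\<bar>" using y w(1) by simp
        then show ?thesis using w(1) T(1) by (intro divide_left_mono) auto
      qed
      also have "\<dots> \<le> 1 / 4" unfolding w_def using M a T(1) by (simp add: field_simps)
      also have "\<dots> \<le> exp (-1)"
      proof -
        have "exp (1::real) \<le> 4" using exp_le by linarith
        then show ?thesis by (simp add: exp_minus field_simps)
      qed
      finally have "norm (dirichlet N w y) ^ M \<le> exp (-1) ^ M" by (intro power_mono) auto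
      also have "\<dots> = exp (- real M)" by (simp add: exp_of_nat_mult[symmetric])
      finally have 1: "norm (dirichlet N w y) ^ M \<le> exp (- real M)" .
      have "C2 / (1 + x\<^sup>2) ^ 2 \<le> C2 / (1 + x\<^sup>2)"
        using self_le_power[OF p1, of 2] by (intro divide_left_mono C20 mult_pos_pos zero_less_power pp) simp
      then have "norm (\<theta>0 x) \<le> C2 / (1 + x\<^sup>2)" using C2' by linarith
      then have "norm (dirichlet N w y) ^ M * norm (\<theta>0 x) \<le> exp (- real M) * (C2 / (1 + x\<^sup>2))"
        using 1 by (intro mult_mono) auto
      then show ?thesis by simp
    next
      case False
      then have "2 * w * \<bar>y\<bar> > real N" using N0 by (simp add: field_simps)
      then have "(exp (real M) + \<bar>q0\<bar>) * (2 * w) < \<bar>y\<bar> * (2 * w)" using N by (simp add: mult_ac)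
      then have "exp (real M) + \<bar>q0\<bar> < \<bar>y\<bar>" using w(1) by simp
      then have "exp (real M) < \<bar>x\<bar>" unfolding y_def by linarith
      moreover have "\<bar>x\<bar> \<le> 1 + x\<^sup>2" using sum_squares_bound[of "\<bar>x\<bar>" 1] by (simp add: power2_eq_square[symmetric])
      ultimately have ex: "exp (real M) \<le> 1 + x\<^sup>2" by linarith
      have "norm (dirichlet N w y) ^ M \<le> 1" by (intro power_le_one norm_dirichlet_le_1) auto
      then have "norm (dirichlet N w y) ^ M * norm (\<theta>0 x) \<le> 1 * (C2 / (1 + x\<^sup>2) ^ 2)"
        using C2' by (intro mult_mono) auto
      also have "\<dots> \<le> C2 / (exp (real M) * (1 + x\<^sup>2))"
      proof -
        have "exp (real M) * (1 + x\<^sup>2) \<le> (1 + x\<^sup>2) ^ 2"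
          unfolding power2_eq_square[of "1 + x\<^sup>2"] using ex pp by (intro mult_right_mono) auto
        then show ?thesis
          unfolding mult_1 by (intro divide_left_mono C20 mult_pos_pos zero_less_power pp exp_gt_zero)
      qed
      also have "\<dots> = exp (- real M) * C2 / (1 + x\<^sup>2)" by (simp add: exp_minus field_simps)
      finally show ?thesis .
    qed
    have "norm (h x) = norm (b x) * (norm (G x) * norm (\<theta>0 x))" unfolding h_def using x \<psi>(3)[of x] \<theta>0 by (simp add: norm_mult)
    also have "\<dots> \<le> B * (E * (exp (- real M) * C2 / (1 + x\<^sup>2)))"
    proof (rule mult_mono[OF bd _ B0])
      have "norm (G x) * norm (\<theta>0 x) \<le> E * norm (dirichlet N w y) ^ M * norm (\<theta>0 x)" using GE by (intro mult_right_mono) auto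
      also have "\<dots> \<le> E * (exp (- real M) * C2 / (1 + x\<^sup>2))" using key unfolding mult.assoc E_def by (intro mult_left_mono) auto
      finally show "norm (G x) * norm (\<theta>0 x) \<le> E * (exp (- real M) * C2 / (1 + x\<^sup>2))" .
    qed auto
    finally show ?thesis by (simp add: D_def)
  qed
  have s1: "(\<lambda>x. norm (h x)) summable_on UNIV" "infsum (\<lambda>x. norm (h x)) UNIV \<le> \<bar>D\<bar> * sep_const d"
  proof -
    have "q \<in> supp b" if "norm (h q) \<noteq> 0" for q
      using that by (auto simp: in_supp h_def split: if_splits)
    from separated_summable[OF sep norm_ge_zero this hb]
    show "(\<lambda>x. norm (h x)) summable_on UNIV" "infsum (\<lambda>x. norm (h x)) UNIV \<le> \<bar>D\<bar> * sep_const d" by auto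
  qed
  have C20: "C2 \<ge> 0" using C2[of 0] by (simp add: order_trans[OF _ C2[of 0]])
  have "norm (b q0) * norm (\<theta>0 q0) = norm (infsum h UNIV)" using bq by (simp add: norm_mult[symmetric])
  also have "\<dots> \<le> \<bar>D\<bar> * sep_const d" using norm_infsum_bound[OF s1(1)] s1(2) by linarith
  also have "\<bar>D\<bar> = B * C2 * (E * exp (- real M))" unfolding D_def E_def using B0 C20 by (simp add: abs_mult)
  also have "B * C2 * (E * exp (- real M)) * sep_const d \<le> B * C2 * exp (1 - a * T / 32) * sep_const d"
  proof (intro mult_right_mono mult_left_mono sep_const_nonneg)
    show "E * exp (- real M) \<le> exp (1 - a * T / 32)" unfolding E_def exp_add[symmetric] using M(3) by (simp add: mult.commute[of a])
  qed (use B0 C20 in auto)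
  finally show ?thesis by (simp add: mult_ac)
qed

text \<open>Failure for arbitrarily large \<open>T\<close> would make the right side of the estimate
  tend to zero while the left side is fixed and positive. The bound \<open>gap_density d a\<close>
  depends neither on the weights nor on the position of the gap; only the threshold
  \<open>T0\<close> may.\<close>

lemma spectral_gap_density:
  assumes d: "d > 0" and a: "a > 0" and sep: "separated d (supp b)" and bd: "\<And>x. norm (b x) \<le> B"
    and ann: "annihilates b u (u + a)" and q0: "b q0 \<noteq> 0"
  shows "\<exists>T0. \<forall>T\<ge>T0. gap_density d a * T < card (supp b \<inter> {-T..T})"
proof (rule ccontr)
  assume neg: "\<not> ?thesis"
  \<comment> \<open>Modulation by \<open>q0\<close> makes the transform at \<open>q0\<close> the
    integral of a bump, hence non-zero.\<close>
  define \<phi>0 where "\<phi>0 = (\<lambda>x. ee (q0 * x) * cbump (u + a / 8) (a / 16) x)"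
  have tc: "testfun (cbump (u + a / 8) (a / 16))" using a by (intro testfun_cbump) auto
  have \<phi>0: "testfun \<phi>0" unfolding \<phi>0_def by (intro testfun_mult tc smooth_ee)
  obtain C2 where C2: "\<And>x. (1 + x\<^sup>2) ^ 2 * norm (ft \<phi>0 x) \<le> C2" using rapid_ft[OF \<phi>0] unfolding rapid_def by blast
  have "ft \<phi>0 q0 \<noteq> 0"
  proof -
    have "ft \<phi>0 q0 = ft (cbump (u + a / 8) (a / 16)) 0" unfolding \<phi>0_def using ft_modulate[OF testfun_Cc[OF tc]] by simp
    also have "\<dots> = (LINT x|lborel. cbump (u + a / 8) (a / 16) x)" using ft_lborel[OF testfun_Cc[OF tc], of 0] by simp
    also have "\<dots> = complex_of_real (LINT x|lborel. bump ((x - (u + a / 8)) / (a / 16)))" unfolding cbump_def by simp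
    also have "(LINT x|lborel. bump ((x - (u + a / 8)) / (a / 16))) = (a / 16) * bump_mass"
      using lborel_integral_real_affine[of "a / 16" "\<lambda>x. bump ((x - (u + a / 8)) / (a / 16))" "u + a / 8"] a
      by (simp add: bump_mass_def)
    finally have "ft \<phi>0 q0 = complex_of_real (a / 16 * bump_mass)" .
    moreover have "a / 16 * bump_mass \<noteq> 0" using a bump_mass_pos by simp
    ultimately show ?thesis by (metis of_real_eq_0_iff)
  qed
  then have pos: "norm (b q0) * norm (ft \<phi>0 q0) > 0" using q0 by simp
  define A where "A = B * C2 * sep_const d"
  have est: "\<exists>T\<ge>S. norm (b q0) * norm (ft \<phi>0 q0) \<le> A * exp (1 - a * T / 32)" for S
  proof -
    obtain T where T: "T \<ge> max S (max 1 (max (2 * \<bar>q0\<bar>) (16 / a)))" "card (supp b \<inter> {-T..T}) \<le> gap_density d a * T"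
      using neg by (meson linorder_not_less)
    show ?thesis using spectral_gap_estimate[OF d a sep bd ann q0 refl, folded \<phi>0_def, OF C2 _ _ _ T(2)] T(1)
      unfolding A_def by (intro exI[of _ T]) auto
  qed
  have "((\<lambda>T. A * exp (1 - a * T / 32)) \<longlongrightarrow> A * 0) at_top"
  proof (intro tendsto_intros filterlim_compose[OF exp_at_bot])
    have "filterlim (\<lambda>T. (a / 32) * T) at_top at_top" using a by (intro filterlim_tendsto_pos_mult_at_top[OF tendsto_const] filterlim_ident) auto
    then have "filterlim (\<lambda>T. -1 + (a / 32) * T) at_top at_top"
      by (rule filterlim_tendsto_add_at_top[OF tendsto_const])
    then show "filterlim (\<lambda>T. 1 - a * T / 32) at_bot at_top" by (simp add: filterlim_uminus_at_bot)
  qed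
  then have "eventually (\<lambda>T. A * exp (1 - a * T / 32) < norm (b q0) * norm (ft \<phi>0 q0)) at_top"
    using pos by (intro order_tendstoD(2)) auto
  then obtain S where "\<And>T. T \<ge> S \<Longrightarrow> A * exp (1 - a * T / 32) < norm (b q0) * norm (ft \<phi>0 q0)"
    unfolding eventually_at_top_linorder by blast
  then show False using est[of S] by force
qed

section \<open>Finite local complexity of the support\<close>

lemma infsum_swap_product:
  fixes f :: "'a \<Rightarrow> complex" and g :: "'b \<Rightarrow> complex"
  assumes f: "(\<lambda>x. norm (f x)) summable_on UNIV" and g: "(\<lambda>x. norm (g x)) summable_on UNIV" and u: "\<And>x s. norm (u x s) \<le> 1"
  shows "(\<Sum>\<^sub>\<infinity>x. \<Sum>\<^sub>\<infinity>s. f x * g s * u x s) = (\<Sum>\<^sub>\<infinity>s. \<Sum>\<^sub>\<infinity>x. f x * g s * u x s)"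
proof (rule infsum_swap_banach, rule abs_summable_summable)
  have "(\<lambda>z. norm (case z of (x, s) \<Rightarrow> f x * g s)) summable_on UNIV \<times> UNIV"
    unfolding Infinite_Sum.abs_summable_on_Sigma_iff
  proof (intro conjI ballI)
    fix x :: 'a
    show "(\<lambda>y. norm (case (x, y) of (x, s) \<Rightarrow> f x * g s)) summable_on UNIV"
      using summable_on_cmult_right[OF g, of "norm (f x)"] by (simp add: norm_mult)
  next
    have "(\<Sum>\<^sub>\<infinity>y. norm (f x * g y)) = norm (f x) * (\<Sum>\<^sub>\<infinity>y. norm (g y))" for x
      using infsum_cmult_right[of "norm (f x)" "\<lambda>y. norm (g y)" UNIV] g by (simp add: norm_mult)
    then show "(\<lambda>x. norm (\<Sum>\<^sub>\<infinity>y. norm (case (x, y) of (x, s) \<Rightarrow> f x * g s))) summable_on UNIV"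
      using summable_on_cmult_left[OF f, of "\<Sum>\<^sub>\<infinity>y. norm (g y)"] infsum_nonneg[of UNIV "\<lambda>y. norm (g y)"]
      by (simp add: abs_mult)
  qed
  then show "(\<lambda>z. norm (case z of (x, s) \<Rightarrow> f x * g s * u x s)) summable_on UNIV \<times> UNIV"
  proof (rule Infinite_Sum.abs_summable_on_comparison_test)
    fix z :: "'a \<times> 'b"
    show "norm (case z of (x, s) \<Rightarrow> f x * g s * u x s) \<le> norm (case z of (x, s) \<Rightarrow> f x * g s)"
      using mult_left_mono[OF u[of "fst z" "snd z"], of "norm (f (fst z) * g (snd z))"]
      by (simp add: case_prod_unfold norm_mult)
  qed
qed

lemma sum_indicator_card: "finite I \<Longrightarrow> (\<Sum>x\<in>I. if P x then 1 else (0::real)) = real (card {x \<in> I. P x})"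
  by (simp flip: sum.inter_filter)

lemma cbump_shift: "cbump y r = (\<lambda>x. cbump 0 r (x - y))"
  by (simp add: cbump_def fun_eq_iff)

text \<open>The constant \<open>\<kappa>\<close> is any non-zero number, so that the results also
  cover conjugated weights with the constant \<open>1 / cnj lam\<close>, to which strict
  eigenmeasures lead.\<close>

locale eigen_atoms =
  fixes m :: "real \<Rightarrow> complex" and \<kappa> :: complex and d :: real
  assumes sep: "separated d (supp m)" and grow: "growth m" and \<kappa>: "\<kappa> \<noteq> 0"
    and rel: "\<And>\<phi>. testfun \<phi> \<Longrightarrow> atomic m (ft \<phi>) = \<kappa> * atomic m \<phi>"
    and nontriv: "\<exists>x. m x \<noteq> 0"
begin

lemma d_pos: "d > 0"
  using sep by (simp add: separated_def)

lemma close_eq: "m x \<noteq> 0 \<Longrightarrow> m y \<noteq> 0 \<Longrightarrow> \<bar>x - y\<bar> < d \<Longrightarrow> x = y"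
  using separatedD[OF sep] by (simp add: in_supp)

lemma ft_cbump: "r > 0 \<Longrightarrow> ft (cbump y r) s = ee (- (y * s)) * ft (cbump 0 r) s"
  by (subst cbump_shift) (intro ft_shift testfun_Cc testfun_cbump)

text \<open>The bump that isolates \<open>x\<close> is a translate of a fixed one, so its transform
  differs from a fixed function by a phase only, and the resulting bound for the weight is
  independent of \<open>x\<close>. This upgrades polynomial growth to boundedness.\<close>

lemma bounded_weights: "\<exists>B>0. \<forall>x. norm (m x) \<le> B"
proof -
  define S where "S = (\<Sum>\<^sub>\<infinity>y. norm (m y * ft (cbump 0 d) y))"
  have tf: "testfun (cbump 0 d)" using d_pos by (rule testfun_cbump)
  have sm: "(\<lambda>y. norm (m y * ft (cbump 0 d) y)) summable_on UNIV"
    by (rule atomic_abs_summable[OF sep grow rapid_ft[OF tf]])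
  have S0: "S \<ge> 0" unfolding S_def by (intro infsum_nonneg) auto
  have "norm (m x) \<le> S / norm \<kappa> + 1" for x
  proof (cases "m x = 0")
    case False
    have "\<kappa> * (m x * cbump x d x) = \<kappa> * atomic m (cbump x d)"
      using atomic_point[OF sep False, of "cbump x d"] cbump_nonzero_iff[OF d_pos] by simp
    also have "\<dots> = atomic m (ft (cbump x d))" using rel[OF testfun_cbump[OF d_pos]] by simp
    also have "\<dots> = (\<Sum>\<^sub>\<infinity>y. m y * (ee (- (x * y)) * ft (cbump 0 d) y))" unfolding atomic_def by (subst ft_cbump[OF d_pos]) rule
    finally have "norm \<kappa> * norm (m x) = norm (\<Sum>\<^sub>\<infinity>y. m y * (ee (- (x * y)) * ft (cbump 0 d) y))" by (simp add: norm_mult[symmetric])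
    also have "\<dots> \<le> (\<Sum>\<^sub>\<infinity>y. norm (m y * (ee (- (x * y)) * ft (cbump 0 d) y)))"
      using sm by (intro norm_infsum_bound) (simp add: norm_mult)
    also have "\<dots> = S" unfolding S_def by (simp add: norm_mult)
    finally have "norm (m x) \<le> S / norm \<kappa>" using \<kappa> by (simp add: field_simps)
    then show ?thesis by simp
  qed (use S0 in simp)
  moreover have "S / norm \<kappa> + 1 > 0" using S0 by (simp add: add_nonneg_pos)
  ultimately show ?thesis by blast
qed

text \<open>Modulating a bump at the atom \<open>q0\<close> by \<open>ee (x * y)\<close> keeps the
  modulus of its integral against \<open>m\<close> but moves its transform to the centre
  \<open>x\<close>. The transform side must then carry a definite mass near \<open>x\<close>, hence
  have a support point there.\<close>

lemma rel_dense: "\<exists>R>0. \<forall>x. \<exists>q. m q \<noteq> 0 \<and> \<bar>q - x\<bar> \<le> R"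
proof -
  obtain B where B: "B > 0" "\<And>x. norm (m x) \<le> B" using bounded_weights by blast
  obtain q0 where q0: "m q0 \<noteq> 0" using nontriv by blast
  define \<phi> where "\<phi> = cbump q0 d"
  have \<phi>: "testfun \<phi>" unfolding \<phi>_def using d_pos by (rule testfun_cbump)
  obtain C where C: "\<And>x. (1 + x\<^sup>2) ^ 2 * norm (ft \<phi> x) \<le> C" using rapid_ft[OF \<phi>] unfolding rapid_def by blast
  have C0: "C \<ge> 0" using C[of 0] by (simp add: order_trans[OF _ C[of 0]])
  define A where "A = norm \<kappa> * norm (m q0)"
  have A: "A > 0" using \<kappa> q0 by (simp add: A_def)
  \<comment> \<open>With this \<open>R\<close> an empty window would give
    \<open>1 + R^2 \<le> R - 1\<close>.\<close>
  define R where "R = B * C * sep_const d / A + 1"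
  have R: "R > 0" unfolding R_def using A B C0 sep_const_nonneg[of d] by (simp add: add_nonneg_pos)
  have "\<exists>q. m q \<noteq> 0 \<and> \<bar>q - x\<bar> \<le> R" for x
  proof (rule ccontr)
    assume no: "\<not> ?thesis"
    define \<psi> where "\<psi> = (\<lambda>y. ee (x * y) * \<phi> y)"
    have \<psi>: "testfun \<psi>" unfolding \<psi>_def by (intro testfun_mult \<phi> smooth_ee)
    have "atomic m \<psi> = m q0 * \<psi> q0"
    proof (rule atomic_point[OF sep q0])
      fix y assume "\<psi> y \<noteq> 0"
      then have "\<phi> y \<noteq> 0" unfolding \<psi>_def by auto
      then show "\<bar>y - q0\<bar> < d" using cbump_nonzero_iff[OF d_pos] unfolding \<phi>_def by blast
    qed
    moreover have "\<psi> q0 = ee (x * q0)" by (simp add: \<psi>_def \<phi>_def)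
    ultimately have n: "norm (atomic m (ft \<psi>)) = A" unfolding A_def using rel[OF \<psi>] by (simp add: norm_mult)
    have ftp: "ft \<psi> y = ft \<phi> (y - x)" for y unfolding \<psi>_def by (rule ft_modulate[OF testfun_Cc[OF \<phi>]])
    define h where "h y = norm (m y * ft \<psi> y)" for y
    have hb: "h y \<le> (B * C / (1 + R\<^sup>2)) / (1 + (y - x)\<^sup>2)" for y
    proof (cases "m y = 0")
      case True then show ?thesis using B C0 by (simp add: h_def)
    next
      case False
      then have "\<bar>y - x\<bar> > R" using no by auto
      then have "R\<^sup>2 \<le> (y - x)\<^sup>2" using R by (simp add: abs_le_square_iff[symmetric])
      define p where "p = 1 + (y - x)\<^sup>2"
      have p: "p > 0" "1 + R\<^sup>2 \<le> p" "1 + R\<^sup>2 > 0" using \<open>R\<^sup>2 \<le> (y - x)\<^sup>2\<close> unfolding p_def by (auto simp: add_pos_nonneg)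
      have "p ^ 2 * norm (ft \<psi> y) \<le> C" using C[of "y - x"] unfolding ftp p_def .
      then have "norm (ft \<psi> y) \<le> C / p ^ 2" using p by (simp add: pos_le_divide_eq mult.commute)
      also have "\<dots> \<le> C / ((1 + R\<^sup>2) * p)"
        using p C0 unfolding power2_eq_square[of p] by (intro divide_left_mono mult_right_mono) auto
      finally have "norm (m y) * norm (ft \<psi> y) \<le> B * (C / ((1 + R\<^sup>2) * p))" using B C0 p by (intro mult_mono) auto
      then show ?thesis unfolding h_def p_def by (simp add: norm_mult)
    qed
    have hn: "h q \<ge> 0" for q by (simp add: h_def)
    have hs: "q \<in> supp m" if "h q \<noteq> 0" for q using that by (auto simp: h_def in_supp)
    have sm: "h summable_on UNIV" "infsum h UNIV \<le> \<bar>B * C / (1 + R\<^sup>2)\<bar> * sep_const d"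
      using separated_summable[OF sep hn hs hb] by auto
    have "A \<le> infsum h UNIV" unfolding n[symmetric] atomic_def using norm_infsum_bound[of "\<lambda>y. m y * ft \<psi> y"] sm(1) unfolding h_def by simp
    also have "\<dots> \<le> B * C / (1 + R\<^sup>2) * sep_const d" using sm(2) B C0 by simp
    finally have "A * (1 + R\<^sup>2) \<le> B * C * sep_const d" by (simp add: field_simps add_pos_nonneg)
    moreover have "B * C * sep_const d = A * (R - 1)" unfolding R_def using A by simp
    ultimately have "1 + R\<^sup>2 \<le> R - 1" using A by simp
    moreover have "R - 1 < 1 + R\<^sup>2" using sum_squares_bound[of R 1] R by (simp add: power2_eq_square[symmetric])
    ultimately show False by linarith
  qed
  then show ?thesis using R by blast
qed

text \<open>Smearing the second factor by a shrinking bump gives \<open>A n\<close>, which by the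
  eigenvalue relation is an absolutely convergent sum of characters with frequencies
  \<open>s\<close> in the support. Each frequency shifts \<open>\<phi>\<close> by \<open>s\<close>,
  and a support point in \<open>(s, s + d)\<close> would be too close to \<open>s\<close>. Dominated
  convergence then removes the smearing.\<close>

lemma correlation_gap: "annihilates (\<lambda>x. m x * m (x - h)) 0 d"
  unfolding annihilates_def
proof (intro allI impI)
  fix \<phi> assume \<phi>: "testfun \<phi>" and s\<phi>: "\<forall>x. \<phi> x \<noteq> 0 \<longrightarrow> 0 < x \<and> x < d"
  obtain B where B: "B > 0" "\<And>x. norm (m x) \<le> B" using bounded_weights by blast
  define r where "r n = d / (2 * real (Suc n))" for n
  have r: "r n > 0" "r n \<le> d / 2" for n using d_pos by (auto simp: r_def field_simps)
  define A where "A n y = atomic m (cbump y (r n))" for n y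
  have A_cases: "A n y = 0 \<or> (\<exists>q. m q \<noteq> 0 \<and> \<bar>q - y\<bar> < r n \<and> A n y = m q * cbump y (r n) q)" for n y
  proof (cases "\<exists>q. m q \<noteq> 0 \<and> \<bar>q - y\<bar> < r n")
    case True
    then obtain q where q: "m q \<noteq> 0" "\<bar>q - y\<bar> < r n" by blast
    have "A n y = m q * cbump y (r n) q" unfolding A_def
    proof (rule atomic_point[OF sep q(1)])
      fix x assume "cbump y (r n) x \<noteq> 0"
      then have "\<bar>x - y\<bar> < r n" using cbump_nonzero_iff[OF r(1)] by blast
      then show "\<bar>x - q\<bar> < d" using q(2) r(2)[of n] by linarith
    qed
    then show ?thesis using q by blast
  next
    case False
    then have "m x * cbump y (r n) x = 0" for x using cbump_nonzero_iff[OF r(1), of y n x] by auto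
    then have "A n y = 0" unfolding A_def atomic_def by (simp only: infsum_0_simp)
    then show ?thesis by blast
  qed
  have A_bound: "norm (A n y) \<le> B" for n y
  proof -
    have "norm (m q * cbump y (r n) q) \<le> B * 1" for q
      unfolding norm_mult using B norm_cbump_le_1 by (intro mult_mono) auto
    then show ?thesis using A_cases[of n y] B(1) by fastforce
  qed
  have A_lim: "(\<lambda>n. A n y) \<longlonglongrightarrow> m y" for y
  proof (cases "m y = 0")
    case False
    have "A n y = m y" for n
    proof -
      have "atomic m (cbump y (r n)) = m y * cbump y (r n) y"
      proof (rule atomic_point[OF sep False])
        fix x assume "cbump y (r n) x \<noteq> 0"
        then show "\<bar>x - y\<bar> < d" using cbump_nonzero_iff[OF r(1), of y n x] r(2)[of n] d_pos by simp
      qed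
      then show ?thesis by (simp add: A_def)
    qed
    then show ?thesis by simp
  next
    case True
    have "\<exists>N. \<forall>n\<ge>N. A n y = 0"
    proof (cases "\<exists>q. m q \<noteq> 0 \<and> \<bar>q - y\<bar> < d / 2")
      case q: True
      then obtain q where q: "m q \<noteq> 0" "\<bar>q - y\<bar> < d / 2" by blast
      have ne: "\<bar>q - y\<bar> > 0" using q(1) True by auto
      obtain N :: nat where N: "real N > d / (2 * \<bar>q - y\<bar>)" using reals_Archimedean2 by blast
      have "A n y = 0" if n: "n \<ge> N" for n
      proof (rule ccontr)
        assume "A n y \<noteq> 0"
        then obtain p where p: "m p \<noteq> 0" "\<bar>p - y\<bar> < r n" using A_cases[of n y] by blast
        then have "p = q" using close_eq[OF p(1) q(1)] q(2) r(2)[of n] by linarith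
        then have "\<bar>q - y\<bar> < r n" using p by simp
        then have "\<bar>q - y\<bar> * (2 * real (Suc n)) < d" unfolding r_def by (simp add: pos_less_divide_eq)
        moreover have "d < real N * (2 * \<bar>q - y\<bar>)" using N ne by (simp add: pos_divide_less_eq)
        moreover have "real N * (2 * \<bar>q - y\<bar>) \<le> real (Suc n) * (2 * \<bar>q - y\<bar>)" using n by (intro mult_right_mono) auto
        ultimately show False by (simp add: algebra_simps)
      qed
      then show ?thesis by blast
    next
      case False
      have "A n y = 0" for n using A_cases[of n y] False r(2)[of n] by fastforce
      then show ?thesis by blast
    qed
    then show ?thesis unfolding True
      by (intro tendsto_eventually) (auto simp: eventually_sequentially)
  qed
  have zero: "(\<Sum>\<^sub>\<infinity>x. m x * A n (x - h) * ft \<phi> x) = 0" for n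
  proof -
    define g where "g = ft (cbump 0 (r n))"
    have tg: "testfun (cbump 0 (r n))" by (rule testfun_cbump[OF r(1)])
    have A_eq: "A n y = (1 / \<kappa>) * (\<Sum>\<^sub>\<infinity>s. m s * g s * ee (- (y * s)))" for y
    proof -
      have "\<kappa> * A n y = atomic m (ft (cbump y (r n)))" unfolding A_def using rel[OF testfun_cbump[OF r(1)]] by simp
      also have "\<dots> = (\<Sum>\<^sub>\<infinity>s. m s * g s * ee (- (y * s)))"
        unfolding atomic_def g_def by (subst ft_cbump[OF r(1)]) (simp add: mult_ac)
      finally show ?thesis using \<kappa> by (simp add: field_simps)
    qed
    have "(\<Sum>\<^sub>\<infinity>x. m x * A n (x - h) * ft \<phi> x) = (\<Sum>\<^sub>\<infinity>x. (1 / \<kappa>) * (\<Sum>\<^sub>\<infinity>s. (m x * ft \<phi> x) * (m s * g s) * ee (- ((x - h) * s))))"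
    proof (rule infsum_cong)
      fix x
      have "(\<Sum>\<^sub>\<infinity>s. (m x * ft \<phi> x) * (m s * g s) * ee (- ((x - h) * s))) = (m x * ft \<phi> x) * (\<Sum>\<^sub>\<infinity>s. m s * g s * ee (- ((x - h) * s)))"
        unfolding mult.assoc[of "m x * ft \<phi> x"] by (rule infsum_cmult_right')
      then show "m x * A n (x - h) * ft \<phi> x = (1 / \<kappa>) * (\<Sum>\<^sub>\<infinity>s. (m x * ft \<phi> x) * (m s * g s) * ee (- ((x - h) * s)))"
        unfolding A_eq by (simp add: mult_ac)
    qed
    also have "\<dots> = (1 / \<kappa>) * (\<Sum>\<^sub>\<infinity>x. \<Sum>\<^sub>\<infinity>s. (m x * ft \<phi> x) * (m s * g s) * ee (- ((x - h) * s)))"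
      by (rule infsum_cmult_right')
    also have "(\<Sum>\<^sub>\<infinity>x. \<Sum>\<^sub>\<infinity>s. (m x * ft \<phi> x) * (m s * g s) * ee (- ((x - h) * s)))
        = (\<Sum>\<^sub>\<infinity>s. \<Sum>\<^sub>\<infinity>x. (m x * ft \<phi> x) * (m s * g s) * ee (- ((x - h) * s)))"
      unfolding g_def by (intro infsum_swap_product atomic_abs_summable[OF sep grow] rapid_ft \<phi> tg) simp
    also have "\<dots> = (\<Sum>\<^sub>\<infinity>s::real. 0)"
    proof (rule infsum_cong)
      fix s
      show "(\<Sum>\<^sub>\<infinity>x. (m x * ft \<phi> x) * (m s * g s) * ee (- ((x - h) * s))) = 0"
      proof (cases "m s = 0")
        case False
        have t: "testfun (\<lambda>x. \<phi> (x - s))" by (rule testfun_shift[OF \<phi>])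
        have "m x * \<phi> (x - s) = 0" for x
        proof (rule ccontr)
          assume "m x * \<phi> (x - s) \<noteq> 0"
          then have x: "m x \<noteq> 0" "0 < x - s" "x - s < d" using s\<phi> by auto
          then show False using close_eq[OF x(1) False] by simp
        qed
        then have z: "atomic m (\<lambda>x. \<phi> (x - s)) = 0" unfolding atomic_def by (simp only: infsum_0_simp)
        have e: "ee (- ((x - h) * s)) = ee (h * s) * ee (- (s * x))" for x
          unfolding ee_add[symmetric] by (simp add: algebra_simps)
        have "(\<Sum>\<^sub>\<infinity>x. (m x * ft \<phi> x) * (m s * g s) * ee (- ((x - h) * s)))
            = (\<Sum>\<^sub>\<infinity>x. (m s * g s * ee (h * s)) * (m x * ft (\<lambda>x. \<phi> (x - s)) x))"
          unfolding ft_shift[OF testfun_Cc[OF \<phi>]] e by (simp add: mult_ac)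
        also have "\<dots> = (m s * g s * ee (h * s)) * atomic m (ft (\<lambda>x. \<phi> (x - s)))"
          unfolding atomic_def by (rule infsum_cmult_right')
        finally show ?thesis using rel[OF t] z by simp
      qed simp
    qed
    finally show ?thesis by simp
  qed
  have "(\<lambda>n. \<Sum>\<^sub>\<infinity>x. m x * A n (x - h) * ft \<phi> x) \<longlonglongrightarrow> (\<Sum>\<^sub>\<infinity>x. m x * m (x - h) * ft \<phi> x)"
  proof (rule infsum_dominated)
    show "(\<lambda>n. m x * A n (x - h) * ft \<phi> x) \<longlonglongrightarrow> m x * m (x - h) * ft \<phi> x" for x
      by (intro tendsto_intros A_lim)
    show "norm (m x * A n (x - h) * ft \<phi> x) \<le> B * norm (m x * ft \<phi> x)" for n x
      using mult_left_mono[OF A_bound[of n "x - h"], of "norm (m x * ft \<phi> x)"] by (simp add: norm_mult mult_ac)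
    show "(\<lambda>x. B * norm (m x * ft \<phi> x)) summable_on UNIV"
      by (intro summable_on_cmult_right atomic_abs_summable[OF sep grow] rapid_ft \<phi>)
  qed
  then show "atomic (\<lambda>x. m x * m (x - h)) (ft \<phi>) = 0"
    unfolding atomic_def zero by (simp add: LIMSEQ_const_iff)
qed

definition diffs :: "real set" where
  "diffs = {x - y | x y. m x \<noteq> 0 \<and> m y \<noteq> 0}"

lemma diffsI: "m x \<noteq> 0 \<Longrightarrow> m y \<noteq> 0 \<Longrightarrow> x - y \<in> diffs"
  unfolding diffs_def by blast

text \<open>Double counting of pairs \<open>(h, x)\<close> with \<open>x\<close> and
  \<open>x - h\<close> in the support: each difference \<open>h\<close> accounts for at least
  \<open>c * T\<close> points \<open>x\<close> in \<open>[-T, T]\<close>, while a fixed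
  \<open>x\<close> meets at most \<open>L / d + 1\<close> differences of the window, as the points
  \<open>x - h\<close> are separated. The thresholds for \<open>T\<close> depend on
  \<open>h\<close>, which is harmless for a finite \<open>H\<close>.\<close>

lemma diffs_count:
  assumes "L \<ge> 0"
  shows "\<exists>N. \<forall>y. finite (diffs \<inter> {y..y + L}) \<and> card (diffs \<inter> {y..y + L}) \<le> N"
proof -
  obtain B where B: "B > 0" "\<And>x. norm (m x) \<le> B" using bounded_weights by blast
  define c where "c = gap_density d d"
  have c: "c > 0" unfolding c_def using gap_density_pos[OF d_pos d_pos] .
  define N where "N = nat \<lceil>(2 / d + 1) * (L / d + 1) / c\<rceil>"
  have key: "card H \<le> N" if H: "H \<subseteq> diffs \<inter> {y..y + L}" "finite H" for H y
  proof -
    define b where "b h x = m x * m (x - h)" for h x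
    have "\<exists>T0. \<forall>T\<ge>T0. c * T < card (supp (b h) \<inter> {-T..T})" if h: "h \<in> H" for h
    proof -
      obtain p q where pq: "h = p - q" "m p \<noteq> 0" "m q \<noteq> 0" using h H(1) unfolding diffs_def by blast
      have "annihilates (b h) 0 (0 + d)" using correlation_gap[of h] unfolding b_def by simp
      moreover have "separated d (supp (b h))" by (rule separated_subset[OF sep]) (auto simp: b_def supp_def)
      moreover have "norm (b h x) \<le> B * B" for x unfolding b_def norm_mult using B by (intro mult_mono) auto
      moreover have "b h p \<noteq> 0" using pq by (simp add: b_def)
      ultimately show ?thesis unfolding c_def using spectral_gap_density[OF d_pos d_pos] by blast
    qed
    then obtain T0 where T0: "\<And>h T. h \<in> H \<Longrightarrow> T \<ge> T0 h \<Longrightarrow> c * T < card (supp (b h) \<inter> {-T..T})" by metis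
    define T where "T = Max (insert 1 (T0 ` H))"
    have T1: "T \<ge> 1" and TT: "h \<in> H \<Longrightarrow> T \<ge> T0 h" for h unfolding T_def using H(2) by auto
    define I where "I = supp m \<inter> {-T..T}"
    have I: "finite I" unfolding I_def by (rule separated_finite(1)[OF sep])
    have cI: "real (card I) \<le> 2 * T / d + 1" unfolding I_def using separated_finite(2)[OF sep, of "-T" T] T1 by simp
    have "real (card H) * (c * T) \<le> (\<Sum>h\<in>H. real (card (supp (b h) \<inter> {-T..T})))"
      using sum_mono[of H "\<lambda>_. c * T" "\<lambda>h. real (card (supp (b h) \<inter> {-T..T}))"] T0 TT by (simp add: less_imp_le)
    also have "\<dots> = (\<Sum>h\<in>H. \<Sum>x\<in>I. if m (x - h) \<noteq> 0 then 1 else 0)"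
    proof (intro sum.cong refl)
      fix h
      have "supp (b h) \<inter> {-T..T} = {x \<in> I. m (x - h) \<noteq> 0}" unfolding I_def by (auto simp: supp_def b_def)
      then show "real (card (supp (b h) \<inter> {-T..T})) = (\<Sum>x\<in>I. if m (x - h) \<noteq> 0 then 1 else 0)"
        using sum_indicator_card[OF I] by simp
    qed
    also have "\<dots> = (\<Sum>x\<in>I. \<Sum>h\<in>H. if m (x - h) \<noteq> 0 then 1 else 0)" by (rule sum.swap)
    also have "\<dots> \<le> (\<Sum>x\<in>I. L / d + 1)"
    proof (rule sum_mono)
      fix x
      have "(\<Sum>h\<in>H. if m (x - h) \<noteq> 0 then 1 else 0) = real (card {h \<in> H. m (x - h) \<noteq> 0})"
        using sum_indicator_card[OF H(2)] by simp
      also have "card {h \<in> H. m (x - h) \<noteq> 0} = card ((\<lambda>h. x - h) ` {h \<in> H. m (x - h) \<noteq> 0})"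
        by (rule card_image[symmetric]) (auto simp: inj_on_def)
      also have "\<dots> \<le> card (supp m \<inter> {x - y - L..x - y})"
        by (rule card_mono[OF separated_finite(1)[OF sep]]) (use H(1) in \<open>auto simp: supp_def\<close>)
      finally have "(\<Sum>h\<in>H. if m (x - h) \<noteq> 0 then 1 else 0) \<le> real (card (supp m \<inter> {x - y - L..x - y}))" by simp
      also have "\<dots> \<le> L / d + 1" using separated_finite(2)[OF sep, of "x - y - L" "x - y"] assms by simp
      finally show "(\<Sum>h\<in>H. if m (x - h) \<noteq> 0 then 1 else 0) \<le> L / d + 1" .
    qed
    also have "\<dots> = real (card I) * (L / d + 1)" by simp
    also have "\<dots> \<le> (2 * T / d + 1) * (L / d + 1)" using cI assms d_pos by (intro mult_right_mono) auto
    also have "\<dots> \<le> ((2 / d + 1) * T) * (L / d + 1)" using T1 assms d_pos by (intro mult_right_mono) (auto simp: algebra_simps)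
    finally have "(real (card H) * c) * T \<le> ((2 / d + 1) * (L / d + 1)) * T" by (simp only: mult_ac)
    then have "real (card H) * c \<le> (2 / d + 1) * (L / d + 1)" using T1 by simp
    then have "real (card H) \<le> (2 / d + 1) * (L / d + 1) / c" using c by (simp add: pos_le_divide_eq)
    then show ?thesis unfolding N_def by linarith
  qed
  have "finite (diffs \<inter> {y..y + L}) \<and> card (diffs \<inter> {y..y + L}) \<le> N" for y
    by (rule finite_if_finite_subsets_card_bdd) (use key in blast)
  then show ?thesis by blast
qed

end

section \<open>Almost linearity of additive functions on the support\<close>

lemma crossing:
  fixes x :: "nat \<Rightarrow> real"
  assumes "x 0 \<le> t" "t < x n" shows "\<exists>i<n. x i \<le> t \<and> t < x (Suc i)"
proof (rule ccontr)
  assume "\<not> ?thesis"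
  then have "\<And>i. i < n \<Longrightarrow> x i \<le> t \<Longrightarrow> x (Suc i) \<le> t" by force
  then have "i \<le> n \<Longrightarrow> x i \<le> t" for i by (induction i) (use assms(1) in auto)
  then show False using assms(2) by force
qed

text \<open>A sequence with steps at most \<open>s\<close> cannot jump over a window of length
  \<open>s\<close>. Climbing further than \<open>s * card V\<close>, it would take a value in each
  of the \<open>card V + 1\<close> disjoint windows
  \<open>(x 0 + (k - 1) * s, x 0 + k * s]\<close>.\<close>

lemma small_steps_few_values_aux:
  fixes x :: "nat \<Rightarrow> real"
  assumes step: "\<And>i. i < n \<Longrightarrow> \<bar>x (Suc i) - x i\<bar> \<le> s" and V: "finite V" "\<And>i. i \<le> n \<Longrightarrow> x i \<in> V" and s: "s > 0"
  shows "x n - x 0 \<le> s * real (card V)"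
proof (rule ccontr)
  assume "\<not> ?thesis"
  then have big: "x 0 + s * real (card V) < x n" by simp
  have "\<exists>v\<in>V. x 0 + (real k - 1) * s < v \<and> v \<le> x 0 + real k * s" if k: "k \<le> card V" for k
  proof -
    have "real k * s \<le> real (card V) * s" using k s by (intro mult_right_mono) auto
    then have "x 0 + real k * s < x n" using big by (simp add: mult.commute)
    moreover have "x 0 \<le> x 0 + real k * s" using s by simp
    ultimately obtain i where i: "i < n" "x i \<le> x 0 + real k * s" "x 0 + real k * s < x (Suc i)"
      using crossing[of x "x 0 + real k * s" n] by blast
    then have "x 0 + (real k - 1) * s < x i" using step[OF i(1)] by (simp add: algebra_simps abs_le_iff)
    then show ?thesis using i V(2)[of i] by auto
  qed
  then obtain v where v: "\<And>k. k \<le> card V \<Longrightarrow> v k \<in> V \<and> x 0 + (real k - 1) * s < v k \<and> v k \<le> x 0 + real k * s" by metis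
  have lt: "v j < v k" if "j < k" "k \<le> card V" for j k
  proof -
    have "real j * s \<le> (real k - 1) * s" using that(1) s by (intro mult_right_mono) auto
    then show ?thesis using v[of j] v[of k] that by force
  qed
  have "inj_on v {..card V}"
  proof (rule inj_onI)
    fix j k assume "j \<in> {..card V}" "k \<in> {..card V}" "v j = v k"
    then show "j = k" using lt[of j k] lt[of k j] by (cases j k rule: linorder_cases) auto
  qed
  then have "card {..card V} \<le> card V" using v by (intro card_inj_on_le[OF _ _ V(1)]) auto
  then show False by simp
qed

lemma small_steps_few_values:
  fixes x :: "nat \<Rightarrow> real"
  assumes "\<And>i. i < n \<Longrightarrow> \<bar>x (Suc i) - x i\<bar> \<le> s" "finite V" "\<And>i. i \<le> n \<Longrightarrow> x i \<in> V" "s > 0"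
  shows "\<bar>x n - x 0\<bar> \<le> s * real (card V)"
proof -
  have "x n - x 0 \<le> s * real (card V)" using small_steps_few_values_aux[of n x s V] assms by blast
  moreover have "(- x n) - (- x 0) \<le> s * real (card (uminus ` V))"
    using assms by (intro small_steps_few_values_aux[of n "\<lambda>i. - x i" s "uminus ` V"]) (auto simp: abs_minus_commute)
  moreover have "card (uminus ` V) = card V" by (rule card_image) simp
  ultimately show ?thesis by simp
qed

text \<open>The slope is found as a cut: every \<open>(F n - K) / n\<close> lies below every
  \<open>(F k + K) / k\<close>, by evaluating \<open>F (n * k)\<close> in two ways. No continuity of
  \<open>F\<close> is available, so boundedness on \<open>[0, 1]\<close> is what transfers the
  estimate from natural numbers to reals.\<close>

lemma quasi_additive_linear:
  fixes F :: "real \<Rightarrow> real"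
  assumes qa: "\<And>x y. \<bar>F (x + y) - F x - F y\<bar> \<le> K" and loc: "\<And>t. 0 \<le> t \<Longrightarrow> t \<le> 1 \<Longrightarrow> \<bar>F t\<bar> \<le> K1"
  shows "\<exists>c C. \<forall>x. \<bar>F x - c * x\<bar> \<le> C"
proof -
  have mult: "\<bar>F (real (Suc n) * x) - real (Suc n) * F x\<bar> \<le> real (Suc n) * K" for n x
  proof (induction n)
    case 0 then show ?case using order_trans[OF abs_ge_zero qa[of 0 0]] by simp
  next
    case (Suc n)
    have e: "real (Suc (Suc n)) * x = real (Suc n) * x + x" by (simp add: algebra_simps)
    have "F (real (Suc (Suc n)) * x) - real (Suc (Suc n)) * F x
      = (F (real (Suc n) * x + x) - F (real (Suc n) * x) - F x) + (F (real (Suc n) * x) - real (Suc n) * F x)"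
      unfolding e by (simp add: algebra_simps)
    then have "\<bar>F (real (Suc (Suc n)) * x) - real (Suc (Suc n)) * F x\<bar> \<le> K + real (Suc n) * K"
      using qa[of "real (Suc n) * x" x] Suc by linarith
    then show ?case by (simp add: algebra_simps)
  qed
  have cross: "(F (real n) - K) / real n \<le> (F (real k) + K) / real k" if nk: "n \<ge> 1" "k \<ge> 1" for n k :: nat
  proof -
    have "\<bar>F (real k * real n) - real k * F (real n)\<bar> \<le> real k * K"
      using mult[of "k - 1" "real n"] nk by simp
    moreover have "\<bar>F (real n * real k) - real n * F (real k)\<bar> \<le> real n * K"
      using mult[of "n - 1" "real k"] nk by simp
    ultimately have "real k * F (real n) - real n * F (real k) \<le> real k * K + real n * K"
      by (simp add: mult.commute[of "real n" "real k"])
    then show ?thesis using nk by (simp add: field_simps)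
  qed
  define c where "c = (SUP n\<in>{1..}. (F (real n) - K) / real (n::nat))"
  have bdd: "bdd_above ((\<lambda>n. (F (real n) - K) / real n) ` {1::nat..})"
    by (rule bdd_aboveI2[where M="(F (real 1) + K) / real 1"]) (use cross[of _ 1] in auto)
  have nat: "\<bar>F (real n) - c * real n\<bar> \<le> K" if n: "n \<ge> 1" for n :: nat
  proof -
    have "(F (real n) - K) / real n \<le> c" unfolding c_def by (rule cSUP_upper[OF _ bdd]) (use n in auto)
    moreover have "c \<le> (F (real n) + K) / real n" unfolding c_def by (rule cSUP_least) (use cross n in auto)
    ultimately show ?thesis using n by (simp add: field_simps abs_le_iff)
  qed
  have F0: "\<bar>F 0\<bar> \<le> K" using qa[of 0 0] by simp
  have pos: "\<bar>F x - c * x\<bar> \<le> 2 * K + K1 + \<bar>c\<bar>" if x: "x \<ge> 0" for x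
  proof -
    define n where "n = nat \<lfloor>x\<rfloor>"
    define t where "t = x - real n"
    have t: "0 \<le> t" "t \<le> 1" "x = real n + t" using x unfolding t_def n_def by linarith+
    have 1: "\<bar>F x - F (real n) - F t\<bar> \<le> K" using qa[of "real n" t] t(3) by simp
    have 2: "\<bar>F (real n) - c * real n\<bar> \<le> K" using nat[of n] F0 by (cases "n = 0") auto
    have 3: "\<bar>F t\<bar> \<le> K1" using loc t by simp
    have 4: "\<bar>c * t\<bar> \<le> \<bar>c\<bar>" using t mult_left_mono[of t 1 "\<bar>c\<bar>"] by (simp add: abs_mult)
    have "F x - c * x = (F x - F (real n) - F t) + (F (real n) - c * real n) + F t - c * t"
      unfolding t(3) by (simp add: algebra_simps)
    then show ?thesis using 1 2 3 4 by linarith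
  qed
  have "\<bar>F x - c * x\<bar> \<le> 2 * K + (2 * K + K1 + \<bar>c\<bar>)" for x
  proof (cases "x \<ge> 0")
    case True
    then show ?thesis using pos[OF True] F0 by linarith
  next
    case False
    have "\<bar>F 0 - F x - F (- x)\<bar> \<le> K" using qa[of x "- x"] by simp
    then show ?thesis using pos[of "- x"] False F0 by (simp add: abs_le_iff)
  qed
  then show ?thesis by blast
qed

section \<open>Rational coordinates of differences\<close>

interpretation ratv: vector_space "\<lambda>(q::rat) (x::real). of_rat q * x"
  by unfold_locales (auto simp: algebra_simps of_rat_add of_rat_mult)

lemma common_denominator:
  assumes "finite (Q :: rat set)" shows "\<exists>D::nat. D > 0 \<and> (\<forall>q\<in>Q. \<exists>k::int. of_nat D * q = of_int k)"
  using assms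
proof (induction Q rule: finite_induct)
  case empty then show ?case by auto
next
  case (insert q Q)
  then obtain D :: nat where D: "D > 0" "\<And>p. p \<in> Q \<Longrightarrow> \<exists>k::int. of_nat D * p = of_int k" by blast
  obtain a b where ab: "quotient_of q = (a, b)" by fastforce
  have b: "b > 0" using quotient_of_denom_pos[OF ab] .
  have q: "q = of_int a / of_int b" using quotient_of_div[OF ab] .
  show ?case
  proof (intro exI[of _ "D * nat b"] conjI ballI)
    show "D * nat b > 0" using D b by simp
    fix p assume "p \<in> insert q Q"
    then show "\<exists>k::int. of_nat (D * nat b) * p = of_int k"
    proof
      assume "p = q"
      then have "of_nat (D * nat b) * p = (of_int (int D * a) :: rat)" using b by (simp add: q)
      then show ?thesis by blast
    next
      assume "p \<in> Q"
      then obtain k :: int where "of_nat D * p = of_int k" using D by blast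
      then have "of_nat (D * nat b) * p = (of_int (b * k) :: rat)" using b by (simp add: mult_ac)
      then show ?thesis by blast
    qed
  qed
qed

context eigen_atoms
begin

lemma diffs_finite: "finite (diffs \<inter> {-S..S})"
proof (cases "S \<ge> 0")
  case True
  obtain N where "\<And>y. finite (diffs \<inter> {y..y + 2 * S})" using diffs_count[of "2 * S"] True by auto
  from this[of "-S"] show ?thesis by simp
qed simp

lemma nearest: "\<exists>R p. R > 0 \<and> (\<forall>x. m (p x) \<noteq> 0 \<and> \<bar>p x - x\<bar> \<le> R)"
  using rel_dense by metis

text \<open>An induction principle: every difference is a sum of differences of length at most
  \<open>2 * R + 1\<close>. The segment from \<open>b\<close> to \<open>a\<close> is walked in steps
  of length at most \<open>1\<close>, and each waypoint is replaced by a support point within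
  \<open>R\<close>.\<close>

lemma diffs_generated:
  assumes p: "\<And>x. m (p x) \<noteq> 0 \<and> \<bar>p x - x\<bar> \<le> R"
    and base: "\<And>e. e \<in> diffs \<Longrightarrow> \<bar>e\<bar> \<le> 2 * R + 1 \<Longrightarrow> P e" and add: "\<And>x y. P x \<Longrightarrow> P y \<Longrightarrow> P (x + y)"
    and x: "x \<in> diffs"
  shows "P x"
proof -
  obtain a b where ab: "x = a - b" "m a \<noteq> 0" "m b \<noteq> 0" using x unfolding diffs_def by blast
  have R: "R \<ge> 0" using p[of 0] by linarith
  define n where "n = nat \<lceil>\<bar>a - b\<bar>\<rceil> + 1"
  have n0: "n > 0" by (simp add: n_def)
  define s where "s = (a - b) / real n"
  have s: "\<bar>s\<bar> \<le> 1"
  proof -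
    have "\<bar>a - b\<bar> \<le> real n" unfolding n_def by linarith
    moreover have "real n > 0" using n0 by simp
    ultimately show ?thesis unfolding s_def by (simp add: abs_divide)
  qed
  have ns: "real n * s = a - b" unfolding s_def using n0 by simp
  have "P (p (b + real i * s) - b)" for i
  proof (induction i)
    case 0
    have "\<bar>p b - b\<bar> \<le> 2 * R + 1" using p[of b] R by linarith
    then show ?case using base[of "p b - b"] diffsI[of "p b" b] ab p by simp
  next
    case (Suc i)
    define y where "y = b + real i * s"
    have y': "b + real (Suc i) * s = y + s" by (simp add: y_def algebra_simps)
    have "\<bar>p (y + s) - p y\<bar> \<le> 2 * R + 1" using p[of "y + s"] p[of y] s by linarith
    then have "P (p (y + s) - p y)" using base diffsI p by blast
    then have "P ((p y - b) + (p (y + s) - p y))" using add Suc unfolding y_def by blast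
    then show ?case unfolding y' by simp
  qed
  from this[of n] have "P (p a - b)" using ns by simp
  moreover have "\<bar>a - p a\<bar> \<le> 2 * R + 1" using p[of a] R by linarith
  then have "P (a - p a)" using base[of "a - p a"] diffsI[of a "p a"] ab p by simp
  ultimately have "P ((p a - b) + (a - p a))" using add by blast
  then show ?thesis using ab by simp
qed

text \<open>\<open>f\<close> is an arbitrary additive function, so only its finitely many values on
  short differences are under control. For every base point \<open>y\<close>, \<open>H y\<close> is
  a difference within \<open>2 * R\<close> of \<open>h1\<close>. Moving \<open>y\<close> from
  \<open>b1\<close> to \<open>b2\<close> changes \<open>f (H y)\<close> in bounded steps among
  boundedly many values, hence by a bounded amount. At the two ends \<open>H y\<close> is linked to
  \<open>h1\<close> and to \<open>h2\<close> by short differences.\<close>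

lemma additive_quasi_lipschitz:
  fixes f :: "real \<Rightarrow> real"
  assumes add: "\<And>x y. f (x + y) = f x + f y" and \<rho>: "\<rho> \<ge> 0"
  shows "\<exists>K. \<forall>h1\<in>diffs. \<forall>h2\<in>diffs. \<bar>h1 - h2\<bar> \<le> \<rho> \<longrightarrow> \<bar>f h1 - f h2\<bar> \<le> K"
proof -
  have diff: "f (x - y) = f x - f y" for x y using add[of "x - y" y] by simp
  obtain R p where R: "R > 0" and p: "\<And>x. m (p x) \<noteq> 0 \<and> \<bar>p x - x\<bar> \<le> R" using nearest by blast
  define S where "S = 2 * R + \<rho> + 2"
  have fin: "finite (diffs \<inter> {-S..S})" by (rule diffs_finite)
  define K0 where "K0 = (\<Sum>e\<in>diffs \<inter> {-S..S}. \<bar>f e\<bar>) + 1"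
  have K0: "\<bar>f (x - y)\<bar> \<le> K0" if "m x \<noteq> 0" "m y \<noteq> 0" "\<bar>x - y\<bar> \<le> S" for x y
  proof -
    have "x - y \<in> diffs \<inter> {-S..S}" using diffsI[OF that(1,2)] that(3) by (auto simp: abs_le_iff)
    then have "\<bar>f (x - y)\<bar> \<le> (\<Sum>e\<in>diffs \<inter> {-S..S}. \<bar>f e\<bar>)" using fin by (intro member_le_sum) auto
    then show ?thesis unfolding K0_def by simp
  qed
  have K0p: "K0 > 0" unfolding K0_def by (simp add: add_nonneg_pos sum_nonneg)
  obtain N where N: "\<And>y. finite (diffs \<inter> {y..y + 4 * R}) \<and> card (diffs \<inter> {y..y + 4 * R}) \<le> N"
    using diffs_count[of "4 * R"] R by auto
  have "\<bar>f h1 - f h2\<bar> \<le> 4 * K0 + 2 * K0 * real N" if h: "h1 \<in> diffs" "h2 \<in> diffs" "\<bar>h1 - h2\<bar> \<le> \<rho>" for h1 h2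
  proof -
    obtain a1 b1 where h1: "h1 = a1 - b1" "m a1 \<noteq> 0" "m b1 \<noteq> 0" using h(1) unfolding diffs_def by blast
    obtain a2 b2 where h2: "h2 = a2 - b2" "m a2 \<noteq> 0" "m b2 \<noteq> 0" using h(2) unfolding diffs_def by blast
    define H where "H y = p (y + h1) - p y" for y
    define n where "n = nat \<lceil>\<bar>b2 - b1\<bar>\<rceil> + 1"
    have n0: "n > 0" by (simp add: n_def)
    define s where "s = (b2 - b1) / real n"
    have s: "\<bar>s\<bar> \<le> 1"
    proof -
      have "\<bar>b2 - b1\<bar> \<le> real n" unfolding n_def by linarith
      moreover have "real n > 0" using n0 by simp
    ultimately show ?thesis unfolding s_def by (simp add: abs_divide)
    qed
    have ns: "real n * s = b2 - b1" unfolding s_def using n0 by simp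
    define x where "x i = f (H (b1 + real i * s))" for i
    define V where "V = f ` (diffs \<inter> {h1 - 2 * R..h1 - 2 * R + 4 * R})"
    have "\<bar>x n - x 0\<bar> \<le> (2 * K0) * real (card V)"
    proof (rule small_steps_few_values)
      fix i
      define y where "y = b1 + real i * s"
      have y': "b1 + real (Suc i) * s = y + s" by (simp add: y_def algebra_simps)
      have "x (Suc i) - x i = f (p (y + s + h1) - p (y + h1)) - f (p (y + s) - p y)"
        unfolding x_def H_def y' y_def[symmetric] by (simp add: diff)
      moreover have "\<bar>f (p (y + s + h1) - p (y + h1))\<bar> \<le> K0"
        using p[of "y + s + h1"] p[of "y + h1"] s \<rho> by (intro K0) (auto simp: S_def)
      moreover have "\<bar>f (p (y + s) - p y)\<bar> \<le> K0"
        using p[of "y + s"] p[of y] s \<rho> by (intro K0) (auto simp: S_def)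
      ultimately show "\<bar>x (Suc i) - x i\<bar> \<le> 2 * K0" by linarith
    next
      show "finite V" unfolding V_def using N by blast
      fix i
      define y where "y = b1 + real i * s"
      have "H y \<in> diffs" unfolding H_def using p diffsI by blast
      moreover have "H y \<in> {h1 - 2 * R..h1 - 2 * R + 4 * R}" unfolding H_def using p[of "y + h1"] p[of y] by auto
      ultimately show "x i \<in> V" unfolding x_def V_def y_def by blast
    qed (use K0p in simp)
    also have "(2 * K0) * real (card V) \<le> (2 * K0) * real N"
    proof -
      have "card V \<le> N" unfolding V_def using N[of "h1 - 2 * R"] card_image_le order_trans by blast
      then show ?thesis using K0p by (intro mult_left_mono) auto
    qed
    finally have 1: "\<bar>x n - x 0\<bar> \<le> 2 * K0 * real N" .
    have "x 0 - f h1 = f (p a1 - a1) - f (p b1 - b1)"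
      unfolding x_def H_def h1(1) by (simp add: diff)
    moreover have "\<bar>f (p a1 - a1)\<bar> \<le> K0" using p[of a1] h1 \<rho> R by (intro K0) (auto simp: S_def)
    moreover have "\<bar>f (p b1 - b1)\<bar> \<le> K0" using p[of b1] h1 \<rho> R by (intro K0) (auto simp: S_def)
    ultimately have 2: "\<bar>x 0 - f h1\<bar> \<le> 2 * K0" by linarith
    have "x n - f h2 = f (p (b2 + h1) - a2) - f (p b2 - b2)"
      unfolding x_def H_def h2(1) ns by (simp add: diff)
    moreover have "\<bar>f (p (b2 + h1) - a2)\<bar> \<le> K0"
    proof (rule K0)
      have "b2 + h1 - a2 = h1 - h2" using h2(1) by simp
      then show "\<bar>p (b2 + h1) - a2\<bar> \<le> S" using p[of "b2 + h1"] h(3) R unfolding S_def by linarith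
    qed (use p h2 in auto)
    moreover have "\<bar>f (p b2 - b2)\<bar> \<le> K0" using p[of b2] h2 \<rho> R by (intro K0) (auto simp: S_def)
    ultimately have 3: "\<bar>x n - f h2\<bar> \<le> 2 * K0" by linarith
    show ?thesis using 1 2 3 by linarith
  qed
  then show ?thesis by blast
qed

text \<open>Sampling \<open>f\<close> at a support point near \<open>x\<close> gives a function
  \<open>F\<close> on the whole line. It is quasi-additive because \<open>p (x + y) - p x\<close>
  and \<open>p y - q\<close> are two differences within bounded distance of each other.\<close>

lemma additive_almost_linear:
  fixes f :: "real \<Rightarrow> real"
  assumes add: "\<And>x y. f (x + y) = f x + f y"
  shows "\<exists>c C. \<forall>x. m x \<noteq> 0 \<longrightarrow> \<bar>f x - c * x\<bar> \<le> C"
proof -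
  have diff: "f (x - y) = f x - f y" for x y using add[of "x - y" y] by simp
  obtain R p where R: "R > 0" and p: "\<And>x. m (p x) \<noteq> 0 \<and> \<bar>p x - x\<bar> \<le> R" using nearest by blast
  obtain q where q: "m q \<noteq> 0" using nontriv by blast
  define \<rho> where "\<rho> = 3 * R + \<bar>q\<bar> + 1"
  have \<rho>: "\<rho> \<ge> 0" using R by (simp add: \<rho>_def)
  obtain K where K: "\<And>h1 h2. h1 \<in> diffs \<Longrightarrow> h2 \<in> diffs \<Longrightarrow> \<bar>h1 - h2\<bar> \<le> \<rho> \<Longrightarrow> \<bar>f h1 - f h2\<bar> \<le> K"
    using additive_quasi_lipschitz[OF add \<rho>] by blast
  define F where "F x = f (p x - q)" for x
  have qa: "\<bar>F (x + y) - F x - F y\<bar> \<le> K" for x y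
  proof -
    have "F (x + y) - F x - F y = f (p (x + y) - p x) - f (p y - q)" unfolding F_def by (simp add: diff)
    moreover have "\<bar>(p (x + y) - p x) - (p y - q)\<bar> \<le> \<rho>" using p[of "x + y"] p[of x] p[of y] unfolding \<rho>_def by linarith
    ultimately show ?thesis using K[of "p (x + y) - p x" "p y - q"] diffsI p q by auto
  qed
  have z: "0 \<in> diffs" using diffsI[OF q q] by simp
  have f0: "f 0 = 0" using add[of 0 0] by simp
  have loc: "\<bar>F t\<bar> \<le> K" if "0 \<le> t" "t \<le> 1" for t
  proof -
    have "\<bar>p t - q - 0\<bar> \<le> \<rho>" using p[of t] that R unfolding \<rho>_def by linarith
    then show ?thesis using K[of "p t - q" 0] diffsI p q z f0 unfolding F_def by auto
  qed
  obtain c C where C: "\<And>x. \<bar>F x - c * x\<bar> \<le> C" using quasi_additive_linear[of F, OF qa loc] by blast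
  have "\<bar>f x - c * x\<bar> \<le> C + \<bar>f q\<bar> + K" if x: "m x \<noteq> 0" for x
  proof -
    have "\<bar>p x - x - 0\<bar> \<le> \<rho>" using p[of x] R unfolding \<rho>_def by linarith
    then have "\<bar>f (p x - x)\<bar> \<le> K" using K[of "p x - x" 0] diffsI p x z f0 by auto
    moreover have "f x = F x + f q - f (p x - x)" unfolding F_def by (simp add: diff)
    ultimately show ?thesis using C[of x] by linarith
  qed
  then show ?thesis by blast
qed

text \<open>Coordinates with respect to a basis of the reals over the rationals are additive on the
  whole line. The finitely many short differences involve finitely many basis vectors and have a
  common denominator \<open>D\<close>, and both properties pass to all differences. Dividing the
  basis vectors by \<open>D\<close> makes the coordinates integral.\<close>

lemma diffs_coordinates:
  obtains k :: nat and \<theta> :: "nat \<Rightarrow> real" and n :: "nat \<Rightarrow> real \<Rightarrow> real"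
  where "module.independent (\<lambda>r. times (real_of_int r)) (\<theta> ` {..<k})" "inj_on \<theta> {..<k}"
    "\<And>i x y. n i (x + y) = n i x + n i y" "\<And>i x. x \<in> diffs \<Longrightarrow> \<exists>j::int. n i x = of_int j"
    "\<And>x. x \<in> diffs \<Longrightarrow> x = (\<Sum>i<k. n i x * \<theta> i)"
proof -
  obtain R p where R: "R > 0" and p: "\<And>x. m (p x) \<noteq> 0 \<and> \<bar>p x - x\<bar> \<le> R" using nearest by blast
  define E where "E = diffs \<inter> {-(2 * R + 1)..2 * R + 1}"
  have E: "finite E" unfolding E_def by (rule diffs_finite)
  define B where "B = ratv.extend_basis {}"
  have ind: "ratv.independent B" unfolding B_def by (rule ratv.independent_extend_basis[OF ratv.independent_empty])
  have span: "x \<in> ratv.span B" for x unfolding B_def using ratv.span_extend_basis[OF ratv.independent_empty] by simp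
  define rep where "rep = ratv.representation B"
  have rep_add: "rep (x + y) b = rep x b + rep y b" for x y b
    unfolding rep_def using ratv.representation_add[OF ind span span] by simp
  define B0 where "B0 = (\<Union>e\<in>E. {b. rep e b \<noteq> 0})"
  have finB0: "finite B0" unfolding B0_def rep_def using E ratv.finite_representation by blast
  have B0B: "B0 \<subseteq> B" unfolding B0_def rep_def using ratv.representation_ne_zero by blast
  define Q where "Q = (\<lambda>(e, b). rep e b) ` (E \<times> B0)"
  have finQ: "finite Q" unfolding Q_def using E finB0 by simp
  obtain D :: nat where D': "D > 0 \<and> (\<forall>q\<in>Q. \<exists>j::int. of_nat D * q = of_int j)"
    using common_denominator[OF finQ] by (elim exE)
  then have D: "D > 0" "\<And>q. q \<in> Q \<Longrightarrow> \<exists>j::int. of_nat D * q = of_int j" by simp_all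
  have all: "(\<forall>b. b \<notin> B0 \<longrightarrow> rep x b = 0) \<and> (\<forall>b. \<exists>j::int. of_nat D * rep x b = of_int j)" (is "?P x") if x: "x \<in> diffs" for x
  proof (rule diffs_generated[OF p _ _ x, where P="?P"])
    fix e assume e: "e \<in> diffs" "\<bar>e\<bar> \<le> 2 * R + 1"
    then have eE: "e \<in> E" unfolding E_def by (auto simp: abs_le_iff)
    have 1: "rep e b = 0" if "b \<notin> B0" for b using that eE unfolding B0_def by blast
    have "\<exists>j::int. of_nat D * rep e b = of_int j" for b
    proof (cases "b \<in> B0")
      case True then show ?thesis using D(2)[of "rep e b"] eE unfolding Q_def by force
    next
      case False then show ?thesis using 1[OF False] by (intro exI[of _ 0]) simp
    qed
    then show "?P e" using 1 by blast
  next
    fix x y assume xy: "?P x" "?P y"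
    have "\<exists>j::int. of_nat D * rep (x + y) b = of_int j" for b
    proof -
      obtain i j :: int where "of_nat D * rep x b = of_int i" "of_nat D * rep y b = of_int j" using xy by blast
      then have "of_nat D * rep (x + y) b = of_int (i + j)" by (simp add: rep_add distrib_left)
      then show ?thesis by blast
    qed
    then show "?P (x + y)" using xy by (simp add: rep_add)
  qed
  define k where "k = card B0"
  obtain g where g: "bij_betw g {..<k} B0" using ex_bij_betw_nat_finite[OF finB0] unfolding k_def by (auto simp: atLeast0LessThan)
  define \<theta> where "\<theta> i = g i / real D" for i
  define n where "n i x = real D * of_rat (rep x (g i))" for i x
  have injg: "inj_on g {..<k}" and img: "g ` {..<k} = B0" using g unfolding bij_betw_def by auto
  have inj: "inj_on \<theta> {..<k}" using injg D(1) unfolding inj_on_def \<theta>_def by auto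
  interpret im: Modules.module "\<lambda>r. times (real_of_int r)" by unfold_locales (auto simp: algebra_simps)
  have "im.independent (\<theta> ` {..<k})"
    unfolding im.independent_explicit_module
  proof (intro allI impI)
    fix t u v assume t: "finite t" "t \<subseteq> \<theta> ` {..<k}" and s0: "(\<Sum>v\<in>t. real_of_int (u v) * v) = 0" and v: "v \<in> t"
    define t' where "t' = (\<lambda>v. real D * v) ` t"
    have t'B: "t' \<subseteq> B"
    proof
      fix w assume "w \<in> t'"
      then obtain i where "i < k" "w = real D * \<theta> i" unfolding t'_def using t(2) by blast
      then have "w = g i" unfolding \<theta>_def using D(1) by simp
      then show "w \<in> B" using img B0B \<open>i < k\<close> by blast
    qed
    have injD: "inj_on (\<lambda>v. real D * v) t" using D(1) by (auto simp: inj_on_def)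
    have "(\<Sum>w\<in>t'. of_rat (of_int (u (w / real D))) * w) = (\<Sum>v\<in>t. real_of_int (u v) * (real D * v))"
      unfolding t'_def using D(1) by (subst sum.reindex[OF injD]) (simp add: o_def)
    also have "\<dots> = real D * (\<Sum>v\<in>t. real_of_int (u v) * v)" by (simp add: sum_distrib_left mult_ac)
    finally have "(\<Sum>w\<in>t'. of_rat (of_int (u (w / real D))) * w) = 0" using s0 by simp
    then have "(of_int (u ((real D * v) / real D)) :: rat) = 0"
      using ratv.independentD[OF ind _ t'B, of "\<lambda>w. of_int (u (w / real D))" "real D * v"] t(1) v unfolding t'_def by blast
    then show "u v = 0" using D(1) by simp
  qed
  moreover have "n i (x + y) = n i x + n i y" for i x y by (simp add: n_def rep_add of_rat_add distrib_left)
  moreover have "\<exists>j::int. n i x = of_int j" if x: "x \<in> diffs" for i x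
  proof -
    obtain j :: int where "of_nat D * rep x (g i) = of_int j" using all[OF x] by blast
    then have "of_rat (of_nat D * rep x (g i)) = (real_of_int j)" by (simp only: of_rat_of_int_eq)
    then show ?thesis unfolding n_def by (intro exI[of _ j]) (simp add: of_rat_mult)
  qed
  moreover have "x = (\<Sum>i<k. n i x * \<theta> i)" if x: "x \<in> diffs" for x
  proof -
    have "x = (\<Sum>b | rep x b \<noteq> 0. of_rat (rep x b) * b)"
      unfolding rep_def using ratv.sum_nonzero_representation_eq[OF ind span] by simp
    also have "\<dots> = (\<Sum>b\<in>B0. of_rat (rep x b) * b)"
      using all[OF x] finB0 by (intro sum.mono_neutral_left) auto
    also have "\<dots> = (\<Sum>i<k. of_rat (rep x (g i)) * g i)" unfolding img[symmetric] by (simp add: sum.reindex[OF injg])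
    also have "\<dots> = (\<Sum>i<k. n i x * \<theta> i)" unfolding n_def \<theta>_def using D(1) by (intro sum.cong) auto
    finally show ?thesis .
  qed
  ultimately show ?thesis by (intro that[of \<theta> k n] inj)
qed

end

section \<open>The support lies in finitely many translates of a lattice\<close>

lemma infsum_finite_sum:
  fixes f :: "'i \<Rightarrow> 'a \<Rightarrow> complex"
  assumes "\<And>i. i \<in> I \<Longrightarrow> f i summable_on A"
  shows "infsum (\<lambda>x. \<Sum>i\<in>I. f i x) A = (\<Sum>i\<in>I. infsum (f i) A)" "(\<lambda>x. \<Sum>i\<in>I. f i x) summable_on A"
proof -
  have "((\<lambda>x. \<Sum>i\<in>I. f i x) has_sum (\<Sum>i\<in>I. infsum (f i) A)) A"
    using assms by (induction I rule: infinite_finite_induct) (auto intro!: has_sum_add)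
  then show "infsum (\<lambda>x. \<Sum>i\<in>I. f i x) A = (\<Sum>i\<in>I. infsum (f i) A)" "(\<lambda>x. \<Sum>i\<in>I. f i x) summable_on A"
    by (auto simp: has_sum_iff)
qed

lemma norm_ee_minus_1_le: "norm (ee t - 1) \<le> 2 * pi * \<bar>t\<bar>"
  unfolding norm_ee_minus_1 using abs_sin_x_le_abs_x[of "pi * t"] by (simp add: abs_mult)

text \<open>A non-zero power series has no zero in some punctured disc about \<open>0\<close>; if
  both series were non-zero, a small positive real \<open>u\<close> would give a non-zero
  product.\<close>

lemma powser_no_zero_divisors:
  fixes a b :: "nat \<Rightarrow> complex"
  assumes F: "\<And>z. (\<lambda>n. a n * z ^ n) sums F z" and G: "\<And>z. (\<lambda>n. b n * z ^ n) sums G z"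
    and zero: "\<And>u::real. F (of_real u) * G (of_real u) = 0"
  shows "(\<forall>z. F z = 0) \<or> (\<forall>z. G z = 0)"
proof -
  have iso: "\<exists>s>0. \<forall>z. z \<noteq> 0 \<longrightarrow> norm z \<le> s \<longrightarrow> H z \<noteq> 0"
    if H: "\<And>z. (\<lambda>n. c n * z ^ n) sums H z" and c: "c k \<noteq> 0" for c k and H :: "complex \<Rightarrow> complex"
  proof -
    \<comment> \<open>Multiplying the series by \<open>z\<close> makes it vanish at
      \<open>0\<close>, as \<open>powser_0_nonzero\<close> requires, and does not change the other
      zeros.\<close>
    define c' where "c' n = (case n of 0 \<Rightarrow> 0 | Suc n \<Rightarrow> c n)" for n
    have "(\<lambda>n. c' n * (z - 0) ^ n) sums (z * H z)" for z
    proof -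
      have "(\<lambda>n. z * (c n * z ^ n)) sums (z * H z)" by (intro sums_mult H)
      then have "(\<lambda>n. c' (Suc n) * z ^ Suc n) sums (z * H z)" by (simp add: c'_def mult_ac)
      then have "(\<lambda>n. c' n * z ^ n) sums (z * H z + c' 0 * z ^ 0)" by (rule sums_Suc)
      then show ?thesis by (simp add: c'_def)
    qed
    then obtain s where s: "s > 0" "\<And>z. z \<in> cball 0 s - {0} \<Longrightarrow> z * H z \<noteq> 0"
      using powser_0_nonzero[of 1 0 c' "\<lambda>z. z * H z" "Suc k"] c by (auto simp: c'_def)
    have "H z \<noteq> 0" if "z \<noteq> 0" "norm z \<le> s" for z using s(2)[of z] that by auto
    then show ?thesis using s(1) by blast
  qed
  show ?thesis
  proof (cases "(\<forall>n. a n = 0) \<or> (\<forall>n. b n = 0)")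
    case True
    then show ?thesis
    proof
      assume "\<forall>n. a n = 0"
      then have "(\<lambda>n. 0) sums F z" for z using F[of z] by simp
      then have "F z = 0" for z using sums_unique[of "\<lambda>n. 0" "F z"] by simp
      then show ?thesis by blast
    next
      assume "\<forall>n. b n = 0"
      then have "(\<lambda>n. 0) sums G z" for z using G[of z] by simp
      then have "G z = 0" for z using sums_unique[of "\<lambda>n. 0" "G z"] by simp
      then show ?thesis by blast
    qed
  next
    case False
    then obtain i j where "a i \<noteq> 0" "b j \<noteq> 0" by blast
    then obtain s t where s: "s > 0" "\<And>z. z \<noteq> 0 \<Longrightarrow> norm z \<le> s \<Longrightarrow> F z \<noteq> 0"
      and t: "t > 0" "\<And>z. z \<noteq> 0 \<Longrightarrow> norm z \<le> t \<Longrightarrow> G z \<noteq> 0"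
      using iso[OF F] iso[OF G] by metis
    define u where "u = min s t"
    have "F (of_real u) \<noteq> 0" "G (of_real u) \<noteq> 0" using s t by (auto simp: u_def)
    then show ?thesis using zero[of u] by simp
  qed
qed

text \<open>Bounded frequencies make the exponential sum entire in \<open>z\<close>: the
  exponentials are expanded and the sums exchanged, with the product of \<open>norm (A x)\<close>
  and the exponential series in \<open>2 * pi * C' * norm z\<close> as a majorant.\<close>

lemma exponential_sum_powser:
  fixes A :: "real \<Rightarrow> complex" and w :: "real \<Rightarrow> real"
  assumes A: "(\<lambda>x. norm (A x)) summable_on UNIV" and w: "\<And>x. \<bar>w x\<bar> \<le> C"
  shows "(\<lambda>n. (\<Sum>\<^sub>\<infinity>x. A x * (2 * pi * \<i> * w x) ^ n / fact n) * z ^ n) sums (\<Sum>\<^sub>\<infinity>x. A x * exp (2 * pi * \<i> * w x * z))"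
proof -
  define C' where "C' = \<bar>C\<bar> + 1"
  have C': "C' > 0" "\<bar>w x\<bar> \<le> C'" for x using w[of x] by (auto simp: C'_def)
  define g where "g n = (of_real (2 * pi * C' * norm z) ^ n / fact n :: complex)" for n :: nat
  \<comment> \<open>A term is split into \<open>A x\<close>, a size \<open>g n\<close> independent
    of \<open>x\<close>, and a factor \<open>u x n\<close> of modulus at most \<open>1\<close>, the
    shape that the exchange of sums expects. At \<open>z = 0\<close> there is no unit vector of
    \<open>z\<close>, so the value is given by hand.\<close>
  define u where "u x n = (if z = 0 then (if n = 0 then 1 else 0) else (\<i> * of_real (w x / C') * (z / of_real (norm z))) ^ n)" for x and n :: nat
  have u1: "norm (u x n) \<le> 1" for x n
  proof (cases "z = 0")
    case False
    have "norm (\<i> * of_real (w x / C') * (z / of_real (norm z))) \<le> 1"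
      using C' False by (simp add: norm_mult norm_divide)
    then show ?thesis unfolding u_def using False by (simp add: norm_power power_le_one)
  qed (simp add: u_def)
  have gs: "(\<lambda>n. norm (g n)) summable_on UNIV"
  proof -
    have "summable (\<lambda>n. (2 * pi * C' * norm z) ^ n / fact n)"
      using summable_exp[of "2 * pi * C' * norm z"] by (simp add: field_simps)
    moreover have "norm (g n) = (2 * pi * C' * norm z) ^ n / fact n" for n
      unfolding g_def using C'(1) by (simp add: norm_divide norm_power norm_mult)
    ultimately show ?thesis using C'(1) by (subst summable_on_UNIV_nonneg_real_iff) auto
  qed
  have term_eq: "A x * g n * u x n = A x * (2 * pi * \<i> * w x) ^ n / fact n * z ^ n" for x n
  proof (cases "z = 0")
    case True then show ?thesis by (cases n) (auto simp: g_def u_def)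
  next
    case False
    have "of_real (2 * pi * C' * norm z) * (\<i> * of_real (w x / C') * (z / of_real (norm z))) = (2 * pi * \<i> * w x) * z"
      using False C'(1) by (simp add: field_simps)
    then have "g n * u x n = ((2 * pi * \<i> * w x) * z) ^ n / fact n"
      unfolding g_def u_def using False by (simp add: power_mult_distrib[symmetric])
    then have "A x * g n * u x n = A x * (((2 * pi * \<i> * w x) * z) ^ n / fact n)" by (simp only: mult.assoc)
    also have "\<dots> = A x * (2 * pi * \<i> * w x) ^ n / fact n * z ^ n"
    proof -
      have "a * ((y * z) ^ n / e) = a * y ^ n / e * z ^ n" for a y e :: complex by (simp add: power_mult_distrib)
      then show ?thesis by blast
    qed
    finally show ?thesis .
  qed
  have swap: "(\<Sum>\<^sub>\<infinity>x. \<Sum>\<^sub>\<infinity>n. A x * g n * u x n) = (\<Sum>\<^sub>\<infinity>n. \<Sum>\<^sub>\<infinity>x. A x * g n * u x n)"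
    by (rule infsum_swap_product[OF A gs u1])
  have inner: "(\<Sum>\<^sub>\<infinity>n. A x * g n * u x n) = A x * exp (2 * pi * \<i> * w x * z)" for x
  proof -
    define y where "y = 2 * pi * \<i> * w x * z"
    have "(\<lambda>n. y ^ n /\<^sub>R fact n) sums exp y" by (rule exp_converges)
    moreover have "summable (\<lambda>n. norm (y ^ n /\<^sub>R fact n))" by (rule summable_norm_exp)
    ultimately have "((\<lambda>n. y ^ n /\<^sub>R fact n) has_sum exp y) UNIV"
      by (intro norm_summable_imp_has_sum)
    then have "((\<lambda>n. A x * (y ^ n /\<^sub>R fact n)) has_sum (A x * exp y)) UNIV" by (rule has_sum_cmult_right)
    moreover have "A x * (y ^ n /\<^sub>R fact n) = A x * g n * u x n" for n
      unfolding term_eq y_def by (simp add: power_mult_distrib scaleR_conv_of_real field_simps)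
    ultimately have "((\<lambda>n. A x * g n * u x n) has_sum (A x * exp y)) UNIV" by simp
    then show ?thesis unfolding y_def by (rule infsumI)
  qed
  define c where "c n = (\<Sum>\<^sub>\<infinity>x. A x * (2 * pi * \<i> * w x) ^ n / fact n)" for n
  have outer: "(\<Sum>\<^sub>\<infinity>x. A x * g n * u x n) = c n * z ^ n" for n
    unfolding term_eq c_def by (rule infsum_cmult_left')
  define S where "S = (\<Sum>\<^sub>\<infinity>x. norm (A x))"
  have nb: "norm (c n * z ^ n) \<le> S * norm (g n)" for n
  proof -
    have b: "norm (A x * g n * u x n) \<le> norm (A x) * norm (g n)" for x
      using mult_left_mono[OF u1[of x n], of "norm (A x * g n)"] by (simp add: norm_mult)
    have s: "(\<lambda>x. norm (A x) * norm (g n)) summable_on UNIV" by (rule summable_on_cmult_left[OF A])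
    have s': "(\<lambda>x. norm (A x * g n * u x n)) summable_on UNIV"
      by (rule Infinite_Sum.abs_summable_on_comparison_test'[OF s b])
    have "norm (c n * z ^ n) \<le> (\<Sum>\<^sub>\<infinity>x. norm (A x * g n * u x n))" unfolding outer[symmetric] by (rule norm_infsum_bound[OF s'])
    also have "\<dots> \<le> (\<Sum>\<^sub>\<infinity>x. norm (A x) * norm (g n))" by (rule infsum_mono[OF s' s b])
    also have "\<dots> = S * norm (g n)" unfolding S_def by (rule infsum_cmult_left')
    finally show ?thesis .
  qed
  have "(\<lambda>n. norm (c n * z ^ n)) summable_on UNIV"
    by (rule Infinite_Sum.abs_summable_on_comparison_test'[OF summable_on_cmult_right[OF gs] nb])
  then have "((\<lambda>n. c n * z ^ n) has_sum (\<Sum>\<^sub>\<infinity>n. c n * z ^ n)) UNIV" by (rule has_sum_infsum[OF abs_summable_summable])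
  then have "(\<lambda>n. c n * z ^ n) sums (\<Sum>\<^sub>\<infinity>n. c n * z ^ n)" by (rule has_sum_imp_sums)
  moreover have "(\<Sum>\<^sub>\<infinity>n. c n * z ^ n) = (\<Sum>\<^sub>\<infinity>x. A x * exp (2 * pi * \<i> * w x * z))"
    using swap unfolding inner outer by simp
  ultimately show ?thesis unfolding c_def by simp
qed

text \<open>Averaging over the parameters \<open>u = j * \<tau>\<close> is a mean value of
  characters and filters out the frequency \<open>v\<close>. The step \<open>\<tau>\<close> is small
  enough for \<open>\<tau> * \<bar>w x - v\<bar> \<le> 1 / 2\<close>, so no other frequency is
  confused with \<open>v\<close>.\<close>

lemma exponential_sum_level:
  fixes A :: "real \<Rightarrow> complex" and w :: "real \<Rightarrow> real"
  assumes A: "(\<lambda>x. norm (A x)) summable_on UNIV" and w: "\<And>x. \<bar>w x\<bar> \<le> C"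
    and v: "\<bar>v\<bar> \<le> C" and zero: "\<And>u. (\<Sum>\<^sub>\<infinity>x. A x * ee (u * w x)) = 0"
  shows "(\<Sum>\<^sub>\<infinity>x. if w x = v then A x else 0) = 0"
proof -
  define \<tau> where "\<tau> = 1 / (4 * (C + 1))"
  have C0: "C \<ge> 0" using v by simp
  have \<tau>: "\<tau> > 0" using C0 by (simp add: \<tau>_def)
  define t where "t x = \<tau> * (w x - v)" for x
  have t: "\<bar>t x\<bar> \<le> 1 / 2" for x
  proof -
    have "\<bar>w x - v\<bar> \<le> 2 * C" using w[of x] v by linarith
    then have "\<bar>t x\<bar> \<le> \<tau> * (2 * C)" unfolding t_def abs_mult using \<tau> by (intro mult_mono) auto
    also have "\<dots> \<le> 1 / 2" unfolding \<tau>_def using C0 by (simp add: field_simps)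
    finally show ?thesis .
  qed
  define k where "k N x = (1 / of_nat (Suc N)) * (\<Sum>j<Suc N. ee (real j * t x))" for N x
  have kb: "norm (k N x) \<le> 1" for N x
  proof -
    have "norm (\<Sum>j<Suc N. ee (real j * t x)) \<le> (\<Sum>j<Suc N. 1)" by (intro sum_norm_le) simp
    then show ?thesis unfolding k_def norm_mult norm_divide norm_one norm_of_nat by (simp add: divide_le_eq)
  qed
  have klim: "(\<lambda>N. k N x) \<longlonglongrightarrow> (if w x = v then 1 else 0)" for x
  proof (cases "w x = v")
    case True then show ?thesis by (simp add: k_def t_def del: of_nat_Suc)
  next
    case False
    then have "t x \<noteq> 0" using \<tau> by (simp add: t_def)
    then have pos: "norm (ee (t x) - 1) > 0" using norm_ee_minus_1_ge[OF t[of x]] by linarith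
    then have ne: "ee (t x) \<noteq> 1" by auto
    have b: "norm (k N x) \<le> (2 / norm (ee (t x) - 1)) * (1 / real (Suc N))" for N
    proof -
      have "(\<Sum>j<Suc N. ee (real j * t x)) = (\<Sum>j<Suc N. ee (t x) ^ j)" by (simp only: ee_power)
      also have "\<dots> = (ee (t x) ^ Suc N - 1) / (ee (t x) - 1)" by (rule geometric_sum[OF ne])
      finally have "norm (\<Sum>j<Suc N. ee (real j * t x)) = norm (ee (t x) ^ Suc N - 1) / norm (ee (t x) - 1)"
        by (simp only: norm_divide)
      also have "\<dots> \<le> 2 / norm (ee (t x) - 1)"
        using norm_triangle_ineq4[of "ee (t x) ^ Suc N" 1] by (intro divide_right_mono) (auto simp: norm_power norm_mult)
      finally have "norm (k N x) \<le> (1 / real (Suc N)) * (2 / norm (ee (t x) - 1))"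
        unfolding k_def norm_mult norm_divide norm_one norm_of_nat by (intro mult_left_mono) auto
      then show ?thesis by (simp only: mult.commute)
    qed
    have "(\<lambda>N. (2 / norm (ee (t x) - 1)) * (1 / real (Suc N))) \<longlonglongrightarrow> (2 / norm (ee (t x) - 1)) * 0"
      using LIMSEQ_Suc[OF lim_1_over_n] by (intro tendsto_mult tendsto_const)
    then have l0: "(\<lambda>N. (2 / norm (ee (t x) - 1)) * (1 / real (Suc N))) \<longlonglongrightarrow> 0" by (simp only: mult_zero_right)
    have "(\<lambda>N. k N x) \<longlonglongrightarrow> 0"
      by (rule Lim_null_comparison[OF always_eventually[OF allI[OF b]] l0])
    then show ?thesis using False by simp
  qed
  have sA: "(\<lambda>x. A x * ee (real j * t x)) summable_on UNIV" for j
    by (rule abs_summable_summable) (simp add: norm_mult A)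
  have z: "(\<Sum>\<^sub>\<infinity>x. A x * k N x) = 0" for N
  proof -
    have "(\<Sum>\<^sub>\<infinity>x. A x * k N x) = (\<Sum>\<^sub>\<infinity>x. (1 / of_nat (Suc N)) * (\<Sum>j<Suc N. A x * ee (real j * t x)))"
      unfolding k_def by (intro infsum_cong) (simp only: sum_distrib_left mult_ac)
    also have "\<dots> = (1 / of_nat (Suc N)) * (\<Sum>\<^sub>\<infinity>x. \<Sum>j<Suc N. A x * ee (real j * t x))" by (rule infsum_cmult_right')
    also have "(\<Sum>\<^sub>\<infinity>x. \<Sum>j<Suc N. A x * ee (real j * t x)) = (\<Sum>j<Suc N. \<Sum>\<^sub>\<infinity>x. A x * ee (real j * t x))"
      by (rule infsum_finite_sum(1)) (rule sA)
    also have "\<dots> = (\<Sum>j<Suc N. 0)"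
    proof (rule sum.cong)
      fix j
      have "ee (real j * t x) = ee (- (real j * \<tau> * v)) * ee (real j * \<tau> * w x)" for x
        unfolding ee_add[symmetric] t_def by (simp add: algebra_simps)
      then have "(\<Sum>\<^sub>\<infinity>x. A x * ee (real j * t x)) = (\<Sum>\<^sub>\<infinity>x. ee (- (real j * \<tau> * v)) * (A x * ee (real j * \<tau> * w x)))"
        by (simp only: mult_ac)
      also have "\<dots> = ee (- (real j * \<tau> * v)) * (\<Sum>\<^sub>\<infinity>x. A x * ee (real j * \<tau> * w x))" by (rule infsum_cmult_right')
      finally show "(\<Sum>\<^sub>\<infinity>x. A x * ee (real j * t x)) = 0" using zero[of "real j * \<tau>"] by simp
    qed simp
    finally show ?thesis by simp
  qed
  have "(\<lambda>N. \<Sum>\<^sub>\<infinity>x. A x * k N x) \<longlonglongrightarrow> (\<Sum>\<^sub>\<infinity>x. A x * (if w x = v then 1 else 0))"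
  proof (rule infsum_dominated[OF _ _ A])
    show "(\<lambda>n. A x * k n x) \<longlonglongrightarrow> A x * (if w x = v then 1 else 0)" for x by (intro tendsto_mult tendsto_const klim)
    show "norm (A x * k n x) \<le> norm (A x)" for n x using mult_left_mono[OF kb[of n x], of "norm (A x)"] by (simp add: norm_mult)
  qed
  then have "(\<Sum>\<^sub>\<infinity>x. A x * (if w x = v then 1 else 0)) = 0" unfolding z by (simp add: LIMSEQ_const_iff)
  moreover have "A x * (if w x = v then 1 else 0) = (if w x = v then A x else 0)" for x by simp
  ultimately show ?thesis by (simp only:)
qed

context eigen_atoms
begin

text \<open>Kronecker's theorem provides \<open>t\<close> with \<open>t * \<theta> i0\<close> close
  to \<open>u\<close> and every other \<open>t * \<theta> i\<close> close to \<open>0\<close>,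
  modulo \<open>1\<close>. Since differences have integer coordinates, \<open>t * x\<close> is then
  close to \<open>u * n i0 x\<close> modulo \<open>1\<close>, with an error controlled by the
  coordinate sums over the finite set \<open>E\<close>.\<close>

lemma character_approx:
  fixes \<theta> :: "nat \<Rightarrow> real" and n :: "nat \<Rightarrow> real \<Rightarrow> real"
  assumes ind: "module.independent (\<lambda>r. times (real_of_int r)) (\<theta> ` {..<k})" "inj_on \<theta> {..<k}"
    and int: "\<And>i x. x \<in> diffs \<Longrightarrow> \<exists>j::int. n i x = of_int j"
    and rep: "\<And>x. x \<in> diffs \<Longrightarrow> x = (\<Sum>i<k. n i x * \<theta> i)"
    and i0: "i0 < k" and E: "finite E" "E \<subseteq> diffs" and \<epsilon>: "\<epsilon> > 0"
  shows "\<exists>t. \<forall>x\<in>E. norm (ee (t * x) - ee (u * n i0 x)) < \<epsilon>"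
proof -
  define M where "M = (\<Sum>x\<in>E. \<Sum>i<k. \<bar>n i x\<bar>) + 1"
  have M: "M > 0" unfolding M_def by (simp add: add_nonneg_pos sum_nonneg)
  have Mx: "(\<Sum>i<k. \<bar>n i x\<bar>) \<le> M" if "x \<in> E" for x
    unfolding M_def using member_le_sum[OF that, of "\<lambda>x. \<Sum>i<k. \<bar>n i x\<bar>"] E(1) by (simp add: sum_nonneg)
  define \<alpha> where "\<alpha> i = (if i = i0 then u else 0)" for i
  \<comment> \<open>The factor \<open>8\<close> absorbs the Lipschitz constant of \<open>ee\<close>,
    as \<open>2 * pi / 8 < 1\<close>.\<close>
  have e8: "\<epsilon> / (8 * M) > 0" using \<epsilon> M by simp
  obtain t h where th: "\<And>i. i < k \<Longrightarrow> \<bar>t * \<theta> i - of_int (h i) - \<alpha> i\<bar> < \<epsilon> / (8 * M)"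
    using Kronecker_thm_1[OF ind e8, of \<alpha>] by metis
  have "norm (ee (t * x) - ee (u * n i0 x)) < \<epsilon>" if x: "x \<in> E" for x
  proof -
    have xd: "x \<in> diffs" using x E by blast
    obtain j where j: "\<And>i. n i x = of_int (j i)" using int[OF xd] by metis
    define \<delta> where "\<delta> = (\<Sum>i<k. n i x * (t * \<theta> i - of_int (h i) - \<alpha> i))"
    have sa: "(\<Sum>i<k. n i x * \<alpha> i) = u * n i0 x"
    proof -
      have "(\<Sum>i<k. n i x * \<alpha> i) = (\<Sum>i<k. if i = i0 then n i x * u else 0)" unfolding \<alpha>_def by (intro sum.cong) auto
      then show ?thesis using i0 by (simp add: mult.commute)
    qed
    have "t * x = t * (\<Sum>i<k. n i x * \<theta> i)" using rep[OF xd] by simp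
    also have "\<dots> = \<delta> + (\<Sum>i<k. n i x * of_int (h i)) + (\<Sum>i<k. n i x * \<alpha> i)"
      unfolding \<delta>_def sum_distrib_left sum.distrib[symmetric] by (intro sum.cong) (auto simp: algebra_simps)
    also have "(\<Sum>i<k. n i x * of_int (h i)) = of_int (\<Sum>i<k. j i * h i)" by (simp add: j)
    finally have "t * x = (\<delta> + u * n i0 x) + of_int (\<Sum>i<k. j i * h i)" using sa by simp
    then have "ee (t * x) = ee (\<delta> + u * n i0 x)" by (simp only: ee_add_int(1))
    then have "ee (t * x) = ee \<delta> * ee (u * n i0 x)" by (simp only: ee_add)
    then have "ee (t * x) - ee (u * n i0 x) = (ee \<delta> - 1) * ee (u * n i0 x)" by (simp add: left_diff_distrib)
    then have "norm (ee (t * x) - ee (u * n i0 x)) = norm (ee \<delta> - 1)" by (simp add: norm_mult)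
    also have "\<dots> \<le> 2 * pi * \<bar>\<delta>\<bar>" by (rule norm_ee_minus_1_le)
    also have "\<dots> \<le> 2 * pi * (M * (\<epsilon> / (8 * M)))"
    proof -
      have "\<bar>\<delta>\<bar> \<le> (\<Sum>i<k. \<bar>n i x * (t * \<theta> i - of_int (h i) - \<alpha> i)\<bar>)" unfolding \<delta>_def by (rule sum_abs)
      also have "\<dots> \<le> (\<Sum>i<k. \<bar>n i x\<bar> * (\<epsilon> / (8 * M)))"
        unfolding abs_mult using th by (intro sum_mono mult_left_mono) (auto intro: less_imp_le)
      also have "\<dots> = (\<Sum>i<k. \<bar>n i x\<bar>) * (\<epsilon> / (8 * M))" by (rule sum_distrib_right[symmetric])
      also have "\<dots> \<le> M * (\<epsilon> / (8 * M))" using Mx[OF x] e8 by (intro mult_right_mono) auto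
      finally show ?thesis by (intro mult_left_mono) auto
    qed
    also have "\<dots> = pi / 4 * \<epsilon>" using M by simp
    also have "\<dots> < 1 * \<epsilon>" using \<epsilon> pi_less_4 by (intro mult_strict_right_mono) auto
    finally show ?thesis by simp
  qed
  then show ?thesis by blast
qed

text \<open>A twist by an honest character \<open>ee (t * x)\<close> merely translates the spectrum,
  so a window of length \<open>d\<close> contains at most one atom and one of the two factors
  vanishes. Which one may change along the approximation, so the limit is stated for the product.
  The base point \<open>q\<close> enters because the approximation is available on differences
  only.\<close>

lemma twisted_product_zero:
  fixes g :: "real \<Rightarrow> real"
  assumes approx: "\<And>E \<epsilon>. finite E \<Longrightarrow> E \<subseteq> diffs \<Longrightarrow> \<epsilon> > 0 \<Longrightarrow> \<exists>t. \<forall>x\<in>E. norm (ee (t * x) - ee (g x)) < \<epsilon>"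
    and q: "m q \<noteq> 0" and \<phi>: "testfun \<phi>1" "testfun \<phi>2"
    and s\<phi>: "\<And>x. \<phi>1 x \<noteq> 0 \<Longrightarrow> 0 < x \<and> x < d" "\<And>x. \<phi>2 x \<noteq> 0 \<Longrightarrow> 0 < x \<and> x < d" and disj: "\<And>x. \<phi>1 x = 0 \<or> \<phi>2 x = 0"
  shows "(\<Sum>\<^sub>\<infinity>x. m x * ft \<phi>1 x * ee (g (x - q) + \<sigma> * x)) * (\<Sum>\<^sub>\<infinity>x. m x * ft \<phi>2 x * ee (g (x - q) + \<sigma> * x)) = 0"
proof -
  define E where "E N = (\<lambda>x. x - q) ` (supp m \<inter> {- real N..real N})" for N
  have "\<exists>t. \<forall>x\<in>E N. norm (ee (t * x) - ee (g x)) < 1 / real (Suc N)" for N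
  proof (rule approx)
    show "finite (E N)" unfolding E_def by (intro finite_imageI separated_finite(1)[OF sep])
    show "E N \<subseteq> diffs" unfolding E_def using q diffsI by (auto simp: in_supp)
  qed simp
  then obtain t where t: "\<And>N x. x \<in> E N \<Longrightarrow> norm (ee (t N * x) - ee (g x)) < 1 / real (Suc N)" by metis
  have tlim: "(\<lambda>N. ee (t N * (x - q))) \<longlonglongrightarrow> ee (g (x - q))" if x: "m x \<noteq> 0" for x
  proof -
    obtain N0 :: nat where N0: "real N0 > \<bar>x\<bar>" using reals_Archimedean2 by blast
    have "norm (ee (t N * (x - q)) - ee (g (x - q))) \<le> 1 / real (Suc N)" if "N \<ge> N0" for N
    proof -
      have "real N0 \<le> real N" using that by simp
      then have "x - q \<in> E N" unfolding E_def using x N0 by (intro image_eqI[where x=x]) (auto simp: in_supp)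
      then show ?thesis using t by (simp add: less_imp_le)
    qed
    then have "eventually (\<lambda>N. norm (ee (t N * (x - q)) - ee (g (x - q))) \<le> 1 / real (Suc N)) sequentially"
      unfolding eventually_sequentially by blast
    then have "(\<lambda>N. ee (t N * (x - q)) - ee (g (x - q))) \<longlonglongrightarrow> 0"
      by (rule Lim_null_comparison[OF _ LIMSEQ_Suc[OF lim_1_over_n]])
    then show ?thesis by (simp only: LIM_zero_iff)
  qed
  define H where "H \<phi> N = (\<Sum>\<^sub>\<infinity>x. m x * ft \<phi> x * (ee (t N * (x - q)) * ee (\<sigma> * x)))" for \<phi> N
  have Hlim: "H \<phi> \<longlonglongrightarrow> (\<Sum>\<^sub>\<infinity>x. m x * ft \<phi> x * ee (g (x - q) + \<sigma> * x))" if \<phi>: "testfun \<phi>" for \<phi>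
    unfolding H_def
  proof (rule infsum_dominated)
    show "(\<lambda>n. m x * ft \<phi> x * (ee (t n * (x - q)) * ee (\<sigma> * x))) \<longlonglongrightarrow> m x * ft \<phi> x * ee (g (x - q) + \<sigma> * x)" for x
    proof (cases "m x = 0")
      case False
      then show ?thesis unfolding ee_add by (intro tendsto_mult tendsto_const tlim)
    qed simp
    show "norm (m x * ft \<phi> x * (ee (t n * (x - q)) * ee (\<sigma> * x))) \<le> norm (m x * ft \<phi> x)" for n x by (simp add: norm_mult)
    show "(\<lambda>x. norm (m x * ft \<phi> x)) summable_on UNIV" by (intro atomic_abs_summable[OF sep grow] rapid_ft \<phi>)
  qed
  have Heq: "H \<phi> N = (ee (- (t N * q)) * \<kappa>) * atomic m (\<lambda>x. \<phi> (x - (- (t N + \<sigma>))))" if \<phi>: "testfun \<phi>" for \<phi> N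
  proof -
    have "ee (t N * (x - q)) * ee (\<sigma> * x) = ee (- (t N * q)) * ee (- ((- (t N + \<sigma>)) * x))" for x
      unfolding ee_add[symmetric] by (rule arg_cong[where f=ee]) (simp add: algebra_simps)
    then have "H \<phi> N = (\<Sum>\<^sub>\<infinity>x. ee (- (t N * q)) * (m x * (ee (- ((- (t N + \<sigma>)) * x)) * ft \<phi> x)))"
      unfolding H_def by (simp only: mult_ac)
    also have "\<dots> = ee (- (t N * q)) * (\<Sum>\<^sub>\<infinity>x. m x * (ee (- ((- (t N + \<sigma>)) * x)) * ft \<phi> x))" by (rule infsum_cmult_right')
    also have "(\<Sum>\<^sub>\<infinity>x. m x * (ee (- ((- (t N + \<sigma>)) * x)) * ft \<phi> x)) = atomic m (ft (\<lambda>x. \<phi> (x - (- (t N + \<sigma>)))))"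
      unfolding atomic_def ft_shift[OF testfun_Cc[OF \<phi>]] ..
    also have "\<dots> = \<kappa> * atomic m (\<lambda>x. \<phi> (x - (- (t N + \<sigma>))))" by (rule rel[OF testfun_shift[OF \<phi>]])
    finally show ?thesis by simp
  qed
  have "H \<phi>1 N * H \<phi>2 N = 0" for N
  proof (rule ccontr)
    define c where "c = - (t N + \<sigma>)"
    assume "H \<phi>1 N * H \<phi>2 N \<noteq> 0"
    then have nz: "atomic m (\<lambda>x. \<phi>1 (x - c)) \<noteq> 0" "atomic m (\<lambda>x. \<phi>2 (x - c)) \<noteq> 0"
      using Heq[OF \<phi>(1), of N] Heq[OF \<phi>(2), of N] unfolding c_def by auto
    have "\<exists>x. m x * \<phi>1 (x - c) \<noteq> 0" using nz(1) unfolding atomic_def by (metis (mono_tags, lifting) infsum_0)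
    moreover have "\<exists>x. m x * \<phi>2 (x - c) \<noteq> 0" using nz(2) unfolding atomic_def by (metis (mono_tags, lifting) infsum_0)
    ultimately obtain x y where xy: "m x \<noteq> 0" "\<phi>1 (x - c) \<noteq> 0" "m y \<noteq> 0" "\<phi>2 (y - c) \<noteq> 0" by auto
    then have "x = y" using s\<phi>(1)[OF xy(2)] s\<phi>(2)[OF xy(4)] by (intro close_eq) auto
    then show False using disj[of "x - c"] xy by auto
  qed
  then have "(\<lambda>N. H \<phi>1 N * H \<phi>2 N) = (\<lambda>N. 0)" by blast
  moreover have "(\<lambda>N. H \<phi>1 N * H \<phi>2 N) \<longlonglongrightarrow> (\<Sum>\<^sub>\<infinity>x. m x * ft \<phi>1 x * ee (g (x - q) + \<sigma> * x)) * (\<Sum>\<^sub>\<infinity>x. m x * ft \<phi>2 x * ee (g (x - q) + \<sigma> * x))"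
    by (intro tendsto_mult Hlim \<phi>)
  ultimately show ?thesis by (simp add: LIMSEQ_const_iff)
qed

text \<open>For an additive \<open>f\<close> with \<open>f x - c x\<close> bounded on the support, all twists of the measure by
  \<open>ee (u (f x - c x))\<close> have spectra as separated as the original one, and they depend
  analytically on \<open>u\<close>; hence a common spectral gap.\<close>

lemma level_sets_finite:
  fixes f :: "real \<Rightarrow> real"
  assumes add: "\<And>x y. f (x + y) = f x + f y" and C: "\<And>x. m x \<noteq> 0 \<Longrightarrow> \<bar>f x - c * x\<bar> \<le> C"
    and approx: "\<And>u E \<epsilon>. finite E \<Longrightarrow> E \<subseteq> diffs \<Longrightarrow> \<epsilon> > 0 \<Longrightarrow> \<exists>t. \<forall>x\<in>E. norm (ee (t * x) - ee (u * f x)) < \<epsilon>"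
  shows "finite ((\<lambda>x. f x - c * x) ` supp m)"
proof -
  obtain q where q: "m q \<noteq> 0" using nontriv by blast
  obtain B where B: "B > 0" "\<And>x. norm (m x) \<le> B" using bounded_weights by blast
  have diff: "f (x - y) = f x - f y" for x y using add[of "x - y" y] by simp
  \<comment> \<open>The value \<open>0\<close> off the support keeps \<open>w\<close> bounded on the
    whole line.\<close>
  define w where "w x = (if m x = 0 then 0 else f x - c * x)" for x
  have C0: "C \<ge> 0" using C[OF q] by linarith
  have wC: "\<bar>w x\<bar> \<le> C" for x using C[of x] C0 by (simp add: w_def)
  define G where "G \<phi> z = (\<Sum>\<^sub>\<infinity>x. (m x * ft \<phi> x) * exp (2 * pi * \<i> * w x * z))" for \<phi> z
  have sA: "(\<lambda>x. norm (m x * ft \<phi> x)) summable_on UNIV" if "testfun \<phi>" for \<phi>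
    by (intro atomic_abs_summable[OF sep grow] rapid_ft that)
  have Gee: "G \<phi> (of_real u) = (\<Sum>\<^sub>\<infinity>x. (m x * ft \<phi> x) * ee (u * w x))" for \<phi> u
    unfolding G_def ee_eq_exp by (simp add: mult_ac)
  have G0: "(\<Sum>\<^sub>\<infinity>x. m x * ft \<phi> x * ee (u * f (x - q) + (- u * c) * x)) = ee (- (u * f q)) * G \<phi> (of_real u)" for \<phi> u
  proof -
    have "m x * ft \<phi> x * ee (u * f (x - q) + (- u * c) * x) = ee (- (u * f q)) * (m x * ft \<phi> x * ee (u * w x))" for x
    proof (cases "m x = 0")
      case False
      have "u * f (x - q) + (- u * c) * x = - (u * f q) + u * w x" unfolding w_def diff using False by (simp add: algebra_simps)
      then show ?thesis by (simp only: ee_add mult_ac)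
    qed simp
    then show ?thesis unfolding Gee by (simp only: infsum_cmult_right')
  qed
  have prod: "G \<phi>1 (of_real u) * G \<phi>2 (of_real u) = 0"
    if \<phi>: "testfun \<phi>1" "testfun \<phi>2" "\<And>x. \<phi>1 x \<noteq> 0 \<Longrightarrow> 0 < x \<and> x < d / 2" "\<And>x. \<phi>2 x \<noteq> 0 \<Longrightarrow> d / 2 < x \<and> x < d" for \<phi>1 \<phi>2 u
  proof -
    have "(\<Sum>\<^sub>\<infinity>x. m x * ft \<phi>1 x * ee (u * f (x - q) + (- u * c) * x)) * (\<Sum>\<^sub>\<infinity>x. m x * ft \<phi>2 x * ee (u * f (x - q) + (- u * c) * x)) = 0"
    proof (rule twisted_product_zero[OF approx q \<phi>(1,2)])
      show "0 < x \<and> x < d" if "\<phi>1 x \<noteq> 0" for x using \<phi>(3)[OF that] d_pos by linarith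
      show "0 < x \<and> x < d" if "\<phi>2 x \<noteq> 0" for x using \<phi>(4)[OF that] d_pos by linarith
      show "\<phi>1 x = 0 \<or> \<phi>2 x = 0" for x using \<phi>(3)[of x] \<phi>(4)[of x] by force
    qed
    then show ?thesis unfolding G0 by simp
  qed
  have alt: "(\<forall>z. G \<phi>1 z = 0) \<or> (\<forall>z. G \<phi>2 z = 0)"
    if \<phi>: "testfun \<phi>1" "testfun \<phi>2" "\<And>x. \<phi>1 x \<noteq> 0 \<Longrightarrow> 0 < x \<and> x < d / 2" "\<And>x. \<phi>2 x \<noteq> 0 \<Longrightarrow> d / 2 < x \<and> x < d" for \<phi>1 \<phi>2
    unfolding G_def
    by (rule powser_no_zero_divisors[OF exponential_sum_powser[OF sA[OF \<phi>(1)] wC] exponential_sum_powser[OF sA[OF \<phi>(2)] wC]])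
       (rule prod[OF \<phi>, unfolded G_def])
  define good where "good u0 \<longleftrightarrow> (\<forall>\<phi>. testfun \<phi> \<longrightarrow> (\<forall>x. \<phi> x \<noteq> 0 \<longrightarrow> u0 < x \<and> x < u0 + d / 2) \<longrightarrow> (\<forall>z. G \<phi> z = 0))" for u0
  \<comment> \<open>If both halves of \<open>(0, d)\<close> failed, the witnesses would contradict
    the alternative \<open>alt\<close>. The gap obtained has length \<open>d / 2\<close> and serves
    all parameters at once.\<close>
  have "good 0 \<or> good (d / 2)"
  proof (rule ccontr)
    assume "\<not> ?thesis"
    then obtain \<phi>1 \<phi>2 where \<phi>: "testfun \<phi>1" "\<forall>x. \<phi>1 x \<noteq> 0 \<longrightarrow> 0 < x \<and> x < 0 + d / 2" "\<not> (\<forall>z. G \<phi>1 z = 0)"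
      "testfun \<phi>2" "\<forall>x. \<phi>2 x \<noteq> 0 \<longrightarrow> d / 2 < x \<and> x < d / 2 + d / 2" "\<not> (\<forall>z. G \<phi>2 z = 0)"
      unfolding good_def by blast
    have a: "0 < x \<and> x < d / 2" if "\<phi>1 x \<noteq> 0" for x using \<phi>(2) that by auto
    have b: "d / 2 < x \<and> x < d" if "\<phi>2 x \<noteq> 0" for x using \<phi>(5) that by auto
    show False using alt[OF \<phi>(1,4) a b] \<phi>(3,6) by blast
  qed
  then obtain u0 where u0: "good u0" by blast
  define b where "b v x = (if m x \<noteq> 0 \<and> w x = v then m x else 0)" for v x
  have sb: "x \<in> supp (b v) \<longleftrightarrow> m x \<noteq> 0 \<and> w x = v" for x v by (simp add: supp_def b_def)
  have ann: "annihilates (b v) u0 (u0 + d / 2)" if v: "\<bar>v\<bar> \<le> C" for v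
    unfolding annihilates_def
  proof (intro allI impI)
    fix \<phi> assume \<phi>: "testfun \<phi>" "\<forall>x. \<phi> x \<noteq> 0 \<longrightarrow> u0 < x \<and> x < u0 + d / 2"
    have "(\<Sum>\<^sub>\<infinity>x. if w x = v then m x * ft \<phi> x else 0) = 0"
    proof (rule exponential_sum_level[OF sA[OF \<phi>(1)] wC v])
      fix u show "(\<Sum>\<^sub>\<infinity>x. m x * ft \<phi> x * ee (u * w x)) = 0" using u0 \<phi> unfolding good_def Gee[symmetric] by blast
    qed
    moreover have "(if w x = v then m x * ft \<phi> x else 0) = b v x * ft \<phi> x" for x by (simp add: b_def)
    ultimately show "atomic (b v) (ft \<phi>) = 0" unfolding atomic_def by (simp only:)
  qed
  define \<gamma> where "\<gamma> = gap_density d (d / 2)"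
  have \<gamma>: "\<gamma> > 0" unfolding \<gamma>_def using gap_density_pos d_pos by simp
  define N where "N = nat \<lceil>(2 / d + 1) / \<gamma>\<rceil>"
  \<comment> \<open>Distinct level sets are disjoint subsets of the support, and each has more than
    \<open>\<gamma> * T\<close> points in \<open>[-T, T]\<close> for large \<open>T\<close>; the
    separation of the support limits their number.\<close>
  have key: "card W \<le> N" if W: "W \<subseteq> w ` supp m" "finite W" for W
  proof -
    have "\<exists>T0. \<forall>T\<ge>T0. \<gamma> * T < card (supp (b v) \<inter> {-T..T})" if v: "v \<in> W" for v
    proof -
      obtain x where x: "m x \<noteq> 0" "v = w x" using v W(1) by (auto simp: in_supp)
      have vC: "\<bar>v\<bar> \<le> C" using x wC by simp
      have 1: "separated d (supp (b v))" by (rule separated_subset[OF sep]) (auto simp: b_def supp_def)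
      have 2: "norm (b v x) \<le> B" for x unfolding b_def using B(1) B(2)[of x] by simp
      have 3: "b v x \<noteq> 0" using x by (simp add: b_def)
      have d2: "d / 2 > 0" using d_pos by simp
      show ?thesis unfolding \<gamma>_def by (rule spectral_gap_density[OF d_pos d2 1 2 ann[OF vC] 3])
    qed
    then obtain T0 where T0: "\<And>v T. v \<in> W \<Longrightarrow> T \<ge> T0 v \<Longrightarrow> \<gamma> * T < card (supp (b v) \<inter> {-T..T})" by metis
    define T where "T = Max (insert 1 (T0 ` W))"
    have T1: "T \<ge> 1" and TT: "v \<in> W \<Longrightarrow> T \<ge> T0 v" for v unfolding T_def using W(2) by auto
    have fin: "finite (supp m \<inter> {-T..T})" by (rule separated_finite(1)[OF sep])
    have "real (card W) * (\<gamma> * T) \<le> (\<Sum>v\<in>W. real (card (supp (b v) \<inter> {-T..T})))"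
      using sum_mono[of W "\<lambda>_. \<gamma> * T" "\<lambda>v. real (card (supp (b v) \<inter> {-T..T}))"] T0 TT by (simp add: less_imp_le)
    also have "\<dots> = real (\<Sum>v\<in>W. card (supp (b v) \<inter> {-T..T}))" by simp
    also have "(\<Sum>v\<in>W. card (supp (b v) \<inter> {-T..T})) = card (\<Union>v\<in>W. supp (b v) \<inter> {-T..T})"
    proof (rule card_UN_disjoint[symmetric])
      show "finite W" by (rule W(2))
      show "\<forall>v\<in>W. finite (supp (b v) \<inter> {-T..T})"
        by (intro ballI finite_subset[OF _ fin]) (auto simp: sb[unfolded in_supp] in_supp)
      show "\<forall>v\<in>W. \<forall>v'\<in>W. v \<noteq> v' \<longrightarrow> supp (b v) \<inter> {-T..T} \<inter> (supp (b v') \<inter> {-T..T}) = {}"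
        by (auto simp: sb)
    qed
    also have "\<dots> \<le> card (supp m \<inter> {-T..T})"
      by (rule card_mono[OF fin]) (auto simp: sb[unfolded in_supp] in_supp)
    also have "real (card (supp m \<inter> {-T..T})) \<le> 2 * T / d + 1" using separated_finite(2)[OF sep, of "-T" T] T1 by simp
    also have "\<dots> \<le> (2 / d + 1) * T" using T1 by (simp add: algebra_simps)
    finally have "real (card W) * \<gamma> \<le> 2 / d + 1" using T1 by (simp add: mult.assoc[symmetric])
    then have "real (card W) \<le> (2 / d + 1) / \<gamma>" using \<gamma> by (simp add: pos_le_divide_eq)
    then show ?thesis unfolding N_def by linarith
  qed
  have "finite (w ` supp m)"
    using finite_if_finite_subsets_card_bdd[of "w ` supp m" N] key by blast
  moreover have "(\<lambda>x. f x - c * x) ` supp m = w ` supp m"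
    by (intro image_cong) (auto simp: w_def in_supp)
  ultimately show ?thesis by simp
qed

text \<open>Some coordinate has non-zero slope: otherwise all coordinates, and with them the
  support, would be bounded, against relative density. On a level set of
  \<open>n i x - c i * x\<close>, the integrality of \<open>n i\<close> on differences makes
  \<open>x - y\<close> an integer multiple of \<open>1 / c i\<close>.\<close>

theorem support_lattice:
  "\<exists>b>0. \<exists>F. finite F \<and> (\<forall>x. m x \<noteq> 0 \<longrightarrow> (\<exists>\<theta>\<in>F. \<exists>k::int. x = \<theta> + of_int k * b))"
proof -
  obtain k and \<theta> :: "nat \<Rightarrow> real" and n :: "nat \<Rightarrow> real \<Rightarrow> real" where
    ind: "module.independent (\<lambda>r. times (real_of_int r)) (\<theta> ` {..<k})" "inj_on \<theta> {..<k}"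
    and add: "\<And>i x y. n i (x + y) = n i x + n i y" and int: "\<And>i x. x \<in> diffs \<Longrightarrow> \<exists>j::int. n i x = of_int j"
    and rep: "\<And>x. x \<in> diffs \<Longrightarrow> x = (\<Sum>i<k. n i x * \<theta> i)"
    by (rule diffs_coordinates) blast
  have "\<exists>c C. \<forall>x. m x \<noteq> 0 \<longrightarrow> \<bar>n i x - c * x\<bar> \<le> C" for i
    by (rule additive_almost_linear[of "n i"]) (rule add)
  then obtain c C where cC: "\<And>i x. m x \<noteq> 0 \<Longrightarrow> \<bar>n i x - c i * x\<bar> \<le> C i" by metis
  obtain q where q: "m q \<noteq> 0" using nontriv by blast
  have "\<exists>i<k. c i \<noteq> 0"
  proof (rule ccontr)
    assume "\<not> ?thesis"
    then have c0: "\<And>i. i < k \<Longrightarrow> c i = 0" by blast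
    define S where "S = (\<Sum>i<k. (C i + C i) * \<bar>\<theta> i\<bar>)"
    have bnd: "\<bar>x - q\<bar> \<le> S" if x: "m x \<noteq> 0" for x
    proof -
      have diff: "n i (x - q) = n i x - n i q" for i using add[of i "x - q" q] by simp
      have "\<bar>x - q\<bar> = \<bar>\<Sum>i<k. n i (x - q) * \<theta> i\<bar>" using rep[OF diffsI[OF x q]] by simp
      also have "\<dots> \<le> (\<Sum>i<k. \<bar>n i (x - q) * \<theta> i\<bar>)" by (rule sum_abs)
      also have "\<dots> \<le> S" unfolding S_def
      proof (rule sum_mono)
        fix i assume "i \<in> {..<k}"
        then have "\<bar>n i (x - q)\<bar> \<le> C i + C i" using cC[OF x, of i] cC[OF q, of i] c0[of i] unfolding diff by simp
        then show "\<bar>n i (x - q) * \<theta> i\<bar> \<le> (C i + C i) * \<bar>\<theta> i\<bar>" unfolding abs_mult by (intro mult_right_mono) auto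
      qed
      finally show ?thesis .
    qed
    obtain R where R: "R > 0" "\<And>x. \<exists>p. m p \<noteq> 0 \<and> \<bar>p - x\<bar> \<le> R" using rel_dense by blast
    obtain p where p: "m p \<noteq> 0" "\<bar>p - (q + S + R + 1)\<bar> \<le> R" using R(2) by blast
    then show False using bnd[OF p(1)] by linarith
  qed
  then obtain i where i: "i < k" "c i \<noteq> 0" by blast
  have "finite ((\<lambda>x. n i x - c i * x) ` supp m)"
    by (rule level_sets_finite[of "n i" "c i" "C i"]) (fact add, fact cC, rule character_approx[OF ind int rep i(1)])
  then obtain F where F: "finite F" "F \<subseteq> supp m" "(\<lambda>x. n i x - c i * x) ` supp m = (\<lambda>x. n i x - c i * x) ` F"
    using finite_subset_image[of "(\<lambda>x. n i x - c i * x) ` supp m" "\<lambda>x. n i x - c i * x" "supp m"] by auto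
  have "\<exists>\<theta>\<in>F. \<exists>j::int. x = \<theta> + of_int j * (1 / \<bar>c i\<bar>)" if x: "m x \<noteq> 0" for x
  proof -
    have "n i x - c i * x \<in> (\<lambda>x. n i x - c i * x) ` F" using x F(3) by (auto simp: in_supp)
    then obtain y where y: "y \<in> F" "n i x - c i * x = n i y - c i * y" by blast
    have "m y \<noteq> 0" using y F(2) by (auto simp: in_supp)
    then obtain j :: int where j: "n i (x - y) = of_int j" using int[OF diffsI[OF x]] by blast
    have "n i (x - y) = n i x - n i y" using add[of i "x - y" y] by simp
    then have "c i * (x - y) = of_int j" using j y(2) by (simp add: algebra_simps)
    then have xy: "x = y + of_int j / c i" using i(2) by (simp add: field_simps)
    show ?thesis
    proof (cases "c i > 0")
      case True
      then show ?thesis using xy y by (intro bexI[of _ y] exI[of _ j]) auto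
    next
      case False
      then show ?thesis using xy y i(2) by (intro bexI[of _ y] exI[of _ "- j"]) auto
    qed
  qed
  then show ?thesis using F(1) i(2) by (intro exI[of _ "1 / \<bar>c i\<bar>"]) auto
qed

end

section \<open>Fourier coefficients and the Poisson summation formula\<close>

text \<open>Centred at \<open>0\<close>, so that the point where the Fourier series is evaluated is
  an interior one.\<close>

abbreviation unit_cell :: "real set" where
  "unit_cell \<equiv> {-1/2..1/2}"

definition fcoeff :: "(real \<Rightarrow> complex) \<Rightarrow> int \<Rightarrow> complex" where
  "fcoeff f k = integral unit_cell (\<lambda>y. ee (- (of_int k * y)) * f y)"

lemma integral_ee: "integral unit_cell (\<lambda>y. ee (of_int n * y)) = (if n = 0 then 1 else 0)"
proof (cases "n = 0")
  case False
  define c where "c = 2 * pi * \<i> * of_int n"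
  have c: "c \<noteq> 0" using False by (simp add: c_def)
  have "((\<lambda>y. ee (of_int n * y) / c) has_vector_derivative ee (of_int n * y)) (at y within unit_cell)" for y
  proof -
    have "((\<lambda>y. ee (of_int n * y) * (1 / c)) has_vector_derivative (2 * pi * \<i> * of_int n * ee (of_int n * y)) * (1 / c)) (at y)"
      using has_vector_derivative_ee[of "of_int n" y] by (intro has_vector_derivative_mult_left) simp
    then have "((\<lambda>y. ee (of_int n * y) / c) has_vector_derivative ee (of_int n * y)) (at y)"
      using c by (simp add: c_def)
    then show ?thesis by (rule has_vector_derivative_at_within)
  qed
  then have "((\<lambda>y. ee (of_int n * y)) has_integral ee (of_int n * (1/2)) / c - ee (of_int n * (-1/2)) / c) unit_cell"
    by (intro fundamental_theorem_of_calculus) auto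
  moreover have "ee (of_int n * (1/2)) = ee (of_int n * (-1/2))"
    using ee_add_int(1)[of "of_int n * (-1/2)" n] by (simp add: field_simps)
  ultimately show ?thesis using False by (simp add: integral_unique)
qed simp

lemma bessel:
  assumes f: "continuous_on unit_cell f" and K: "finite K"
  shows "(\<Sum>k\<in>K. (norm (fcoeff f k))\<^sup>2) \<le> integral unit_cell (\<lambda>y. (norm (f y))\<^sup>2)"
proof -
  define S where "S y = (\<Sum>k\<in>K. fcoeff f k * ee (of_int k * y))" for y
  have cS: "continuous_on unit_cell S" unfolding S_def by (intro continuous_intros)
  have int: "g integrable_on unit_cell" if "continuous_on unit_cell g" for g :: "real \<Rightarrow> complex"
    by (rule integrable_continuous_real[OF that])
  note cc = continuous_intros f cS
  have fS: "integral unit_cell (\<lambda>y. f y * cnj (S y)) = (\<Sum>k\<in>K. fcoeff f k * cnj (fcoeff f k))"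
  proof -
    have "integral unit_cell (\<lambda>y. f y * cnj (S y)) = integral unit_cell (\<lambda>y. \<Sum>k\<in>K. cnj (fcoeff f k) * (ee (- (of_int k * y)) * f y))"
      unfolding S_def by (intro integral_cong) (simp add: sum_distrib_left cnj_ee mult_ac)
    also have "\<dots> = (\<Sum>k\<in>K. integral unit_cell (\<lambda>y. cnj (fcoeff f k) * (ee (- (of_int k * y)) * f y)))"
      by (rule integral_sum[OF K]) (intro int cc)
    finally show ?thesis by (simp add: fcoeff_def mult.commute)
  qed
  have SS: "integral unit_cell (\<lambda>y. S y * cnj (S y)) = (\<Sum>k\<in>K. fcoeff f k * cnj (fcoeff f k))"
  proof -
    have "S y * cnj (S y) = (\<Sum>k\<in>K. \<Sum>l\<in>K. (fcoeff f k * cnj (fcoeff f l)) * ee (of_int (k - l) * y))" for y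
    proof -
      have "ee (of_int k * y) * ee (- (of_int l * y)) = ee (of_int (k - l) * y)" for k l
        unfolding ee_add[symmetric] by (simp add: algebra_simps)
      then show ?thesis unfolding S_def cnj_sum complex_cnj_mult cnj_ee sum_product by (intro sum.cong refl) (simp add: mult_ac)
    qed
    then have "integral unit_cell (\<lambda>y. S y * cnj (S y)) = integral unit_cell (\<lambda>y. \<Sum>k\<in>K. \<Sum>l\<in>K. (fcoeff f k * cnj (fcoeff f l)) * ee (of_int (k - l) * y))" by presburger
    also have "\<dots> = (\<Sum>k\<in>K. integral unit_cell (\<lambda>y. \<Sum>l\<in>K. (fcoeff f k * cnj (fcoeff f l)) * ee (of_int (k - l) * y)))"
      by (rule integral_sum[OF K]) (intro int cc)
    also have "\<dots> = (\<Sum>k\<in>K. \<Sum>l\<in>K. integral unit_cell (\<lambda>y. (fcoeff f k * cnj (fcoeff f l)) * ee (of_int (k - l) * y)))"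
      by (intro sum.cong refl integral_sum[OF K] int cc)
    also have "\<dots> = (\<Sum>k\<in>K. \<Sum>l\<in>K. if k = l then fcoeff f k * cnj (fcoeff f l) else 0)"
    proof (intro sum.cong refl)
      fix k l
      show "integral unit_cell (\<lambda>y. (fcoeff f k * cnj (fcoeff f l)) * ee (of_int (k - l) * y)) = (if k = l then fcoeff f k * cnj (fcoeff f l) else 0)"
        using integral_ee[of "k - l"] by (simp only: integral_mult_right) simp
    qed
    finally show ?thesis using K by simp
  qed
  have "integral unit_cell (\<lambda>y. (f y - S y) * cnj (f y - S y)) = integral unit_cell (\<lambda>y. f y * cnj (f y) - f y * cnj (S y) - cnj (f y * cnj (S y)) + S y * cnj (S y))"
    by (intro integral_cong) (simp add: algebra_simps)
  also have "\<dots> = integral unit_cell (\<lambda>y. f y * cnj (f y)) - integral unit_cell (\<lambda>y. f y * cnj (S y)) - integral unit_cell (\<lambda>y. cnj (f y * cnj (S y))) + integral unit_cell (\<lambda>y. S y * cnj (S y))"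
  proof -
    have i: "(\<lambda>y. f y * cnj (f y)) integrable_on unit_cell" "(\<lambda>y. f y * cnj (S y)) integrable_on unit_cell"
      "(\<lambda>y. cnj (f y * cnj (S y))) integrable_on unit_cell" "(\<lambda>y. S y * cnj (S y)) integrable_on unit_cell"
      by (intro int cc)+
    show ?thesis
      using i by (simp add: Henstock_Kurzweil_Integration.integral_add Henstock_Kurzweil_Integration.integral_diff integrable_diff del: complex_cnj_mult)
  qed
  also have "integral unit_cell (\<lambda>y. cnj (f y * cnj (S y))) = cnj (integral unit_cell (\<lambda>y. f y * cnj (S y)))"
    by (rule Henstock_Kurzweil_Integration.integral_cnj[symmetric])
  finally have e: "integral unit_cell (\<lambda>y. (f y - S y) * cnj (f y - S y)) = integral unit_cell (\<lambda>y. f y * cnj (f y)) - (\<Sum>k\<in>K. fcoeff f k * cnj (fcoeff f k))"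
    unfolding fS SS by (simp add: mult.commute)
  have sq: "integral unit_cell (\<lambda>y. g y * cnj (g y)) = of_real (integral unit_cell (\<lambda>y. (norm (g y))\<^sup>2))"
    if g: "continuous_on unit_cell g" for g :: "real \<Rightarrow> complex"
  proof -
    have "(\<lambda>y. (norm (g y))\<^sup>2) integrable_on unit_cell" by (intro integrable_continuous_real continuous_intros g)
    from integral_linear[OF this bounded_linear_of_real[where 'a=complex]]
    show ?thesis unfolding complex_norm_square[symmetric] by (simp add: o_def)
  qed
  have cfS: "continuous_on unit_cell (\<lambda>y. f y - S y)" by (intro cc)
  have "complex_of_real (integral unit_cell (\<lambda>y. (norm (f y - S y))\<^sup>2)) = of_real (integral unit_cell (\<lambda>y. (norm (f y))\<^sup>2) - (\<Sum>k\<in>K. (norm (fcoeff f k))\<^sup>2))"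
    by (simp only: of_real_diff of_real_sum complex_norm_square sq[OF f, symmetric] sq[OF cfS, symmetric] e)
  then have "integral unit_cell (\<lambda>y. (norm (f y - S y))\<^sup>2) = integral unit_cell (\<lambda>y. (norm (f y))\<^sup>2) - (\<Sum>k\<in>K. (norm (fcoeff f k))\<^sup>2)"
    by (simp only: of_real_eq_iff)
  moreover have "integral unit_cell (\<lambda>y. (norm (f y - S y))\<^sup>2) \<ge> 0"
    by (intro integral_nonneg integrable_continuous_real cc) auto
  ultimately show ?thesis by linarith
qed

text \<open>By Bessel's inequality the squares along distinct frequencies are summable. This form of
  the Riemann-Lebesgue lemma is all that the telescoped partial sums need.\<close>

lemma fcoeff_tendsto:
  assumes f: "continuous_on unit_cell f" and g: "inj g"
  shows "(\<lambda>n. fcoeff f (g n)) \<longlonglongrightarrow> 0"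
proof -
  have "summable (\<lambda>n. (norm (fcoeff f (g n)))\<^sup>2)"
  proof (rule summableI_nonneg_bounded)
    fix n
    have "inj_on g {..<n}" using g inj_on_subset by blast
    then have "(\<Sum>i<n. (norm (fcoeff f (g i)))\<^sup>2) = (\<Sum>k\<in>g ` {..<n}. (norm (fcoeff f k))\<^sup>2)"
      by (simp add: sum.reindex)
    also have "\<dots> \<le> integral unit_cell (\<lambda>y. (norm (f y))\<^sup>2)" by (rule bessel[OF f]) simp
    finally show "(\<Sum>i<n. (norm (fcoeff f (g i)))\<^sup>2) \<le> integral unit_cell (\<lambda>y. (norm (f y))\<^sup>2)" .
  qed simp
  then have "(\<lambda>n. (norm (fcoeff f (g n)))\<^sup>2) \<longlonglongrightarrow> 0" by (rule summable_LIMSEQ_zero)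
  then have "(\<lambda>n. sqrt ((norm (fcoeff f (g n)))\<^sup>2)) \<longlonglongrightarrow> sqrt 0" by (rule tendsto_real_sqrt)
  then show ?thesis by (simp add: tendsto_norm_zero_iff)
qed

text \<open>For \<open>f\<close> supported in \<open>[-M, M]\<close> these \<open>2 * M + 1\<close>
  translates already give the full periodization on the unit cell, and no convergence is
  involved.\<close>

definition periodize :: "nat \<Rightarrow> (real \<Rightarrow> complex) \<Rightarrow> real \<Rightarrow> complex" where
  "periodize M f y = (\<Sum>i<2 * M + 1. f (y + (real i - real M)))"

lemma periodize_continuous: "Cc f \<Longrightarrow> continuous_on S (periodize M f)"
  unfolding periodize_def[abs_def]
  by (intro continuous_intros continuous_on_compose2[OF Cc_continuous[of f UNIV]]) auto

lemma ft_eq_fcoeff: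
  assumes f: "Cc f" and supp: "\<And>x. f x \<noteq> 0 \<Longrightarrow> \<bar>x\<bar> \<le> real M"
  shows "ft f (of_int k) = fcoeff (periodize M f) k"
proof -
  define F where "F x = ee (- (x * of_int k)) * f x" for x
  have cF: "continuous_on S F" for S unfolding F_def by (intro continuous_intros Cc_continuous f)
  have iF: "F integrable_on {a..b}" for a b by (rule integrable_continuous_real[OF cF])
  define p where "p i = real i - real M - 1/2" for i :: nat
  have "ft f (of_int k) = integral {- real M - 1/2..real M + 1/2} F"
    unfolding F_def by (rule ft_interval[OF Cc_continuous[OF f]]) (use supp in force)
  also have "\<dots> = integral {p 0..p (2 * M + 1)} F"
  proof -
    have "- real M - 1/2 = p 0" "real M + 1/2 = p (2 * M + 1)" by (simp_all add: p_def)
    then show ?thesis by (simp only:)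
  qed
  also have "\<dots> = (\<Sum>i<2 * M + 1. integral {p i..p (Suc i)} F)"
  proof -
    have "integral {p 0..p n} F = (\<Sum>i<n. integral {p i..p (Suc i)} F)" for n
    proof (induction n)
      case (Suc n)
      have "integral {p 0..p n} F + integral {p n..p (Suc n)} F = integral {p 0..p (Suc n)} F"
        by (rule Henstock_Kurzweil_Integration.integral_combine[OF _ _ iF]) (auto simp: p_def)
      then show ?case using Suc by simp
    qed simp
    then show ?thesis by blast
  qed
  also have "\<dots> = (\<Sum>i<2 * M + 1. integral unit_cell (\<lambda>y. ee (- (of_int k * y)) * f (y + (real i - real M))))"
  proof (intro sum.cong refl)
    fix i
    define c where "c = real i - real M"
    have e: "ee (- ((y + c) * of_int k)) = ee (- (of_int k * y))" for y
    proof -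
      have "- ((y + c) * of_int k) = - (of_int k * y) + of_int (- (int i - int M) * k)" by (simp add: c_def algebra_simps)
      then show ?thesis by (simp only: ee_add_int)
    qed
    have "integral {p i..p (Suc i)} F = integral {-1/2 + c..1/2 + c} F" by (simp add: p_def c_def algebra_simps)
    also have "\<dots> = integral unit_cell (F \<circ> (\<lambda>x. x + c))" by (rule integral_shift[symmetric, OF cF])
    also have "F \<circ> (\<lambda>x. x + c) = (\<lambda>y. ee (- (of_int k * y)) * f (y + c))" unfolding F_def o_def e ..
    finally show "integral {p i..p (Suc i)} F = integral unit_cell (\<lambda>y. ee (- (of_int k * y)) * f (y + (real i - real M)))"
      unfolding c_def .
  qed
  also have "\<dots> = integral unit_cell (\<lambda>y. \<Sum>i<2 * M + 1. ee (- (of_int k * y)) * f (y + (real i - real M)))"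
    by (rule integral_sum[symmetric])
       (auto intro!: integrable_continuous_real continuous_intros continuous_on_compose2[OF Cc_continuous[OF f, of UNIV]])
  finally show ?thesis unfolding fcoeff_def periodize_def sum_distrib_left .
qed

lemma vector_derivative_quotient:
  fixes f :: "real \<Rightarrow> complex"
  assumes "(f has_vector_derivative D) (at 0)"
  shows "((\<lambda>h. (f h - f 0) / of_real h) \<longlongrightarrow> D) (at 0)"
proof -
  have "((\<lambda>h. norm (f (0 + h) - f 0 - h *\<^sub>R D) / norm h) \<longlongrightarrow> 0) (at 0)"
    using assms unfolding has_vector_derivative_def has_derivative_at by simp
  moreover have "eventually (\<lambda>h. norm (f (0 + h) - f 0 - h *\<^sub>R D) / norm h = norm ((f h - f 0) / of_real h - D)) (at 0)"
  proof (rule eventually_mono[OF eventually_neq_at_within[of 0]])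
    fix h :: real assume h: "h \<noteq> 0"
    have "(f h - f 0) / of_real h - D = (f (0 + h) - f 0 - h *\<^sub>R D) / of_real h"
      using h by (simp add: scaleR_conv_of_real field_simps)
    then show "norm (f (0 + h) - f 0 - h *\<^sub>R D) / norm h = norm ((f h - f 0) / of_real h - D)"
      by (simp add: norm_divide)
  qed
  ultimately have "((\<lambda>h. norm ((f h - f 0) / of_real h - D)) \<longlongrightarrow> 0) (at 0)"
    by (rule Lim_transform_eventually)
  then show ?thesis by (simp add: tendsto_norm_zero_iff LIM_zero_iff)
qed

text \<open>Writing \<open>f - f 0 = (ee - 1) * q\<close> with \<open>q\<close> continuous makes the partial sums of the Fourier
  series of \<open>f\<close> at \<open>0\<close> telescope.\<close>

lemma fourier_series_at_0:
  assumes f: "continuous_on unit_cell f" and D: "(f has_vector_derivative D) (at 0)"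
  shows "(\<lambda>N. \<Sum>k\<in>{- int N..int N}. fcoeff f k) \<longlonglongrightarrow> f 0"
proof -
  define q where "q y = (if y = 0 then D / (2 * pi * \<i>) else (f y - f 0) / (ee y - 1))" for y
  have ne: "ee y \<noteq> 1" if "y \<in> unit_cell" "y \<noteq> 0" for y
  proof
    assume "ee y = 1"
    moreover have "\<bar>y\<bar> \<le> 1 / 2" using that(1) by (simp add: abs_le_iff) linarith
    ultimately have "4 * \<bar>y\<bar> \<le> 0" using norm_ee_minus_1_ge[of y] by simp
    then show False using that(2) by simp
  qed
  have "((\<lambda>y. ee (1 * y)) has_vector_derivative 2 * pi * \<i> * 1 * ee (1 * 0)) (at 0)"
    using has_vector_derivative_ee[of 1 0] by simp
  then have De: "(ee has_vector_derivative 2 * pi * \<i>) (at 0)" by simp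
  have lim0: "(q \<longlongrightarrow> D / (2 * pi * \<i>)) (at 0)"
  proof -
    have "((\<lambda>h. ((f h - f 0) / of_real h) / ((ee h - ee 0) / of_real h)) \<longlongrightarrow> D / (2 * pi * \<i>)) (at 0)"
      by (intro tendsto_divide vector_derivative_quotient D De) simp
    moreover have "eventually (\<lambda>h. ((f h - f 0) / of_real h) / ((ee h - ee 0) / of_real h) = q h) (at 0)"
      by (rule eventually_mono[OF eventually_neq_at_within[of 0]]) (simp add: q_def)
    ultimately show ?thesis by (rule Lim_transform_eventually)
  qed
  have cq: "continuous_on unit_cell q"
    unfolding continuous_on_eq_continuous_within
  proof
    fix y :: real assume y: "y \<in> unit_cell"
    show "continuous (at y within unit_cell) q"
    proof (cases "y = 0")
      case True
      have "(q \<longlongrightarrow> q 0) (at 0 within unit_cell)" using tendsto_within_subset[OF lim0, of unit_cell] by (simp add: q_def)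
      then show ?thesis unfolding True continuous_within .
    next
      case False
      have "continuous (at y within unit_cell) (\<lambda>y. (f y - f 0) / (ee y - 1))"
      proof (intro continuous_intros)
        show "continuous (at y within unit_cell) f" using f y continuous_on_eq_continuous_within by blast
        have "continuous_on unit_cell ee" using continuous_on_ee[OF continuous_on_id] by simp
        then show "continuous (at y within unit_cell) ee" using y continuous_on_eq_continuous_within by blast
        show "ee y - 1 \<noteq> 0" using ne[OF y False] by simp
      qed
      moreover have "eventually (\<lambda>z. (f z - f 0) / (ee z - 1) = q z) (at y within unit_cell)"
        by (rule eventually_mono[OF eventually_neq_at_within[of 0 y unit_cell]]) (simp add: q_def)
      ultimately show ?thesis
        unfolding continuous_within using False by (simp add: q_def cong: Lim_cong_within) (rule Lim_transform_eventually)
    qed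
  qed
  have fq: "f y = f 0 + (ee y - 1) * q y" if "y \<in> unit_cell" for y
    using ne[OF that] by (simp add: q_def)
  have coeff: "fcoeff f k = (if k = 0 then f 0 else 0) + (fcoeff q (k - 1) - fcoeff q k)" for k
  proof -
    have "fcoeff f k = integral unit_cell (\<lambda>y. ee (of_int (- k) * y) * f 0 + (ee (- (of_int (k - 1) * y)) * q y - ee (- (of_int k * y)) * q y))"
      unfolding fcoeff_def
    proof (rule integral_cong)
      fix y :: real assume y: "y \<in> unit_cell"
      have "ee (- (of_int (k - 1) * y)) = ee (- (of_int k * y)) * ee y"
        unfolding ee_add[symmetric] by (simp add: algebra_simps)
      then show "ee (- (of_int k * y)) * f y = ee (of_int (- k) * y) * f 0 + (ee (- (of_int (k - 1) * y)) * q y - ee (- (of_int k * y)) * q y)"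
        by (subst fq[OF y]) (simp add: algebra_simps)
    qed
    also have "\<dots> = integral unit_cell (\<lambda>y. ee (of_int (- k) * y) * f 0) + (integral unit_cell (\<lambda>y. ee (- (of_int (k - 1) * y)) * q y) - integral unit_cell (\<lambda>y. ee (- (of_int k * y)) * q y))"
    proof -
      have i: "(\<lambda>y. ee (of_int (- k) * y) * f 0) integrable_on unit_cell" "(\<lambda>y. ee (- (of_int (k - 1) * y)) * q y) integrable_on unit_cell"
        "(\<lambda>y. ee (- (of_int k * y)) * q y) integrable_on unit_cell"
        by (intro integrable_continuous_real continuous_intros cq)+
      show ?thesis using i by (simp only: Henstock_Kurzweil_Integration.integral_add Henstock_Kurzweil_Integration.integral_diff integrable_diff)
    qed
    also have "integral unit_cell (\<lambda>y. ee (of_int (- k) * y) * f 0) = (if k = 0 then f 0 else 0)"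
      using integral_ee[of "- k"] by (simp only: integral_mult_left) simp
    finally show ?thesis unfolding fcoeff_def .
  qed
  have part: "(\<Sum>k\<in>{- int N..int N}. fcoeff f k) = f 0 + (fcoeff q (- int (Suc N)) - fcoeff q (int N))" for N
  proof (induction N)
    case 0 then show ?case by (simp add: coeff)
  next
    case (Suc N)
    have "{- int (Suc N)..int (Suc N)} = insert (- int (Suc N)) (insert (int (Suc N)) {- int N..int N})" by auto
    then have "(\<Sum>k\<in>{- int (Suc N)..int (Suc N)}. fcoeff f k) = fcoeff f (- int (Suc N)) + (fcoeff f (int (Suc N)) + (\<Sum>k\<in>{- int N..int N}. fcoeff f k))"
      by simp
    moreover have "fcoeff f (- int (Suc N)) = fcoeff q (- int (Suc (Suc N))) - fcoeff q (- int (Suc N))"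
      using coeff[of "- int (Suc N)"] by (simp add: algebra_simps)
    moreover have "fcoeff f (int (Suc N)) = fcoeff q (int N) - fcoeff q (int (Suc N))"
      using coeff[of "int (Suc N)"] by simp
    ultimately show ?case using Suc by simp
  qed
  have "(\<lambda>N. f 0 + (fcoeff q (- int (Suc N)) - fcoeff q (int N))) \<longlonglongrightarrow> f 0 + (0 - 0)"
    by (intro tendsto_intros fcoeff_tendsto[OF cq, of "\<lambda>N. - int (Suc N)"] fcoeff_tendsto[OF cq, of int]) (auto simp: inj_def)
  then show ?thesis unfolding part by simp
qed

text \<open>Both sides are the value at \<open>0\<close> of the periodization, the left one through
  its Fourier series. Symmetric partial sums are enough, since the decay of \<open>ft f\<close>
  makes the sum over the integers unconditional.\<close>

lemma poisson_int:
  assumes f: "testfun f"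
  shows "(\<Sum>\<^sub>\<infinity>k::int. ft f (of_int k)) = (\<Sum>\<^sub>\<infinity>k::int. f (of_int k))"
proof -
  obtain R where R: "R > 0" "\<And>x. f x \<noteq> 0 \<Longrightarrow> \<bar>x\<bar> < R" using testfunE[OF f] by metis
  obtain M :: nat where M: "real M > R" using reals_Archimedean2 by blast
  have sM: "\<bar>x\<bar> \<le> real M" if "f x \<noteq> 0" for x using R(2)[OF that] M by simp
  have fc: "ft f (of_int k) = fcoeff (periodize M f) k" for k :: int
    by (rule ft_eq_fcoeff[OF testfun_Cc[OF f] sM])
  have "(periodize M f has_vector_derivative (\<Sum>i<2 * M + 1. 1 *\<^sub>R vd f (1 * 0 + (real i - real M)))) (at 0)"
    unfolding periodize_def[abs_def]
  proof (intro has_vector_derivative_sum)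
    fix i
    have "((\<lambda>y. f (1 * y + (real i - real M))) has_vector_derivative 1 *\<^sub>R vd f (1 * 0 + (real i - real M))) (at 0)"
      by (intro has_vector_derivative_affine smooth_has_vector_derivative testfun_smooth f)
    then show "((\<lambda>y. f (y + (real i - real M))) has_vector_derivative 1 *\<^sub>R vd f (1 * 0 + (real i - real M))) (at 0)" by simp
  qed
  then have "(\<lambda>N. \<Sum>k\<in>{- int N..int N}. fcoeff (periodize M f) k) \<longlonglongrightarrow> periodize M f 0"
    by (rule fourier_series_at_0[OF periodize_continuous[OF testfun_Cc[OF f]]])
  then have lim: "(\<lambda>N. \<Sum>k\<in>{- int N..int N}. ft f (of_int k)) \<longlonglongrightarrow> periodize M f 0"
    unfolding fc .
  obtain C where C: "\<And>x. (1 + x\<^sup>2) ^ 1 * norm (ft f x) \<le> C" using rapid_ft[OF f] unfolding rapid_def by blast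
  have b: "norm (ft f (of_int k)) \<le> C * (1 / (1 + (of_int k)\<^sup>2))" for k :: int
    using C[of "of_int k"] by (simp add: pos_le_divide_eq add_pos_nonneg mult.commute)
  have sm: "(\<lambda>k::int. C * (1 / (1 + (of_int k)\<^sup>2))) summable_on UNIV"
    by (rule summable_on_cmult_right[OF summable_inverse_square_int])
  have C0: "C \<ge> 0" using C[of 0] by (simp add: order_trans[OF norm_ge_zero])
  have "(\<lambda>N. \<Sum>\<^sub>\<infinity>k::int. if k \<in> {- int N..int N} then ft f (of_int k) else 0) \<longlonglongrightarrow> (\<Sum>\<^sub>\<infinity>k::int. ft f (of_int k))"
  proof (rule infsum_dominated[OF _ _ sm])
    show "(\<lambda>N. if k \<in> {- int N..int N} then ft f (of_int k) else 0) \<longlonglongrightarrow> ft f (of_int k)" for k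
    proof (rule tendsto_eventually)
      show "eventually (\<lambda>N. (if k \<in> {- int N..int N} then ft f (of_int k) else 0) = ft f (of_int k)) sequentially"
        unfolding eventually_sequentially by (intro exI[of _ "nat \<bar>k\<bar>"]) auto
    qed
    show "norm (if k \<in> {- int N..int N} then ft f (of_int k) else 0) \<le> C * (1 / (1 + (of_int k)\<^sup>2))" for N k
      using b[of k] C0 by auto
  qed
  moreover have "(\<Sum>\<^sub>\<infinity>k::int. if k \<in> {- int N..int N} then ft f (of_int k) else 0) = (\<Sum>k\<in>{- int N..int N}. ft f (of_int k))" for N
  proof -
    have "(\<Sum>\<^sub>\<infinity>k::int. if k \<in> {- int N..int N} then ft f (of_int k) else 0) = infsum (\<lambda>k. ft f (of_int k)) {- int N..int N}"
      by (rule infsum_cong_neutral) auto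
    then show ?thesis by simp
  qed
  ultimately have "(\<Sum>\<^sub>\<infinity>k::int. ft f (of_int k)) = periodize M f 0" using lim LIMSEQ_unique by simp
  also have "\<dots> = (\<Sum>k\<in>(\<lambda>i. int i - int M) ` {..<2 * M + 1}. f (of_int k))"
    unfolding periodize_def by (subst sum.reindex) (auto simp: inj_on_def)
  also have "\<dots> = infsum (\<lambda>k::int. f (of_int k)) ((\<lambda>i. int i - int M) ` {..<2 * M + 1})" by simp
  also have "\<dots> = (\<Sum>\<^sub>\<infinity>k::int. f (of_int k))"
  proof (rule infsum_cong_neutral)
    fix k assume k: "k \<in> UNIV - (\<lambda>i. int i - int M) ` {..<2 * M + 1}"
    show "f (of_int k) = 0"
    proof (rule ccontr)
      assume "f (of_int k) \<noteq> 0"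
      then have "\<bar>k\<bar> \<le> int M" using sM[of "of_int k"] by linarith
      then have "k = int (nat (k + int M)) - int M" "nat (k + int M) \<in> {..<2 * M + 1}" by auto
      then show False using k by blast
    qed
  qed auto
  finally show ?thesis .
qed

section \<open>Dirac combs\<close>

text \<open>The weight function that turns \<open>Zcomb\<close> into an \<open>atomic\<close>
  measure; combs on different lattices can then be added pointwise.\<close>

definition zw :: "real \<Rightarrow> real \<Rightarrow> real \<Rightarrow> real \<Rightarrow> complex" where
  "zw r s a x = (if \<exists>k::int. x = s + of_int k * a then ee (r * x) else 0)"

lemma zw_nonzero_iff: "zw r s a x \<noteq> 0 \<longleftrightarrow> (\<exists>k::int. x = s + of_int k * a)"
  by (simp add: zw_def)

lemma norm_zw_le: "norm (zw r s a x) \<le> 1"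
  by (simp add: zw_def)

lemma separated_zw: "a > 0 \<Longrightarrow> separated a (supp (zw r s a))"
  unfolding separated_def
proof (intro conjI ballI impI)
  fix x y assume a: "a > 0" and xy: "x \<in> supp (zw r s a)" "y \<in> supp (zw r s a)" "x \<noteq> y"
  obtain k l :: int where kl: "x = s + of_int k * a" "y = s + of_int l * a" using xy unfolding in_supp zw_nonzero_iff by blast
  then have "k \<noteq> l" using xy(3) by auto
  then have "1 \<le> \<bar>real_of_int k - real_of_int l\<bar>" by linarith
  then have "1 * a \<le> \<bar>real_of_int k - real_of_int l\<bar> * a" using a by (intro mult_right_mono) auto
  also have "\<dots> = \<bar>(real_of_int k - real_of_int l) * a\<bar>" using a by (simp add: abs_mult)
  finally show "a \<le> \<bar>x - y\<bar>" unfolding kl by (simp add: left_diff_distrib)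
qed

lemma growth_zw: "growth (zw r s a)"
  by (rule growth_bounded[OF norm_zw_le])

lemma atomic_zw:
  assumes "a > 0"
  shows "atomic (zw r s a) f = (\<Sum>\<^sub>\<infinity>k::int. ee (r * (s + of_int k * a)) * f (s + of_int k * a))"
proof -
  define h where "h k = s + of_int k * a" for k :: int
  have inj: "inj h" unfolding h_def inj_def using assms by simp
  have "atomic (zw r s a) f = infsum (\<lambda>x. ee (r * x) * f x) (range h)"
    unfolding atomic_def by (rule infsum_cong_neutral) (auto simp: zw_def h_def)
  also have "\<dots> = infsum ((\<lambda>x. ee (r * x) * f x) \<circ> h) UNIV" by (rule infsum_reindex[OF inj])
  finally show ?thesis by (simp add: h_def o_def)
qed

lemma Zcomb_eq_atomic: "a > 0 \<Longrightarrow> Zcomb r s a = atomic (zw r s a)"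
  by (rule ext) (simp add: atomic_zw Zcomb_def ee_eq_exp)

text \<open>Modulation by \<open>- s\<close>, a shift by \<open>r\<close> and a rescaling by
  \<open>1 / a\<close> move the comb to the integers, where the classical formula applies. The phase
  \<open>ee (r * s)\<close> arises because modulation and translation do not commute.\<close>

lemma poisson_zw:
  assumes f: "testfun f" and a: "a > 0"
  shows "atomic (zw r s a) (ft f) = (ee (r * s) / a) * atomic (zw (- s) r (1 / a)) f"
proof -
  define g where "g x = ee ((- s) * x) * f (1 * x + r)" for x
  have g: "testfun g" unfolding g_def by (intro testfun_mult testfun_affine f smooth_ee) simp
  have ftg: "ft g t = ee (r * (s + t)) * ft f (s + t)" for t
    unfolding g_def ft_modulate[OF Cc_affine[OF testfun_Cc[OF f] one_neq_zero]] ft_affine[OF testfun_Cc[OF f] one_neq_zero] by (simp add: add.commute)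
  define h where "h y = g ((1 / a) * y + 0)" for y
  have h: "testfun h" unfolding h_def using a by (intro testfun_affine g) simp
  have fth: "ft h t = a * ft g (a * t)" for t
    unfolding h_def using ft_affine[OF testfun_Cc[OF g], of "1 / a" 0 t] a by (simp add: mult.commute)
  have "(\<Sum>\<^sub>\<infinity>k::int. ft h (of_int k)) = (\<Sum>\<^sub>\<infinity>k::int. of_real a * (ee (r * (s + of_int k * a)) * ft f (s + of_int k * a)))"
    unfolding fth ftg by (simp add: mult.commute[of a])
  also have "\<dots> = of_real a * atomic (zw r s a) (ft f)" unfolding atomic_zw[OF a] by (rule infsum_cmult_right')
  finally have L: "(\<Sum>\<^sub>\<infinity>k::int. ft h (of_int k)) = of_real a * atomic (zw r s a) (ft f)" .
  have "h (of_int k) = ee (r * s) * (ee ((- s) * (r + of_int k * (1 / a))) * f (r + of_int k * (1 / a)))" for k :: int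
  proof -
    have "ee ((- s) * (of_int k / a)) = ee (r * s) * ee ((- s) * (r + of_int k * (1 / a)))"
      unfolding ee_add[symmetric] by (simp add: algebra_simps)
    then show ?thesis unfolding h_def g_def by (simp add: add.commute mult.assoc)
  qed
  then have "(\<Sum>\<^sub>\<infinity>k::int. h (of_int k)) = (\<Sum>\<^sub>\<infinity>k::int. ee (r * s) * (ee ((- s) * (r + of_int k * (1 / a))) * f (r + of_int k * (1 / a))))"
    by presburger
  also have "\<dots> = ee (r * s) * atomic (zw (- s) r (1 / a)) f"
    using a by (subst atomic_zw) (simp, rule infsum_cmult_right')
  finally have "of_real a * atomic (zw r s a) (ft f) = ee (r * s) * atomic (zw (- s) r (1 / a)) f"
    using L poisson_int[OF h] by simp
  then show ?thesis using a by (simp add: field_simps)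
qed

lemma is_ft_zw:
  assumes "a > 0"
  shows "is_ft (atomic (zw r s a)) (\<lambda>f. (ee (r * s) / a) * atomic (zw (- s) r (1 / a)) f)"
  unfolding is_ft_def
proof (intro conjI exI[of _ "atomic (zw r s a)"])
  have "1 / a > 0" using assms by simp
  then show "radon (\<lambda>f. (ee (r * s) / a) * atomic (zw (- s) r (1 / a)) f)"
    by (intro radon_cmult radon_atomic[OF separated_zw])
  show "\<forall>f. testfun f \<longrightarrow> atomic (zw r s a) (ft f) = (ee (r * s) / a) * atomic (zw (- s) r (1 / a)) f"
    using poisson_zw assms by simp
qed (use assms in \<open>auto intro: radon_atomic separated_zw tempered_ext_atomic growth_zw\<close>)

text \<open>The iterates of the transform on a comb in closed form. Index \<open>4\<close> falls
  into the last case and returns the comb itself, in accordance with the fourth power of the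
  transform being the identity.\<close>

definition zchain :: "real \<Rightarrow> real \<Rightarrow> real \<Rightarrow> nat \<Rightarrow> rmeas" where
  "zchain r s a j =
     (if j = 1 then (\<lambda>f. (ee (r * s) / a) * atomic (zw (- s) r (1 / a)) f)
      else if j = 2 then atomic (zw (- r) (- s) a)
      else if j = 3 then (\<lambda>f. (ee (r * s) / a) * atomic (zw s (- r) (1 / a)) f)
      else atomic (zw r s a))"

lemma zchain_0: "zchain r s a 0 = atomic (zw r s a)"
  by (simp add: zchain_def)

lemma zchain_values:
  "zchain r s a 1 = (\<lambda>f. (ee (r * s) / a) * atomic (zw (- s) r (1 / a)) f)"
  "zchain r s a 2 = atomic (zw (- r) (- s) a)"
  "zchain r s a 3 = (\<lambda>f. (ee (r * s) / a) * atomic (zw s (- r) (1 / a)) f)"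
  "zchain r s a 4 = atomic (zw r s a)"
  by (simp_all add: zchain_def)

lemma is_ft_zchain:
  assumes a: "a > 0" and j: "j < 4"
  shows "is_ft (zchain r s a j) (zchain r s a (Suc j))"
proof -
  have a': "1 / a > 0" using a by simp
  have c: "complex_of_real a \<noteq> 0" using a by simp
  have eq: "(ee (r * s) / a) * ((ee (- (r * s)) / complex_of_real (1 / a)) * z) = z" for z
  proof -
    have "(ee (r * s) / a) * ((ee (- (r * s)) / complex_of_real (1 / a)) * z) = (ee (r * s) * ee (- (r * s))) * z"
      using c by (simp add: field_simps)
    then show ?thesis by simp
  qed
  have e: "- s * r = - (r * s)" "s * - r = - (r * s)" "1 / (1 / a) = a" by simp_all
  consider "j = 0" | "j = 1" | "j = 2" | "j = 3" using j by linarith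
  then show ?thesis
  proof cases
    case 1 then show ?thesis using is_ft_zw[OF a, of r s] by (simp add: zchain_def)
  next
    case 2
    have "is_ft (\<lambda>f. (ee (r * s) / a) * atomic (zw (- s) r (1 / a)) f)
       (\<lambda>f. (ee (r * s) / a) * ((ee (- (r * s)) / complex_of_real (1 / a)) * atomic (zw (- r) (- s) a) f))"
      using is_ft_cmult[OF is_ft_zw[OF a', of "- s" r], of "ee (r * s) / a"] by (simp only: e)
    then show ?thesis unfolding eq using 2 by (simp only: zchain_values One_nat_def[symmetric] Suc_1)
  next
    case 3
    then show ?thesis using is_ft_zw[OF a, of "- r" "- s"] by (simp add: zchain_def)
  next
    case 4
    have "is_ft (\<lambda>f. (ee (r * s) / a) * atomic (zw s (- r) (1 / a)) f)
       (\<lambda>f. (ee (r * s) / a) * ((ee (- (r * s)) / complex_of_real (1 / a)) * atomic (zw r s a) f))"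
      using is_ft_cmult[OF is_ft_zw[OF a', of s "- r"], of "ee (r * s) / a"] by (simp only: e minus_minus)
    moreover have "Suc 3 = 4" by simp
    ultimately show ?thesis unfolding eq using 4 by (simp only: zchain_values)
  qed
qed

section \<open>Spans of Dirac combs\<close>

inductive comb_span :: "real \<Rightarrow> (real \<Rightarrow> complex) \<Rightarrow> bool" for a where
  zero: "comb_span a (\<lambda>x. 0)"
| plus: "comb_span a m \<Longrightarrow> comb_span a (\<lambda>x. c * zw r s a x + m x)"

lemma comb_span_explicit:
  "comb_span a m \<Longrightarrow> \<exists>(k::nat) c r s. \<forall>x. m x = (\<Sum>i<k. c i * zw (r i) (s i) a x)"
proof (induction rule: comb_span.induct)
  case zero
  show ?case by (intro exI[of _ "0::nat"]) simp
next
  case (plus m c0 r0 s0)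
  then obtain k :: nat and c r s where m: "\<And>x. m x = (\<Sum>i<k. c i * zw (r i) (s i) a x)" by blast
  show ?case
    by (intro exI[of _ "Suc k"] exI[of _ "case_nat c0 c"] exI[of _ "case_nat r0 r"] exI[of _ "case_nat s0 s"] allI)
       (simp only: sum.lessThan_Suc_shift, simp add: m)
qed

lemma comb_span_add: "comb_span a m \<Longrightarrow> comb_span a m' \<Longrightarrow> comb_span a (\<lambda>x. m x + m' x)"
proof (induction rule: comb_span.induct)
  case (plus m c r s)
  then show ?case using comb_span.plus[of a "\<lambda>x. m x + m' x" c r s] by (simp add: add.assoc)
qed simp

lemma comb_span_zw: "comb_span a (\<lambda>x. c * zw r s a x)"
  using comb_span.plus[OF comb_span.zero, of a c r s] by simp

lemma comb_span_sum: "(\<And>i. i \<in> I \<Longrightarrow> comb_span a (m i)) \<Longrightarrow> comb_span a (\<lambda>x. \<Sum>i\<in>I. m i x)"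
  by (induction I rule: infinite_finite_induct) (auto intro: comb_span.zero comb_span_add)

text \<open>The remainder modulo \<open>q\<close> of the position \<open>k\<close> in the lattice
  selects exactly one of the \<open>q\<close> sublattices of step \<open>q * b\<close>.\<close>

lemma zw_refine:
  assumes "b > 0" "q \<ge> (1::nat)"
  shows "zw r s b x = (\<Sum>l<q. zw r (s + real l * b) (real q * b) x)"
proof (cases "\<exists>k::int. x = s + of_int k * b")
  case False
  have "zw r (s + real l * b) (real q * b) x = 0" for l
  proof (rule ccontr)
    assume "zw r (s + real l * b) (real q * b) x \<noteq> 0"
    then obtain j :: int where "x = s + real l * b + of_int j * (real q * b)" unfolding zw_nonzero_iff by blast
    then have "x = s + of_int (int l + j * int q) * b" by (simp add: algebra_simps)
    then show False using False by blast
  qed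
  then show ?thesis using False by (simp add: zw_def)
next
  case True
  then obtain k :: int where k: "x = s + of_int k * b" by blast
  define l0 where "l0 = nat (k mod int q)"
  have l0: "l0 < q" "int l0 = k mod int q" using assms(2) by (auto simp: l0_def nat_less_iff)
  have iff: "(\<exists>j::int. x = s + real l * b + of_int j * (real q * b)) \<longleftrightarrow> l = l0" if l: "l < q" for l
  proof
    assume "\<exists>j::int. x = s + real l * b + of_int j * (real q * b)"
    then obtain j :: int where "x = s + real l * b + of_int j * (real q * b)" by blast
    then have "of_int k * b = of_int (int l + j * int q) * b" using k by (simp add: algebra_simps)
    then have "real_of_int k = of_int (int l + j * int q)" using assms(1) by simp
    then have "k = int l + j * int q" by (simp only: of_int_eq_iff)
    then have "k mod int q = int l" using l by simp
    then show "l = l0" using l0(2) by simp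
  next
    assume "l = l0"
    moreover have "k = int l0 + (k div int q) * int q" using l0(2) by simp
    then have "real_of_int k = of_int (int l0 + (k div int q) * int q)" by simp
    then have "x = s + real l0 * b + of_int (k div int q) * (real q * b)" unfolding k by (simp add: algebra_simps)
    ultimately show "\<exists>j::int. x = s + real l * b + of_int j * (real q * b)" by blast
  qed
  have "(\<Sum>l<q. zw r (s + real l * b) (real q * b) x) = (\<Sum>l<q. if l = l0 then ee (r * x) else 0)"
    unfolding zw_def by (intro sum.cong refl) (use iff in auto)
  also have "\<dots> = ee (r * x)" using l0(1) by simp
  finally show ?thesis using True by (simp add: zw_def)
qed

lemma comb_span_refine: "comb_span b m \<Longrightarrow> b > 0 \<Longrightarrow> q \<ge> 1 \<Longrightarrow> comb_span (real q * b) m"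
proof (induction rule: comb_span.induct)
  case (plus m c r s)
  have "comb_span (real q * b) (\<lambda>x. \<Sum>l<q. c * zw r (s + real l * b) (real q * b) x)"
    by (intro comb_span_sum comb_span_zw)
  then have "comb_span (real q * b) (\<lambda>x. c * zw r s b x)"
    unfolding zw_refine[OF plus.prems] by (simp add: sum_distrib_left)
  then show ?case using plus by (intro comb_span_add) auto
qed (rule comb_span.zero)

section \<open>Locally finite weights\<close>

text \<open>Sums of separated weights need not be separated; local finiteness survives sums and
  still allows weights to be recovered from test functions by isolating bumps.\<close>

definition locally_finite :: "(real \<Rightarrow> complex) \<Rightarrow> bool" where
  "locally_finite e \<longleftrightarrow> (\<forall>a b. finite (supp e \<inter> {a..b}))"

lemma locally_finite_separated: "separated d (supp e) \<Longrightarrow> locally_finite e"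
  unfolding locally_finite_def using separated_finite(1) by blast

lemma locally_finite_cmult: "locally_finite e \<Longrightarrow> locally_finite (\<lambda>x. c * e x)"
  unfolding locally_finite_def
proof (intro allI)
  fix a b assume "\<forall>a b. finite (supp e \<inter> {a..b})"
  then have "finite (supp e \<inter> {a..b})" by blast
  then show "finite (supp (\<lambda>x. c * e x) \<inter> {a..b})" by (rule finite_subset[rotated]) (auto simp: supp_def)
qed

lemma locally_finite_add: assumes "locally_finite e" "locally_finite e'" shows "locally_finite (\<lambda>x. e x + e' x)"
  unfolding locally_finite_def
proof (intro allI)
  fix a b
  have "finite ((supp e \<inter> {a..b}) \<union> (supp e' \<inter> {a..b}))" using assms unfolding locally_finite_def by blast
  then show "finite (supp (\<lambda>x. e x + e' x) \<inter> {a..b})"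
    by (rule finite_subset[rotated]) (auto simp: supp_def)
qed

lemma locally_finite_sum: "(\<And>i. i \<in> I \<Longrightarrow> locally_finite (e i)) \<Longrightarrow> locally_finite (\<lambda>x. \<Sum>i\<in>I. e i x)"
proof (induction I rule: infinite_finite_induct)
  case (insert i I)
  then show ?case by (simp add: locally_finite_add)
qed (auto simp: locally_finite_def supp_def)

lemma locally_finite_shift: assumes "locally_finite e" shows "locally_finite (\<lambda>x. e (x + c))"
  unfolding locally_finite_def
proof (intro allI)
  fix a b
  have "supp (\<lambda>x. e (x + c)) \<inter> {a..b} = (\<lambda>y. y - c) ` (supp e \<inter> {a + c..b + c})"
  proof
    show "supp (\<lambda>x. e (x + c)) \<inter> {a..b} \<subseteq> (\<lambda>y. y - c) ` (supp e \<inter> {a + c..b + c})"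
    proof
      fix x assume "x \<in> supp (\<lambda>x. e (x + c)) \<inter> {a..b}"
      then show "x \<in> (\<lambda>y. y - c) ` (supp e \<inter> {a + c..b + c})"
        by (intro image_eqI[where x="x + c"]) (auto simp: supp_def)
    qed
  qed (auto simp: supp_def)
  then show "finite (supp (\<lambda>x. e (x + c)) \<inter> {a..b})" using assms by (simp add: locally_finite_def)
qed

lemma locally_finite_summable:
  assumes "locally_finite e" "Cc f" shows "(\<lambda>x. e x * f x) summable_on UNIV"
proof -
  obtain R where R: "\<And>x. f x \<noteq> 0 \<Longrightarrow> -R \<le> x \<and> x \<le> R" using CcE'[OF assms(2)] by metis
  have "{x \<in> UNIV. e x * f x \<noteq> 0} \<subseteq> supp e \<inter> {-R..R}" using R by (auto simp: supp_def)
  moreover have "finite (supp e \<inter> {-R..R})" using assms(1) unfolding locally_finite_def by blast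
  ultimately show ?thesis by (intro finite_nonzero_values_imp_summable_on) (rule finite_subset)
qed

lemma atomic_zero_imp_zero:
  assumes lf: "locally_finite e" and z: "\<And>f. testfun f \<Longrightarrow> atomic e f = 0"
  shows "e x = 0"
proof (rule ccontr)
  assume nz: "e x \<noteq> 0"
  have "finite (supp e \<inter> {x - 1..x + 1})" using lf unfolding locally_finite_def by blast
  then obtain r where r: "r > 0" "\<And>y. y \<in> supp e \<inter> {x - 1..x + 1} \<Longrightarrow> y \<noteq> x \<Longrightarrow> r \<le> dist x y"
    using finite_set_avoid[of "supp e \<inter> {x - 1..x + 1}" x] by auto
  define h where "h = min r 1"
  have h: "h > 0" "h \<le> r" "h \<le> 1" using r(1) by (auto simp: h_def)
  have "atomic e (cbump x h) = infsum (\<lambda>y. e y * cbump x h y) {x}"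
    unfolding atomic_def
  proof (rule infsum_cong_neutral)
    fix y assume y: "y \<in> UNIV - {x}"
    show "e y * cbump x h y = 0"
    proof (rule ccontr)
      assume "e y * cbump x h y \<noteq> 0"
      then have "y \<in> supp e" "\<bar>y - x\<bar> < h" using cbump_nonzero_iff[OF h(1)] by (auto simp: in_supp)
      moreover have "y \<in> {x - 1..x + 1}" using calculation(2) h by auto
      ultimately show False using r(2)[of y] y h by (auto simp: dist_real_def abs_minus_commute)
    qed
  qed auto
  then have "atomic e (cbump x h) = e x" by simp
  then show False using z[OF testfun_cbump[OF h(1)]] nz by simp
qed

lemma atomic_weight_sum:
  assumes "\<And>i. i \<in> I \<Longrightarrow> (\<lambda>x. w i x * f x) summable_on UNIV"
  shows "atomic (\<lambda>x. \<Sum>i\<in>I. c i * w i x) f = (\<Sum>i\<in>I. c i * atomic (w i) f)"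
proof -
  have "atomic (\<lambda>x. \<Sum>i\<in>I. c i * w i x) f = (\<Sum>\<^sub>\<infinity>x. \<Sum>i\<in>I. c i * (w i x * f x))"
    unfolding atomic_def by (simp add: sum_distrib_right mult.assoc)
  also have "\<dots> = (\<Sum>i\<in>I. \<Sum>\<^sub>\<infinity>x. c i * (w i x * f x))"
    by (rule infsum_finite_sum(1)) (rule summable_on_cmult_right[OF assms])
  also have "\<dots> = (\<Sum>i\<in>I. c i * atomic (w i) f)" unfolding atomic_def by (simp add: infsum_cmult_right')
  finally show ?thesis .
qed

lemma atomic_diff:
  assumes "(\<lambda>x. v x * f x) summable_on UNIV" "(\<lambda>x. w x * f x) summable_on UNIV"
  shows "atomic (\<lambda>x. v x - w x) f = atomic v f - atomic w f"
proof -
  have "atomic (\<lambda>x. v x - w x) f = (\<Sum>\<^sub>\<infinity>x. v x * f x + (- (w x * f x)))"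
    unfolding atomic_def by (simp add: left_diff_distrib)
  also have "\<dots> = atomic v f + (\<Sum>\<^sub>\<infinity>x. - (w x * f x))"
    unfolding atomic_def by (rule infsum_add) (use assms in \<open>auto simp: summable_on_uminus\<close>)
  finally show ?thesis unfolding atomic_def by (simp add: infsum_uminus)
qed

lemma atomic_translate: "atomic m (\<lambda>x. f (x + c)) = atomic (\<lambda>y. m (y - c)) f"
  unfolding atomic_def
  by (rule infsum_reindex_bij_witness[of UNIV "\<lambda>y. y - c" "\<lambda>x. x + c"]) auto

text \<open>A vanishing transform is a spectral gap of arbitrary length \<open>a\<close>, and the
  density that it forces grows with \<open>a\<close> beyond what a \<open>d\<close>-separated set
  can have.\<close>

lemma ft_injective:
  assumes sep: "separated d (supp e)" and bd: "\<And>x. norm (e x) \<le> B"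
    and z: "\<And>f. testfun f \<Longrightarrow> atomic e (ft f) = 0"
  shows "e x = 0"
proof (rule ccontr)
  assume nz: "e x \<noteq> 0"
  have d: "d > 0" using separated_pos[OF sep] .
  \<comment> \<open>The first entry makes \<open>min 1 (a * d / 128) = 1\<close>, so the logarithm
    in \<open>gap_density\<close> becomes \<open>ln 2 \<le> 1\<close>; the second then gives a
    density of at least \<open>2 / d + 1\<close>.\<close>
  define a where "a = max (128 / d) (64 * (2 / d + 1))"
  have a1: "a \<ge> 128 / d" "a \<ge> 64 * (2 / d + 1)" by (simp_all add: a_def)
  moreover have "128 / d > 0" using d by simp
  ultimately have a: "a \<ge> 128 / d" "a \<ge> 64 * (2 / d + 1)" "a > 0" by linarith+
  have g: "gap_density d a \<ge> 2 / d + 1"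
  proof -
    have "a * d / 128 \<ge> 1" using a(1) d by (simp add: field_simps)
    then have m: "min 1 (a * d / 128) = 1" by simp
    have "ln (2::real) \<le> 1" using ln_add_one_self_le_self[of "1::real"] by simp
    then have "64 * ln (2::real) \<le> 64" by simp
    moreover have "64 * ln (2::real) > 0" by simp
    ultimately have "a / 64 \<le> a / (64 * ln 2)" using a(3) by (intro divide_left_mono) auto
    moreover have "a / 64 \<ge> 2 / d + 1" using a(2) by simp
    moreover have "a \<ge> a / 64" using a(3) by simp
    ultimately show ?thesis unfolding gap_density_def m by simp
  qed
  have "annihilates e 0 (0 + a)" unfolding annihilates_def using z by blast
  then obtain T0 where T0: "\<And>T. T \<ge> T0 \<Longrightarrow> gap_density d a * T < card (supp e \<inter> {-T..T})"
    using spectral_gap_density[OF d a(3) sep bd _ nz] by blast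
  define T where "T = max T0 1"
  have "gap_density d a * T < 2 * T / d + 1"
  proof -
    have "T \<ge> T0" "T \<ge> 1" by (simp_all add: T_def)
    then show ?thesis using T0[of T] separated_finite(2)[OF sep, of "-T" T] by simp
  qed
  moreover have "(2 / d + 1) * T \<le> gap_density d a * T" using g by (intro mult_right_mono) (auto simp: T_def)
  moreover have "2 * T / d + 1 \<le> (2 / d + 1) * T" by (simp add: algebra_simps T_def)
  ultimately show False by linarith
qed

section \<open>Residues modulo a period\<close>

definition residue :: "real \<Rightarrow> real \<Rightarrow> real" where
  "residue b x = x - of_int \<lfloor>x / b\<rfloor> * b"

lemma residue_bounds: assumes "b > 0" shows "0 \<le> residue b x" "residue b x < b"
proof -
  have "of_int \<lfloor>x / b\<rfloor> \<le> x / b" "x / b < of_int \<lfloor>x / b\<rfloor> + 1" by linarith+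
  then have "of_int \<lfloor>x / b\<rfloor> * b \<le> x" "x < (of_int \<lfloor>x / b\<rfloor> + 1) * b"
    using assms pos_le_divide_eq pos_divide_less_eq by blast+
  then show "0 \<le> residue b x" "residue b x < b" by (simp_all add: residue_def algebra_simps)
qed

lemma residue_decomp: "x = residue b x + of_int \<lfloor>x / b\<rfloor> * b"
  by (simp add: residue_def)

lemma residue_unique:
  assumes "b > 0" "x = t + of_int k * b" "0 \<le> t" "t < b" shows "residue b x = t" "\<lfloor>x / b\<rfloor> = k"
proof -
  have "x / b = of_int k + t / b" using assms by (simp add: add_divide_distrib)
  moreover have "0 \<le> t / b" "t / b < 1" using assms by auto
  ultimately show "\<lfloor>x / b\<rfloor> = k" by linarith
  then show "residue b x = t" using assms by (simp add: residue_def)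
qed

lemma residue_add: assumes "b > 0" shows "residue b (x + of_int k * b) = residue b x"
proof (rule residue_unique(1)[OF assms _ residue_bounds[OF assms]])
  show "x + of_int k * b = residue b x + of_int (\<lfloor>x / b\<rfloor> + k) * b"
    by (simp add: residue_def algebra_simps)
qed

section \<open>Structure of eigenmeasures\<close>

context eigen_atoms
begin

text \<open>On the support, restriction to one residue class is multiplication by a polynomial in
  the character \<open>ee (x / b)\<close>, so the transform of the restriction is a finite
  combination \<open>e\<close> of translates of \<open>m\<close>, still locally finite. As the
  restriction lives on a single coset of \<open>b\<close> times the integers, \<open>e\<close> is
  \<open>1 / b\<close>-periodic up to a phase, hence a finite combination of combs; transforming
  back gives combs of period \<open>b\<close>.\<close>

lemma residue_class_comb:
  assumes b: "b > 0" and fin: "finite (residue b ` supp m)" and \<theta>: "\<theta> \<in> residue b ` supp m"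
  shows "comb_span b (\<lambda>x. if residue b x = \<theta> then m x else 0)"
proof -
  define F where "F = residue b ` supp m"
  define mt where "mt x = (if residue b x = \<theta> then m x else 0)" for x
  obtain B where B: "B > 0" "\<And>x. norm (m x) \<le> B" using bounded_weights by blast
  have F: "0 \<le> t \<and> t < b" if "t \<in> F" for t using that residue_bounds[OF b] unfolding F_def by auto
  have inj: "t = u" if "t \<in> F" "u \<in> F" "ee (t / b) = ee (u / b)" for t u
  proof -
    have "ee (t / b - u / b) = 1" using that(3) by (simp add: ee_diff)
    then obtain k :: int where k: "t / b - u / b = of_int k" unfolding ee_eq_1_iff by blast
    have "0 \<le> t / b" "t / b < 1" "0 \<le> u / b" "u / b < 1" using F[OF that(1)] F[OF that(2)] b by auto
    then have "\<bar>real_of_int k\<bar> < 1" using k by linarith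
    then have "k = 0" by linarith
    then show ?thesis using k b by simp
  qed
  \<comment> \<open>The Lagrange polynomial with value \<open>1\<close> at
    \<open>ee (\<theta> / b)\<close> and \<open>0\<close> at \<open>ee (t / b)\<close> for the other
    residues \<open>t\<close>.\<close>
  define P where "P = (\<Prod>t\<in>F - {\<theta>}. smult (1 / (ee (\<theta> / b) - ee (t / b))) [:- ee (t / b), 1:])"
  have finF: "finite F" unfolding F_def by (rule fin)
  have P1: "poly P (ee (t / b)) = (if t = \<theta> then 1 else 0)" if t: "t \<in> F" for t
  proof (cases "t = \<theta>")
    case True
    have "poly (smult (1 / (ee (\<theta> / b) - ee (u / b))) [:- ee (u / b), 1:]) (ee (\<theta> / b)) = 1" if "u \<in> F - {\<theta>}" for u
    proof -
      have "ee (\<theta> / b) \<noteq> ee (u / b)" using inj[of u \<theta>] that \<theta> unfolding F_def by auto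
      moreover have "poly (smult (1 / (A - B)) [:- B, 1:]) A = 1" if "A \<noteq> B" for A B :: complex
      proof -
        have "poly (smult (1 / (A - B)) [:- B, 1:]) A = (1 / (A - B)) * (A - B)" unfolding poly_smult by simp
        then show ?thesis using that by simp
      qed
      ultimately show ?thesis by blast
    qed
    then have "poly P (ee (\<theta> / b)) = 1" unfolding P_def poly_prod by (intro prod.neutral) blast
    then show ?thesis using True by simp
  next
    case False
    then have "t \<in> F - {\<theta>}" using t by blast
    then show ?thesis unfolding P_def poly_prod using False finF
      by (simp add: prod_zero_iff) blast
  qed
  define a where "a = coeff P"
  define D where "D = degree P"
  have mt: "mt x = (\<Sum>i\<le>D. a i * (m x * ee (real i * (x / b))))" for x
  proof (cases "m x = 0")
    case False
    then have xF: "residue b x \<in> F" unfolding F_def by (simp add: in_supp)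
    have "x / b = residue b x / b + of_int \<lfloor>x / b\<rfloor>" using b by (simp add: residue_def diff_divide_distrib)
    then have "ee (x / b) = ee (residue b x / b)" by (metis ee_add_int(1))
    then have "poly P (ee (x / b)) = (if residue b x = \<theta> then 1 else 0)" using P1[OF xF] by simp
    moreover have "poly P (ee (x / b)) = (\<Sum>i\<le>D. a i * ee (real i * (x / b)))"
      unfolding poly_altdef a_def D_def by (simp add: ee_power)
    ultimately have "(if residue b x = \<theta> then 1 else 0) = (\<Sum>i\<le>D. a i * ee (real i * (x / b)))" by simp
    then have "m x * (if residue b x = \<theta> then 1 else 0) = m x * (\<Sum>i\<le>D. a i * ee (real i * (x / b)))" by simp
    then show ?thesis unfolding mt_def sum_distrib_left by (simp add: mult_ac split: if_splits)
  qed (simp add: mt_def)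
  define e where "e y = \<kappa> * (\<Sum>i\<le>D. a i * m (y - real i / b))" for y
  have sepm: "separated d (supp (\<lambda>y. m (y - c)))" for c
    using sep unfolding separated_def supp_def by (smt (verit) mem_Collect_eq)
  have lfm: "locally_finite (\<lambda>y. m (y - c))" for c by (rule locally_finite_separated[OF sepm])
  have lfe: "locally_finite e" unfolding e_def by (intro locally_finite_cmult locally_finite_sum lfm)
  have rele: "atomic mt (ft \<phi>) = atomic e \<phi>" if \<phi>: "testfun \<phi>" for \<phi>
  proof -
    have s: "(\<lambda>x. (m x * ee (real i * (x / b))) * ft \<phi> x) summable_on UNIV" for i
    proof (rule abs_summable_summable)
      show "(\<lambda>x. norm (m x * ee (real i * (x / b)) * ft \<phi> x)) summable_on UNIV"
        using atomic_abs_summable[OF sep grow rapid_ft[OF \<phi>]] by (simp add: norm_mult)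
    qed
    have "atomic mt (ft \<phi>) = (\<Sum>i\<le>D. a i * atomic (\<lambda>x. m x * ee (real i * (x / b))) (ft \<phi>))"
      unfolding mt by (rule atomic_weight_sum) (rule s)
    also have "\<dots> = (\<Sum>i\<le>D. a i * (\<kappa> * atomic (\<lambda>y. m (y - real i / b)) \<phi>))"
    proof (intro sum.cong refl arg_cong[where f="\<lambda>z. _ * z"])
      fix i
      have "m x * ee (real i * (x / b)) * ft \<phi> x = m x * ft (\<lambda>y. \<phi> (y - (- (real i / b)))) x" for x
        unfolding ft_shift[OF testfun_Cc[OF \<phi>]] by simp
      then have "atomic (\<lambda>x. m x * ee (real i * (x / b))) (ft \<phi>) = atomic m (ft (\<lambda>y. \<phi> (y - (- (real i / b)))))"
        unfolding atomic_def by presburger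
      also have "\<dots> = \<kappa> * atomic m (\<lambda>y. \<phi> (y - (- (real i / b))))" by (rule rel[OF testfun_shift[OF \<phi>]])
      also have "atomic m (\<lambda>y. \<phi> (y - (- (real i / b)))) = atomic (\<lambda>y. m (y - real i / b)) \<phi>"
        using atomic_translate[of m \<phi> "real i / b"] by simp
      finally show "atomic (\<lambda>x. m x * ee (real i * (x / b))) (ft \<phi>) = \<kappa> * atomic (\<lambda>y. m (y - real i / b)) \<phi>" .
    qed
    also have "\<dots> = \<kappa> * (\<Sum>i\<le>D. a i * atomic (\<lambda>y. m (y - real i / b)) \<phi>)" by (simp add: sum_distrib_left mult_ac)
    also have "(\<Sum>i\<le>D. a i * atomic (\<lambda>y. m (y - real i / b)) \<phi>) = atomic (\<lambda>y. \<Sum>i\<le>D. a i * m (y - real i / b)) \<phi>"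
      by (rule atomic_weight_sum[symmetric]) (rule locally_finite_summable[OF lfm testfun_Cc[OF \<phi>]])
    also have "\<kappa> * atomic (\<lambda>y. \<Sum>i\<le>D. a i * m (y - real i / b)) \<phi> = atomic e \<phi>"
      unfolding e_def atomic_def by (simp add: mult.assoc infsum_cmult_right')
    finally show ?thesis .
  qed
  have mtres: "x = \<theta> + of_int \<lfloor>x / b\<rfloor> * b" if "mt x \<noteq> 0" for x
    using that residue_decomp[of x b] unfolding mt_def by (simp split: if_splits)
  \<comment> \<open>Translating a test function by \<open>1 / b\<close> multiplies its transform by
    the character \<open>ee (- (1 / b * x))\<close>, which is constant on the coset of
    \<open>\<theta>\<close>.\<close>
  have period1: "e (y + 1 / b) = ee (- (\<theta> / b)) * e y" for y
  proof -
    define e' where "e' y = e (y + 1 / b) - ee (- (\<theta> / b)) * e y" for y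
    have lf1: "locally_finite (\<lambda>y. e (y + 1 / b))" by (rule locally_finite_shift[OF lfe])
    have lf2: "locally_finite (\<lambda>y. ee (- (\<theta> / b)) * e y)" by (rule locally_finite_cmult[OF lfe])
    have "locally_finite e'"
      unfolding e'_def using locally_finite_add[OF lf1 locally_finite_cmult[OF lf2, of "-1"]] by simp
    moreover have "atomic e' \<phi> = 0" if \<phi>: "testfun \<phi>" for \<phi>
    proof -
      have "atomic e' \<phi> = atomic (\<lambda>y. e (y + 1 / b)) \<phi> - atomic (\<lambda>y. ee (- (\<theta> / b)) * e y) \<phi>"
        unfolding e'_def by (intro atomic_diff locally_finite_summable lf1 lf2 testfun_Cc[OF \<phi>])
      also have "atomic (\<lambda>y. ee (- (\<theta> / b)) * e y) \<phi> = ee (- (\<theta> / b)) * atomic e \<phi>"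
        unfolding atomic_def by (simp add: mult.assoc infsum_cmult_right')
      also have "atomic (\<lambda>y. e (y + 1 / b)) \<phi> = atomic e (\<lambda>x. \<phi> (x - 1 / b))"
        using atomic_translate[of e \<phi> "- (1 / b)"] by simp
      also have "\<dots> = atomic mt (ft (\<lambda>x. \<phi> (x - 1 / b)))" by (rule rele[OF testfun_shift[OF \<phi>], symmetric])
      also have "\<dots> = (\<Sum>\<^sub>\<infinity>x. ee (- (\<theta> / b)) * (mt x * ft \<phi> x))"
        unfolding atomic_def
      proof (rule infsum_cong)
        fix x
        show "mt x * ft (\<lambda>x. \<phi> (x - 1 / b)) x = ee (- (\<theta> / b)) * (mt x * ft \<phi> x)"
        proof (cases "mt x = 0")
          case False
          have "- (1 / b * x) = - (\<theta> / b) + of_int (- \<lfloor>x / b\<rfloor>)" using arg_cong[OF mtres[OF False], of "\<lambda>x. - (1 / b * x)"] b by (simp add: field_simps)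
          then have "ee (- (1 / b * x)) = ee (- (\<theta> / b))" by (metis ee_add_int(1))
          then show ?thesis unfolding ft_shift[OF testfun_Cc[OF \<phi>]] by simp
        qed simp
      qed
      also have "\<dots> = ee (- (\<theta> / b)) * atomic mt (ft \<phi>)" unfolding atomic_def by (rule infsum_cmult_right')
      also have "\<dots> = ee (- (\<theta> / b)) * atomic e \<phi>" by (simp only: rele[OF \<phi>])
      finally show ?thesis by simp
    qed
    ultimately have "e' y = 0" by (rule atomic_zero_imp_zero)
    then show ?thesis by (simp add: e'_def)
  qed
  have periodn: "e (y + real k * (1 / b)) = ee (- (\<theta> * real k / b)) * e y" for y and k :: nat
  proof (induction k)
    case (Suc k)
    have "e (y + real (Suc k) * (1 / b)) = e ((y + real k * (1 / b)) + 1 / b)" by (simp add: algebra_simps add_divide_distrib)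
    also have "\<dots> = (ee (- (\<theta> / b)) * ee (- (\<theta> * real k / b))) * e y" unfolding period1 Suc by simp
    also have "ee (- (\<theta> / b)) * ee (- (\<theta> * real k / b)) = ee (- (\<theta> * real (Suc k) / b))"
      unfolding ee_add[symmetric] by (rule arg_cong[where f=ee]) (simp add: algebra_simps add_divide_distrib)
    finally show ?case .
  qed simp
  have period: "e (y + of_int k * (1 / b)) = ee (- (\<theta> * of_int k / b)) * e y" for y and k :: int
  proof (cases "k \<ge> 0")
    case True
    then show ?thesis using periodn[of y "nat k"] by simp
  next
    case False
    define n where "n = nat (- k)"
    have k: "of_int k = - real n" using False by (simp add: n_def)
    have "e y = ee (- (\<theta> * real n / b)) * e (y + of_int k * (1 / b))" using periodn[of "y + of_int k * (1 / b)" n] by (simp add: k)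
    then have "ee (\<theta> * real n / b) * e y = (ee (\<theta> * real n / b) * ee (- (\<theta> * real n / b))) * e (y + of_int k * (1 / b))" by simp
    then show ?thesis by (simp add: k)
  qed
  \<comment> \<open>The atoms of \<open>e\<close> in the fundamental domain
    \<open>[0, 1 / b)\<close>; the right end point represents the same class as \<open>0\<close> and
    is removed.\<close>
  define X where "X = supp e \<inter> {0..1 / b} - {1 / b}"
  have finX: "finite X" unfolding X_def using lfe unfolding locally_finite_def by blast
  have b': "1 / b > 0" using b by simp
  have Xb: "0 \<le> t \<and> t < 1 / b" if "t \<in> X" for t using that unfolding X_def by auto
  have e_eq: "e y = (\<Sum>t\<in>X. (e t * ee (\<theta> * t)) * zw (- \<theta>) t (1 / b) y)" for y
  proof -
    define t0 where "t0 = residue (1 / b) y"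
    define k where "k = \<lfloor>y / (1 / b)\<rfloor>"
    have y: "y = t0 + of_int k * (1 / b)" unfolding t0_def k_def by (rule residue_decomp)
    have t0: "0 \<le> t0" "t0 < 1 / b" unfolding t0_def using residue_bounds[OF b'] by auto
    have z: "zw (- \<theta>) t (1 / b) y = (if t = t0 then ee (- \<theta> * y) else 0)" if t: "t \<in> X" for t
    proof (cases "t = t0")
      case True
      have "\<exists>j::int. y = t + of_int j * (1 / b)" unfolding True using y by blast
      then show ?thesis unfolding zw_def using True by simp
    next
      case False
      have "\<not> (\<exists>j::int. y = t + of_int j * (1 / b))"
      proof
        assume "\<exists>j::int. y = t + of_int j * (1 / b)"
        then obtain j :: int where "y = t + of_int j * (1 / b)" by blast
        then have "t0 = t" unfolding t0_def using residue_unique(1)[OF b'] Xb[OF t] by blast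
        then show False using False by simp
      qed
      then show ?thesis unfolding zw_def using False by simp
    qed
    have "(\<Sum>t\<in>X. (e t * ee (\<theta> * t)) * zw (- \<theta>) t (1 / b) y) = (\<Sum>t\<in>X. if t = t0 then (e t * ee (\<theta> * t)) * ee (- \<theta> * y) else 0)"
      by (intro sum.cong refl) (simp add: z)
    also have "\<dots> = (if t0 \<in> X then (e t0 * ee (\<theta> * t0)) * ee (- \<theta> * y) else 0)" using finX by simp
    also have "\<dots> = (e t0 * ee (\<theta> * t0)) * ee (- \<theta> * y)" using t0 by (auto simp: X_def in_supp)
    also have "\<dots> = (ee (\<theta> * t0) * ee (- \<theta> * y)) * e t0" by simp
    also have "ee (\<theta> * t0) * ee (- \<theta> * y) = ee (- (\<theta> * of_int k / b))"
      unfolding ee_add[symmetric] by (rule arg_cong[where f=ee]) (subst y, simp add: algebra_simps)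
    also have "ee (- (\<theta> * of_int k / b)) * e t0 = e y" using period[of t0 k] y by simp
    finally show ?thesis by simp
  qed
  \<comment> \<open>The combination of combs of period \<open>b\<close> whose transform is
    \<open>e\<close>; by \<open>ft_injective\<close> it coincides with \<open>mt\<close>.\<close>
  define n where "n x = (\<Sum>t\<in>X. (e t * of_real b) * zw t \<theta> b x)" for x
  have reln: "atomic n (ft \<phi>) = atomic e \<phi>" if \<phi>: "testfun \<phi>" for \<phi>
  proof -
    have "atomic n (ft \<phi>) = (\<Sum>t\<in>X. (e t * of_real b) * atomic (zw t \<theta> b) (ft \<phi>))"
      unfolding n_def by (rule atomic_weight_sum) (intro atomic_summable[OF separated_zw[OF b]] growth_zw rapid_ft \<phi>)
    also have "\<dots> = (\<Sum>t\<in>X. (e t * ee (\<theta> * t)) * atomic (zw (- \<theta>) t (1 / b)) \<phi>)"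
      unfolding poisson_zw[OF \<phi> b] using b by (intro sum.cong refl) (simp add: mult_ac)
    also have "\<dots> = atomic (\<lambda>y. \<Sum>t\<in>X. (e t * ee (\<theta> * t)) * zw (- \<theta>) t (1 / b) y) \<phi>"
      by (rule atomic_weight_sum[symmetric]) (intro atomic_summable[OF separated_zw[OF b']] growth_zw rapid_Cc testfun_Cc \<phi>)
    also have "(\<lambda>y. \<Sum>t\<in>X. (e t * ee (\<theta> * t)) * zw (- \<theta>) t (1 / b) y) = e" by (rule ext) (rule e_eq[symmetric])
    finally show ?thesis .
  qed
  have nz: "\<exists>k::int. x = \<theta> + of_int k * b" if "n x \<noteq> 0" for x
  proof (rule ccontr)
    assume "\<not> ?thesis"
    then have "zw t \<theta> b x = 0" for t unfolding zw_def by simp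
    then have "n x = 0" unfolding n_def by simp
    then show False using that by simp
  qed
  have seplat: "separated b (supp h)" if h: "\<And>x. h x \<noteq> 0 \<Longrightarrow> \<exists>k::int. x = \<theta> + of_int k * b" for h
  proof (rule separated_subset[OF separated_zw[OF b, of 0 \<theta>]])
    show "supp h \<subseteq> supp (zw 0 \<theta> b)" using h by (auto simp: supp_def zw_nonzero_iff)
  qed
  have mtz: "\<exists>k::int. x = \<theta> + of_int k * b" if "mt x \<noteq> 0" for x using mtres[OF that] by blast
  have bmt: "norm (mt x) \<le> B" for x unfolding mt_def using B by simp
  have bn: "norm (n x) \<le> (\<Sum>t\<in>X. norm (e t * of_real b))" for x
    unfolding n_def
  proof (rule sum_norm_le)
    fix t
    show "norm (e t * of_real b * zw t \<theta> b x) \<le> norm (e t * of_real b)"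
      using mult_left_mono[OF norm_zw_le[of t \<theta> b x], of "norm (e t * of_real b)"] by (simp add: norm_mult)
  qed
  have "mt x - n x = 0" for x
  proof (rule ft_injective[where e="\<lambda>x. mt x - n x"])
    show "separated b (supp (\<lambda>x. mt x - n x))"
    proof (rule seplat)
      fix x assume "mt x - n x \<noteq> 0"
      then have "mt x \<noteq> 0 \<or> n x \<noteq> 0" by auto
      then show "\<exists>k::int. x = \<theta> + of_int k * b" using mtz nz by blast
    qed
    show "norm (mt x - n x) \<le> B + (\<Sum>t\<in>X. norm (e t * of_real b))" for x
      using norm_triangle_ineq4[of "mt x" "n x"] bmt[of x] bn[of x] by linarith
    fix \<phi> assume \<phi>: "testfun \<phi>"
    have "atomic (\<lambda>x. mt x - n x) (ft \<phi>) = atomic mt (ft \<phi>) - atomic n (ft \<phi>)"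
      using atomic_summable[OF seplat[OF mtz] growth_bounded[OF bmt] rapid_ft[OF \<phi>]]
        atomic_summable[OF seplat[OF nz] growth_bounded[OF bn] rapid_ft[OF \<phi>]] by (rule atomic_diff)
    then show "atomic (\<lambda>x. mt x - n x) (ft \<phi>) = 0" using rele[OF \<phi>] reln[OF \<phi>] by simp
  qed
  then have "mt = n" by (simp add: fun_eq_iff)
  moreover have "comb_span b n" unfolding n_def by (intro comb_span_sum comb_span_zw)
  ultimately have "comb_span b mt" by simp
  then show ?thesis unfolding mt_def .
qed

lemma comb_span_lattice: "\<exists>b>0. comb_span b m \<and> finite (residue b ` supp m)"
proof -
  obtain b F where b: "b > 0" and F: "finite F" "\<And>x. m x \<noteq> 0 \<Longrightarrow> \<exists>\<theta>\<in>F. \<exists>k::int. x = \<theta> + of_int k * b"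
    using support_lattice by blast
  have "residue b ` supp m \<subseteq> residue b ` F"
  proof
    fix y assume "y \<in> residue b ` supp m"
    then obtain x where x: "m x \<noteq> 0" "y = residue b x" by (auto simp: in_supp)
    then obtain \<theta> and k :: int where "\<theta> \<in> F" "x = \<theta> + of_int k * b" using F(2) by blast
    then show "y \<in> residue b ` F" using x residue_add[OF b] by auto
  qed
  then have fin: "finite (residue b ` supp m)" using F(1) finite_subset by blast
  have "m = (\<lambda>x. \<Sum>\<theta>\<in>residue b ` supp m. if residue b x = \<theta> then m x else 0)"
  proof
    fix x
    show "m x = (\<Sum>\<theta>\<in>residue b ` supp m. if residue b x = \<theta> then m x else 0)"
      using fin by (cases "m x = 0") (auto simp: in_supp)
  qed
  moreover have "comb_span b (\<lambda>x. \<Sum>\<theta>\<in>residue b ` supp m. if residue b x = \<theta> then m x else 0)"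
    by (intro comb_span_sum residue_class_comb[OF b fin])
  ultimately have "comb_span b m" by simp
  then show ?thesis using b fin by blast
qed

lemma infinite_support: "infinite (supp m)"
proof
  assume fin: "finite (supp m)"
  obtain R where R: "R > 0" "\<And>x. \<exists>p. m p \<noteq> 0 \<and> \<bar>p - x\<bar> \<le> R" using rel_dense by blast
  obtain S where S: "\<And>x. x \<in> supp m \<Longrightarrow> x \<le> S" using fin by (metis Max_ge)
  obtain p where "m p \<noteq> 0" "\<bar>p - (S + R + 1)\<bar> \<le> R" using R(2) by blast
  then show False using S[of p] by (auto simp: in_supp)
qed

text \<open>The support lies in finitely many cosets of \<open>b\<close> times the integers and, by
  the eigenvalue relation, in finitely many cosets of \<open>1 / b\<close> times the integers. As it
  is infinite, two distinct points share both cosets, so their difference is an integer multiple of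
  \<open>b\<close> and of \<open>1 / b\<close>, which makes \<open>b^2\<close> rational.\<close>

theorem comb_structure: "\<exists>n::nat. n \<ge> 1 \<and> comb_span (sqrt (real n)) m"
proof -
  obtain b where b: "b > 0" and cs: "comb_span b m" and fin: "finite (residue b ` supp m)" using comb_span_lattice by blast
  have b': "1 / b > 0" using b by simp
  obtain k :: nat and c r s where m: "\<And>x. m x = (\<Sum>i<k. c i * zw (r i) (s i) b x)" using comb_span_explicit[OF cs] by blast
  define e where "e x = \<kappa> * m x - (\<Sum>i<k. (c i * (ee (r i * s i) / of_real b)) * zw (- s i) (r i) (1 / b) x)" for x
  have lf1: "locally_finite (\<lambda>x. \<kappa> * m x)" by (intro locally_finite_cmult locally_finite_separated[OF sep])
  have lf2: "locally_finite (\<lambda>x. \<Sum>i<k. (c i * (ee (r i * s i) / of_real b)) * zw (- s i) (r i) (1 / b) x)"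
    by (intro locally_finite_sum locally_finite_cmult locally_finite_separated[OF separated_zw[OF b']])
  have "locally_finite e" unfolding e_def using locally_finite_add[OF lf1 locally_finite_cmult[OF lf2, of "-1"]] by simp
  moreover have "atomic e \<phi> = 0" if \<phi>: "testfun \<phi>" for \<phi>
  proof -
    have "atomic e \<phi> = atomic (\<lambda>x. \<kappa> * m x) \<phi> - atomic (\<lambda>x. \<Sum>i<k. (c i * (ee (r i * s i) / of_real b)) * zw (- s i) (r i) (1 / b) x) \<phi>"
      unfolding e_def by (intro atomic_diff locally_finite_summable lf1 lf2 testfun_Cc[OF \<phi>])
    also have "atomic (\<lambda>x. \<kappa> * m x) \<phi> = \<kappa> * atomic m \<phi>" unfolding atomic_def by (simp add: mult.assoc infsum_cmult_right')
    also have "\<dots> = atomic m (ft \<phi>)" using rel[OF \<phi>] by simp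
    also have "\<dots> = atomic (\<lambda>x. \<Sum>i<k. c i * zw (r i) (s i) b x) (ft \<phi>)"
      by (rule arg_cong[where f="\<lambda>w. atomic w (ft \<phi>)"], rule ext, rule m)
    also have "\<dots> = (\<Sum>i<k. c i * atomic (zw (r i) (s i) b) (ft \<phi>))"
      by (rule atomic_weight_sum) (intro atomic_summable[OF separated_zw[OF b]] growth_zw rapid_ft \<phi>)
    also have "\<dots> = (\<Sum>i<k. (c i * (ee (r i * s i) / of_real b)) * atomic (zw (- s i) (r i) (1 / b)) \<phi>)"
      unfolding poisson_zw[OF \<phi> b] by (simp add: mult.assoc)
    also have "\<dots> = atomic (\<lambda>x. \<Sum>i<k. (c i * (ee (r i * s i) / of_real b)) * zw (- s i) (r i) (1 / b) x) \<phi>"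
      by (rule atomic_weight_sum[symmetric]) (intro atomic_summable[OF separated_zw[OF b']] growth_zw rapid_Cc testfun_Cc \<phi>)
    finally show ?thesis by simp
  qed
  ultimately have e0: "e x = 0" for x by (rule atomic_zero_imp_zero)
  have "\<exists>i<k. \<exists>j::int. x = r i + of_int j * (1 / b)" if x: "m x \<noteq> 0" for x
  proof (rule ccontr)
    assume neg: "\<not> ?thesis"
    have "zw (- s i) (r i) (1 / b) x = 0" if "i < k" for i using neg zw_nonzero_iff[of "- s i" "r i" "1 / b" x] that by blast
    then have "\<kappa> * m x = 0" using e0[of x] unfolding e_def by simp
    then show False using x \<kappa> by simp
  qed
  then obtain i where i: "\<And>x. m x \<noteq> 0 \<Longrightarrow> i x < k \<and> (\<exists>j::int. x = r (i x) + of_int j * (1 / b))" by metis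
  have "(\<lambda>x. (residue b x, i x)) ` supp m \<subseteq> (residue b ` supp m) \<times> {..<k}" using i by (auto simp: in_supp)
  then have "finite ((\<lambda>x. (residue b x, i x)) ` supp m)" using fin finite_subset by blast
  then have "\<not> inj_on (\<lambda>x. (residue b x, i x)) (supp m)" using infinite_support finite_imageD by blast
  then obtain x y where xy: "m x \<noteq> 0" "m y \<noteq> 0" "x \<noteq> y" "residue b x = residue b y" "i x = i y" by (auto simp: inj_on_def in_supp)
  define j where "j = \<lfloor>x / b\<rfloor> - \<lfloor>y / b\<rfloor>"
  have 1: "x - y = of_int j * b"
    using residue_decomp[of x b] residue_decomp[of y b] xy(4) unfolding j_def by (simp add: left_diff_distrib)
  obtain u v :: int where "x = r (i x) + of_int u * (1 / b)" "y = r (i y) + of_int v * (1 / b)" using i xy(1,2) by blast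
  then have 2: "x - y = of_int (u - v) * (1 / b)" using xy(5) by (simp add: diff_divide_distrib)
  define l where "l = u - v"
  have "(of_int j * b) * b = (of_int l * (1 / b)) * b" using 1 2 by (simp add: l_def)
  then have jl: "of_int j * b\<^sup>2 = of_int l" using b by (simp add: power2_eq_square)
  have j0: "j \<noteq> 0" using 1 xy(3) by auto
  define q where "q = nat \<bar>j\<bar>"
  define p where "p = nat \<bar>l\<bar>"
  have q1: "q \<ge> 1" using j0 by (simp add: q_def)
  have qp: "real q * b\<^sup>2 = real p"
  proof -
    have "\<bar>real_of_int j * b\<^sup>2\<bar> = \<bar>real_of_int l\<bar>" using jl by simp
    then show ?thesis by (simp add: q_def p_def abs_mult)
  qed
  have p1: "p \<ge> 1"
  proof -
    have "real p > 0" using qp q1 b by (metis mult_pos_pos of_nat_0_less_iff zero_less_power less_le_trans zero_less_one)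
    then show ?thesis by simp
  qed
  \<comment> \<open>From \<open>q * b^2 = p\<close> the period \<open>q * b\<close> has the square
    \<open>p * q\<close>; passing from \<open>b\<close> to the multiple \<open>q * b\<close> only
    splits the combs.\<close>
  have "real (p * q) = (real q * b)\<^sup>2" unfolding of_nat_mult qp[symmetric] by (simp add: power2_eq_square)
  then have "sqrt (real (p * q)) = real q * b" using b by simp
  moreover have "comb_span (real q * b) m" by (rule comb_span_refine[OF cs b q1])
  ultimately have "comb_span (sqrt (real (p * q))) m" by simp
  moreover have "p * q \<ge> 1" using p1 q1 by simp
  ultimately show ?thesis by blast
qed

end

section \<open>Eigenmeasures as weighted point masses\<close>

lemma uniformly_discrete_iff: "uniformly_discrete S \<longleftrightarrow> (\<exists>d. separated d S)"
  unfolding uniformly_discrete_def separated_def dist_real_def by blast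

lemma vd_pow_shift: "smooth f \<Longrightarrow> (vd ^^ b) (\<lambda>y. f (y - x)) = (\<lambda>y. (vd ^^ b) f (y - x))"
proof (induction b)
  case (Suc b)
  have "vd (\<lambda>y. (vd ^^ b) f (y - x)) = (\<lambda>y. vd ((vd ^^ b) f) (y - x))"
  proof (rule vd_eqI)
    fix y
    have "((\<lambda>y. (vd ^^ b) f (1 * y + (- x))) has_vector_derivative 1 *\<^sub>R vd ((vd ^^ b) f) (1 * y + (- x))) (at y)"
      by (intro has_vector_derivative_affine smooth_has_vector_derivative smooth_vd_pow Suc.prems)
    then show "((\<lambda>y. (vd ^^ b) f (y - x)) has_vector_derivative vd ((vd ^^ b) f) (y - x)) (at y)" by simp
  qed
  then show ?case using Suc by simp
qed simp

lemma one_plus_abs_le: "1 + \<bar>t\<bar> \<le> 2 * (1 + t\<^sup>2)" for t :: real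
proof -
  have "\<bar>t\<bar> \<le> 1 + t\<^sup>2" using sum_squares_bound[of "\<bar>t\<bar>" 1] by (simp add: power2_eq_square[symmetric])
  then show ?thesis by (smt (verit) zero_le_power2)
qed

text \<open>Because of \<open>\<bar>y\<bar> \<le> (1 + \<bar>x\<bar>) * (1 + \<bar>y -
  x\<bar>)\<close>, a translation by \<open>x\<close> costs at most a polynomial factor in
  \<open>x\<close>. This turns the continuity of a tempered distribution into polynomial growth of
  point masses.\<close>

lemma seminorm_shift_growth:
  assumes f: "testfun f" shows "\<exists>K\<ge>0. \<forall>x. seminorm_sum N (\<lambda>y. f (y - x)) \<le> K * (1 + x\<^sup>2) ^ N"
proof -
  have "\<exists>C. \<forall>y. (1 + y\<^sup>2) ^ a * norm ((vd ^^ b) f y) \<le> C" for a b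
  proof -
    have "testfun ((vd ^^ b) f)" by (induction b) (auto intro: testfun_vd f)
    then show ?thesis using rapid_Cc[OF testfun_Cc] unfolding rapid_def by blast
  qed
  then obtain C where C: "\<And>a b y. (1 + y\<^sup>2) ^ a * norm ((vd ^^ b) f y) \<le> C a b" by metis
  have C0: "C a b \<ge> 0" for a b using order_trans[OF _ C[of 0 a b]] by simp
  define K where "K = (\<Sum>a\<le>N. \<Sum>b\<le>N. 2 ^ a * 2 ^ a * C a b)"
  have "seminorm_sum N (\<lambda>y. f (y - x)) \<le> K * (1 + x\<^sup>2) ^ N" for x
  proof -
    have "(SUP y. \<bar>y\<bar> ^ a * norm ((vd ^^ b) (\<lambda>y. f (y - x)) y)) \<le> (2 ^ a * 2 ^ a * C a b) * (1 + x\<^sup>2) ^ N" if a: "a \<le> N" for a b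
    proof (rule cSUP_least)
      fix y
      define t where "t = y - x"
      have "\<bar>y\<bar> \<le> (1 + \<bar>x\<bar>) * (1 + \<bar>t\<bar>)"
      proof -
        have "\<bar>y\<bar> \<le> \<bar>t\<bar> + \<bar>x\<bar>" unfolding t_def by linarith
        moreover have "0 \<le> \<bar>x\<bar> * \<bar>t\<bar>" by simp
        moreover have "(1 + \<bar>x\<bar>) * (1 + \<bar>t\<bar>) = 1 + \<bar>t\<bar> + \<bar>x\<bar> + \<bar>x\<bar> * \<bar>t\<bar>" by (simp only: distrib_left distrib_right mult_1_left mult_1_right add_ac)
        ultimately show ?thesis by linarith
      qed
      also have "\<dots> \<le> (2 * (1 + x\<^sup>2)) * (2 * (1 + t\<^sup>2))" by (intro mult_mono one_plus_abs_le) auto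
      finally have "\<bar>y\<bar> ^ a \<le> ((2 * (1 + x\<^sup>2)) * (2 * (1 + t\<^sup>2))) ^ a" by (intro power_mono) auto
      also have "\<dots> = (2 ^ a * 2 ^ a * (1 + x\<^sup>2) ^ a) * (1 + t\<^sup>2) ^ a" by (simp only: power_mult_distrib mult_ac)
      finally have "\<bar>y\<bar> ^ a * norm ((vd ^^ b) f t) \<le> (2 ^ a * 2 ^ a * (1 + x\<^sup>2) ^ a) * (1 + t\<^sup>2) ^ a * norm ((vd ^^ b) f t)"
        by (intro mult_right_mono) auto
      also have "\<dots> \<le> (2 ^ a * 2 ^ a * (1 + x\<^sup>2) ^ a) * C a b" unfolding mult.assoc[of _ "(1 + t\<^sup>2) ^ a"] using C by (intro mult_left_mono) auto
      also have "\<dots> \<le> (2 ^ a * 2 ^ a * (1 + x\<^sup>2) ^ N) * C a b"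
        using a C0 by (intro mult_right_mono mult_left_mono power_increasing) auto
      finally show "\<bar>y\<bar> ^ a * norm ((vd ^^ b) (\<lambda>y. f (y - x)) y) \<le> (2 ^ a * 2 ^ a * C a b) * (1 + x\<^sup>2) ^ N"
        unfolding vd_pow_shift[OF testfun_smooth[OF f]] t_def by (simp add: mult_ac)
    qed simp
    then show ?thesis unfolding seminorm_sum_def K_def sum_distrib_right by (intro sum_mono) auto
  qed
  moreover have "K \<ge> 0" unfolding K_def using C0 by (intro sum_nonneg) auto
  ultimately show ?thesis by blast
qed

lemma nontrivial_weights:
  assumes "nontrivial \<mu>" "\<And>f. Cc f \<Longrightarrow> \<mu> f = atomic m f" shows "\<exists>x. m x \<noteq> 0"
proof (rule ccontr)
  assume "\<not> ?thesis"
  then have "m = (\<lambda>x. 0)" by auto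
  then have "atomic m f = 0" for f by (simp add: atomic_def)
  then show False using assms unfolding nontrivial_def by auto
qed

text \<open>Each weight is the value of \<open>T\<close> on a translate of one bump, hence grows at
  most polynomially. With growth known, \<open>atomic m\<close> is itself a tempered extension and
  agrees with \<open>T\<close> on Schwartz functions, so the eigenvalue relation becomes one between
  sums.\<close>

lemma eigenmeasure_atoms:
  assumes eig: "eigenmeasure \<mu> lam" and sep: "separated d (msupp \<mu>)" and lam: "lam \<noteq> 0"
  obtains m where "eigen_atoms m lam d" "\<And>f. Cc f \<Longrightarrow> \<mu> f = atomic m f"
proof -
  have rad: "radon \<mu>" and nt: "nontrivial \<mu>" using eig unfolding eigenmeasure_def is_ft_def by auto
  obtain T where T: "tempered_ext \<mu> T" "\<And>f. testfun f \<Longrightarrow> T (ft f) = lam * \<mu> f"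
    using eig unfolding eigenmeasure_def is_ft_def by auto
  obtain m where m: "supp m \<subseteq> msupp \<mu>" "separated d (supp m)" "\<And>f. Cc f \<Longrightarrow> \<mu> f = atomic m f"
    using radon_separated_atomic[OF rad sep] by metis
  have d: "d > 0" using separated_pos[OF sep] .
  have gr: "growth m"
  proof -
    obtain C N where C: "\<And>f. schwartz f \<Longrightarrow> norm (T f) \<le> C * seminorm_sum N f" using T(1) unfolding tempered_ext_def by blast
    obtain K where K: "K \<ge> 0" "\<And>x. seminorm_sum N (\<lambda>y. cbump 0 d (y - x)) \<le> K * (1 + x\<^sup>2) ^ N"
      using seminorm_shift_growth[OF testfun_cbump[OF d], of N 0] by blast
    have "norm (m x) \<le> (\<bar>C\<bar> * K) * (1 + x\<^sup>2) ^ N" for x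
    proof (cases "m x = 0")
      case False
      have tb: "testfun (cbump x d)" by (rule testfun_cbump[OF d])
      have "m x = atomic m (cbump x d)" using atomic_point[OF m(2) False, of "cbump x d"] cbump_nonzero_iff[OF d] by simp
      also have "\<dots> = T (cbump x d)" using m(3)[OF testfun_Cc[OF tb]] T(1) tb unfolding tempered_ext_def by auto
      finally have "norm (m x) \<le> C * seminorm_sum N (cbump x d)" using C[OF testfun_schwartz[OF tb]] by simp
      also have "\<dots> \<le> \<bar>C\<bar> * seminorm_sum N (cbump x d)"
        by (intro mult_right_mono seminorm_sum_nonneg testfun_schwartz tb) auto
      also have "\<dots> \<le> \<bar>C\<bar> * (K * (1 + x\<^sup>2) ^ N)"
        using K(2)[of x] unfolding cbump_shift[of x, symmetric] by (intro mult_left_mono) auto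
      finally show ?thesis by (simp add: mult.assoc)
    qed (use K(1) in simp)
    then show ?thesis unfolding growth_def by blast
  qed
  have "eigen_atoms m lam d"
  proof
    fix \<phi> assume \<phi>: "testfun \<phi>"
    have "atomic m (ft \<phi>) = T (ft \<phi>)"
      using tempered_ext_unique[OF T(1) tempered_ext_atomic[OF m(2) gr] _ schwartz_ft[OF \<phi>]] m(3) testfun_Cc by simp
    then show "atomic m (ft \<phi>) = lam * atomic m \<phi>" using T(2)[OF \<phi>] m(3)[OF testfun_Cc[OF \<phi>]] by simp
  qed (use m gr lam nontrivial_weights[OF nt m(3)] in auto)
  then show ?thesis using that m(3) by blast
qed

section \<open>Finite sums of combs and their transforms\<close>

definition Zsum :: "nat \<Rightarrow> (nat \<Rightarrow> complex) \<Rightarrow> (nat \<Rightarrow> real) \<Rightarrow> (nat \<Rightarrow> real) \<Rightarrow> real \<Rightarrow> nat \<Rightarrow> rmeas" where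
  "Zsum k c r s a j f = (\<Sum>i<k. c i * zchain (r i) (s i) a j f)"

lemma is_ft_Zsum: "a > 0 \<Longrightarrow> j < 4 \<Longrightarrow> is_ft (Zsum k c r s a j) (Zsum k c r s a (Suc j))"
  unfolding Zsum_def[abs_def] by (intro is_ft_sum is_ft_cmult is_ft_zchain)

lemma Zsum_4: "Zsum k c r s a 4 = Zsum k c r s a 0"
  by (simp add: Zsum_def fun_eq_iff zchain_def)

lemma Zsum_0: "a > 0 \<Longrightarrow> Zsum k c r s a 0 f = (\<Sum>i<k. c i * Zcomb (r i) (s i) a f)"
  by (simp add: Zsum_def zchain_0 Zcomb_eq_atomic)

lemma Zsum_atomic:
  assumes "a > 0" "\<And>x. m x = (\<Sum>i<k. c i * zw (r i) (s i) a x)" "rapid f"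
  shows "atomic m f = Zsum k c r s a 0 f"
proof -
  have "m = (\<lambda>x. \<Sum>i<k. c i * zw (r i) (s i) a x)" by (rule ext) (rule assms)
  then show ?thesis unfolding Zsum_def zchain_0
    by (simp only:) (intro atomic_weight_sum atomic_summable[OF separated_zw[OF assms(1)]] growth_zw assms)
qed

lemma Zsum_ft: assumes "a > 0" "testfun f" shows "Zsum k c r s a 0 (ft f) = Zsum k c r s a 1 f"
  unfolding Zsum_def zchain_0 zchain_values poisson_zw[OF assms(2,1)] ..

lemma zw_reflect: "zw r s a (- x) = zw (- r) (- s) a x"
proof -
  have "(\<exists>k::int. - x = s + of_int k * a) \<longleftrightarrow> (\<exists>k::int. x = - s + of_int k * a)"
  proof
    assume "\<exists>k::int. - x = s + of_int k * a"
    then obtain k :: int where "- x = s + of_int k * a" by blast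
    then have "x = - s + of_int (- k) * a" by simp
    then show "\<exists>k::int. x = - s + of_int k * a" by blast
  next
    assume "\<exists>k::int. x = - s + of_int k * a"
    then obtain k :: int where "x = - s + of_int k * a" by blast
    then have "- x = s + of_int (- k) * a" by simp
    then show "\<exists>k::int. - x = s + of_int k * a" by blast
  qed
  then show ?thesis by (simp add: zw_def)
qed

lemma atomic_reflect: "atomic m (\<lambda>x. f (- x)) = atomic (\<lambda>x. m (- x)) f"
  unfolding atomic_def by (rule infsum_reindex_bij_witness[of UNIV uminus uminus]) auto

text \<open>Reflecting the argument turns the transform into its inverse, and the inverse is the
  third iterate.\<close>

lemma Zsum_reflect: "Zsum k c r s a 1 (\<lambda>x. f (- x)) = Zsum k c r s a 3 f"
  unfolding Zsum_def zchain_values atomic_reflect zw_reflect minus_minus ..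

lemma eigen_Zsum:
  assumes a: "a > 0" and eig: "is_ft \<mu> (\<lambda>f. lam * \<mu> f)" and eq: "\<And>f. Cc f \<Longrightarrow> \<mu> f = Zsum k c r s a 0 f"
    and j: "j \<le> 4" and f: "Cc f"
  shows "Zsum k c r s a j f = lam ^ j * \<mu> f"
  using j f
proof (induction j arbitrary: f)
  case (Suc j)
  have "is_ft (\<lambda>f. lam ^ j * \<mu> f) (\<lambda>f. lam ^ j * (lam * \<mu> f))" by (rule is_ft_cmult[OF eig])
  moreover have "is_ft (Zsum k c r s a j) (Zsum k c r s a (Suc j))" using Suc.prems by (intro is_ft_Zsum a) simp
  ultimately have "Zsum k c r s a (Suc j) f = lam ^ j * (lam * \<mu> f)"
    by (rule is_ft_unique) (use Suc in auto)
  then show ?case by simp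
qed (simp add: eq)

text \<open>The theorem admits any chain of transforms that starts from the given combination of
  combs; uniqueness of transforms identifies it with the explicit one.\<close>

lemma chain_unique:
  assumes a: "a > 0" and n0: "\<nu> 0 = (\<lambda>f. \<Sum>i<k. c i * Zcomb (r i) (s i) a f)"
    and ch: "\<And>j. j < 3 \<Longrightarrow> is_ft (\<nu> j) (\<nu> (Suc j))" and j: "j \<le> 3" and f: "Cc f"
  shows "\<nu> j f = Zsum k c r s a j f"
  using j f
proof (induction j arbitrary: f)
  case 0 then show ?case using n0 Zsum_0[OF a] by simp
next
  case (Suc j)
  show ?case
    by (rule is_ft_unique[OF is_ft_Zsum[OF a] ch]) (use Suc in auto)
qed

section \<open>Uniform discreteness of unions of translated lattices\<close>

lemma finite_separated: assumes "finite P" shows "\<exists>d. separated d P"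
proof -
  define D where "D = insert 1 ((\<lambda>(x, y). \<bar>x - y\<bar>) ` {(x, y) \<in> P \<times> P. x \<noteq> y})"
  have "finite {(x, y) \<in> P \<times> P. x \<noteq> y}" by (rule finite_subset[of _ "P \<times> P"]) (use assms in auto)
  then have D: "finite D" "D \<noteq> {}" unfolding D_def by auto
  have "Min D > 0" using D by (subst Min_gr_iff) (auto simp: D_def)
  moreover have "Min D \<le> \<bar>x - y\<bar>" if "x \<in> P" "y \<in> P" "x \<noteq> y" for x y
    using that by (intro Min_le D) (force simp: D_def)
  ultimately show ?thesis unfolding separated_def by blast
qed

text \<open>Invariance under translation by \<open>b\<close> reduces the claim to the finitely many
  points in a bounded interval.\<close>

lemma lattice_union_separated:
  assumes b: "b > 0" and F: "finite F"
  shows "\<exists>d. separated d {x. \<exists>\<theta>\<in>F. \<exists>k::int. x = \<theta> + of_int k * b}"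
proof -
  define S where "S = {x. \<exists>\<theta>\<in>F. \<exists>k::int. x = \<theta> + of_int k * b}"
  have shift: "x + of_int j * b \<in> S" if x: "x \<in> S" for x and j :: int
  proof -
    obtain \<theta> and k :: int where "\<theta> \<in> F" "x = \<theta> + of_int k * b" using x unfolding S_def by blast
    then have "\<theta> \<in> F" "x + of_int j * b = \<theta> + of_int (k + j) * b" by (auto simp: algebra_simps)
    then show ?thesis unfolding S_def by blast
  qed
  have "S \<inter> {- b..2 * b} \<subseteq> (\<Union>\<theta>\<in>F. supp (zw 0 \<theta> b) \<inter> {- b..2 * b})"
    unfolding S_def by (auto simp: in_supp zw_nonzero_iff)
  moreover have "finite (\<Union>\<theta>\<in>F. supp (zw 0 \<theta> b) \<inter> {- b..2 * b})"
    using F separated_finite(1)[OF separated_zw[OF b]] by blast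
  ultimately have "finite (S \<inter> {- b..2 * b})" by (rule finite_subset)
  then obtain d where d: "separated d (S \<inter> {- b..2 * b})" using finite_separated by blast
  have dpos: "d > 0" using separated_pos[OF d] .
  have "min d b \<le> \<bar>x - y\<bar>" if xy: "x \<in> S" "y \<in> S" "x \<noteq> y" for x y
  proof (rule ccontr)
    assume neg: "\<not> ?thesis"
    define k where "k = \<lfloor>x / b\<rfloor>"
    \<comment> \<open>Both points are moved by the same multiple of \<open>b\<close> so that
      \<open>x'\<close> lies in \<open>[0, b)\<close>; being closer than \<open>b\<close> to it,
      \<open>y'\<close> stays in \<open>[- b, 2 * b]\<close>.\<close>
    define x' where "x' = x + of_int (- k) * b"
    define y' where "y' = y + of_int (- k) * b"
    have "x' = residue b x" unfolding x'_def k_def residue_def by simp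
    then have "0 \<le> x'" "x' < b" using residue_bounds[OF b] by auto
    moreover have "x' - y' = x - y" unfolding x'_def y'_def by simp
    ultimately have "x' \<in> S \<inter> {- b..2 * b}" "y' \<in> S \<inter> {- b..2 * b}"
      using shift[OF xy(1), of "- k"] shift[OF xy(2), of "- k"] neg b unfolding x'_def[symmetric] y'_def[symmetric] by auto
    moreover have "\<bar>x' - y'\<bar> < d" using neg \<open>x' - y' = x - y\<close> by auto
    ultimately have "x' = y'" using separatedD[OF d] by blast
    then show False using \<open>x' - y' = x - y\<close> xy(3) by simp
  qed
  then have "separated (min d b) S" unfolding separated_def using dpos b by auto
  then show ?thesis unfolding S_def by blast
qed

lemma separated_closed: assumes "separated d S" "x \<notin> S" shows "\<exists>e>0. \<forall>y\<in>S. e \<le> \<bar>y - x\<bar>"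
proof -
  have "finite (S \<inter> {x - 1..x + 1})" by (rule separated_finite(1)[OF assms(1)])
  then obtain r where r: "r > 0" "\<And>y. y \<in> S \<inter> {x - 1..x + 1} \<Longrightarrow> y \<noteq> x \<Longrightarrow> r \<le> dist x y"
    using finite_set_avoid[of "S \<inter> {x - 1..x + 1}" x] by auto
  have "min r 1 \<le> \<bar>y - x\<bar>" if "y \<in> S" for y
  proof (cases "y \<in> {x - 1..x + 1}")
    case True
    have "y \<noteq> x" using that assms(2) by auto
    then have "r \<le> \<bar>x - y\<bar>" using r(2)[of y] that True by (simp add: dist_real_def)
    then show ?thesis by (simp add: abs_minus_commute)
  qed auto
  then show ?thesis using r(1) by (intro exI[of _ "min r 1"]) auto
qed

lemma atomic_zw_zero:
  assumes "\<And>k::int. f (s + of_int k * a) = 0" shows "atomic (zw r s a) f = 0"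
proof -
  have "zw r s a x * f x = 0" for x using assms unfolding zw_def by auto
  then show ?thesis unfolding atomic_def by (simp only: infsum_0_simp)
qed

text \<open>Because \<open>a^2 = n\<close>, the lattice of step \<open>a\<close> is contained in
  that of step \<open>1 / a\<close>, so combs and transformed combs live on finitely many cosets of
  one lattice.\<close>

lemma Zsum_msupp:
  assumes n: "n \<ge> (1::nat)" and a: "a = sqrt (real n)"
    and \<mu>: "\<And>f. Cc f \<Longrightarrow> \<mu> f = (\<Sum>j<4. e j * Zsum k c r s a j f)"
  shows "uniformly_discrete (msupp \<mu>)"
proof -
  have apos: "a > 0" using n a by simp
  define b where "b = 1 / a"
  have b: "b > 0" using apos by (simp add: b_def)
  have ab: "a = real n * b"
  proof -
    have "a * a = real n" using a by simp
    then show ?thesis using apos by (simp add: b_def field_simps)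
  qed
  define F where "F = (\<Union>i<k. {s i, - s i, r i, - r i})"
  define S where "S = {x. \<exists>\<theta>\<in>F. \<exists>k::int. x = \<theta> + of_int k * b}"
  obtain d where d: "separated d S" using lattice_union_separated[OF b, of F] unfolding S_def F_def by auto
  have inS: "\<theta> + of_int l * a \<in> S" "\<theta> + of_int l * (1 / a) \<in> S" if "\<theta> \<in> F" for \<theta> and l :: int
  proof -
    have "\<theta> + of_int l * a = \<theta> + of_int (l * int n) * b" unfolding ab by simp
    then show "\<theta> + of_int l * a \<in> S" unfolding S_def using that by blast
    show "\<theta> + of_int l * (1 / a) \<in> S" unfolding S_def b_def[symmetric] using that by blast
  qed
  have "msupp \<mu> \<subseteq> S"
  proof (rule subsetI, rule ccontr)
    fix x assume x: "x \<in> msupp \<mu>" "x \<notin> S"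
    obtain e0 where e0: "e0 > 0" "\<And>y. y \<in> S \<Longrightarrow> e0 \<le> \<bar>y - x\<bar>" using separated_closed[OF d x(2)] by blast
    obtain f where f: "Cc f" "fsupp f \<subseteq> ball x e0" "\<mu> f \<noteq> 0" using x(1) e0(1) unfolding msupp_def by blast
    have f0: "f y = 0" if "y \<in> S" for y
    proof (rule not_in_fsupp, rule notI)
      assume "y \<in> fsupp f"
      then have "\<bar>y - x\<bar> < e0" using f(2) by (auto simp: dist_real_def abs_minus_commute)
      then show False using e0(2)[OF that] by simp
    qed
    have "zchain (r i) (s i) a j f = 0" if "i < k" for i j
    proof -
      have F: "s i \<in> F" "- s i \<in> F" "r i \<in> F" "- r i \<in> F" using that unfolding F_def by auto
      have "atomic (zw (r i) (s i) a) f = 0" "atomic (zw (- r i) (- s i) a) f = 0"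
        "atomic (zw (- s i) (r i) (1 / a)) f = 0" "atomic (zw (s i) (- r i) (1 / a)) f = 0"
        by (rule atomic_zw_zero, rule f0, rule inS, rule F)+
      then show ?thesis unfolding zchain_def by simp
    qed
    then have "Zsum k c r s a j f = 0" for j unfolding Zsum_def by simp
    then show False using f(3) \<mu>[OF f(1)] by simp
  qed
  then show ?thesis unfolding uniformly_discrete_iff using separated_subset[OF d] by blast
qed

section \<open>Strict transformability\<close>

text \<open>Modulation and rescaling move the sampling points to the integers, where the values of
  the transform are Fourier coefficients of a periodization and Bessel's inequality applies.\<close>

lemma lattice_bessel:
  assumes g: "Cc g" and a: "a > 0"
  shows "(\<lambda>k::int. (norm (ft g (s + of_int k * a)))\<^sup>2) summable_on UNIV"
proof -
  define h where "h x = ee ((- s) * x) * g x" for x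
  have h: "Cc h" unfolding h_def by (rule Cc_ee_mult[OF g])
  define G where "G y = h ((1 / a) * y + 0)" for y
  have G: "Cc G" unfolding G_def using a by (intro Cc_affine h) simp
  have ftG: "ft g (s + of_int k * a) = ft G (of_int k) / a" for k :: int
  proof -
    have "ft G (of_int k) = a * ft h (a * of_int k)"
      unfolding G_def using ft_affine[OF h, of "1 / a" 0 "of_int k"] a by (simp add: mult.commute)
    moreover have "ft h (a * of_int k) = ft g (s + of_int k * a)"
      unfolding h_def ft_modulate[OF g] by (simp add: algebra_simps)
    ultimately show ?thesis using a by simp
  qed
  obtain R where R: "R > 0" "\<And>x. G x \<noteq> 0 \<Longrightarrow> \<bar>x\<bar> < R" using CcE'[OF G] by metis
  obtain M :: nat where M: "real M > R" using reals_Archimedean2 by blast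
  have sM: "\<bar>x\<bar> \<le> real M" if "G x \<noteq> 0" for x using R(2)[OF that] M by simp
  have fc: "ft G (of_int k) = fcoeff (periodize M G) k" for k :: int by (rule ft_eq_fcoeff[OF G sM])
  define I where "I = integral unit_cell (\<lambda>y. (norm (periodize M G y))\<^sup>2)"
  have "(\<Sum>k\<in>K. (norm (ft g (s + of_int k * a)))\<^sup>2) \<le> I / a\<^sup>2" if K: "finite K" for K :: "int set"
  proof -
    have "(\<Sum>k\<in>K. (norm (ft g (s + of_int k * a)))\<^sup>2) = (\<Sum>k\<in>K. (norm (fcoeff (periodize M G) k))\<^sup>2) / a\<^sup>2"
      unfolding ftG fc sum_divide_distrib using a by (simp add: norm_divide power_divide)
    also have "\<dots> \<le> I / a\<^sup>2" unfolding I_def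
      by (intro divide_right_mono bessel periodize_continuous G K) auto
    finally show ?thesis .
  qed
  then show ?thesis
    by (intro nonneg_bdd_above_summable_on) (auto intro!: bdd_aboveI2[where M="I / a\<^sup>2"])
qed

text \<open>The transform of a single continuous function is in general only square summable along a
  lattice; the product of two is summable, which matches the use of convolutions in the strict
  notion.\<close>

lemma comb_product_summable:
  assumes g: "Cc g" "Cc h" and a: "a > 0"
  shows "(\<lambda>x. norm (zw r s a x * (ft g x * ft h x))) summable_on UNIV"
proof -
  have "(\<lambda>k::int. norm (ft g (s + of_int k * a) * ft h (s + of_int k * a))) summable_on UNIV"
  proof (rule Infinite_Sum.abs_summable_on_comparison_test'[OF summable_on_add[OF lattice_bessel[OF g(1) a] lattice_bessel[OF g(2) a]]])
    fix k :: int
    define u v where "u = norm (ft g (s + of_int k * a))" "v = norm (ft h (s + of_int k * a))"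
    have "u * v \<le> u\<^sup>2 + v\<^sup>2"
    proof -
      have "2 * u * v \<le> u\<^sup>2 + v\<^sup>2" by (rule sum_squares_bound)
      moreover have "0 \<le> u * v" by (simp add: u_v_def)
      ultimately show ?thesis by linarith
    qed
    then show "norm (ft g (s + of_int k * a) * ft h (s + of_int k * a)) \<le> (norm (ft g (s + of_int k * a)))\<^sup>2 + (norm (ft h (s + of_int k * a)))\<^sup>2"
      by (simp add: u_v_def norm_mult)
  qed
  then have "(\<lambda>x. norm (ft g x * ft h x)) summable_on (range (\<lambda>k::int. s + of_int k * a))"
    by (subst summable_on_reindex) (use a in \<open>auto simp: o_def inj_def\<close>)
  moreover have "(\<lambda>x. norm (ft g x * ft h x)) summable_on (range (\<lambda>k::int. s + of_int k * a)) \<longleftrightarrow>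
      (\<lambda>x. norm (zw r s a x * (ft g x * ft h x))) summable_on UNIV"
    by (rule summable_on_cong_neutral) (auto simp: zw_def norm_mult)
  ultimately show ?thesis by simp
qed

lemma ftc_conv: "Cc g \<Longrightarrow> Cc h \<Longrightarrow> ftc (conv g h) y = ftc g y * ftc h y"
  by (simp add: ftc_def ft_conv)

lemma ftc_eq: "Cc f \<Longrightarrow> ftc f y = ft (\<lambda>x. f (- x)) y"
  using ft_affine[of f "-1" 0 y] by (simp add: ftc_def)

lemma Cc_reflect: "Cc f \<Longrightarrow> Cc (\<lambda>x. f (- x))"
  using Cc_affine[of f "-1" 0] by simp

lemma testfun_reflect: "testfun f \<Longrightarrow> testfun (\<lambda>x. f (- x))"
  using testfun_affine[of f "-1" 0] by simp

lemma ft_moll: assumes "e > 0" shows "ft (moll e) y = ft (moll 1) (e * y)"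
proof -
  have c1: "Cc (moll 1)" by (intro testfun_Cc testfun_moll) simp
  have "moll e = (\<lambda>x. of_real (1 / e) * moll 1 ((1 / e) * x + 0))" using assms by (simp add: moll_def fun_eq_iff)
  then have "ft (moll e) y = of_real (1 / e) * ft (\<lambda>x. moll 1 ((1 / e) * x + 0)) y"
    using ft_cmult[OF Cc_affine[OF c1, of "1 / e" 0], of "of_real (1 / e)" y] assms by (simp only: divide_eq_0_iff) simp
  also have "ft (\<lambda>x. moll 1 ((1 / e) * x + 0)) y = ft (moll 1) (y / (1 / e)) / \<bar>1 / e\<bar>"
    using ft_affine[OF c1, of "1 / e" 0 y] assms by simp
  finally show ?thesis using assms by (simp add: mult.commute)
qed

lemma ft_moll_tendsto: "(\<lambda>n. ft (moll (1 / real (Suc n))) y) \<longlonglongrightarrow> 1"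
proof -
  have c1: "Cc (moll 1)" by (intro testfun_Cc testfun_moll) simp
  have ic: "isCont (ft (moll 1)) 0" using ft_continuous[OF c1, of UNIV] by (simp add: continuous_on_eq_continuous_at)
  have "(\<lambda>n. 1 / real (Suc n) * y) \<longlonglongrightarrow> 0 * y"
    by (intro tendsto_mult tendsto_const LIMSEQ_Suc[OF lim_1_over_n])
  then have l0: "(\<lambda>n. 1 / real (Suc n) * y) \<longlonglongrightarrow> 0" by (simp only: mult_zero_left)
  have "(\<lambda>n. ft (moll 1) (1 / real (Suc n) * y)) \<longlonglongrightarrow> ft (moll 1) 0"
    by (rule isCont_tendsto_compose[OF ic l0])
  moreover have "ft (moll 1) 0 = 1" using ft_lborel[OF c1, of 0] moll_integral(2)[of 1] by simp
  moreover have "ft (moll (1 / real (Suc n))) y = ft (moll 1) (1 / real (Suc n) * y)" for n by (rule ft_moll) simp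
  ultimately show ?thesis by (simp only:)
qed

lemma norm_ft_moll_le: "e > 0 \<Longrightarrow> norm (ft (moll e) y) \<le> 1"
  using norm_ft_le[OF testfun_Cc[OF testfun_moll], of e y] moll_integral(1)[of e] by simp

text \<open>Mollifying \<open>f\<close> multiplies \<open>ftc f\<close> by factors that are bounded
  by \<open>1\<close> and tend to \<open>1\<close>, so the relation for the mollified functions
  passes to the limit on both sides.\<close>

lemma strict_relation_extend:
  assumes \<mu>: "radon \<mu>" and rel: "\<And>\<rho>. testfun \<rho> \<Longrightarrow> \<mu> (conv \<rho> f) = lam * atomic m (ftc (conv \<rho> f))"
    and f: "Cc f" and sm: "(\<lambda>x. norm (m x * ftc f x)) summable_on UNIV"
  shows "\<mu> f = lam * atomic m (ftc f)"
proof -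
  define \<rho> where "\<rho> n = moll (1 / real (Suc n))" for n
  have \<rho>: "testfun (\<rho> n)" for n unfolding \<rho>_def by (rule testfun_moll) simp
  have "(\<lambda>n. \<mu> (conv (\<rho> n) f)) \<longlonglongrightarrow> \<mu> f" unfolding \<rho>_def by (rule radon_moll_tendsto[OF \<mu> f])
  moreover have "(\<lambda>n. lam * (\<Sum>\<^sub>\<infinity>x. m x * ftc f x * ftc (\<rho> n) x)) \<longlonglongrightarrow> lam * (\<Sum>\<^sub>\<infinity>x. m x * ftc f x * 1)"
  proof (intro tendsto_mult tendsto_const infsum_dominated[OF _ _ sm])
    show "(\<lambda>n. ftc (\<rho> n) x) \<longlonglongrightarrow> 1" for x unfolding ftc_def \<rho>_def by (rule ft_moll_tendsto)
    show "norm (m x * ftc f x * ftc (\<rho> n) x) \<le> norm (m x * ftc f x)" for n x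
      using mult_left_mono[OF norm_ft_moll_le[of "1 / real (Suc n)" "- x"], of "norm (m x * ftc f x)"]
      by (simp add: norm_mult ftc_def \<rho>_def)
  qed
  moreover have "\<mu> (conv (\<rho> n) f) = lam * (\<Sum>\<^sub>\<infinity>x. m x * ftc f x * ftc (\<rho> n) x)" for n
    unfolding rel[OF \<rho>] atomic_def ftc_conv[OF testfun_Cc[OF \<rho>] f] by (simp add: mult_ac)
  ultimately have "\<mu> f = lam * (\<Sum>\<^sub>\<infinity>x. m x * ftc f x * 1)" using LIMSEQ_unique by simp
  then show ?thesis by (simp add: atomic_def)
qed

section \<open>Integrals of continuous functions against atomic measures\<close>

lemma meas_integral_atomic:
  assumes \<mu>: "\<And>f. Cc f \<Longrightarrow> \<mu> f = atomic m f" and F: "continuous_on UNIV F"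
    and sm: "(\<lambda>x. norm (m x * F x)) summable_on UNIV" and v: "v = lam * atomic m F"
  shows "meas_integral_is (\<lambda>f. lam * \<mu> f) F v"
  unfolding meas_integral_is_def
proof (intro conjI allI impI F)
  define S where "S = (\<Sum>\<^sub>\<infinity>x. norm (m x * F x))"
  show "\<exists>B. \<forall>h. Cc h \<and> (\<forall>x. norm (h x) \<le> norm (F x)) \<longrightarrow> norm (lam * \<mu> h) \<le> B"
  proof (intro exI[of _ "norm lam * S"] allI impI)
    fix h assume h: "Cc h \<and> (\<forall>x. norm (h x) \<le> norm (F x))"
    have le: "norm (m x * h x) \<le> norm (m x * F x)" for x unfolding norm_mult using h by (intro mult_left_mono) auto
    have s: "(\<lambda>x. norm (m x * h x)) summable_on UNIV" by (rule Infinite_Sum.abs_summable_on_comparison_test'[OF sm le])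
    have "norm (atomic m h) \<le> (\<Sum>\<^sub>\<infinity>x. norm (m x * h x))" unfolding atomic_def by (rule norm_infsum_bound[OF s])
    also have "\<dots> \<le> S" unfolding S_def by (rule infsum_mono[OF s sm le])
    finally show "norm (lam * \<mu> h) \<le> norm lam * S" using \<mu>[of h] h by (simp add: norm_mult mult_left_mono)
  qed
  fix e :: real assume e: "e > 0"
  define e' where "e' = e / (norm lam + 1)"
  have e': "e' > 0" unfolding e'_def using e by (simp add: add_nonneg_pos)
  \<comment> \<open>A finite set that carries all but \<open>e'\<close> of the absolute sum serves
    as the compact set.\<close>
  obtain X where X: "finite X" "dist (sum (\<lambda>x. norm (m x * F x)) X) S \<le> e'"
    using infsum_finite_approximation[OF sm e'] unfolding S_def by auto
  show "\<exists>K. compact K \<and> (\<forall>g::real \<Rightarrow> real. Cc (\<lambda>x. complex_of_real (g x)) \<and> (\<forall>x. 0 \<le> g x \<and> g x \<le> 1) \<and> (\<forall>x\<in>K. g x = 1)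
      \<longrightarrow> norm (lam * \<mu> (\<lambda>x. complex_of_real (g x) * F x) - v) \<le> e)"
  proof (intro exI[of _ X] conjI allI impI finite_imp_compact X(1))
    fix g :: "real \<Rightarrow> real"
    assume g: "Cc (\<lambda>x. complex_of_real (g x)) \<and> (\<forall>x. 0 \<le> g x \<and> g x \<le> 1) \<and> (\<forall>x\<in>X. g x = 1)"
    have cg: "Cc (\<lambda>x. complex_of_real (g x) * F x)" using Cc_mult[OF _ F, of "\<lambda>x. complex_of_real (g x)"] g by (simp add: mult.commute)
    define h where "h x = m x * ((1 - complex_of_real (g x)) * F x)" for x
    have hb: "norm (h x) \<le> (if x \<in> X then 0 else norm (m x * F x))" for x
    proof (cases "x \<in> X")
      case True then show ?thesis using g by (simp add: h_def)
    next
      case False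
      have "norm (1 - complex_of_real (g x)) = \<bar>1 - g x\<bar>" by (metis norm_of_real of_real_1 of_real_diff)
      also have "\<dots> \<le> 1" using g by (simp add: abs_le_iff)
      finally have "norm (m x * F x) * norm (1 - complex_of_real (g x)) \<le> norm (m x * F x) * 1" by (intro mult_left_mono) auto
      then show ?thesis using False by (simp add: h_def norm_mult mult_ac)
    qed
    have smX: "(\<lambda>x. norm (m x * F x)) summable_on (- X)" by (rule summable_on_subset_banach[OF sm]) simp
    have sX: "(\<lambda>x. if x \<in> X then 0 else norm (m x * F x)) summable_on UNIV"
      and iX: "(\<Sum>\<^sub>\<infinity>x. if x \<in> X then 0 else norm (m x * F x)) = infsum (\<lambda>x. norm (m x * F x)) (- X)"
    proof -
      show "(\<lambda>x. if x \<in> X then 0 else norm (m x * F x)) summable_on UNIV"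
        by (rule summable_on_cong_neutral[THEN iffD1, OF _ _ _ smX]) auto
      show "(\<Sum>\<^sub>\<infinity>x. if x \<in> X then 0 else norm (m x * F x)) = infsum (\<lambda>x. norm (m x * F x)) (- X)"
        by (rule infsum_cong_neutral) auto
    qed
    have "S = sum (\<lambda>x. norm (m x * F x)) X + infsum (\<lambda>x. norm (m x * F x)) (- X)"
      unfolding S_def using infsum_Un_disjoint[of "\<lambda>x. norm (m x * F x)" X "- X"] X(1) smX by (simp add: Compl_partition)
    then have tail: "infsum (\<lambda>x. norm (m x * F x)) (- X) \<le> e'" using X(2) by (simp add: dist_real_def abs_le_iff)
    have sh: "(\<lambda>x. norm (h x)) summable_on UNIV" by (rule Infinite_Sum.abs_summable_on_comparison_test'[OF sX hb])
    have "norm (infsum h UNIV) \<le> (\<Sum>\<^sub>\<infinity>x. norm (h x))" by (rule norm_infsum_bound[OF sh])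
    also have "\<dots> \<le> e'" using infsum_mono[OF sh sX hb] iX tail by linarith
    finally have hh: "norm (infsum h UNIV) \<le> e'" .
    have "atomic m F - atomic m (\<lambda>x. complex_of_real (g x) * F x) = infsum h UNIV"
    proof -
      have sgF: "(\<lambda>x. m x * (complex_of_real (g x) * F x)) summable_on UNIV"
      proof (rule abs_summable_summable, rule Infinite_Sum.abs_summable_on_comparison_test'[OF sm])
        fix x
        have "norm (complex_of_real (g x)) \<le> 1" using g by simp
        then have "norm (m x * F x) * norm (complex_of_real (g x)) \<le> norm (m x * F x) * 1" by (intro mult_left_mono) auto
        then show "norm (m x * (complex_of_real (g x) * F x)) \<le> norm (m x * F x)" by (simp add: norm_mult mult_ac)
      qed
      have "atomic m F = (\<Sum>\<^sub>\<infinity>x. m x * (complex_of_real (g x) * F x) + h x)"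
        unfolding atomic_def h_def by (rule infsum_cong) (simp add: algebra_simps)
      also have "\<dots> = atomic m (\<lambda>x. complex_of_real (g x) * F x) + infsum h UNIV"
        unfolding atomic_def by (rule infsum_add[OF sgF abs_summable_summable[OF sh]])
      finally show ?thesis by simp
    qed
    then have "norm (lam * \<mu> (\<lambda>x. complex_of_real (g x) * F x) - v) = norm lam * norm (infsum h UNIV)"
      unfolding v \<mu>[OF cg] by (simp only: right_diff_distrib[symmetric] norm_mult norm_minus_commute[of "atomic m F"] flip: \<open>atomic m F - _ = _\<close>)
    also have "\<dots> \<le> norm lam * e'" by (intro mult_left_mono hh) auto
    also have "\<dots> \<le> e"
    proof -
      have n1: "norm lam + 1 > 0" by (simp add: add_nonneg_pos)
      have "norm lam * e' \<le> (norm lam + 1) * e'" using e' by (intro mult_right_mono) auto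
      also have "\<dots> = e" unfolding e'_def using n1 by simp
      finally show ?thesis .
    qed
    finally show "norm (lam * \<mu> (\<lambda>x. complex_of_real (g x) * F x) - v) \<le> e" .
  qed
qed

lemma meas_integral_cutoff:
  "meas_integral_is \<nu> F v \<Longrightarrow> e > 0 \<Longrightarrow> \<exists>K. compact K \<and> (\<forall>g::real \<Rightarrow> real. Cc (\<lambda>x. complex_of_real (g x)) \<and> (\<forall>x. 0 \<le> g x \<and> g x \<le> 1)
            \<and> (\<forall>x\<in>K. g x = 1) \<longrightarrow> norm (\<nu> (\<lambda>x. complex_of_real (g x) * F x) - v) \<le> e)"
  unfolding meas_integral_is_def by simp

text \<open>Two values of the integral are compared through one cut-off that equals \<open>1\<close>
  on the compact sets belonging to both.\<close>

lemma meas_integral_atomic_unique: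
  assumes \<mu>: "\<And>f. Cc f \<Longrightarrow> \<mu> f = atomic m f" and mi: "meas_integral_is (\<lambda>f. lam * \<mu> f) F v"
    and sm: "(\<lambda>x. norm (m x * F x)) summable_on UNIV"
  shows "v = lam * atomic m F"
proof -
  define w where "w = lam * atomic m F"
  have F: "continuous_on UNIV F" using mi unfolding meas_integral_is_def by blast
  have w: "meas_integral_is (\<lambda>f. lam * \<mu> f) F w" by (rule meas_integral_atomic[OF \<mu> F sm]) (auto simp: w_def)
  have eps: "norm (v - w) \<le> 2 * e" if e: "e > 0" for e
  proof -
    obtain K where K: "compact K" "(\<forall>g::real \<Rightarrow> real. Cc (\<lambda>x. complex_of_real (g x)) \<and> (\<forall>x. 0 \<le> g x \<and> g x \<le> 1)
            \<and> (\<forall>x\<in>K. g x = 1) \<longrightarrow> norm (lam * \<mu> (\<lambda>x. complex_of_real (g x) * F x) - v) \<le> e)"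
      using meas_integral_cutoff[OF mi e] by (elim exE conjE)
    obtain L where L: "compact L" "(\<forall>g::real \<Rightarrow> real. Cc (\<lambda>x. complex_of_real (g x)) \<and> (\<forall>x. 0 \<le> g x \<and> g x \<le> 1)
            \<and> (\<forall>x\<in>L. g x = 1) \<longrightarrow> norm (lam * \<mu> (\<lambda>x. complex_of_real (g x) * F x) - w) \<le> e)"
      using meas_integral_cutoff[OF w e] by (elim exE conjE)
    have "bounded (K \<union> L)" by (intro bounded_Un[THEN iffD2] conjI compact_imp_bounded K(1) L(1))
    then obtain R where R: "\<And>x. x \<in> K \<union> L \<Longrightarrow> \<bar>x\<bar> \<le> R" unfolding bounded_real by blast
    define g where "g x = max 0 (min 1 (R + 1 - \<bar>x\<bar>))" for x
    have "Cc (\<lambda>x. complex_of_real (g x))"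
    proof (rule CcI[where a="- (R + 1)" and b="R + 1"])
      show "continuous_on UNIV (\<lambda>x. complex_of_real (g x))" unfolding g_def by (intro continuous_intros)
      show "- (R + 1) \<le> x \<and> x \<le> R + 1" if "complex_of_real (g x) \<noteq> 0" for x
        using that unfolding g_def by (auto simp: max_def min_def abs_if split: if_splits)
    qed
    moreover have "0 \<le> g x \<and> g x \<le> 1" for x unfolding g_def by auto
    moreover have "g x = 1" if "x \<in> K \<union> L" for x using R[OF that] unfolding g_def by auto
    ultimately have "norm (lam * \<mu> (\<lambda>x. complex_of_real (g x) * F x) - v) \<le> e" "norm (lam * \<mu> (\<lambda>x. complex_of_real (g x) * F x) - w) \<le> e"
      by (intro K(2)[rule_format] L(2)[rule_format] conjI allI ballI; simp)+
    then show ?thesis using norm_triangle_ineq4[of "lam * \<mu> (\<lambda>x. complex_of_real (g x) * F x) - w" "lam * \<mu> (\<lambda>x. complex_of_real (g x) * F x) - v"] by simp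
  qed
  have "norm (v - w) \<le> 0"
  proof (rule field_le_epsilon)
    fix e :: real assume "e > 0"
    then show "norm (v - w) \<le> 0 + e" using eps[of "e / 2"] by simp
  qed
  then show ?thesis by (simp add: w_def)
qed

lemma abs_summable_sum:
  fixes f :: "'i \<Rightarrow> 'a \<Rightarrow> complex"
  assumes "\<And>i. i \<in> I \<Longrightarrow> (\<lambda>x. norm (f i x)) summable_on A"
  shows "(\<lambda>x. norm (\<Sum>i\<in>I. f i x)) summable_on A"
  using assms
proof (induction I rule: infinite_finite_induct)
  case (insert i F)
  have "(\<lambda>x. norm (f i x) + norm (\<Sum>i\<in>F. f i x)) summable_on A"
    by (intro summable_on_add) (use insert in auto)
  then have "(\<lambda>x. norm (f i x + (\<Sum>i\<in>F. f i x))) summable_on A"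
    by (rule Infinite_Sum.abs_summable_on_comparison_test') (rule norm_triangle_ineq)
  then show ?case using insert by simp
qed auto

lemma ftc_sum_conv:
  fixes n :: nat
  assumes "\<And>i. i < n \<Longrightarrow> Cc (g i) \<and> Cc (h i)"
  shows "ftc (\<lambda>x. \<Sum>i<n. conv (g i) (h i) x) y = (\<Sum>i<n. ft (\<lambda>x. g i (- x)) y * ft (\<lambda>x. h i (- x)) y)"
proof -
  have "ftc (\<lambda>x. \<Sum>i<n. conv (g i) (h i) x) y = (\<Sum>i<n. ftc (conv (g i) (h i)) y)"
    unfolding ftc_def by (rule ft_sum) (use assms conv_Cc in auto)
  also have "\<dots> = (\<Sum>i<n. ft (\<lambda>x. g i (- x)) y * ft (\<lambda>x. h i (- x)) y)"
    by (rule sum.cong) (use assms in \<open>auto simp: ftc_conv ftc_eq\<close>)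
  finally show ?thesis .
qed

lemma Zsum_ftc:
  assumes a: "a > 0" and m: "\<And>x. m x = (\<Sum>i<k. c i * zw (r i) (s i) a x)" and \<phi>: "testfun \<phi>"
  shows "atomic m (ftc \<phi>) = Zsum k c r s a 3 \<phi>"
proof -
  have "ftc \<phi> = ft (\<lambda>x. \<phi> (- x))" by (rule ext) (rule ftc_eq[OF testfun_Cc[OF \<phi>]])
  then show ?thesis
    using Zsum_atomic[OF a m rapid_ft[OF testfun_reflect[OF \<phi>]]] Zsum_ft[OF a testfun_reflect[OF \<phi>]] Zsum_reflect[of k c r s a \<phi>]
    by (simp only:)
qed

text \<open>Along a lattice the transforms of convolutions are absolutely summable, so a relation
  known on test functions extends by mollification to the whole span.\<close>

lemma comb_strict_ft:
  assumes a: "a > 0" and m: "\<And>x. m x = (\<Sum>l<k. c l * zw (r l) (s l) a x)"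
    and rad: "radon \<mu>" and \<mu>: "\<And>f. Cc f \<Longrightarrow> \<mu> f = atomic m f"
    and rel: "\<And>\<phi>. testfun \<phi> \<Longrightarrow> \<mu> \<phi> = lam * atomic m (ftc \<phi>)"
  shows "strict_ft \<mu> (\<lambda>f. lam * \<mu> f)"
  unfolding strict_ft_def
proof (intro conjI allI impI rad radon_cmult)
  fix f assume "conv_span f"
  then obtain n :: nat and g h where gh': "\<forall>i<n. Cc (g i) \<and> Cc (h i)" and f: "f = (\<lambda>x. \<Sum>i<n. conv (g i) (h i) x)"
    unfolding conv_span_def by (elim exE conjE)
  have gh: "Cc (g i) \<and> Cc (h i)" if "i < n" for i using gh' that by simp
  have Ccf: "Cc f" unfolding f by (rule Cc_sum) (use gh conv_Cc in auto)
  have eq: "m x * ftc f x = (\<Sum>l<k. \<Sum>i<n. c l * (zw (r l) (s l) a x * (ft (\<lambda>x. g i (- x)) x * ft (\<lambda>x. h i (- x)) x)))" for x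
  proof -
    have "ftc f x = (\<Sum>i<n. ft (\<lambda>x. g i (- x)) x * ft (\<lambda>x. h i (- x)) x)" unfolding f by (rule ftc_sum_conv[OF gh])
    then show ?thesis unfolding m by (simp only: sum_product mult.assoc)
  qed
  have sm: "(\<lambda>x. norm (m x * ftc f x)) summable_on UNIV"
    unfolding eq
  proof (intro abs_summable_sum)
    fix l i assume "i \<in> {..<n}"
    then have "Cc (\<lambda>x. g i (- x))" "Cc (\<lambda>x. h i (- x))" using gh Cc_reflect by auto
    from comb_product_summable[OF this a]
    show "(\<lambda>x. norm (c l * (zw (r l) (s l) a x * (ft (\<lambda>x. g i (- x)) x * ft (\<lambda>x. h i (- x)) x)))) summable_on UNIV"
      unfolding norm_mult[of "c l"] by (rule summable_on_cmult_right)
  qed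
  show "meas_integral_is (\<lambda>f. lam * \<mu> f) (ftc f) (\<mu> f)"
  proof (rule meas_integral_atomic[OF \<mu> _ sm])
    have "ftc f = ft (\<lambda>x. f (- x))" by (rule ext) (rule ftc_eq[OF Ccf])
    then show "continuous_on UNIV (ftc f)" using ft_continuous[OF Cc_reflect[OF Ccf]] by (simp only:)
    show "\<mu> f = lam * atomic m (ftc f)"
      by (rule strict_relation_extend[OF rad _ Ccf sm]) (rule rel[OF conv_testfun[OF _ Ccf]])
  qed
qed

lemma eigenmeasure_comb:
  assumes eig: "eigenmeasure \<mu> lam" and ud: "uniformly_discrete (msupp \<mu>)" and lam: "lam \<noteq> 0"
  obtains n k :: nat and c r s m where "n \<ge> 1" "\<And>x. m x = (\<Sum>i<k. c i * zw (r i) (s i) (sqrt (real n)) x)"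
    "\<And>f. Cc f \<Longrightarrow> \<mu> f = atomic m f"
proof -
  obtain d where d: "separated d (msupp \<mu>)" using ud unfolding uniformly_discrete_iff by (elim exE)
  obtain m where m: "eigen_atoms m lam d" and \<mu>: "\<And>f. Cc f \<Longrightarrow> \<mu> f = atomic m f"
    using eigenmeasure_atoms[OF eig d lam] by metis
  obtain n :: nat where n: "n \<ge> 1" "comb_span (sqrt (real n)) m" using eigen_atoms.comb_structure[OF m] by (elim exE conjE)
  obtain k :: nat and c r s where "\<And>x. m x = (\<Sum>i<k. c i * zw (r i) (s i) (sqrt (real n)) x)"
    using comb_span_explicit[OF n(2)] by (elim exE) simp
  then show ?thesis using that n(1) \<mu> by metis
qed

text \<open>The strict relation involves the inverse transform \<open>ftc\<close>, that is the third
  iterate, which acts as \<open>lam ^ 3\<close>; the condition \<open>lam ^ 4 = 1\<close> closes the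
  relation.\<close>

lemma eigen_imp_strict:
  assumes eig: "eigenmeasure \<mu> lam" and ud: "uniformly_discrete (msupp \<mu>)" and lam: "lam ^ 4 = 1"
  shows "strict_eigenmeasure \<mu> lam"
proof -
  have lam0: "lam \<noteq> 0" using lam by auto
  obtain n k :: nat and c r s m where n: "n \<ge> 1" and m: "\<And>x. m x = (\<Sum>i<k. c i * zw (r i) (s i) (sqrt (real n)) x)"
    and \<mu>: "\<And>f. Cc f \<Longrightarrow> \<mu> f = atomic m f" using eigenmeasure_comb[OF eig ud lam0] by metis
  have a: "sqrt (real n) > 0" using n by simp
  have ft: "is_ft \<mu> (\<lambda>f. lam * \<mu> f)" and nt: "nontrivial \<mu>" using eig unfolding eigenmeasure_def by auto
  have rad: "radon \<mu>" using ft unfolding is_ft_def by simp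
  have Z: "\<mu> f = Zsum k c r s (sqrt (real n)) 0 f" if "Cc f" for f
    using \<mu>[OF that] Zsum_atomic[OF a m rapid_Cc[OF that]] by simp
  have rel: "\<mu> \<phi> = lam * atomic m (ftc \<phi>)" if "testfun \<phi>" for \<phi>
  proof -
    have "lam * atomic m (ftc \<phi>) = lam * (lam ^ 3 * \<mu> \<phi>)"
      using Zsum_ftc[OF a m that] eigen_Zsum[OF a ft Z _ testfun_Cc[OF that], of 3] by simp
    also have "\<dots> = lam ^ 4 * \<mu> \<phi>" by (simp add: eval_nat_numeral)
    finally show ?thesis using lam by simp
  qed
  have "strict_ft \<mu> (\<lambda>f. lam * \<mu> f)" by (rule comb_strict_ft[OF a m rad \<mu> rel])
  then show ?thesis unfolding strict_eigenmeasure_def using nt by simp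
qed

text \<open>The exponential factor moves the zeros of the Fejer kernel off the real line, so the transform
  has a lower bound of order \<open>1 / (1 + y\<^sup>2)\<close>.\<close>

definition tent_exp :: "real \<Rightarrow> complex" where
  "tent_exp x = of_real (max 0 (1 - \<bar>x\<bar>) * exp x)"

lemma Cc_tent_exp: "Cc tent_exp"
proof (rule CcI[where a="-1" and b=1])
  show "continuous_on UNIV tent_exp" unfolding tent_exp_def[abs_def] by (intro continuous_intros)
  show "- 1 \<le> x \<and> x \<le> 1" if "tent_exp x \<noteq> 0" for x
    using that unfolding tent_exp_def by (auto simp: max_def abs_if split: if_splits)
qed

lemma ft_tent_exp:
  defines "z \<equiv> \<lambda>y::real. 1 - 2 * of_real pi * \<i> * of_real y"
  shows "ft tent_exp y = (exp (z y) + exp (- z y) - 2) / (z y)\<^sup>2"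
proof -
  define w where "w = z y"
  have w: "w \<noteq> 0" unfolding w_def z_def by (simp add: complex_eq_iff)
  define F where "F x = exp (- 2 * pi * \<i> * complex_of_real (x * y)) * tent_exp x" for x
  have F: "F x = of_real (max 0 (1 - \<bar>x\<bar>)) * exp (w * of_real x)" for x
  proof -
    have "exp (w * of_real x) = exp (- 2 * pi * \<i> * complex_of_real (x * y)) * exp (of_real x)"
      unfolding exp_add[symmetric] w_def z_def by (simp add: algebra_simps)
    then show ?thesis unfolding F_def tent_exp_def by (simp add: exp_of_real)
  qed
  \<comment> \<open>\<open>A\<close> and \<open>B\<close> are antiderivatives of the integrand on
    \<open>[0, 1]\<close> and on \<open>[-1, 0]\<close>, found by integrating by parts.\<close>
  define A where "A x = ((1 - x) / w + 1 / w\<^sup>2) * exp (w * x)" for x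
  define B where "B x = ((1 + x) / w - 1 / w\<^sup>2) * exp (w * x)" for x
  have "(A has_field_derivative (1 - x) * exp (w * x)) (at x)" for x
    unfolding A_def[abs_def] using w by (auto intro!: derivative_eq_intros simp: field_simps power2_eq_square)
  then have dA: "((\<lambda>x. A (of_real x)) has_vector_derivative (1 - of_real x) * exp (w * of_real x)) (at x within S)" for x S
    by (rule has_vector_derivative_real_field)
  have "(B has_field_derivative (1 + x) * exp (w * x)) (at x)" for x
    unfolding B_def[abs_def] using w by (auto intro!: derivative_eq_intros simp: field_simps power2_eq_square)
  then have dB: "((\<lambda>x. B (of_real x)) has_vector_derivative (1 + of_real x) * exp (w * of_real x)) (at x within S)" for x S
    by (rule has_vector_derivative_real_field)
  have "((\<lambda>x. (1 + of_real x) * exp (w * of_real x)) has_integral B (of_real 0) - B (of_real (- 1))) {-1..0}"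
    by (rule fundamental_theorem_of_calculus) (auto intro: dB)
  then have 1: "(F has_integral B (of_real 0) - B (of_real (- 1))) {-1..0}"
    by (rule has_integral_eq[rotated]) (simp add: F)
  have "((\<lambda>x. (1 - of_real x) * exp (w * of_real x)) has_integral A (of_real 1) - A (of_real 0)) {0..1}"
    by (rule fundamental_theorem_of_calculus) (auto intro: dA)
  then have 2: "(F has_integral A (of_real 1) - A (of_real 0)) {0..1}"
    by (rule has_integral_eq[rotated]) (simp add: F)
  have "(F has_integral (B (of_real 0) - B (of_real (- 1))) + (A (of_real 1) - A (of_real 0))) {-1..1}"
    by (rule has_integral_combine[OF _ _ 1 2]) auto
  then have "(F has_integral (B (of_real 0) - B (of_real (- 1))) + (A (of_real 1) - A (of_real 0))) UNIV"
    by (rule has_integral_on_superset) (auto simp: F max_def)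
  moreover have "(B (of_real 0) - B (of_real (- 1))) + (A (of_real 1) - A (of_real 0)) = (exp w + exp (- w) - 2) / w\<^sup>2"
    unfolding A_def B_def using w by (simp add: field_simps power2_eq_square)
  ultimately show ?thesis unfolding ft_def F_def[symmetric] w_def[symmetric] by (simp add: integral_unique)
qed

text \<open>The numerator is the square of \<open>exp (z / 2) - exp (- (z / 2))\<close>. As
  \<open>z\<close> has real part \<open>1\<close>, the two exponentials have the moduli
  \<open>exp (1/2)\<close> and \<open>exp (- (1/2))\<close>, so their difference is at least
  \<open>q\<close> in modulus.\<close>

lemma ft_tent_exp_bound: "\<exists>c>0. \<forall>y. c \<le> (1 + y\<^sup>2) * norm (ft tent_exp y)"
proof -
  define q where "q = exp (1/2) - exp (- (1/2) :: real)"
  define p where "p = 1 + (2 * pi)\<^sup>2"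
  have q: "q > 0" by (simp add: q_def)
  have p: "p > 0" by (simp add: p_def add_pos_nonneg)
  have "q\<^sup>2 / p \<le> (1 + y\<^sup>2) * norm (ft tent_exp y)" for y
  proof -
    define z where "z = 1 - 2 * of_real pi * \<i> * complex_of_real y"
    define u where "u = exp (z / 2)"
    define v where "v = exp (- (z / 2))"
    have "norm u = exp (1/2)" "norm v = exp (- (1/2))" unfolding u_def v_def z_def by (simp_all add: norm_exp_eq_Re)
    then have uv: "q \<le> norm (u - v)" unfolding q_def using norm_triangle_ineq2[of u v] by simp
    have "u * v = 1" unfolding u_def v_def exp_add[symmetric] by simp
    moreover have "exp z = u * u" "exp (- z) = v * v" unfolding u_def v_def exp_add[symmetric] by simp_all
    ultimately have "exp z + exp (- z) - 2 = (u - v)\<^sup>2" by (simp add: power2_eq_square algebra_simps)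
    then have "norm (ft tent_exp y) = (norm (u - v))\<^sup>2 / (norm z)\<^sup>2"
      unfolding ft_tent_exp z_def[symmetric] by (simp add: norm_divide norm_power)
    moreover have nz: "(norm z)\<^sup>2 = 1 + (2 * pi * y)\<^sup>2" unfolding z_def cmod_power2 by simp
    ultimately have "norm (ft tent_exp y) * (1 + (2 * pi * y)\<^sup>2) = (norm (u - v))\<^sup>2"
      by (simp add: add_nonneg_eq_0_iff)
    then have "q\<^sup>2 \<le> norm (ft tent_exp y) * (1 + (2 * pi * y)\<^sup>2)" using uv q by (simp add: power_mono)
    also have "\<dots> \<le> norm (ft tent_exp y) * (p * (1 + y\<^sup>2))"
      by (intro mult_left_mono) (auto simp: p_def power_mult_distrib algebra_simps)
    finally show ?thesis using p by (simp add: field_simps)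
  qed
  then show ?thesis using q p by (intro exI[of _ "q\<^sup>2 / p"]) auto
qed

section \<open>From strict eigenmeasures to eigenmeasures\<close>

lemma conv_span_conv: "Cc g \<Longrightarrow> Cc h \<Longrightarrow> conv_span (conv g h)"
  unfolding conv_span_def by (intro exI[of _ 1] exI[of _ "\<lambda>_. g"] exI[of _ "\<lambda>_. h"]) auto

text \<open>Temperedness is not built into \<open>strict_ft\<close>, so the growth of the weights is
  extracted from integrability. The function \<open>G\<close>, the square of a reflected transform
  of \<open>tent_exp\<close>, is at least of order \<open>1 / (1 + x^2)^2\<close>; testing with
  \<open>G\<close> times an isolating bump bounds \<open>norm (m x) * norm (G x)\<close>
  uniformly.\<close>

lemma strict_growth:
  assumes st: "strict_ft \<mu> (\<lambda>f. lam * \<mu> f)" and lam: "lam \<noteq> 0"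
    and sep: "separated d (supp m)" and \<mu>: "\<And>f. Cc f \<Longrightarrow> \<mu> f = atomic m f"
  shows "growth m"
proof -
  obtain c where c: "c > 0" "\<And>y. c \<le> (1 + y\<^sup>2) * norm (ft tent_exp y)" using ft_tent_exp_bound by (elim exE conjE) simp
  define G where "G = ftc (conv tent_exp tent_exp)"
  have G: "c\<^sup>2 \<le> (1 + x\<^sup>2) ^ 2 * norm (G x)" for x
  proof -
    have "c\<^sup>2 \<le> ((1 + x\<^sup>2) * norm (ft tent_exp (- x)))\<^sup>2" using c(2)[of "- x"] c(1) by (intro power_mono) auto
    also have "\<dots> = (1 + x\<^sup>2) ^ 2 * norm (G x)"
      unfolding G_def ftc_conv[OF Cc_tent_exp Cc_tent_exp] unfolding ftc_def by (simp add: norm_mult power2_eq_square)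
    finally show ?thesis .
  qed
  have "meas_integral_is (\<lambda>f. lam * \<mu> f) G (\<mu> (conv tent_exp tent_exp))"
    using st conv_span_conv[OF Cc_tent_exp Cc_tent_exp] unfolding strict_ft_def G_def by simp
  then obtain B where contG: "continuous_on UNIV G"
    and B: "\<forall>h. Cc h \<and> (\<forall>x. norm (h x) \<le> norm (G x)) \<longrightarrow> norm (lam * \<mu> h) \<le> B"
    unfolding meas_integral_is_def by (elim exE conjE) simp
  have d: "d > 0" using separated_pos[OF sep] .
  have "norm (m x) \<le> (\<bar>B\<bar> / (norm lam * c\<^sup>2)) * (1 + x\<^sup>2) ^ 2" for x
  proof (cases "m x = 0")
    case False
    define h where "h y = G y * cbump x d y" for y
    have h: "Cc h" unfolding h_def by (intro Cc_mult testfun_Cc testfun_cbump d contG)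
    have hn: "norm (h y) \<le> norm (G y)" for y
      using mult_left_mono[OF norm_cbump_le_1[of x d y], of "norm (G y)"] by (simp add: h_def norm_mult)
    have nB: "norm (lam * \<mu> h) \<le> B" by (rule B[rule_format]) (use h hn in simp)
    have "\<mu> h = m x * h x"
      unfolding \<mu>[OF h] by (rule atomic_point[OF sep False]) (use cbump_nonzero_iff[OF d] in \<open>auto simp: h_def\<close>)
    then have "norm lam * norm (m x) * norm (G x) \<le> \<bar>B\<bar>" using nB by (simp add: h_def norm_mult mult.assoc)
    then have "norm lam * norm (m x) * norm (G x) * (1 + x\<^sup>2) ^ 2 \<le> \<bar>B\<bar> * (1 + x\<^sup>2) ^ 2" by (intro mult_right_mono) auto
    moreover have "norm lam * norm (m x) * c\<^sup>2 \<le> norm lam * norm (m x) * ((1 + x\<^sup>2) ^ 2 * norm (G x))"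
      by (intro mult_left_mono G) auto
    ultimately have "norm (m x) * (norm lam * c\<^sup>2) \<le> \<bar>B\<bar> * (1 + x\<^sup>2) ^ 2" by (simp add: mult_ac)
    moreover have "norm lam * c\<^sup>2 > 0" using lam c(1) by simp
    ultimately show ?thesis by (simp add: pos_le_divide_eq)
  qed simp
  then show ?thesis unfolding growth_def by (intro exI allI)
qed

text \<open>\<open>conv_span\<close> contains the convolutions of \<open>\<phi>\<close> with
  mollifiers, where the relation holds by assumption; growth provides the summability for the
  limit.\<close>

lemma strict_relation:
  assumes st: "strict_ft \<mu> (\<lambda>f. lam * \<mu> f)" and sep: "separated d (supp m)" and gr: "growth m"
    and \<mu>: "\<And>f. Cc f \<Longrightarrow> \<mu> f = atomic m f" and \<phi>: "testfun \<phi>"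
  shows "\<mu> \<phi> = lam * atomic m (ftc \<phi>)"
proof -
  have rad: "radon \<mu>" using st unfolding strict_ft_def by simp
  have sm: "(\<lambda>x. norm (m x * ftc f x)) summable_on UNIV" if "testfun f" for f
  proof -
    have "ftc f = ft (\<lambda>x. f (- x))" by (rule ext) (rule ftc_eq[OF testfun_Cc[OF that]])
    then show ?thesis using atomic_abs_summable[OF sep gr rapid_ft[OF testfun_reflect[OF that]]] by (simp only:)
  qed
  show ?thesis
  proof (rule strict_relation_extend[OF rad _ testfun_Cc[OF \<phi>] sm[OF \<phi>]])
    fix \<rho> assume \<rho>: "testfun \<rho>"
    have "meas_integral_is (\<lambda>f. lam * \<mu> f) (ftc (conv \<rho> \<phi>)) (\<mu> (conv \<rho> \<phi>))"
      using st conv_span_conv[OF testfun_Cc[OF \<rho>] testfun_Cc[OF \<phi>]] unfolding strict_ft_def by simp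
    from meas_integral_atomic_unique[OF \<mu> this sm[OF conv_testfun[OF \<rho> testfun_Cc[OF \<phi>]]]]
    show "\<mu> (conv \<rho> \<phi>) = lam * atomic m (ftc (conv \<rho> \<phi>))" .
  qed
qed

lemma cnj_zw: "cnj (zw r s a x) = zw (- r) s a x"
  by (simp add: zw_def cnj_ee)

lemma atomic_cnj: "atomic (\<lambda>x. cnj (m x)) f = cnj (atomic m (\<lambda>x. cnj (f x)))"
  unfolding atomic_def infsum_cnj[symmetric] by simp

text \<open>The structure theorem concerns the forward transform, while strictness yields a relation
  for the inverse one. Once the measure is a finite sum of combs, all iterates are explicit:
  \<open>Z 0 = lam * Z 3\<close>, and one more transform gives
  \<open>Z 1 = lam * Z 4 = lam * Z 0\<close>.\<close>

lemma strict_imp_eigen: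
  assumes st: "strict_eigenmeasure \<mu> lam" and ud: "uniformly_discrete (msupp \<mu>)" and lam: "lam ^ 4 = 1"
  shows "eigenmeasure \<mu> lam"
proof -
  have lam0: "lam \<noteq> 0" using lam by auto
  have sf: "strict_ft \<mu> (\<lambda>f. lam * \<mu> f)" and nt: "nontrivial \<mu>" using st unfolding strict_eigenmeasure_def by auto
  have rad: "radon \<mu>" using sf unfolding strict_ft_def by simp
  obtain d where d: "separated d (msupp \<mu>)" using ud unfolding uniformly_discrete_iff by (elim exE)
  obtain m where sep: "separated d (supp m)" and \<mu>: "\<And>f. Cc f \<Longrightarrow> \<mu> f = atomic m f"
    using radon_separated_atomic[OF rad d] by metis
  have gr: "growth m" by (rule strict_growth[OF sf lam0 sep \<mu>])
  have rel: "\<mu> \<phi> = lam * atomic m (ftc \<phi>)" if "testfun \<phi>" for \<phi> by (rule strict_relation[OF sf sep gr \<mu> that])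
  \<comment> \<open>conjugating the weights turns the inverse transform into the transform\<close>
  define m' where "m' x = cnj (m x)" for x
  have "eigen_atoms m' (1 / cnj lam) d"
  proof
    have "supp m' = supp m" unfolding m'_def supp_def by simp
    then show "separated d (supp m')" using sep by simp
    show "growth m'" using gr unfolding growth_def m'_def by simp
    show "1 / cnj lam \<noteq> 0" using lam0 by simp
    show "\<exists>x. m' x \<noteq> 0" using nontrivial_weights[OF nt \<mu>] unfolding m'_def by simp
    fix \<phi> assume \<phi>: "testfun \<phi>"
    have c: "testfun (\<lambda>x. cnj (\<phi> x))" by (rule testfun_cnj[OF \<phi>])
    have "ftc (\<lambda>x. cnj (\<phi> x)) = (\<lambda>x. cnj (ft \<phi> x))" by (rule ext) (simp add: ftc_def ft_cnj[OF testfun_Cc[OF \<phi>]])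
    then have "atomic m (\<lambda>x. cnj (\<phi> x)) = lam * atomic m (\<lambda>x. cnj (ft \<phi> x))" using rel[OF c] \<mu>[OF testfun_Cc[OF c]] by simp
    then have "atomic m (\<lambda>x. cnj (ft \<phi> x)) = atomic m (\<lambda>x. cnj (\<phi> x)) / lam" using lam0 by simp
    then show "atomic m' (ft \<phi>) = 1 / cnj lam * atomic m' \<phi>" unfolding m'_def atomic_cnj by simp
  qed
  from eigen_atoms.comb_structure[OF this] obtain n :: nat where n: "n \<ge> 1" "comb_span (sqrt (real n)) m'" by (elim exE conjE)
  define a where "a = sqrt (real n)"
  have a: "a > 0" unfolding a_def using n by simp
  obtain k :: nat and c r s where m': "\<And>x. m' x = (\<Sum>i<k. c i * zw (r i) (s i) a x)"
    using comb_span_explicit[OF n(2)] unfolding a_def by (elim exE) simp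
  have m: "m x = (\<Sum>i<k. cnj (c i) * zw (- r i) (s i) a x)" for x
  proof -
    have "m x = cnj (m' x)" by (simp add: m'_def)
    then show ?thesis unfolding m' by (simp add: cnj_zw)
  qed
  define Z where "Z = Zsum k (\<lambda>i. cnj (c i)) (\<lambda>i. - r i) s a"
  have ZF: "is_ft (Z j) (Z (Suc j))" if "j < 4" for j unfolding Z_def by (rule is_ft_Zsum[OF a that])
  have Z0: "\<mu> f = Z 0 f" if "Cc f" for f
    using \<mu>[OF that] Zsum_atomic[OF a m rapid_Cc[OF that]] unfolding Z_def by simp
  have Z3: "is_ft (\<lambda>f. lam * Z 3 f) (\<lambda>f. lam * Z 4 f)" using is_ft_cmult[OF ZF[of 3]] by simp
  have "Z 0 f = lam * Z 3 f" if "Cc f" for f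
  proof (rule radon_eq_testfun[OF _ _ _ that])
    show "radon (Z 0)" "radon (\<lambda>f. lam * Z 3 f)" using ZF[of 0] Z3 unfolding is_ft_def by auto
    show "Z 0 \<phi> = lam * Z 3 \<phi>" if "testfun \<phi>" for \<phi>
      using rel[OF that] Z0[OF testfun_Cc[OF that]] Zsum_ftc[OF a m that] unfolding Z_def by simp
  qed
  then have "Z (Suc 0) f = lam * Z 4 f" if "Cc f" for f
    by (intro is_ft_unique[OF Z3 ZF[of 0] _ that]) auto
  moreover have "Z 4 = Z 0" unfolding Z_def by (rule Zsum_4)
  ultimately have "is_ft \<mu> (\<lambda>f. lam * \<mu> f)"
    by (intro is_ft_cong[OF ZF[of 0]]) (use Z0 in auto)
  then show ?thesis unfolding eigenmeasure_def using nt by simp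
qed

section \<open>Orbit sums of combs\<close>

text \<open>Kept literally in the form of the theorem's conclusion, so that it can be folded
  there.\<close>

definition comb_orbit_sum :: "rmeas \<Rightarrow> complex \<Rightarrow> nat \<Rightarrow> bool" where
  "comb_orbit_sum \<mu> lam n \<longleftrightarrow> (\<exists>(k::nat) c r s \<nu>. \<nu> 0 = (\<lambda>f. \<Sum>i<k. c i * Zcomb (r i) (s i) (sqrt (real n)) f) \<and>
              (\<forall>j<3. is_ft (\<nu> j) (\<nu> (Suc j))) \<and>
              (\<forall>f. Cc f \<longrightarrow> \<mu> f = (\<Sum>j<4. inverse lam ^ j * \<nu> j f)))"

definition Y_span :: "rmeas \<Rightarrow> complex \<Rightarrow> nat \<Rightarrow> bool" where
  "Y_span \<mu> lam n \<longleftrightarrow> (\<exists>(k::nat) c r s Y. (\<forall>i<k. is_Y (r i) (s i) (sqrt (real n)) lam (Y i)) \<and>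
              (\<forall>f. Cc f \<longrightarrow> \<mu> f = (\<Sum>i<k. c i * Y i f)))"

text \<open>On an eigenmeasure all four summands of the orbit operator act as the identity, so the
  comb representation of \<open>\<mu>\<close> divided by \<open>4\<close> is a suitable start of the
  chain.\<close>

lemma eigen_imp_comb_orbit_sum:
  assumes eig: "eigenmeasure \<mu> lam" and ud: "uniformly_discrete (msupp \<mu>)" and lam: "lam \<noteq> 0"
  shows "\<exists>n\<ge>1. comb_orbit_sum \<mu> lam n"
proof -
  obtain n k :: nat and c r s m where n: "n \<ge> 1" and m: "\<And>x. m x = (\<Sum>i<k. c i * zw (r i) (s i) (sqrt (real n)) x)"
    and \<mu>: "\<And>f. Cc f \<Longrightarrow> \<mu> f = atomic m f" using eigenmeasure_comb[OF eig ud lam] by metis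
  have a: "sqrt (real n) > 0" using n by simp
  have ft: "is_ft \<mu> (\<lambda>f. lam * \<mu> f)" using eig unfolding eigenmeasure_def by auto
  have Z: "\<mu> f = Zsum k c r s (sqrt (real n)) 0 f" if "Cc f" for f
    using \<mu>[OF that] Zsum_atomic[OF a m rapid_Cc[OF that]] by simp
  define \<nu> where "\<nu> = Zsum k (\<lambda>i. c i / 4) r s (sqrt (real n))"
  have \<nu>: "\<nu> j f = Zsum k c r s (sqrt (real n)) j f / 4" for j f
    unfolding \<nu>_def Zsum_def sum_divide_distrib by simp
  have "\<nu> 0 = (\<lambda>f. \<Sum>i<k. (c i / 4) * Zcomb (r i) (s i) (sqrt (real n)) f)"
    unfolding \<nu>_def by (rule ext) (rule Zsum_0[OF a])
  moreover have "\<forall>j<3. is_ft (\<nu> j) (\<nu> (Suc j))" unfolding \<nu>_def using is_ft_Zsum[OF a] by simp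
  moreover have "\<mu> f = (\<Sum>j<4. inverse lam ^ j * \<nu> j f)" if "Cc f" for f
  proof -
    have "inverse lam ^ j * \<nu> j f = \<mu> f / 4" if "j < 4" for j
      using eigen_Zsum[OF a ft Z _ \<open>Cc f\<close>, of j] that lam by (simp add: \<nu> power_inverse field_simps)
    then have "(\<Sum>j<4. inverse lam ^ j * \<nu> j f) = (\<Sum>j<(4::nat). \<mu> f / 4)" by (intro sum.cong) auto
    then show ?thesis by simp
  qed
  ultimately have "comb_orbit_sum \<mu> lam n" unfolding comb_orbit_sum_def
    by (intro exI[of _ k] exI[of _ "\<lambda>i. c i / 4"] exI[of _ r] exI[of _ s] exI[of _ \<nu>]) simp
  then show ?thesis using n by (intro exI[of _ n]) simp
qed

text \<open>The transform permutes the four terms of the orbit sum cyclically; the coefficients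
  match up to the factor \<open>lam\<close> because \<open>inverse lam ^ 3 = lam\<close> and the
  fourth iterate of a comb is the comb.\<close>

lemma comb_orbit_sum_imp_eigen:
  assumes co: "comb_orbit_sum \<mu> lam n" and n: "n \<ge> 1" and nt: "nontrivial \<mu>" and lam: "lam ^ 4 = 1"
  shows "uniformly_discrete (msupp \<mu>)" "eigenmeasure \<mu> lam"
proof -
  define a where "a = sqrt (real n)"
  have a: "a > 0" unfolding a_def using n by simp
  have lam0: "lam \<noteq> 0" using lam by auto
  obtain k :: nat and c r s \<nu> where \<nu>0: "\<nu> 0 = (\<lambda>f. \<Sum>i<k. c i * Zcomb (r i) (s i) a f)"
    and \<nu>: "\<And>j. j < 3 \<Longrightarrow> is_ft (\<nu> j) (\<nu> (Suc j))"
    and \<mu>\<nu>: "\<And>f. Cc f \<Longrightarrow> \<mu> f = (\<Sum>j<4. inverse lam ^ j * \<nu> j f)"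
    using co unfolding comb_orbit_sum_def a_def[symmetric] by (elim exE conjE) simp
  define Z where "Z = Zsum k c r s a"
  have \<mu>: "\<mu> f = (\<Sum>j<4. inverse lam ^ j * Z j f)" if "Cc f" for f
  proof -
    have "\<nu> j f = Z j f" if "j < 4" for j unfolding Z_def
      by (rule chain_unique[OF a \<nu>0 \<nu> _ \<open>Cc f\<close>]) (use that in auto)
    then show ?thesis unfolding \<mu>\<nu>[OF that] by (intro sum.cong) auto
  qed
  show "uniformly_discrete (msupp \<mu>)"
    by (rule Zsum_msupp[OF n a_def, of \<mu> "\<lambda>j. inverse lam ^ j" k c r s]) (use \<mu> in \<open>simp add: Z_def\<close>)
  have F: "is_ft (\<lambda>f. \<Sum>j<4. inverse lam ^ j * Z j f) (\<lambda>f. \<Sum>j<4. inverse lam ^ j * Z (Suc j) f)"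
    unfolding Z_def by (intro is_ft_sum is_ft_cmult is_ft_Zsum a) simp
  have "lam * \<mu> f = (\<Sum>j<4. inverse lam ^ j * Z (Suc j) f)" if "Cc f" for f
  proof -
    define l where "l = inverse lam"
    have l: "lam * l = 1" using lam0 by (simp add: l_def)
    have l3: "l ^ 3 = lam"
    proof -
      have "l ^ 3 = lam ^ 4 * l ^ 3" using lam by simp
      also have "\<dots> = lam * (lam * l) ^ 3" by (simp add: power_mult_distrib eval_nat_numeral)
      finally show ?thesis using l by simp
    qed
    have Z4: "Z 4 = Z 0" unfolding Z_def by (rule Zsum_4)
    have "(\<Sum>j<4. l ^ j * Z (Suc j) f) = Z 1 f + l * Z 2 f + l\<^sup>2 * Z 3 f + l ^ 3 * Z 4 f"
      by (simp add: eval_nat_numeral)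
    also have "\<dots> = Z 1 f + l * Z 2 f + l\<^sup>2 * Z 3 f + lam * Z 0 f" unfolding l3 Z4 ..
    also have "\<dots> = lam * Z 0 f + (lam * l) * Z 1 f + (lam * l) * l * Z 2 f + (lam * l) * l\<^sup>2 * Z 3 f" unfolding l by simp
    also have "\<dots> = lam * (\<Sum>j<4. l ^ j * Z j f)"
      by (simp add: eval_nat_numeral distrib_left mult.assoc)
    finally show ?thesis unfolding \<mu>[OF that] l_def ..
  qed
  then have "is_ft \<mu> (\<lambda>f. lam * \<mu> f)" by (intro is_ft_cong[OF F]) (use \<mu> in auto)
  then show "eigenmeasure \<mu> lam" unfolding eigenmeasure_def using nt by simp
qed

text \<open>The double sum over combs and iterates is regrouped by combs. The given chain is known
  only as a whole, so it is replaced by the explicit iterates of the single combs.\<close>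

lemma comb_orbit_sum_imp_Y_span:
  assumes co: "comb_orbit_sum \<mu> lam n" and n: "n \<ge> 1" shows "Y_span \<mu> lam n"
proof -
  define a where "a = sqrt (real n)"
  have a: "a > 0" unfolding a_def using n by simp
  obtain k :: nat and c r s \<nu> where \<nu>0: "\<nu> 0 = (\<lambda>f. \<Sum>i<k. c i * Zcomb (r i) (s i) a f)"
    and \<nu>: "\<And>j. j < 3 \<Longrightarrow> is_ft (\<nu> j) (\<nu> (Suc j))"
    and \<mu>\<nu>: "\<And>f. Cc f \<Longrightarrow> \<mu> f = (\<Sum>j<4. inverse lam ^ j * \<nu> j f)"
    using co unfolding comb_orbit_sum_def a_def[symmetric] by (elim exE conjE) simp
  define Y where "Y i f = (\<Sum>j<4. inverse lam ^ j * zchain (r i) (s i) a j f)" for i f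
  have "is_Y (r i) (s i) a lam (Y i)" for i unfolding is_Y_def
  proof (intro exI[of _ "zchain (r i) (s i) a"] conjI allI impI)
    show "zchain (r i) (s i) a 0 = Zcomb (r i) (s i) a" using Zcomb_eq_atomic[OF a] zchain_0 by simp
    show "is_ft (zchain (r i) (s i) a j) (zchain (r i) (s i) a (Suc j))" if "j < 3" for j
      using that by (intro is_ft_zchain a) simp
  qed (simp add: Y_def)
  moreover have "\<mu> f = (\<Sum>i<k. c i * Y i f)" if "Cc f" for f
  proof -
    have "\<nu> j f = Zsum k c r s a j f" if "j < 4" for j
      by (rule chain_unique[OF a \<nu>0 \<nu> _ \<open>Cc f\<close>]) (use that in auto)
    then have "\<mu> f = (\<Sum>j<4. inverse lam ^ j * Zsum k c r s a j f)" unfolding \<mu>\<nu>[OF that] by (intro sum.cong) auto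
    also have "\<dots> = (\<Sum>i<k. \<Sum>j<4. inverse lam ^ j * (c i * zchain (r i) (s i) a j f))"
      unfolding Zsum_def sum_distrib_left by (rule sum.swap)
    also have "\<dots> = (\<Sum>i<k. c i * Y i f)" unfolding Y_def sum_distrib_left by (simp only: mult.left_commute)
    finally show ?thesis .
  qed
  ultimately show ?thesis unfolding Y_span_def a_def[symmetric]
    by (intro exI[of _ k] exI[of _ c] exI[of _ r] exI[of _ s] exI[of _ Y]) simp
qed

lemma Y_span_imp_comb_orbit_sum:
  assumes "Y_span \<mu> lam n" shows "comb_orbit_sum \<mu> lam n"
proof -
  define a where "a = sqrt (real n)"
  obtain k :: nat and c r s Y where Y: "\<forall>i<k. is_Y (r i) (s i) a lam (Y i)"
    and \<mu>': "\<forall>f. Cc f \<longrightarrow> \<mu> f = (\<Sum>i<k. c i * Y i f)"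
    using assms unfolding Y_span_def a_def[symmetric] by (elim exE conjE)
  have \<mu>: "\<mu> f = (\<Sum>i<k. c i * Y i f)" if "Cc f" for f using \<mu>' that by simp
  have "\<forall>i. \<exists>\<zeta>. i < k \<longrightarrow> \<zeta> 0 = Zcomb (r i) (s i) a \<and> (\<forall>j<3. is_ft (\<zeta> j) (\<zeta> (Suc j))) \<and>
      (\<forall>f. Cc f \<longrightarrow> Y i f = (\<Sum>j<4. inverse lam ^ j * \<zeta> j f))"
    using Y unfolding is_Y_def by simp
  \<comment> \<open>Each \<open>Y i\<close> comes with a chain of its own; chosen simultaneously,
    these chains are summed to the chain \<open>\<nu>\<close>.\<close>
  from choice[OF this] obtain \<zeta> where \<zeta>: "\<forall>i. i < k \<longrightarrow> \<zeta> i 0 = Zcomb (r i) (s i) a \<and> (\<forall>j<3. is_ft (\<zeta> i j) (\<zeta> i (Suc j))) \<and>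
      (\<forall>f. Cc f \<longrightarrow> Y i f = (\<Sum>j<4. inverse lam ^ j * \<zeta> i j f))" by (elim exE)
  define \<nu> where "\<nu> j f = (\<Sum>i<k. c i * \<zeta> i j f)" for j f
  have "\<nu> 0 = (\<lambda>f. \<Sum>i<k. c i * Zcomb (r i) (s i) a f)" unfolding \<nu>_def using \<zeta> by (intro ext sum.cong) auto
  moreover have "is_ft (\<nu> j) (\<nu> (Suc j))" if "j < 3" for j
    unfolding \<nu>_def[abs_def] by (intro is_ft_sum is_ft_cmult) (use \<zeta> that in simp)
  moreover have "\<mu> f = (\<Sum>j<4. inverse lam ^ j * \<nu> j f)" if "Cc f" for f
  proof -
    have "\<mu> f = (\<Sum>i<k. c i * (\<Sum>j<4. inverse lam ^ j * \<zeta> i j f))" unfolding \<mu>[OF that] using \<zeta> that by (intro sum.cong) auto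
    also have "\<dots> = (\<Sum>j<4. \<Sum>i<k. c i * (inverse lam ^ j * \<zeta> i j f))" unfolding sum_distrib_left by (rule sum.swap)
    also have "\<dots> = (\<Sum>j<4. inverse lam ^ j * \<nu> j f)" unfolding \<nu>_def sum_distrib_left by (simp only: mult.left_commute)
    finally show ?thesis .
  qed
  ultimately show ?thesis unfolding comb_orbit_sum_def a_def[symmetric]
    by (intro exI[of _ k] exI[of _ c] exI[of _ r] exI[of _ s] exI[of _ \<nu>]) simp
qed

theorem theorem6p3:
  fixes \<mu> :: rmeas and lam :: complex
  assumes "transformable \<mu>" and "nontrivial \<mu>" and "lam ^ 4 = 1"
  shows "((uniformly_discrete (msupp \<mu>) \<and> eigenmeasure \<mu> lam) \<longleftrightarrow>
          (\<exists>n::nat. n \<ge> 1 \<and> (\<exists>(k::nat) c r s \<nu>. \<nu> 0 = (\<lambda>f. \<Sum>i<k. c i * Zcomb (r i) (s i) (sqrt (real n)) f) \<and>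
              (\<forall>j<3. is_ft (\<nu> j) (\<nu> (Suc j))) \<and>
              (\<forall>f. Cc f \<longrightarrow> \<mu> f = (\<Sum>j<4. inverse lam ^ j * \<nu> j f))))) \<and>
         ((\<exists>n::nat. n \<ge> 1 \<and> (\<exists>(k::nat) c r s \<nu>. \<nu> 0 = (\<lambda>f. \<Sum>i<k. c i * Zcomb (r i) (s i) (sqrt (real n)) f) \<and>
              (\<forall>j<3. is_ft (\<nu> j) (\<nu> (Suc j))) \<and>
              (\<forall>f. Cc f \<longrightarrow> \<mu> f = (\<Sum>j<4. inverse lam ^ j * \<nu> j f)))) \<longleftrightarrow>
          (\<exists>n::nat. n \<ge> 1 \<and> (\<exists>(k::nat) c r s Y. (\<forall>i<k. is_Y (r i) (s i) (sqrt (real n)) lam (Y i)) \<and>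
              (\<forall>f. Cc f \<longrightarrow> \<mu> f = (\<Sum>i<k. c i * Y i f))))) \<and>
         ((uniformly_discrete (msupp \<mu>) \<and> eigenmeasure \<mu> lam) \<longleftrightarrow>
          (uniformly_discrete (msupp \<mu>) \<and> strict_eigenmeasure \<mu> lam))"
  unfolding comb_orbit_sum_def[symmetric] Y_span_def[symmetric]
proof (intro conjI)
  have lam: "lam \<noteq> 0" using assms(3) by auto
  show "(uniformly_discrete (msupp \<mu>) \<and> eigenmeasure \<mu> lam) \<longleftrightarrow> (\<exists>n\<ge>1. comb_orbit_sum \<mu> lam n)"
    using eigen_imp_comb_orbit_sum[OF _ _ lam] comb_orbit_sum_imp_eigen[OF _ _ assms(2,3)] by blast
  show "(\<exists>n\<ge>1. comb_orbit_sum \<mu> lam n) \<longleftrightarrow> (\<exists>n\<ge>1. Y_span \<mu> lam n)"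
    using comb_orbit_sum_imp_Y_span Y_span_imp_comb_orbit_sum by blast
  show "(uniformly_discrete (msupp \<mu>) \<and> eigenmeasure \<mu> lam) \<longleftrightarrow> (uniformly_discrete (msupp \<mu>) \<and> strict_eigenmeasure \<mu> lam)"
    using eigen_imp_strict[OF _ _ assms(3)] strict_imp_eigen[OF _ _ assms(3)] by blast
qed

end
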